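(* Let $X_1\leftarrow X_2\leftarrow X_3\leftarrow\cdots$ be a sequence of regular finite coverings of connected manifolds, where $X_1$ is a complete Riemannian manifold and each $X_i$ carries the pulled-back metric, and let $X_\infty$ be the associated covering solenoid. Let $\mathcal M$ be the Lebesgue $\sigma$-algebra on $\mathbb R$. For each $i\in\mathbb N$ let $E^i$ be the resolution of the identity for the self-adjoint Laplacian $\Delta_{X_i}$ on $L^2(X_i)$. Let $V_1=L^2(X_1)$ and, for $i\ge1$, let $V_{i+1}$ be the orthogonal complement of $P_{i+1,i}^*(L^2(X_i))$ in $L^2(X_{i+1})$. Let $Q_i:L^2(X_\infty)\to V_i$ be the composition of the orthogonal projection $L^2(X_\infty)\to P_{\infty,i}^*(V_i)$ with the identification $P_{\infty,i}^*(V_i)\to V_i$ inverse to $P_{\infty,i}^*|_{V_i}$. Then the resolution of the identity $E$ for the self-adjoint leaf-wise Laplacian $\Delta_{X_\infty}$ is given by $$\omega\mapsto\Bigl(f\mapsto\sum_{i\in\mathbb N}P_{\infty,i}^*\bigl(E^i(\omega)|_{V_i}\,Q_i(f)\bigr)\Bigr),$$ where $\omega\in\mathcal M$ and $f\in L^2(X_\infty)$.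
   Context: Setting. $X_1\leftarrow X_2\leftarrow X_3\leftarrow\cdots$ is a sequence of finite coverings of connected smooth manifolds (without boundary). For $j>i$, $P_{j,i}:X_j\to X_i$ denotes the resulting covering map, and every $P_{j,i}$ is a regular (normal) finite covering. $X_1$ has a complete Riemannian metric $g$ and each $X_i$ has the metric $P_{i,1}^*g$. Solenoid. $X_\infty=\{(x_1,x_2,\dots)\in\prod X_i : P_{j,i}(x_j)=x_i \text{ for all } j>i\}$ with the subspace topology from the product; $P_{\infty,i}:X_\infty\to X_i$ is the projection. Let $G_i=\pi_1(X_i)$, regarded as a finite-index normal subgroup of $G_1$ via $P_{i,1}$, so that $G_1/G_i$ is the deck group of $P_{i,1}$, and let $G_\infty=\varprojlim G_1/G_i$ (a compact group). Then $P_{\infty,1}:X_\infty\to X_1$ is a principal $G_\infty$-bundle. Measures. $\mu_1$ is the Riemannian volume measure of $X_1$. $\mu_i$ is the measure on $X_i$ given by $\mu_i(E)=\int_{X_1}\frac{\#(E\cap P_{i,1}^{-1}(x))}{[G_1:G_i]}\,d\mu_1(x)$. $\mu_\infty$ is the measure on $X_\infty$ given by $\mu_\infty(Z)=\int_{X_1}\nu_x(Z\cap P_{\infty,1}^{-1}(x))\,d\mu_1(x)$, where $\nu_x$ is the push-forward to the fiber $P_{\infty,1}^{-1}(x)$ of the Haar measure of total mass $1$ on $G_\infty$ (by a local trivialization). $L^2(X_i)$ and $L^2(X_\infty)$ are complex $L^2$-spaces for $\mu_i$ and $\mu_\infty$; the pullbacks $P_{j,i}^*:L^2(X_i)\to L^2(X_j)$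 and $P_{\infty,i}^*:L^2(X_i)\to L^2(X_\infty)$ are isometric embeddings. Leaf-wise Laplacian. A leaf $\ell$ is a path component of $X_\infty$, with the topology whose basis consists of the path components of open subsets of $X_\infty$ that lie in $\ell$; $P_{\infty,1}|_\ell:\ell\to X_1$ is a covering map, and $\ell$ is given the pulled-back smooth structure and Riemannian metric. For $u:X_\infty\to\mathbb C$ smooth on each leaf, $(\Delta_{X_\infty}u)(x)=\Delta_\ell(u|_\ell)(x)$ for $x\in\ell$, where $\Delta_\ell=-\operatorname{div}\nabla$ is the nonnegative Laplacian. Restricted to the dense domain $\bigcup_i P_{\infty,i}^*(C_c^\infty(X_i))\subset L^2(X_\infty)$ this operator is essentially self-adjoint, and $\Delta_{X_\infty}$ denotes its unique self-adjoint extension. Similarly $\Delta_{X_i}$ denotes the unique self-adjoint extension in $L^2(X_i)$ of the nonnegative Laplacian on $C_c^\infty(X_i)$. Resolution of the identity. For a self-adjoint operator $T$, its resolution of the identity is the unique projection-valued measure $E$, taken here as a map defined on the Lebesgue $\sigma$-algebra $\mathcal M$ of $\mathbb R$, with $\langle Tf,u\rangle=\int_{\mathbb R}t\,dE_{f,u}(t)$ for $f,u\in\mathrm{Dom}(T)$, where $E_{f,u}(\omega)=\langle E(\omega)f,u\rangle$. The spaces $V_i$ are invariant under $E^i(\omega)$, $\omega\in\mathcal M$. *)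

theory Defs
  imports "HOL-Analysis.Analysis"
begin

section \<open>Smooth manifolds\<close>

text \<open>A chart is an open set together with a coordinate map. Different manifolds are different
  topologies on a common carrier type; coordinate maps and functions on a manifold are total
  functions whose values outside the underlying space are irrelevant. The metric tensor is
  given by its matrices in all charts of the atlas.\<close>

type_synonym ('a, 'n) chart = "'a set \<times> ('a \<Rightarrow> real ^ 'n)"
type_synonym ('a, 'n) metric_tensor = "('a, 'n) chart \<Rightarrow> 'a \<Rightarrow> real ^ 'n ^ 'n"

definition chart_inv :: "('a, 'n::finite) chart \<Rightarrow> real ^ 'n \<Rightarrow> 'a" where
  "chart_inv c = inv_into (fst c) (snd c)"

definition partial_deriv :: "'n::finite \<Rightarrow> (real ^ 'n \<Rightarrow> 'b::real_normed_vector) \<Rightarrow> real ^ 'n \<Rightarrow> 'b" where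
  "partial_deriv k f y = frechet_derivative f (at y) (axis k 1)"

text \<open>The following two notions are used for open sets only.\<close>

primrec C_k_on :: "nat \<Rightarrow> (real ^ 'n) set \<Rightarrow> (real ^ 'n::finite \<Rightarrow> 'b::real_normed_vector) \<Rightarrow> bool" where
  "C_k_on 0 S f \<longleftrightarrow> continuous_on S f"
| "C_k_on (Suc k) S f \<longleftrightarrow>
     (\<forall>y\<in>S. f differentiable (at y)) \<and> (\<forall>i. C_k_on k S (partial_deriv i f))"

definition smooth_on :: "(real ^ 'n) set \<Rightarrow> (real ^ 'n::finite \<Rightarrow> 'b::real_normed_vector) \<Rightarrow> bool" where
  "smooth_on S f \<longleftrightarrow> (\<forall>k. C_k_on k S f)"

definition smooth_manifold :: "'a topology \<Rightarrow> ('a, 'n::finite) chart set \<Rightarrow> bool" where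
  "smooth_manifold X A \<longleftrightarrow>
     Hausdorff_space X \<and> second_countable X \<and>
     (\<Union>c\<in>A. fst c) = topspace X \<and>
     (\<forall>c\<in>A. openin X (fst c) \<and> open (snd c ` fst c) \<and>
        homeomorphic_map (subtopology X (fst c)) (top_of_set (snd c ` fst c)) (snd c)) \<and>
     (\<forall>c\<in>A. \<forall>c'\<in>A. smooth_on (snd c ` (fst c \<inter> fst c')) (snd c' \<circ> chart_inv c))"

text \<open>Smoothness of a map on an open set \<open>W\<close> of the source.\<close>

definition smooth_map_on ::
    "('a, 'm::finite) chart set \<Rightarrow> ('b, 'n::finite) chart set \<Rightarrow> 'a set \<Rightarrow> ('a \<Rightarrow> 'b) \<Rightarrow> bool" where
  "smooth_map_on A B W p \<longleftrightarrow>
     (\<forall>c\<in>A. \<forall>d\<in>B. smooth_on (snd c ` (W \<inter> fst c \<inter> p -` fst d)) (snd d \<circ> p \<circ> chart_inv c))"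

definition diffeomorphism_between ::
    "'a topology \<Rightarrow> ('a, 'n::finite) chart set \<Rightarrow> 'a set \<Rightarrow>
     'b topology \<Rightarrow> ('b, 'n) chart set \<Rightarrow> 'b set \<Rightarrow> ('a \<Rightarrow> 'b) \<Rightarrow> bool" where
  "diffeomorphism_between Y B W X A U p \<longleftrightarrow>
     homeomorphic_map (subtopology Y W) (subtopology X U) p \<and>
     smooth_map_on B A W p \<and> smooth_map_on A B U (inv_into W p)"

definition smooth_compact_support ::
    "'a topology \<Rightarrow> ('a, 'n::finite) chart set \<Rightarrow> ('a \<Rightarrow> complex) set" where
  "smooth_compact_support X A =
     {u. (\<forall>c\<in>A. smooth_on (snd c ` fst c) (u \<circ> chart_inv c)) \<and>
         compactin X (X closure_of {x \<in> topspace X. u x \<noteq> 0})}"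


section \<open>Coverings\<close>

definition smooth_covering ::
    "'a topology \<Rightarrow> ('a, 'n::finite) chart set \<Rightarrow>
     'b topology \<Rightarrow> ('b, 'n) chart set \<Rightarrow> ('a \<Rightarrow> 'b) \<Rightarrow> bool" where
  "smooth_covering Y B X A p \<longleftrightarrow>
     continuous_map Y X p \<and> p ` topspace Y = topspace X \<and>
     (\<forall>x\<in>topspace X. \<exists>U. x \<in> U \<and> openin X U \<and>
        (\<exists>\<W>. \<Union>\<W> = topspace Y \<inter> p -` U \<and> pairwise disjnt \<W> \<and>
           (\<forall>W\<in>\<W>. openin Y W \<and> diffeomorphism_between Y B W X A U p)))"

text \<open>Deck transformations are made extensional, so that equality of functions is equality
  of transformations.\<close>

definition deck_group :: "'a topology \<Rightarrow> ('a \<Rightarrow> 'b) \<Rightarrow> ('a \<Rightarrow> 'a) set" where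
  "deck_group Y p =
     {h \<in> extensional (topspace Y). homeomorphic_map Y Y h \<and> (\<forall>y\<in>topspace Y. p (h y) = p y)}"

definition regular_finite_covering ::
    "'a topology \<Rightarrow> ('a, 'n::finite) chart set \<Rightarrow>
     'b topology \<Rightarrow> ('b, 'n) chart set \<Rightarrow> ('a \<Rightarrow> 'b) \<Rightarrow> bool" where
  "regular_finite_covering Y B X A p \<longleftrightarrow>
     smooth_covering Y B X A p \<and>
     (\<forall>x\<in>topspace X. finite {y \<in> topspace Y. p y = x}) \<and>
     (\<forall>y\<in>topspace Y. \<forall>y'\<in>topspace Y. p y = p y' \<longrightarrow> (\<exists>h\<in>deck_group Y p. h y = y'))"


section \<open>Riemannian metrics\<close>

definition riemannian_metric ::
    "('a, 'n::finite) chart set \<Rightarrow> ('a, 'n) metric_tensor \<Rightarrow> bool" where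
  "riemannian_metric A g \<longleftrightarrow>
     (\<forall>c\<in>A. smooth_on (snd c ` fst c) (g c \<circ> chart_inv c) \<and>
        (\<forall>x\<in>fst c. transpose (g c x) = g c x \<and> (\<forall>v. v \<noteq> 0 \<longrightarrow> v \<bullet> (g c x *v v) > 0))) \<and>
     (\<forall>c\<in>A. \<forall>d\<in>A. \<forall>x\<in>fst c \<inter> fst d.
        let J = matrix (frechet_derivative (snd d \<circ> chart_inv c) (at (snd c x)))
        in g c x = transpose J ** g d x ** J)"

text \<open>By the transformation rule for metric tensors, the choice of the chart around
  \<open>p y\<close> does not matter; similarly for the choices of charts below.\<close>

definition pullback_metric ::
    "('a \<Rightarrow> 'b) \<Rightarrow> ('b, 'n::finite) chart set \<Rightarrow> ('b, 'n) metric_tensor \<Rightarrow> ('a, 'n) metric_tensor" where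
  "pullback_metric p A g c y =
     (let d = (SOME d. d \<in> A \<and> p y \<in> fst d);
          J = matrix (frechet_derivative (snd d \<circ> p \<circ> chart_inv c) (at (snd c y)))
      in transpose J ** g d (p y) ** J)"

definition speed ::
    "('a, 'n::finite) chart set \<Rightarrow> ('a, 'n) metric_tensor \<Rightarrow> (real \<Rightarrow> 'a) \<Rightarrow> real \<Rightarrow> real" where
  "speed A g \<gamma> t =
     (let c = (SOME c. c \<in> A \<and> \<gamma> t \<in> fst c);
          v = vector_derivative (snd c \<circ> \<gamma>) (at t)
      in sqrt (v \<bullet> (g c (\<gamma> t) *v v)))"

definition piecewise_C1_path ::
    "'a topology \<Rightarrow> ('a, 'n::finite) chart set \<Rightarrow> (real \<Rightarrow> 'a) \<Rightarrow> bool" where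
  "piecewise_C1_path X A \<gamma> \<longleftrightarrow>
     pathin X \<gamma> \<and>
     (\<exists>S. finite S \<and> (\<forall>c\<in>A. (snd c \<circ> \<gamma>) C1_differentiable_on {t \<in> {0..1} - S. \<gamma> t \<in> fst c}))"

definition riemannian_dist ::
    "'a topology \<Rightarrow> ('a, 'n::finite) chart set \<Rightarrow> ('a, 'n) metric_tensor \<Rightarrow> 'a \<Rightarrow> 'a \<Rightarrow> real" where
  "riemannian_dist X A g x y =
     enn2real (INF \<gamma> \<in> {\<gamma>. piecewise_C1_path X A \<gamma> \<and> \<gamma> 0 = x \<and> \<gamma> 1 = y}.
       \<integral>\<^sup>+ t \<in> {0..1}. ennreal (speed A g \<gamma> t) \<partial>lborel)"

text \<open>For connected manifolds.\<close>

definition complete_riemannian_metric ::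
    "'a topology \<Rightarrow> ('a, 'n::finite) chart set \<Rightarrow> ('a, 'n) metric_tensor \<Rightarrow> bool" where
  "complete_riemannian_metric X A g \<longleftrightarrow>
     riemannian_metric A g \<and> Metric_space.mcomplete (topspace X) (riemannian_dist X A g)"

definition borel_of :: "'a topology \<Rightarrow> 'a measure" where
  "borel_of X = sigma (topspace X) {U. openin X U}"

text \<open>These properties determine the measure, since \<open>X\<close> is a countable union of chart domains.\<close>

definition riemannian_volume ::
    "'a topology \<Rightarrow> ('a, 'n::finite) chart set \<Rightarrow> ('a, 'n) metric_tensor \<Rightarrow> 'a measure \<Rightarrow> bool" where
  "riemannian_volume X A g \<mu> \<longleftrightarrow>
     sets \<mu> = sets (borel_of X) \<and>
     (\<forall>c\<in>A. \<forall>B\<in>sets \<mu>. B \<subseteq> fst c \<longrightarrow>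
        emeasure \<mu> B = (\<integral>\<^sup>+ y \<in> snd c ` B. ennreal (sqrt (det (g c (chart_inv c y)))) \<partial>lborel))"

text \<open>In coordinates, \<open>grad u\<close> has the components \<open>\<Sum>j. g\<^sup>i\<^sup>j \<partial>\<^sub>j u\<close> and
  \<open>div Y = (1 / \<surd>det g) \<Sum>i. \<partial>\<^sub>i (\<surd>det g Y\<^sup>i)\<close>; the Laplacian is \<open>- div grad\<close>.\<close>

definition coord_grad ::
    "(real ^ 'n \<Rightarrow> real ^ 'n ^ 'n) \<Rightarrow> (real ^ 'n::finite \<Rightarrow> complex) \<Rightarrow> 'n \<Rightarrow> real ^ 'n \<Rightarrow> complex" where
  "coord_grad G u i y = (\<Sum>j\<in>UNIV. (matrix_inv (G y) $ i $ j) *\<^sub>R partial_deriv j u y)"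

definition coord_div ::
    "(real ^ 'n \<Rightarrow> real ^ 'n ^ 'n) \<Rightarrow> ('n::finite \<Rightarrow> real ^ 'n \<Rightarrow> complex) \<Rightarrow> real ^ 'n \<Rightarrow> complex" where
  "coord_div G Y y =
     (1 / sqrt (det (G y))) *\<^sub>R
       (\<Sum>i\<in>UNIV. partial_deriv i (\<lambda>z. sqrt (det (G z)) *\<^sub>R Y i z) y)"

definition laplacian ::
    "('a, 'n::finite) chart set \<Rightarrow> ('a, 'n) metric_tensor \<Rightarrow> ('a \<Rightarrow> complex) \<Rightarrow> 'a \<Rightarrow> complex" where
  "laplacian A g u x =
     (let c = (SOME c. c \<in> A \<and> x \<in> fst c);
          G = g c \<circ> chart_inv c
      in - coord_div G (coord_grad G (u \<circ> chart_inv c)) (snd c x))"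


section \<open>Operators on $L^2$ spaces\<close>

text \<open>Elements of an $L^2$ space are represented by square-integrable functions; equality in
  $L^2$ is equality almost everywhere. An unbounded operator is represented by its graph, a set
  of pairs of representatives.\<close>

type_synonym 'a operator_graph = "(('a \<Rightarrow> complex) \<times> ('a \<Rightarrow> complex)) set"

definition L2_space :: "'a measure \<Rightarrow> ('a \<Rightarrow> complex) set" where
  "L2_space M = {f \<in> borel_measurable M. integrable M (\<lambda>x. (cmod (f x))\<^sup>2)}"

definition L2_inner :: "'a measure \<Rightarrow> ('a \<Rightarrow> complex) \<Rightarrow> ('a \<Rightarrow> complex) \<Rightarrow> complex" where
  "L2_inner M f u = (\<integral>x. f x * cnj (u x) \<partial>M)"

definition L2_norm :: "'a measure \<Rightarrow> ('a \<Rightarrow> complex) \<Rightarrow> real" where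
  "L2_norm M f = sqrt (\<integral>x. (cmod (f x))\<^sup>2 \<partial>M)"

definition L2_adjoint :: "'a measure \<Rightarrow> 'a operator_graph \<Rightarrow> 'a operator_graph" where
  "L2_adjoint M T =
     {(u, v). u \<in> L2_space M \<and> v \<in> L2_space M \<and>
              (\<forall>(f, h)\<in>T. L2_inner M h u = L2_inner M f v)}"

text \<open>Since \<open>T = T*\<close>, the graph is linear and closed under a.e. equality; by density of the domain
  it is single-valued up to a.e. equality.\<close>

definition L2_self_adjoint :: "'a measure \<Rightarrow> 'a operator_graph \<Rightarrow> bool" where
  "L2_self_adjoint M T \<longleftrightarrow>
     (\<forall>f\<in>L2_space M. \<forall>\<epsilon>>0. \<exists>(v, h)\<in>T. L2_norm M (\<lambda>x. f x - v x) < \<epsilon>) \<and>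
     L2_adjoint M T = T"

definition unique_self_adjoint_extension ::
    "'a measure \<Rightarrow> 'a operator_graph \<Rightarrow> 'a operator_graph \<Rightarrow> bool" where
  "unique_self_adjoint_extension M T0 T \<longleftrightarrow>
     L2_self_adjoint M T \<and> T0 \<subseteq> T \<and> (\<forall>S. L2_self_adjoint M S \<and> T0 \<subseteq> S \<longrightarrow> S = T)"

definition projection_valued_measure ::
    "'a measure \<Rightarrow> (real set \<Rightarrow> ('a \<Rightarrow> complex) \<Rightarrow> 'a \<Rightarrow> complex) \<Rightarrow> bool" where
  "projection_valued_measure M E \<longleftrightarrow>
     (\<forall>\<omega>\<in>sets lebesgue. \<forall>f\<in>L2_space M. \<forall>u\<in>L2_space M.
        E \<omega> f \<in> L2_space M \<and>
        (\<forall>a b. AE x in M. E \<omega> (\<lambda>x. a * f x + b * u x) x = a * E \<omega> f x + b * E \<omega> u x) \<and>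
        (AE x in M. E \<omega> (E \<omega> f) x = E \<omega> f x) \<and>
        L2_inner M (E \<omega> f) u = L2_inner M f (E \<omega> u)) \<and>
     (\<forall>f\<in>L2_space M. (AE x in M. E {} f x = 0) \<and> (AE x in M. E UNIV f x = f x)) \<and>
     (\<forall>\<omega>\<in>sets lebesgue. \<forall>\<eta>\<in>sets lebesgue. \<forall>f\<in>L2_space M.
        (AE x in M. E (\<omega> \<inter> \<eta>) f x = E \<omega> (E \<eta> f) x) \<and>
        (\<omega> \<inter> \<eta> = {} \<longrightarrow> (AE x in M. E (\<omega> \<union> \<eta>) f x = E \<omega> f x + E \<eta> f x))) \<and>
     (\<forall>f\<in>L2_space M. \<forall>u\<in>L2_space M. \<forall>\<omega>::nat \<Rightarrow> real set.
        range \<omega> \<subseteq> sets lebesgue \<longrightarrow> disjoint_family \<omega> \<longrightarrow>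
        (\<lambda>n. L2_inner M (E (\<omega> n) f) u) sums L2_inner M (E (\<Union>n. \<omega> n) f) u)"

text \<open>Integration with respect to a complex measure \<open>\<nu>\<close> on the Lebesgue sets, by decomposing
  \<open>\<nu>\<close> into finite positive measures. The value does not depend on the decomposition, and a
  decomposition as required exists iff \<open>k\<close> is integrable for the total variation of \<open>\<nu>\<close>.\<close>

definition has_complex_measure_integral ::
    "(real set \<Rightarrow> complex) \<Rightarrow> (real \<Rightarrow> real) \<Rightarrow> complex \<Rightarrow> bool" where
  "has_complex_measure_integral \<nu> k I \<longleftrightarrow>
     (\<exists>m1 m2 m3 m4 :: real measure.
        (\<forall>m\<in>{m1, m2, m3, m4}. sets m = sets lebesgue \<and> finite_measure m \<and> integrable m k) \<and>
        (\<forall>\<omega>\<in>sets lebesgue.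
           \<nu> \<omega> = Complex (measure m1 \<omega> - measure m2 \<omega>) (measure m3 \<omega> - measure m4 \<omega>)) \<and>
        I = Complex (integral\<^sup>L m1 k - integral\<^sup>L m2 k) (integral\<^sup>L m3 k - integral\<^sup>L m4 k))"

definition spectral_measure_for ::
    "'a measure \<Rightarrow> 'a operator_graph \<Rightarrow> (real set \<Rightarrow> ('a \<Rightarrow> complex) \<Rightarrow> 'a \<Rightarrow> complex) \<Rightarrow> bool" where
  "spectral_measure_for M T E \<longleftrightarrow>
     projection_valued_measure M E \<and>
     (\<forall>(f, h)\<in>T. \<forall>u\<in>L2_space M.
        has_complex_measure_integral (\<lambda>\<omega>. L2_inner M (E \<omega> f) u) (\<lambda>t. t) (L2_inner M h u))"

text \<open>The second argument \<open>u\<close> above ranges over the whole space: if it were restricted to the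
  domain of \<open>T\<close>, the spectral measure of a self-adjoint operator with a larger quadratic form would
  qualify as well (e.g. that of the Neumann Laplacian for the Dirichlet Laplacian), and
  there would be no uniqueness.\<close>

definition resolution_of_identity ::
    "'a measure \<Rightarrow> 'a operator_graph \<Rightarrow> (real set \<Rightarrow> ('a \<Rightarrow> complex) \<Rightarrow> 'a \<Rightarrow> complex) \<Rightarrow> bool" where
  "resolution_of_identity M T E \<longleftrightarrow>
     spectral_measure_for M T E \<and>
     (\<forall>E'. spectral_measure_for M T E' \<longrightarrow>
        (\<forall>\<omega>\<in>sets lebesgue. \<forall>f\<in>L2_space M. AE x in M. E' \<omega> f x = E \<omega> f x))"

text \<open>\<open>p\<close> represents the orthogonal projection of \<open>f\<close> to the subspace \<open>S\<close>.\<close>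

definition is_orthogonal_projection ::
    "'a measure \<Rightarrow> ('a \<Rightarrow> complex) set \<Rightarrow> ('a \<Rightarrow> complex) \<Rightarrow> ('a \<Rightarrow> complex) \<Rightarrow> bool" where
  "is_orthogonal_projection M S f p \<longleftrightarrow>
     p \<in> S \<and> (\<forall>s\<in>S. L2_inner M (\<lambda>x. f x - p x) s = 0)"


section \<open>Covering solenoids\<close>

text \<open>The tower $X_1 \leftarrow X_2 \leftarrow \cdots$ is indexed from 0: \<open>X i\<close> is $X_{i+1}$, and
  \<open>P i\<close> maps \<open>X (Suc i)\<close> to \<open>X i\<close>.\<close>

primrec tower_map :: "(nat \<Rightarrow> 'a \<Rightarrow> 'a) \<Rightarrow> nat \<Rightarrow> nat \<Rightarrow> 'a \<Rightarrow> 'a" where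
  "tower_map P 0 i = id"
| "tower_map P (Suc j) i = (if i \<le> j then tower_map P j i \<circ> P j else id)"

definition solenoid :: "(nat \<Rightarrow> 'a topology) \<Rightarrow> (nat \<Rightarrow> 'a \<Rightarrow> 'a) \<Rightarrow> (nat \<Rightarrow> 'a) topology" where
  "solenoid X P =
     subtopology (product_topology X UNIV)
       {x. \<forall>i j. i < j \<longrightarrow> tower_map P j i (x j) = x i}"

definition solenoid_proj :: "nat \<Rightarrow> (nat \<Rightarrow> 'a) \<Rightarrow> 'a" where
  "solenoid_proj i x = x i"

text \<open>$G_\infty = \varprojlim G_1/G_i$, where $G_1/G_i$ is the deck group of \<open>X i\<close> over \<open>X 0\<close>
  and the bonding maps send \<open>h\<close> to the transformation that \<open>h\<close> covers.\<close>

definition solenoid_group ::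
    "(nat \<Rightarrow> 'a topology) \<Rightarrow> (nat \<Rightarrow> 'a \<Rightarrow> 'a) \<Rightarrow> (nat \<Rightarrow> 'a \<Rightarrow> 'a) topology" where
  "solenoid_group X P =
     subtopology (product_topology (\<lambda>i. discrete_topology (deck_group (X i) (tower_map P i 0))) UNIV)
       {h. \<forall>i j. i < j \<longrightarrow> (\<forall>y\<in>topspace (X j). tower_map P j i (h j y) = h i (tower_map P j i y))}"

definition solenoid_group_mult ::
    "(nat \<Rightarrow> 'a topology) \<Rightarrow> (nat \<Rightarrow> 'a \<Rightarrow> 'a) \<Rightarrow> (nat \<Rightarrow> 'a \<Rightarrow> 'a) \<Rightarrow> nat \<Rightarrow> 'a \<Rightarrow> 'a" where
  "solenoid_group_mult X h k = (\<lambda>i. compose (topspace (X i)) (h i) (k i))"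

definition normalized_haar_measure ::
    "'g topology \<Rightarrow> ('g \<Rightarrow> 'g \<Rightarrow> 'g) \<Rightarrow> 'g measure \<Rightarrow> bool" where
  "normalized_haar_measure T mul H \<longleftrightarrow>
     sets H = sets (borel_of T) \<and> emeasure H (topspace T) = 1 \<and>
     (\<forall>h\<in>topspace T. \<forall>B\<in>sets H. emeasure H (mul h ` B) = emeasure H B)"

text \<open>$\nu_x(S)$ for a Borel subset $S$ of the fibre over $x$. An equivariant trivialization
  identifies $G_\infty$ with this fibre by \<open>h \<mapsto> h \<cdot> y\<close> for some \<open>y\<close> in it; by invariance of the
  Haar measure the result is the same for all \<open>y\<close>.\<close>

definition fiber_measure ::
    "(nat \<Rightarrow> 'a topology) \<Rightarrow> (nat \<Rightarrow> 'a \<Rightarrow> 'a) \<Rightarrow> (nat \<Rightarrow> 'a \<Rightarrow> 'a) measure \<Rightarrow> 'a \<Rightarrow>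
     (nat \<Rightarrow> 'a) set \<Rightarrow> ennreal" where
  "fiber_measure X P H x S =
     (let y = (SOME y. y \<in> topspace (solenoid X P) \<and> solenoid_proj 0 y = x)
      in emeasure H {h \<in> topspace (solenoid_group X P). (\<lambda>i. h i (y i)) \<in> S})"

definition level_measure ::
    "(nat \<Rightarrow> 'a topology) \<Rightarrow> (nat \<Rightarrow> 'a \<Rightarrow> 'a) \<Rightarrow> 'a measure \<Rightarrow> nat \<Rightarrow> 'a measure" where
  "level_measure X P \<mu> i =
     measure_of (topspace (X i)) (sets (borel_of (X i)))
       (\<lambda>B. \<integral>\<^sup>+ x. ennreal (real (card (B \<inter> {y \<in> topspace (X i). tower_map P i 0 y = x})) /
                           real (card (deck_group (X i) (tower_map P i 0)))) \<partial>\<mu>)"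

definition solenoid_measure ::
    "(nat \<Rightarrow> 'a topology) \<Rightarrow> (nat \<Rightarrow> 'a \<Rightarrow> 'a) \<Rightarrow> 'a measure \<Rightarrow> (nat \<Rightarrow> 'a \<Rightarrow> 'a) measure \<Rightarrow>
     (nat \<Rightarrow> 'a) measure" where
  "solenoid_measure X P \<mu> H =
     measure_of (topspace (solenoid X P)) (sets (borel_of (solenoid X P)))
       (\<lambda>Z. \<integral>\<^sup>+ x. fiber_measure X P H x
              (Z \<inter> {y \<in> topspace (solenoid X P). solenoid_proj 0 y = x}) \<partial>\<mu>)"

definition leaf_topology :: "'b topology \<Rightarrow> 'b set \<Rightarrow> 'b topology" where
  "leaf_topology Y l =
     topology_generated_by
       {W. \<exists>U. openin Y U \<and> W \<in> path_components_of (subtopology Y U) \<and> W \<subseteq> l}"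

text \<open>The smooth structure making the local homeomorphism \<open>p\<close> a local diffeomorphism.\<close>

definition pullback_atlas ::
    "'b topology \<Rightarrow> ('b \<Rightarrow> 'a) \<Rightarrow> 'a topology \<Rightarrow> ('a, 'n::finite) chart set \<Rightarrow> ('b, 'n) chart set" where
  "pullback_atlas Y p X A =
     {(W, \<phi> \<circ> p) | W U \<phi>. (U, \<phi>) \<in> A \<and> openin Y W \<and> openin X (p ` W) \<and> p ` W \<subseteq> U \<and>
        homeomorphic_map (subtopology Y W) (subtopology X (p ` W)) p}"

definition leafwise_laplacian ::
    "(nat \<Rightarrow> 'a topology) \<Rightarrow> (nat \<Rightarrow> ('a, 'n::finite) chart set) \<Rightarrow> (nat \<Rightarrow> 'a \<Rightarrow> 'a) \<Rightarrow>
     ('a, 'n) metric_tensor \<Rightarrow> ((nat \<Rightarrow> 'a) \<Rightarrow> complex) \<Rightarrow> (nat \<Rightarrow> 'a) \<Rightarrow> complex" where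
  "leafwise_laplacian X A P g u x =
     (let l = path_component_of_set (solenoid X P) x;
          B = pullback_atlas (leaf_topology (solenoid X P) l) (solenoid_proj 0) (X 0) (A 0)
      in laplacian B (pullback_metric (solenoid_proj 0) (A 0) g) u x)"

definition level_laplacian_graph ::
    "(nat \<Rightarrow> 'a topology) \<Rightarrow> (nat \<Rightarrow> ('a, 'n::finite) chart set) \<Rightarrow> (nat \<Rightarrow> 'a \<Rightarrow> 'a) \<Rightarrow>
     ('a, 'n) metric_tensor \<Rightarrow> nat \<Rightarrow> 'a operator_graph" where
  "level_laplacian_graph X A P g i =
     {(u, laplacian (A i) (pullback_metric (tower_map P i 0) (A 0) g) u) | u.
        u \<in> smooth_compact_support (X i) (A i)}"

definition leafwise_laplacian_graph ::
    "(nat \<Rightarrow> 'a topology) \<Rightarrow> (nat \<Rightarrow> ('a, 'n::finite) chart set) \<Rightarrow> (nat \<Rightarrow> 'a \<Rightarrow> 'a) \<Rightarrow>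
     ('a, 'n) metric_tensor \<Rightarrow> (nat \<Rightarrow> 'a) operator_graph" where
  "leafwise_laplacian_graph X A P g =
     {(u \<circ> solenoid_proj i, leafwise_laplacian X A P g (u \<circ> solenoid_proj i)) | i u.
        u \<in> smooth_compact_support (X i) (A i)}"

primrec new_space :: "(nat \<Rightarrow> 'a topology) \<Rightarrow> (nat \<Rightarrow> 'a \<Rightarrow> 'a) \<Rightarrow> 'a measure \<Rightarrow> nat \<Rightarrow> ('a \<Rightarrow> complex) set" where
  "new_space X P \<mu> 0 = L2_space (level_measure X P \<mu> 0)"
| "new_space X P \<mu> (Suc i) =
     {v \<in> L2_space (level_measure X P \<mu> (Suc i)).
        \<forall>w\<in>L2_space (level_measure X P \<mu> i). L2_inner (level_measure X P \<mu> (Suc i)) v (w \<circ> P i) = 0}"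

text \<open>The map $Q_i$. The representative is determined up to a.e. equality.\<close>

definition new_component ::
    "(nat \<Rightarrow> 'a topology) \<Rightarrow> (nat \<Rightarrow> 'a \<Rightarrow> 'a) \<Rightarrow> 'a measure \<Rightarrow> (nat \<Rightarrow> 'a \<Rightarrow> 'a) measure \<Rightarrow> nat \<Rightarrow>
     ((nat \<Rightarrow> 'a) \<Rightarrow> complex) \<Rightarrow> 'a \<Rightarrow> complex" where
  "new_component X P \<mu> H i f =
     (SOME v. v \<in> new_space X P \<mu> i \<and>
        is_orthogonal_projection (solenoid_measure X P \<mu> H)
          ((\<lambda>w. w \<circ> solenoid_proj i) ` new_space X P \<mu> i) f (v \<circ> solenoid_proj i))"

end

theory Submission
  imports Defs
begin

text \<open>
  The pullbacks embed $L^2(X_i)$ isometrically as an increasing chain of closed subspaces $W_i$ of $L^2(X_\<infinity>)$.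
  On the core of test functions the orthogonal projection onto $W_i$ is the averaging over a deck group, which
  commutes with the Laplacians. Hence the reflection $R_i$ in $W_i$ maps the leaf-wise Laplacian on the core into its
  self-adjoint extension $T$, so $R_i T R_i$ is another self-adjoint extension and equals $T$ by
  uniqueness. Then $R_i E R_i$ is a resolution of the identity for $T$ as well, so $E$ commutes with the
  projections and restricts on $W_i$ to a resolution of the identity for $\<Delta>_{X_i}$, that is, to $E^i$.
  The union of the $W_i$ is dense because otherwise the projection onto its orthogonal complement, which annihilates
  the core, could be added to $T$ to give another self-adjoint extension.

  The leaf-wise Laplacian of a pulled back function is computed in any coordinates of the base, since coordinate balls
  lift to the leaves and the Laplacian is coordinate invariant by Piola's identity.
\<close>

section \<open>Square-integrable functions\<close>

text \<open>Elements of the Hilbert spaces are functions, not classes modulo null sets, and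
  operators are graphs of such functions. Identities between values of operators therefore hold only
  almost everywhere and are mostly checked against inner products; a self-adjoint graph tolerates
  changes on null sets because it equals its adjoint, which sees only inner products. Uniqueness has
  two sources: that of the extension controls operators, that of the resolution of the identity
  controls spectral measures. Each use exhibits a competitor and identifies it with the given
  object. The geometric input is that projecting a test function of level j to a lower level i gives
  a test function again. Here finiteness and regularity of the coverings enter: the deck group is
  finite, acts simply transitively on the fibres and preserves the measure. On the leaves the
  obstacle is that the Laplacian picks its chart by choice, so its value means something only once
  every point of a leaf is known to lie in a chart of the pulled back atlas, and it must not depend
  on the chart that is picked.\<close>

lemma L2_space_measurable: "f \<in> L2_space M \<Longrightarrow> f \<in> borel_measurable M"
  by (simp add: L2_space_def)

lemma L2_space_integrable: "f \<in> L2_space M \<Longrightarrow> integrable M (\<lambda>x. (cmod (f x))\<^sup>2)"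
  by (simp add: L2_space_def)

lemma L2_lincomb:
  assumes "f \<in> L2_space M" "u \<in> L2_space M"
  shows "(\<lambda>x. a * f x + b * u x) \<in> L2_space M"
proof -
  have [measurable]: "f \<in> borel_measurable M" "u \<in> borel_measurable M"
    using assms by (auto intro: L2_space_measurable)
  have int: "integrable M (\<lambda>x. 2 * (cmod a)\<^sup>2 * (cmod (f x))\<^sup>2 + 2 * (cmod b)\<^sup>2 * (cmod (u x))\<^sup>2)"
    using assms by (auto intro!: Bochner_Integration.integrable_add integrable_mult_right L2_space_integrable)
  have bd: "(cmod (a * f x + b * u x))\<^sup>2 \<le> 2 * (cmod a)\<^sup>2 * (cmod (f x))\<^sup>2 + 2 * (cmod b)\<^sup>2 * (cmod (u x))\<^sup>2" for x
  proof -
    have "(cmod (a * f x + b * u x))\<^sup>2 \<le> (cmod (a * f x) + cmod (b * u x))\<^sup>2"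
      by (intro power_mono norm_triangle_ineq) auto
    also have "\<dots> \<le> 2 * (cmod (a * f x))\<^sup>2 + 2 * (cmod (b * u x))\<^sup>2"
      using sum_squares_bound[of "cmod (a * f x)" "cmod (b * u x)"] by (simp add: power2_sum)
    finally show ?thesis by (simp add: norm_mult power_mult_distrib)
  qed
  have "integrable M (\<lambda>x. (cmod (a * f x + b * u x))\<^sup>2)"
    by (rule Bochner_Integration.integrable_bound[OF int]) (use bd in auto)
  thus ?thesis by (simp add: L2_space_def)
qed

lemma L2_add: "f \<in> L2_space M \<Longrightarrow> u \<in> L2_space M \<Longrightarrow> (\<lambda>x. f x + u x) \<in> L2_space M"
  using L2_lincomb[of f M u 1 1] by simp

lemma L2_diff: "f \<in> L2_space M \<Longrightarrow> u \<in> L2_space M \<Longrightarrow> (\<lambda>x. f x - u x) \<in> L2_space M"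
  using L2_lincomb[of f M u 1 "-1"] by simp

lemma L2_scale: "f \<in> L2_space M \<Longrightarrow> (\<lambda>x. a * f x) \<in> L2_space M"
  using L2_lincomb[of f M f a 0] by simp

lemma L2_zero: "(\<lambda>x. 0) \<in> L2_space M"
  by (simp add: L2_space_def)

lemma L2_sum: "finite I \<Longrightarrow> (\<And>i. i \<in> I \<Longrightarrow> f i \<in> L2_space M) \<Longrightarrow> (\<lambda>x. \<Sum>i\<in>I. f i x) \<in> L2_space M"
  by (induction I rule: finite_induct) (auto simp: L2_zero intro: L2_add)

lemma L2_mult_integrable:
  assumes "f \<in> L2_space M" "u \<in> L2_space M"
  shows "integrable M (\<lambda>x. f x * cnj (u x))"
proof -
  have [measurable]: "f \<in> borel_measurable M" "u \<in> borel_measurable M"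
    using assms by (auto intro: L2_space_measurable)
  have [measurable]: "(\<lambda>x. cnj (u x)) \<in> borel_measurable M"
    by (rule borel_measurable_continuous_on[OF continuous_on_cnj[OF continuous_on_id]]) measurable
  have int: "integrable M (\<lambda>x. (cmod (f x))\<^sup>2 + (cmod (u x))\<^sup>2)"
    using assms by (auto intro!: Bochner_Integration.integrable_add L2_space_integrable)
  have "cmod (f x * cnj (u x)) \<le> (cmod (f x))\<^sup>2 + (cmod (u x))\<^sup>2" for x
    unfolding norm_mult complex_mod_cnj
    using sum_squares_bound[of "cmod (f x)" "cmod (u x)"] mult_nonneg_nonneg[OF norm_ge_zero[of "f x"] norm_ge_zero[of "u x"]]
    by linarith
  thus ?thesis
    by (intro Bochner_Integration.integrable_bound[OF int]) (auto simp del: norm_mult)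
qed

lemma L2_inner_lincomb_left:
  assumes "f \<in> L2_space M" "h \<in> L2_space M" "u \<in> L2_space M"
  shows "L2_inner M (\<lambda>x. a * f x + b * h x) u = a * L2_inner M f u + b * L2_inner M h u"
proof -
  have "L2_inner M (\<lambda>x. a * f x + b * h x) u = (\<integral>x. a * (f x * cnj (u x)) + b * (h x * cnj (u x)) \<partial>M)"
    unfolding L2_inner_def by (simp add: algebra_simps)
  also have "\<dots> = a * L2_inner M f u + b * L2_inner M h u"
    unfolding L2_inner_def using L2_mult_integrable[OF assms(1,3)] L2_mult_integrable[OF assms(2,3)]
    by (subst Bochner_Integration.integral_add) auto
  finally show ?thesis .
qed

lemma L2_inner_commute: "L2_inner M u f = cnj (L2_inner M f u)"
  unfolding L2_inner_def
  using integral_bounded_linear'[OF bounded_linear_cnj bounded_linear_cnj, of M "\<lambda>x. f x * cnj (u x)"]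
  by (simp add: mult.commute)

lemma L2_inner_lincomb_right:
  assumes "f \<in> L2_space M" "h \<in> L2_space M" "u \<in> L2_space M"
  shows "L2_inner M u (\<lambda>x. a * f x + b * h x) = cnj a * L2_inner M u f + cnj b * L2_inner M u h"
  using L2_inner_lincomb_left[OF assms, of a b] by (metis L2_inner_commute complex_cnj_add complex_cnj_mult)

lemma L2_inner_diff_left:
  "f \<in> L2_space M \<Longrightarrow> h \<in> L2_space M \<Longrightarrow> u \<in> L2_space M \<Longrightarrow>
    L2_inner M (\<lambda>x. f x - h x) u = L2_inner M f u - L2_inner M h u"
  using L2_inner_lincomb_left[of f M h u 1 "-1"] by simp

lemma L2_inner_add_left:
  "f \<in> L2_space M \<Longrightarrow> h \<in> L2_space M \<Longrightarrow> u \<in> L2_space M \<Longrightarrow>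
    L2_inner M (\<lambda>x. f x + h x) u = L2_inner M f u + L2_inner M h u"
  using L2_inner_lincomb_left[of f M h u 1 1] by simp

lemma L2_inner_diff_right:
  "f \<in> L2_space M \<Longrightarrow> h \<in> L2_space M \<Longrightarrow> u \<in> L2_space M \<Longrightarrow>
    L2_inner M u (\<lambda>x. f x - h x) = L2_inner M u f - L2_inner M u h"
  using L2_inner_lincomb_right[of f M h u 1 "-1"] by simp

lemma L2_inner_scale_left:
  "f \<in> L2_space M \<Longrightarrow> u \<in> L2_space M \<Longrightarrow> L2_inner M (\<lambda>x. a * f x) u = a * L2_inner M f u"
  using L2_inner_lincomb_left[of f M f u a 0] by simp

lemma L2_inner_scale_right:
  "f \<in> L2_space M \<Longrightarrow> u \<in> L2_space M \<Longrightarrow> L2_inner M u (\<lambda>x. a * f x) = cnj a * L2_inner M u f"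
  using L2_inner_lincomb_right[of f M f u a 0] by simp

lemma L2_inner_cong_AE:
  assumes "AE x in M. f x = f' x" "AE x in M. u x = u' x"
    and "f \<in> L2_space M" "f' \<in> L2_space M" "u \<in> L2_space M" "u' \<in> L2_space M"
  shows "L2_inner M f u = L2_inner M f' u'"
  unfolding L2_inner_def
  by (rule integral_cong_AE)
     (use assms L2_mult_integrable[of f M u] L2_mult_integrable[of f' M u'] in auto)

lemma L2_norm_nonneg [simp]: "0 \<le> L2_norm M f"
  by (simp add: L2_norm_def)

lemma L2_norm_power2: "(L2_norm M f)\<^sup>2 = (\<integral>x. (cmod (f x))\<^sup>2 \<partial>M)"
  by (simp add: L2_norm_def)

lemma L2_inner_self: "L2_inner M f f = complex_of_real ((L2_norm M f)\<^sup>2)"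
  unfolding L2_inner_def L2_norm_power2 
  by (simp add: complex_norm_square[symmetric] flip: integral_complex_of_real)

lemma L2_norm_cong_AE:
  assumes "AE x in M. f x = f' x" "f \<in> L2_space M" "f' \<in> L2_space M"
  shows "L2_norm M f = L2_norm M f'"
  unfolding L2_norm_def
  by (rule arg_cong[where f=sqrt], rule integral_cong_AE)
     (use assms L2_space_integrable[of f M] L2_space_integrable[of f' M] in auto)

lemma L2_norm_eq_0_iff:
  assumes "f \<in> L2_space M"
  shows "L2_norm M f = 0 \<longleftrightarrow> (AE x in M. f x = 0)"
  unfolding L2_norm_def
  using integral_nonneg_eq_0_iff_AE[OF L2_space_integrable[OF assms]] by simp

lemma L2_norm_minus_commute: "L2_norm M (\<lambda>x. f x - u x) = L2_norm M (\<lambda>x. u x - f x)"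
  by (simp add: L2_norm_def norm_minus_commute)

lemma L2_norm_diff_power2:
  assumes "f \<in> L2_space M" "u \<in> L2_space M"
  shows "(L2_norm M (\<lambda>x. f x - u x))\<^sup>2 = (L2_norm M f)\<^sup>2 - 2 * Re (L2_inner M f u) + (L2_norm M u)\<^sup>2"
proof -
  have "complex_of_real ((L2_norm M (\<lambda>x. f x - u x))\<^sup>2) =
     complex_of_real ((L2_norm M f)\<^sup>2) - (L2_inner M f u + cnj (L2_inner M f u)) + complex_of_real ((L2_norm M u)\<^sup>2)"
    unfolding L2_inner_self[symmetric]
    using assms by (simp add: L2_inner_diff_left L2_inner_diff_right L2_diff L2_inner_commute[of M u f])
  also have "\<dots> = complex_of_real ((L2_norm M f)\<^sup>2 - 2 * Re (L2_inner M f u) + (L2_norm M u)\<^sup>2)"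
    by (simp add: complex_add_cnj)
  finally show ?thesis by (simp only: of_real_eq_iff)
qed

text \<open>The squared norm of f - t <f,u> u is nonnegative for every real t; the factor <f,u>
  makes the mixed term real.\<close>

lemma L2_Cauchy_Schwarz:
  assumes "f \<in> L2_space M" "u \<in> L2_space M"
  shows "cmod (L2_inner M f u) \<le> L2_norm M f * L2_norm M u"
proof -
  define c where "c = L2_inner M f u"
  have *: "0 \<le> (L2_norm M f)\<^sup>2 - 2 * t * (cmod c)\<^sup>2 + t\<^sup>2 * (cmod c)\<^sup>2 * (L2_norm M u)\<^sup>2" for t :: real
  proof -
    define s where "s = complex_of_real t * c"
    have "0 \<le> (L2_norm M (\<lambda>x. f x - s * u x))\<^sup>2" by simp
    also have "\<dots> = (L2_norm M f)\<^sup>2 - 2 * Re (cnj s * c) + (L2_norm M (\<lambda>x. s * u x))\<^sup>2"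
      using assms by (simp add: L2_norm_diff_power2 L2_scale L2_inner_scale_right c_def)
    also have "(L2_norm M (\<lambda>x. s * u x))\<^sup>2 = (cmod s)\<^sup>2 * (L2_norm M u)\<^sup>2"
      by (simp add: L2_norm_power2 norm_mult power_mult_distrib)
    also have "Re (cnj s * c) = t * (cmod c)\<^sup>2"
      unfolding s_def cmod_power2 by (simp add: algebra_simps power2_eq_square)
    also have "(cmod s)\<^sup>2 = t\<^sup>2 * (cmod c)\<^sup>2"
      by (simp add: s_def norm_mult power_mult_distrib)
    finally show ?thesis by (simp add: algebra_simps)
  qed
  show ?thesis
  proof (cases "c = 0")
    case True thus ?thesis by (simp add: c_def[symmetric])
  next
    case False
    hence c: "(cmod c)\<^sup>2 > 0" by simp
    show ?thesis
    proof (cases "L2_norm M u = 0")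
      case True
      \<comment> \<open>With u of norm 0 the bound \<open>*\<close> is linear in t, and this t makes
        its right-hand side equal to -1.\<close>
      define t where "t = ((L2_norm M f)\<^sup>2 + 1) / (2 * (cmod c)\<^sup>2)"
      have "2 * t * (cmod c)\<^sup>2 = (L2_norm M f)\<^sup>2 + 1" using c by (simp add: t_def)
      with *[of t] True show ?thesis by simp
    next
      case False
      define U where "U = (L2_norm M u)\<^sup>2"
      have U: "U > 0" using False by (simp add: U_def)
      \<comment> \<open>The value t = 1/U minimizes the quadratic polynomial in
        \<open>*\<close>.\<close>
      have "0 \<le> (L2_norm M f)\<^sup>2 - (cmod c)\<^sup>2 / U"
        using *[of "1/U", folded U_def] U by (simp add: power2_eq_square field_simps)
      hence "(cmod c)\<^sup>2 \<le> (L2_norm M f * L2_norm M u)\<^sup>2"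
        using U by (simp add: U_def field_simps power_mult_distrib)
      thus ?thesis unfolding c_def by (rule power2_le_imp_le) simp
    qed
  qed
qed

lemma L2_norm_scale: "L2_norm M (\<lambda>x. a * f x) = cmod a * L2_norm M f"
  by (simp add: L2_norm_def norm_mult power_mult_distrib real_sqrt_mult)

lemma L2_norm_diff_triangle:
  assumes "f \<in> L2_space M" "u \<in> L2_space M"
  shows "L2_norm M (\<lambda>x. f x - u x) \<le> L2_norm M f + L2_norm M u"
proof (rule power2_le_imp_le)
  have "- Re (L2_inner M f u) \<le> L2_norm M f * L2_norm M u"
    using L2_Cauchy_Schwarz[OF assms] abs_Re_le_cmod[of "L2_inner M f u"] by linarith
  thus "(L2_norm M (\<lambda>x. f x - u x))\<^sup>2 \<le> (L2_norm M f + L2_norm M u)\<^sup>2"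
    unfolding L2_norm_diff_power2[OF assms] by (simp add: power2_sum)
qed simp

lemma L2_norm_triangle:
  assumes "f \<in> L2_space M" "u \<in> L2_space M"
  shows "L2_norm M (\<lambda>x. f x + u x) \<le> L2_norm M f + L2_norm M u"
  using L2_norm_diff_triangle[OF assms(1) L2_scale[OF assms(2), of "-1"]]
  unfolding L2_norm_scale by simp

lemma L2_norm_triangle3:
  assumes "f \<in> L2_space M" "u \<in> L2_space M" "v \<in> L2_space M"
  shows "L2_norm M (\<lambda>x. f x - v x) \<le> L2_norm M (\<lambda>x. f x - u x) + L2_norm M (\<lambda>x. u x - v x)"
  using L2_norm_triangle[OF L2_diff[OF assms(1,2)] L2_diff[OF assms(2,3)]] by simp

lemma L2_AE_eqI:
  assumes "f \<in> L2_space M" "u \<in> L2_space M" "L2_norm M (\<lambda>x. f x - u x) = 0"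
  shows "AE x in M. f x = u x"
  using assms L2_norm_eq_0_iff[OF L2_diff[OF assms(1,2)]] by simp

text \<open>Test with v = f - u. Equality in the space is equality almost everywhere, and this is
  how most operator identities below are obtained.\<close>

lemma L2_AE_eqI_inner:
  assumes "f \<in> L2_space M" "u \<in> L2_space M"
    and "\<And>v. v \<in> L2_space M \<Longrightarrow> L2_inner M f v = L2_inner M u v"
  shows "AE x in M. f x = u x"
proof (rule L2_AE_eqI[OF assms(1,2)])
  have "L2_inner M (\<lambda>x. f x - u x) (\<lambda>x. f x - u x) = 0"
    using assms by (simp add: L2_inner_diff_left L2_diff)
  thus "L2_norm M (\<lambda>x. f x - u x) = 0" by (simp add: L2_inner_self)
qed

text \<open>Riesz-Fischer: a subsequence with rapidly decreasing steps converges almost everywhere,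
  and Fatou's lemma carries the Cauchy bounds over to its limit.\<close>

lemma L2_complete:
  assumes f: "\<And>n. f n \<in> L2_space M"
    and Cauchy: "\<And>e. e > 0 \<Longrightarrow> \<exists>N. \<forall>m\<ge>N. \<forall>n\<ge>N. L2_norm M (\<lambda>x. f m x - f n x) < e"
  obtains F where "F \<in> L2_space M" "(\<lambda>n. L2_norm M (\<lambda>x. f n x - F x)) \<longlonglongrightarrow> 0"
proof -
  have fm [measurable]: "f n \<in> borel_measurable M" for n using f by (rule L2_space_measurable)
  have nn: "(\<integral>\<^sup>+x. ennreal ((cmod (f m x - f n x))\<^sup>2) \<partial>M) = ennreal ((L2_norm M (\<lambda>x. f m x - f n x))\<^sup>2)" for m n
    unfolding L2_norm_power2
    by (rule nn_integral_eq_integral) (use L2_space_integrable[OF L2_diff[OF f f]] in auto)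
  have "\<exists>N. \<forall>m\<ge>N. \<forall>n\<ge>N. L2_norm M (\<lambda>x. f m x - f n x) < (1/4) ^ k" for k :: nat
    by (rule Cauchy) simp
  then obtain r0 where r0: "\<And>k m n. m \<ge> r0 k \<Longrightarrow> n \<ge> r0 k \<Longrightarrow> L2_norm M (\<lambda>x. f m x - f n x) < (1/4) ^ k"
    by metis
  \<comment> \<open>The partial sums make r increasing, and the summand k makes it unbounded, so
    that the subsequence passes every N in the Fatou step.\<close>
  define r where "r k = (\<Sum>j\<le>k. r0 j) + k" for k
  have r_ge: "r k \<ge> r0 k" for k by (simp add: r_def member_le_sum trans_le_add1)
  have r_mono: "r k \<le> r (Suc k)" for k by (simp add: r_def)
  have r_k: "r k \<ge> k" for k by (simp add: r_def)
  define d where "d k x = cmod (f (r (Suc k)) x - f (r k) x)" for k x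
  have dm [measurable]: "d k \<in> borel_measurable M" for k unfolding d_def by measurable
  \<comment> \<open>The steps have squared norm at most 16^(-k). The weight 4^k still leaves a
    convergent series, and finiteness of its sum at a point forces the steps there below 2^(-k)
    eventually.\<close>
  have d_int: "(\<integral>\<^sup>+x. ennreal (4 ^ k * (d k x)\<^sup>2) \<partial>M) \<le> ennreal ((1/4) ^ k)" for k
  proof -
    have "(\<integral>\<^sup>+x. ennreal (4 ^ k * (d k x)\<^sup>2) \<partial>M) = ennreal (4 ^ k) * (\<integral>\<^sup>+x. ennreal ((d k x)\<^sup>2) \<partial>M)"
      by (subst nn_integral_cmult[symmetric]) (auto simp: ennreal_mult)
    also have "\<dots> = ennreal (4 ^ k * (L2_norm M (\<lambda>x. f (r (Suc k)) x - f (r k) x))\<^sup>2)"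
      unfolding d_def nn by (simp add: ennreal_mult)
    also have "\<dots> \<le> ennreal (4 ^ k * ((1/4) ^ k)\<^sup>2)"
      using r0[of k "r (Suc k)" "r k"] r_ge[of k] r_mono[of k]
      by (intro ennreal_leI mult_left_mono power_mono) auto
    also have "4 ^ k * ((1/4) ^ k)\<^sup>2 = ((1/4) ^ k :: real)"
      by (simp add: power2_eq_square power_one_over)
    finally show ?thesis .
  qed
  have "(\<integral>\<^sup>+x. (\<Sum>k. ennreal (4 ^ k * (d k x)\<^sup>2)) \<partial>M) = (\<Sum>k. \<integral>\<^sup>+x. ennreal (4 ^ k * (d k x)\<^sup>2) \<partial>M)"
    by (rule nn_integral_suminf) measurable
  also have "\<dots> \<le> (\<Sum>k. ennreal ((1/4) ^ k))"
    by (intro suminf_le d_int) auto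
  also have "\<dots> = ennreal (\<Sum>k. (1/4) ^ k)"
    by (rule suminf_ennreal2) (auto simp: summable_geometric)
  also have "\<dots> < \<infinity>" by simp
  finally have "AE x in M. (\<Sum>k. ennreal (4 ^ k * (d k x)\<^sup>2)) \<noteq> \<infinity>"
    by (intro nn_integral_PInf_AE) auto
  hence conv: "AE x in M. convergent (\<lambda>k. f (r k) x)"
  proof (rule AE_mp, intro AE_I2 impI)
    fix x assume fin: "(\<Sum>k. ennreal (4 ^ k * (d k x)\<^sup>2)) \<noteq> \<infinity>"
    have "summable (\<lambda>k. 4 ^ k * (d k x)\<^sup>2)"
      by (rule summable_suminf_not_top) (use fin in auto)
    hence "(\<lambda>k. 4 ^ k * (d k x)\<^sup>2) \<longlonglongrightarrow> 0" by (rule summable_LIMSEQ_zero)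
    hence "\<forall>\<^sub>F k in sequentially. 4 ^ k * (d k x)\<^sup>2 < 1" by (rule order_tendstoD) simp
    hence ev: "\<forall>\<^sub>F k in sequentially. norm (f (r (Suc k)) x - f (r k) x) \<le> (1/2) ^ k"
    proof eventually_elim
      case (elim k)
      have "(2 ^ k)\<^sup>2 = (4 ^ k :: real)" by (simp add: power2_eq_square flip: power_mult_distrib)
      hence "(2 ^ k * d k x)\<^sup>2 < 1\<^sup>2" using elim by (simp add: power_mult_distrib)
      hence "2 ^ k * d k x < 1" by (rule power_less_imp_less_base) simp
      thus ?case by (simp add: d_def power_one_over field_simps)
    qed
    have "summable (\<lambda>k. f (r (Suc k)) x - f (r k) x)"
      by (rule summable_comparison_test_ev[OF ev]) (auto simp: summable_geometric)
    hence "(\<lambda>n. \<Sum>k<n. f (r (Suc k)) x - f (r k) x) \<longlonglongrightarrow> suminf (\<lambda>k. f (r (Suc k)) x - f (r k) x)"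
      by (rule summable_LIMSEQ)
    hence "(\<lambda>n. f (r n) x - f (r 0) x) \<longlonglongrightarrow> suminf (\<lambda>k. f (r (Suc k)) x - f (r k) x)"
      using sum_lessThan_telescope[of "\<lambda>k. f (r k) x"] by simp
    hence "(\<lambda>n. (f (r n) x - f (r 0) x) + f (r 0) x) \<longlonglongrightarrow> suminf (\<lambda>k. f (r (Suc k)) x - f (r k) x) + f (r 0) x"
      by (intro tendsto_intros)
    thus "convergent (\<lambda>k. f (r k) x)" by (auto simp: convergent_def)
  qed
  define F where "F x = lim (\<lambda>k. f (r k) x)" for x
  have Fm [measurable]: "F \<in> borel_measurable M" unfolding F_def by measurable
  have FAE: "AE x in M. (\<lambda>k. f (r k) x) \<longlonglongrightarrow> F x"
    using conv by eventually_elim (simp add: F_def convergent_LIMSEQ_iff)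
  have bound: "(\<integral>\<^sup>+x. ennreal ((cmod (f n x - F x))\<^sup>2) \<partial>M) \<le> ennreal (e\<^sup>2)"
    if "\<forall>m\<ge>N. L2_norm M (\<lambda>x. f n x - f m x) < e" for n N e
  proof -
    have "(\<integral>\<^sup>+x. ennreal ((cmod (f n x - F x))\<^sup>2) \<partial>M) = (\<integral>\<^sup>+x. liminf (\<lambda>k. ennreal ((cmod (f n x - f (r k) x))\<^sup>2)) \<partial>M)"
    proof (rule nn_integral_cong_AE, use FAE in eventually_elim)
      case (elim x)
      have "(\<lambda>k. ennreal ((cmod (f n x - f (r k) x))\<^sup>2)) \<longlonglongrightarrow> ennreal ((cmod (f n x - F x))\<^sup>2)"
        by (intro tendsto_intros elim tendsto_ennrealI)
      thus ?case by (rule lim_imp_Liminf[OF trivial_limit_sequentially, symmetric])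
    qed
    also have "\<dots> \<le> liminf (\<lambda>k. \<integral>\<^sup>+x. ennreal ((cmod (f n x - f (r k) x))\<^sup>2) \<partial>M)"
      by (rule nn_integral_liminf) measurable
    also have "\<dots> \<le> ennreal (e\<^sup>2)"
    proof (rule Liminf_le[OF trivial_limit_sequentially], rule eventually_mono[OF eventually_ge_at_top[of N]])
      fix k assume "k \<ge> N"
      hence "L2_norm M (\<lambda>x. f n x - f (r k) x) < e" using that r_k[of k] by (meson order_trans)
      thus "(\<integral>\<^sup>+x. ennreal ((cmod (f n x - f (r k) x))\<^sup>2) \<partial>M) \<le> ennreal (e\<^sup>2)"
        unfolding nn by (intro ennreal_leI power_mono) auto
    qed
    finally show ?thesis .
  qed
  have mem: "(\<lambda>x. f n x - F x) \<in> L2_space M" and le: "L2_norm M (\<lambda>x. f n x - F x) \<le> e"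
    if "\<forall>m\<ge>N. L2_norm M (\<lambda>x. f n x - f m x) < e" "e > 0" for n N e
  proof -
    note b = bound[OF that(1)]
    have i: "integrable M (\<lambda>x. (cmod (f n x - F x))\<^sup>2)"
      using le_less_trans[OF b ennreal_less_top] by (intro integrableI_bounded) auto
    thus "(\<lambda>x. f n x - F x) \<in> L2_space M" by (simp add: L2_space_def)
    have "ennreal ((L2_norm M (\<lambda>x. f n x - F x))\<^sup>2) \<le> ennreal (e\<^sup>2)"
      unfolding L2_norm_power2 using b i by (simp add: nn_integral_eq_integral)
    hence "(L2_norm M (\<lambda>x. f n x - F x))\<^sup>2 \<le> e\<^sup>2" by (subst (asm) ennreal_le_iff) auto
    thus "L2_norm M (\<lambda>x. f n x - F x) \<le> e" by (rule power2_le_imp_le) (use that(2) in simp)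
  qed
  \<comment> \<open>Square-integrability is so far known only for the differences f n - F, so F is
    recovered from f N1 and one of them.\<close>
  obtain N1 where N1: "\<forall>m\<ge>N1. \<forall>n\<ge>N1. L2_norm M (\<lambda>x. f m x - f n x) < 1" using Cauchy[of 1] by auto
  have "(\<lambda>x. f N1 x - F x) \<in> L2_space M" by (rule mem[of N1 N1 1]) (use N1 in simp_all)
  from L2_diff[OF f[of N1] this] have F: "F \<in> L2_space M" by simp
  have "(\<lambda>n. L2_norm M (\<lambda>x. f n x - F x)) \<longlonglongrightarrow> 0"
  proof (rule LIMSEQ_I)
    fix e :: real assume e: "e > 0"
    obtain N where N: "\<forall>m\<ge>N. \<forall>n\<ge>N. L2_norm M (\<lambda>x. f m x - f n x) < e/2" using Cauchy[of "e/2"] e by auto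
    have "L2_norm M (\<lambda>x. f n x - F x) \<le> e/2" if "n \<ge> N" for n
      by (rule le[of N n]) (use N e that in simp_all)
    thus "\<exists>N. \<forall>n\<ge>N. norm (L2_norm M (\<lambda>x. f n x - F x) - 0) < e"
      using e by (intro exI[of _ N]) fastforce
  qed
  with F show ?thesis by (rule that)
qed

text \<open>Limits have to lie in S only up to a null set: the pullbacks along a map, to which this
  is applied, are not closed under changes on null sets.\<close>

definition L2_closed_subspace :: "'a measure \<Rightarrow> ('a \<Rightarrow> complex) set \<Rightarrow> bool" where
  "L2_closed_subspace M S \<longleftrightarrow> S \<subseteq> L2_space M \<and> S \<noteq> {} \<and>
     (\<forall>f\<in>S. \<forall>u\<in>S. \<forall>a b. (\<lambda>x. a * f x + b * u x) \<in> S) \<and>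
     (\<forall>f F. (\<forall>n::nat. f n \<in> S) \<longrightarrow> F \<in> L2_space M \<longrightarrow>
        (\<lambda>n. L2_norm M (\<lambda>x. f n x - F x)) \<longlonglongrightarrow> 0 \<longrightarrow> (\<exists>G\<in>S. AE x in M. F x = G x))"

lemma L2_parallelogram:
  assumes "f \<in> L2_space M" "u \<in> L2_space M"
  shows "(L2_norm M (\<lambda>x. f x + u x))\<^sup>2 + (L2_norm M (\<lambda>x. f x - u x))\<^sup>2 = 2 * (L2_norm M f)\<^sup>2 + 2 * (L2_norm M u)\<^sup>2"
  using L2_norm_diff_power2[OF assms] L2_norm_diff_power2[OF assms(1) L2_scale[OF assms(2), of "-1"]]
    L2_inner_scale_right[OF assms(2,1), of "-1"] L2_norm_scale[of M "-1" u]
  by simp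

text \<open>Hilbert's projection theorem. The midpoint of two members of S is not nearer to f than
  the infimum, so the parallelogram law makes a minimizing sequence Cauchy. Orthogonality follows by
  comparing the minimizer p with p + a u.\<close>

lemma L2_projection_exists:
  assumes S: "L2_closed_subspace M S" and f: "f \<in> L2_space M"
  obtains p where "is_orthogonal_projection M S f p"
proof -
  have SL: "S \<subseteq> L2_space M" and lin: "\<And>h u a b. h \<in> S \<Longrightarrow> u \<in> S \<Longrightarrow> (\<lambda>x. a * h x + b * u x) \<in> S"
    using S by (auto simp: L2_closed_subspace_def)
  define D where "D = (\<lambda>s. (L2_norm M (\<lambda>x. f x - s x))\<^sup>2) ` S"
  define d where "d = Inf D"
  have Dne: "D \<noteq> {}" using S by (auto simp: D_def L2_closed_subspace_def)
  have bdd: "bdd_below D" by (rule bdd_belowI[of _ 0]) (auto simp: D_def)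
  have d_le: "d \<le> (L2_norm M (\<lambda>x. f x - s x))\<^sup>2" if "s \<in> S" for s
    unfolding d_def by (rule cInf_lower[OF _ bdd]) (use that in \<open>auto simp: D_def\<close>)
  have "\<exists>s\<in>S. (L2_norm M (\<lambda>x. f x - s x))\<^sup>2 < d + inverse (real (Suc n))" for n
    using cInf_lessD[OF Dne, of "d + inverse (real (Suc n))"] by (auto simp: D_def d_def)
  then obtain s where s: "\<And>n. s n \<in> S" 
    and sd: "\<And>n. (L2_norm M (\<lambda>x. f x - s n x))\<^sup>2 < d + inverse (real (Suc n))" by metis
  have sL: "s n \<in> L2_space M" for n using s SL by auto
  have diff: "(L2_norm M (\<lambda>x. s m x - s n x))\<^sup>2 \<le> 2 * inverse (real (Suc n)) + 2 * inverse (real (Suc m))" for m n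
  proof -
    have "(L2_norm M (\<lambda>x. (f x - s n x) + (f x - s m x)))\<^sup>2 + (L2_norm M (\<lambda>x. (f x - s n x) - (f x - s m x)))\<^sup>2
        = 2 * (L2_norm M (\<lambda>x. f x - s n x))\<^sup>2 + 2 * (L2_norm M (\<lambda>x. f x - s m x))\<^sup>2"
      by (rule L2_parallelogram) (auto intro: L2_diff f sL)
    moreover have "(\<lambda>x. (f x - s n x) + (f x - s m x)) = (\<lambda>x. 2 * (f x - ((1/2) * s n x + (1/2) * s m x)))"
      by (auto simp: algebra_simps)
    hence "(L2_norm M (\<lambda>x. (f x - s n x) + (f x - s m x)))\<^sup>2 = 4 * (L2_norm M (\<lambda>x. f x - ((1/2) * s n x + (1/2) * s m x)))\<^sup>2"
      by (simp only: L2_norm_scale power_mult_distrib) simp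
    moreover have "d \<le> (L2_norm M (\<lambda>x. f x - ((1/2) * s n x + (1/2) * s m x)))\<^sup>2"
      by (rule d_le) (rule lin[OF s s])
    moreover have "(\<lambda>x. (f x - s n x) - (f x - s m x)) = (\<lambda>x. s m x - s n x)" by auto
    ultimately show ?thesis using sd[of n] sd[of m] by simp
  qed
  have "\<exists>N. \<forall>m\<ge>N. \<forall>n\<ge>N. L2_norm M (\<lambda>x. s m x - s n x) < e" if "e > 0" for e
  proof -
    obtain N where N: "inverse (real (Suc N)) < e\<^sup>2 / 4" 
      using reals_Archimedean[of "e\<^sup>2/4"] \<open>e > 0\<close> by (metis zero_less_divide_iff zero_less_numeral zero_less_power)
    have "L2_norm M (\<lambda>x. s m x - s n x) < e" if mn: "m \<ge> N" "n \<ge> N" for m n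
    proof (rule power2_less_imp_less)
      have "inverse (real (Suc k)) \<le> inverse (real (Suc N))" if "k \<ge> N" for k
        using that by (simp add: field_simps)
      from this[OF mn(1)] this[OF mn(2)] 
      show "(L2_norm M (\<lambda>x. s m x - s n x))\<^sup>2 < e\<^sup>2" using diff[of m n] N by linarith
    qed (use \<open>e > 0\<close> in simp)
    thus ?thesis by blast
  qed
  from L2_complete[OF sL this] obtain F where F: "F \<in> L2_space M" "(\<lambda>n. L2_norm M (\<lambda>x. s n x - F x)) \<longlonglongrightarrow> 0"
    by blast
  then obtain p where p: "p \<in> S" and pF: "AE x in M. F x = p x"
    using S s unfolding L2_closed_subspace_def by blast
  have pL: "p \<in> L2_space M" using p SL by auto
  have np: "L2_norm M (\<lambda>x. s n x - p x) = L2_norm M (\<lambda>x. s n x - F x)" for n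
    by (rule L2_norm_cong_AE) (use pF sL pL F L2_diff in auto)
  have pd: "(L2_norm M (\<lambda>x. f x - p x))\<^sup>2 \<le> d"
  proof -
    have lim: "(\<lambda>n. (sqrt (d + inverse (real (Suc n))) + L2_norm M (\<lambda>x. s n x - p x))\<^sup>2) \<longlonglongrightarrow> (sqrt (d + 0) + 0)\<^sup>2"
      by (intro tendsto_intros LIMSEQ_inverse_real_of_nat) (use F np in simp)
    have d0: "d \<ge> 0" unfolding d_def by (rule cInf_greatest[OF Dne]) (auto simp: D_def)
    have "L2_norm M (\<lambda>x. f x - p x) \<le> sqrt (d + inverse (real (Suc n))) + L2_norm M (\<lambda>x. s n x - p x)" for n
    proof -
      have "L2_norm M (\<lambda>x. f x - s n x) \<le> sqrt (d + inverse (real (Suc n)))"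
        using sd[of n] by (intro real_le_rsqrt) simp
      with L2_norm_triangle3[OF f sL[of n] pL] show ?thesis by linarith
    qed
    hence "(L2_norm M (\<lambda>x. f x - p x))\<^sup>2 \<le> (sqrt (d + inverse (real (Suc n))) + L2_norm M (\<lambda>x. s n x - p x))\<^sup>2" for n
      by (intro power_mono) auto
    from LIMSEQ_le_const[OF lim] this have "(L2_norm M (\<lambda>x. f x - p x))\<^sup>2 \<le> (sqrt (d + 0) + 0)\<^sup>2" by blast
    thus ?thesis using d0 by simp
  qed
  have "L2_inner M (\<lambda>x. f x - p x) u = 0" if u: "u \<in> S" for u
  proof -
    have uL: "u \<in> L2_space M" using u SL by auto
    define c where "c = L2_inner M (\<lambda>x. f x - p x) u"
    \<comment> \<open>The added 1 avoids a division by zero and still gives t |u|^2 <= 1, so that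
      minimality turns into 2 |c|^2 <= |c|^2.\<close>
    define t where "t = 1 / ((L2_norm M u)\<^sup>2 + 1)"
    define a where "a = complex_of_real t * c"
    have fp: "(\<lambda>x. f x - p x) \<in> L2_space M" by (rule L2_diff[OF f pL])
    have "(L2_norm M (\<lambda>x. f x - p x))\<^sup>2 \<le> (L2_norm M (\<lambda>x. (f x - p x) - a * u x))\<^sup>2"
    proof -
      have "(\<lambda>x. f x - (1 * p x + a * u x)) = (\<lambda>x. (f x - p x) - a * u x)" by (simp add: algebra_simps)
      with d_le[OF lin[OF p u, of 1 a]] have "d \<le> (L2_norm M (\<lambda>x. (f x - p x) - a * u x))\<^sup>2" by metis
      with pd show ?thesis by (rule order_trans)
    qed
    also have "\<dots> = (L2_norm M (\<lambda>x. f x - p x))\<^sup>2 - 2 * Re (cnj a * c) + (cmod a)\<^sup>2 * (L2_norm M u)\<^sup>2"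
      using L2_norm_diff_power2[OF fp L2_scale[OF uL, of a]] 
      by (simp add: L2_inner_scale_right[OF uL fp] c_def L2_norm_scale power_mult_distrib)
    also have "Re (cnj a * c) = t * (cmod c)\<^sup>2"
      unfolding a_def cmod_power2 by (simp add: algebra_simps power2_eq_square)
    also have "(cmod a)\<^sup>2 = t\<^sup>2 * (cmod c)\<^sup>2"
      by (simp add: a_def norm_mult power_mult_distrib)
    finally have "2 * t * (cmod c)\<^sup>2 \<le> t\<^sup>2 * (cmod c)\<^sup>2 * (L2_norm M u)\<^sup>2" by simp
    hence "t * (2 * (cmod c)\<^sup>2) \<le> t * ((cmod c)\<^sup>2 * (t * (L2_norm M u)\<^sup>2))" 
      by (simp add: power2_eq_square algebra_simps)
    moreover have t: "t > 0" by (simp add: t_def add_nonneg_pos)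
    ultimately have 1: "2 * (cmod c)\<^sup>2 \<le> (cmod c)\<^sup>2 * (t * (L2_norm M u)\<^sup>2)" 
      by (simp only: mult_le_cancel_left_pos)
    have "t * (L2_norm M u)\<^sup>2 \<le> 1" by (simp add: t_def divide_simps add_nonneg_pos) 
    hence "(cmod c)\<^sup>2 * (t * (L2_norm M u)\<^sup>2) \<le> (cmod c)\<^sup>2 * 1" by (intro mult_left_mono) auto
    with 1 have "(cmod c)\<^sup>2 \<le> 0" by linarith
    thus ?thesis by (simp add: c_def)
  qed
  with p have "is_orthogonal_projection M S f p" by (simp add: is_orthogonal_projection_def)
  thus ?thesis by (rule that)
qed

section \<open>Symmetric operators and orthogonal projections\<close>

text \<open>Covers projections, reflections and the values of a projection-valued measure at once.
  Linearity and compatibility with almost-everywhere equality are consequences of the symmetry, see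
  \<open>L2_symmetric_lincomb\<close> and \<open>L2_symmetric_cong\<close>.\<close>

definition L2_symmetric :: "'a measure \<Rightarrow> (('a \<Rightarrow> complex) \<Rightarrow> 'a \<Rightarrow> complex) \<Rightarrow> bool" where
  "L2_symmetric M R \<longleftrightarrow> (\<forall>f\<in>L2_space M. R f \<in> L2_space M) \<and>
     (\<forall>f\<in>L2_space M. \<forall>u\<in>L2_space M. L2_inner M (R f) u = L2_inner M f (R u))"

lemma L2_symmetric_mem: "L2_symmetric M R \<Longrightarrow> f \<in> L2_space M \<Longrightarrow> R f \<in> L2_space M"
  by (simp add: L2_symmetric_def)

lemma L2_symmetric_inner:
  "L2_symmetric M R \<Longrightarrow> f \<in> L2_space M \<Longrightarrow> u \<in> L2_space M \<Longrightarrow> L2_inner M (R f) u = L2_inner M f (R u)"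
  by (simp add: L2_symmetric_def)

text \<open>R is moved to the test function; what remains is linearity of the inner product.\<close>

lemma L2_symmetric_lincomb:
  assumes R: "L2_symmetric M R" and f: "f \<in> L2_space M" and u: "u \<in> L2_space M"
  shows "AE x in M. R (\<lambda>x. a * f x + b * u x) x = a * R f x + b * R u x"
  by (rule L2_AE_eqI_inner)
     (simp_all add: L2_symmetric_mem[OF R] L2_lincomb f u L2_symmetric_inner[OF R] L2_inner_lincomb_left)

lemma L2_symmetric_diff:
  assumes "L2_symmetric M R" "f \<in> L2_space M" "u \<in> L2_space M"
  shows "AE x in M. R (\<lambda>x. f x - u x) x = R f x - R u x"
  using L2_symmetric_lincomb[OF assms, of 1 "-1"] by simp

lemma L2_symmetric_add:
  assumes "L2_symmetric M R" "f \<in> L2_space M" "u \<in> L2_space M"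
  shows "AE x in M. R (\<lambda>x. f x + u x) x = R f x + R u x"
  using L2_symmetric_lincomb[OF assms, of 1 1] by simp

lemma L2_symmetric_cong:
  assumes R: "L2_symmetric M R" and f: "f \<in> L2_space M" and u: "u \<in> L2_space M" and "AE x in M. f x = u x"
  shows "AE x in M. R f x = R u x"
proof (rule L2_AE_eqI_inner)
  fix v assume v: "v \<in> L2_space M"
  have "L2_inner M f (R v) = L2_inner M u (R v)"
    by (rule L2_inner_cong_AE) (use assms v L2_symmetric_mem[OF R] in auto)
  thus "L2_inner M (R f) v = L2_inner M (R u) v" 
    by (simp add: L2_symmetric_inner[OF R] f u v)
qed (use R f u L2_symmetric_mem in auto)

lemma L2_symmetric_sum:
  assumes R: "L2_symmetric M R" and "finite I" "\<And>i. i \<in> I \<Longrightarrow> f i \<in> L2_space M"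
  shows "AE x in M. R (\<lambda>x. \<Sum>i\<in>I. f i x) x = (\<Sum>i\<in>I. R (f i) x)"
  using assms(2,3)
proof (induction I rule: finite_induct)
  case empty
  show ?case using L2_symmetric_lincomb[OF R L2_zero L2_zero, of 0 0] by simp
next
  case (insert i I)
  have "AE x in M. R (\<lambda>x. f i x + (\<Sum>i\<in>I. f i x)) x = R (f i) x + R (\<lambda>x. \<Sum>i\<in>I. f i x) x"
    by (rule L2_symmetric_add[OF R]) (use insert in \<open>auto intro: L2_sum\<close>)
  moreover have "AE x in M. R (\<lambda>x. \<Sum>i\<in>I. f i x) x = (\<Sum>i\<in>I. R (f i) x)" using insert by auto
  ultimately show ?case using insert(1,2) by auto
qed

text \<open>U is its own adjoint and, up to null sets, its own inverse, hence unitary.\<close>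

lemma L2_involution_inner:
  assumes U: "L2_symmetric M U" and UU: "\<And>f. f \<in> L2_space M \<Longrightarrow> AE x in M. U (U f) x = f x"
    and f: "f \<in> L2_space M" and u: "u \<in> L2_space M"
  shows "L2_inner M (U f) (U u) = L2_inner M f u"
proof -
  note Umem = L2_symmetric_mem[OF U]
  have "L2_inner M f (U (U u)) = L2_inner M f u"
    by (rule L2_inner_cong_AE[OF AE_I2[OF refl] UU[OF u]]) (intro Umem f u)+
  thus ?thesis by (simp add: L2_symmetric_inner[OF U f Umem[OF u]])
qed

lemma is_orthogonal_projection_unique:
  assumes S: "L2_closed_subspace M S" and f: "f \<in> L2_space M"
    and p: "is_orthogonal_projection M S f p" and q: "is_orthogonal_projection M S f q"
  shows "AE x in M. p x = q x"
proof -
  have SL: "S \<subseteq> L2_space M" using S by (simp add: L2_closed_subspace_def)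
  have pq: "p \<in> S" "q \<in> S" and pqL: "p \<in> L2_space M" "q \<in> L2_space M"
    using p q SL by (auto simp: is_orthogonal_projection_def)
  have s: "(\<lambda>x. p x - q x) \<in> S"
  proof -
    have "(\<lambda>x. 1 * p x + (-1) * q x) \<in> S" using S pq unfolding L2_closed_subspace_def by blast
    thus ?thesis by simp
  qed
  have sL: "(\<lambda>x. p x - q x) \<in> L2_space M" using s SL by auto
  have "L2_inner M f (\<lambda>x. p x - q x) = L2_inner M p (\<lambda>x. p x - q x)"
    "L2_inner M f (\<lambda>x. p x - q x) = L2_inner M q (\<lambda>x. p x - q x)"
    using p q s sL f pqL by (auto simp: is_orthogonal_projection_def L2_inner_diff_left)
  hence "L2_inner M (\<lambda>x. p x - q x) (\<lambda>x. p x - q x) = 0"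
    using L2_inner_diff_left[OF pqL sL] by simp
  thus ?thesis by (intro L2_AE_eqI[OF pqL]) (simp add: L2_inner_self)
qed

definition L2_proj :: "'a measure \<Rightarrow> ('a \<Rightarrow> complex) set \<Rightarrow> ('a \<Rightarrow> complex) \<Rightarrow> 'a \<Rightarrow> complex" where
  "L2_proj M S f = (SOME p. is_orthogonal_projection M S f p)"

context
  fixes M :: "'a measure" and S
  assumes S: "L2_closed_subspace M S"
begin

lemma L2_proj_is_projection: "f \<in> L2_space M \<Longrightarrow> is_orthogonal_projection M S f (L2_proj M S f)"
  unfolding L2_proj_def using L2_projection_exists[OF S] by (metis someI_ex)

lemma L2_closed_subspace_mem: "f \<in> S \<Longrightarrow> f \<in> L2_space M"
  using S by (auto simp: L2_closed_subspace_def)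

lemma L2_proj_mem: "f \<in> L2_space M \<Longrightarrow> L2_proj M S f \<in> S"
  using L2_proj_is_projection by (auto simp: is_orthogonal_projection_def)

lemma L2_proj_mem_L2: "f \<in> L2_space M \<Longrightarrow> L2_proj M S f \<in> L2_space M"
  by (simp add: L2_closed_subspace_mem L2_proj_mem)

lemma L2_proj_inner:
  assumes "f \<in> L2_space M" "s \<in> S"
  shows "L2_inner M (L2_proj M S f) s = L2_inner M f s"
  using L2_proj_is_projection[OF assms(1)] assms
  by (auto simp: is_orthogonal_projection_def L2_inner_diff_left L2_closed_subspace_mem)

lemma L2_proj_symmetric: "L2_symmetric M (L2_proj M S)"
proof -
  have "L2_inner M (L2_proj M S f) u = L2_inner M f (L2_proj M S u)"
    if "f \<in> L2_space M" "u \<in> L2_space M" for f u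
    using L2_proj_inner[OF that(2) L2_proj_mem[OF that(1)]] L2_proj_inner[OF that(1) L2_proj_mem[OF that(2)]]
    by (metis L2_inner_commute)
  thus ?thesis by (simp add: L2_symmetric_def L2_proj_mem_L2)
qed

lemma L2_proj_eqI:
  assumes "f \<in> L2_space M" "q \<in> S" "\<And>s. s \<in> S \<Longrightarrow> L2_inner M f s = L2_inner M q s"
  shows "AE x in M. L2_proj M S f x = q x"
proof (rule is_orthogonal_projection_unique[OF S assms(1) L2_proj_is_projection[OF assms(1)]])
  show "is_orthogonal_projection M S f q"
    using assms by (auto simp: is_orthogonal_projection_def L2_inner_diff_left L2_closed_subspace_mem)
qed

lemma L2_proj_id: "s \<in> S \<Longrightarrow> AE x in M. L2_proj M S s x = s x"
  by (rule L2_proj_eqI) (auto intro: L2_closed_subspace_mem)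

lemma L2_proj_norm_le:
  assumes "f \<in> L2_space M"
  shows "L2_norm M (L2_proj M S f) \<le> L2_norm M f"
proof -
  have "(L2_norm M (L2_proj M S f))\<^sup>2 = cmod (L2_inner M f (L2_proj M S f))"
    using L2_proj_inner[OF assms L2_proj_mem[OF assms]] L2_inner_self[of M "L2_proj M S f"]
    by (metis abs_power2 norm_of_real)
  also have "\<dots> \<le> L2_norm M f * L2_norm M (L2_proj M S f)"
    by (rule L2_Cauchy_Schwarz[OF assms L2_proj_mem_L2[OF assms]])
  finally show ?thesis
    by (cases "L2_norm M (L2_proj M S f) = 0") (auto simp: power2_eq_square less_le)
qed

text \<open>Passing from P to 2P - 1 turns commutation with P into invariance under conjugation by a
  unitary, and conjugates of self-adjoint operators and of spectral measures are objects of the same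
  kind, to which uniqueness applies.\<close>

lemma L2_proj_reflection:
  defines "U \<equiv> \<lambda>f x. 2 * L2_proj M S f x - f x"
  shows "L2_symmetric M U" and "f \<in> L2_space M \<Longrightarrow> AE x in M. U (U f) x = f x"
proof -
  have mem: "U f \<in> L2_space M" if "f \<in> L2_space M" for f
    unfolding U_def by (rule L2_diff[OF L2_scale]) (use that L2_proj_mem_L2 in auto)
  show "L2_symmetric M U"
    unfolding L2_symmetric_def
  proof (intro conjI ballI mem)
    fix f u assume f: "f \<in> L2_space M" and u: "u \<in> L2_space M"
    show "L2_inner M (U f) u = L2_inner M f (U u)"
      using f u L2_symmetric_inner[OF L2_proj_symmetric f u] unfolding U_def
      by (simp add: L2_inner_diff_left L2_inner_diff_right L2_inner_scale_left L2_inner_scale_right L2_scale L2_proj_mem_L2)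
  qed
  assume f: "f \<in> L2_space M"
  have "AE x in M. L2_proj M S (\<lambda>x. 2 * L2_proj M S f x + (-1) * f x) x = 2 * L2_proj M S (L2_proj M S f) x + (-1) * L2_proj M S f x"
    by (rule L2_symmetric_lincomb[OF L2_proj_symmetric]) (auto intro: f L2_proj_mem_L2)
  moreover have "AE x in M. L2_proj M S (L2_proj M S f) x = L2_proj M S f x"
    by (rule L2_proj_id) (rule L2_proj_mem[OF f])
  ultimately show "AE x in M. U (U f) x = f x"
    unfolding U_def by eventually_elim simp
qed

end

section \<open>Self-adjoint operators\<close>

context
  fixes M :: "'a measure" and T
  assumes T: "L2_self_adjoint M T"
begin

lemma self_adjoint_mem:
  assumes "(f, h) \<in> T"
  shows "f \<in> L2_space M" "h \<in> L2_space M"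
proof -
  have "(f, h) \<in> L2_adjoint M T" using T assms by (simp add: L2_self_adjoint_def)
  thus "f \<in> L2_space M" "h \<in> L2_space M" by (auto simp: L2_adjoint_def)
qed

lemma self_adjoint_inner:
  assumes "(f, h) \<in> T" "(u, v) \<in> T"
  shows "L2_inner M h u = L2_inner M f v"
proof -
  have "(u, v) \<in> L2_adjoint M T" using T assms by (simp add: L2_self_adjoint_def)
  thus ?thesis using assms by (auto simp: L2_adjoint_def)
qed

lemma self_adjointI:
  assumes "u \<in> L2_space M" "v \<in> L2_space M"
    "\<And>f h. (f, h) \<in> T \<Longrightarrow> L2_inner M h u = L2_inner M f v"
  shows "(u, v) \<in> T"
proof -
  have "(u, v) \<in> L2_adjoint M T" using assms by (auto simp: L2_adjoint_def)
  thus ?thesis using T by (simp add: L2_self_adjoint_def)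
qed

text \<open>Membership in the adjoint is decided by inner products alone, which do not see null
  sets.\<close>

lemma self_adjoint_cong:
  assumes "(u, v) \<in> T" "AE x in M. u x = u' x" "AE x in M. v x = v' x" "u' \<in> L2_space M" "v' \<in> L2_space M"
  shows "(u', v') \<in> T"
proof (rule self_adjointI[OF assms(4,5)])
  fix f h assume fh: "(f, h) \<in> T"
  note mem = self_adjoint_mem[OF fh] self_adjoint_mem[OF assms(1)]
  have "L2_inner M h u' = L2_inner M h u" "L2_inner M f v' = L2_inner M f v"
    by (rule L2_inner_cong_AE; use assms mem in auto)+
  thus "L2_inner M h u' = L2_inner M f v'" using self_adjoint_inner[OF fh assms(1)] by simp
qed

lemma self_adjoint_lincomb:
  assumes "(f, h) \<in> T" "(u, v) \<in> T"
  shows "((\<lambda>x. a * f x + b * u x), (\<lambda>x. a * h x + b * v x)) \<in> T"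
  using self_adjoint_mem[OF assms(1)] self_adjoint_mem[OF assms(2)]
proof (intro self_adjointI L2_lincomb)
  fix f' h' assume fh: "(f', h') \<in> T"
  show "L2_inner M h' (\<lambda>x. a * f x + b * u x) = L2_inner M f' (\<lambda>x. a * h x + b * v x)"
    using self_adjoint_mem[OF assms(1)] self_adjoint_mem[OF assms(2)] self_adjoint_mem[OF fh]
      self_adjoint_inner[OF fh assms(1)] self_adjoint_inner[OF fh assms(2)]
    by (simp add: L2_inner_lincomb_right)
qed

lemma self_adjoint_dense:
  assumes "f \<in> L2_space M" "e > 0"
  obtains v h where "(v, h) \<in> T" "L2_norm M (\<lambda>x. f x - v x) < e"
  using T assms unfolding L2_self_adjoint_def by (metis (no_types, lifting) case_prodE)

text \<open>The graph is that of T + R. Since R is symmetric and defined everywhere, taking the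
  adjoint of the sum reduces to taking that of T.\<close>

lemma self_adjoint_perturbation:
  assumes R: "L2_symmetric M R"
  shows "L2_self_adjoint M {(f, h). f \<in> L2_space M \<and> h \<in> L2_space M \<and> (f, \<lambda>x. h x - R f x) \<in> T}"
    (is "L2_self_adjoint M ?T'")
  unfolding L2_self_adjoint_def
proof (intro conjI ballI allI impI)
  have T': "(f, \<lambda>x. h x + R f x) \<in> ?T'" if "(f, h) \<in> T" for f h
    using that self_adjoint_mem[OF that] L2_symmetric_mem[OF R] by (auto intro: L2_add)
  fix f and e :: real assume "f \<in> L2_space M" "e > 0"
  then obtain v h where "(v, h) \<in> T" "L2_norm M (\<lambda>x. f x - v x) < e" by (rule self_adjoint_dense)
  with T' show "\<exists>(v, h)\<in>?T'. L2_norm M (\<lambda>x. f x - v x) < e" by blast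
next
  have "(u, v) \<in> L2_adjoint M ?T' \<longleftrightarrow> (u, v) \<in> ?T'" for u v
  proof
    assume uv: "(u, v) \<in> L2_adjoint M ?T'"
    hence u: "u \<in> L2_space M" and v: "v \<in> L2_space M" by (auto simp: L2_adjoint_def)
    have Ru: "R u \<in> L2_space M" using u R by (simp add: L2_symmetric_mem)
    have "(u, \<lambda>x. v x - R u x) \<in> T"
    proof (rule self_adjointI[OF u L2_diff[OF v Ru]])
      fix f h assume fh: "(f, h) \<in> T"
      note mem = self_adjoint_mem[OF fh]
      have Rf: "R f \<in> L2_space M" using mem R by (simp add: L2_symmetric_mem)
      have "(f, \<lambda>x. h x + R f x) \<in> ?T'" using fh mem Rf by (auto intro: L2_add)
      hence "L2_inner M (\<lambda>x. h x + R f x) u = L2_inner M f v" using uv by (auto simp: L2_adjoint_def)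
      thus "L2_inner M h u = L2_inner M f (\<lambda>x. v x - R u x)"
        using mem Rf u v Ru L2_symmetric_inner[OF R mem(1) u] 
        by (simp add: L2_inner_add_left L2_inner_diff_right algebra_simps)
    qed
    thus "(u, v) \<in> ?T'" using u v by simp
  next
    assume "(u, v) \<in> ?T'"
    hence u: "u \<in> L2_space M" and v: "v \<in> L2_space M" and uv: "(u, \<lambda>x. v x - R u x) \<in> T" by auto
    have Ru: "R u \<in> L2_space M" using u R by (simp add: L2_symmetric_mem)
    have "L2_inner M h u = L2_inner M f v" if "(f, h) \<in> ?T'" for f h
    proof -
      from that have f: "f \<in> L2_space M" and h: "h \<in> L2_space M" and fh: "(f, \<lambda>x. h x - R f x) \<in> T" by auto
      have Rf: "R f \<in> L2_space M" using f R by (simp add: L2_symmetric_mem)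
      show ?thesis using self_adjoint_inner[OF fh uv] f h u v Rf Ru L2_symmetric_inner[OF R f u]
        by (simp add: L2_inner_diff_left L2_inner_diff_right)
    qed
    thus "(u, v) \<in> L2_adjoint M ?T'" using u v by (auto simp: L2_adjoint_def)
  qed
  thus "L2_adjoint M ?T' = ?T'" by auto
qed

text \<open>The graph is that of U T U, written with U on both entries because U is its own
  inverse.\<close>

lemma self_adjoint_conjugation:
  assumes U: "L2_symmetric M U" and UU: "\<And>f. f \<in> L2_space M \<Longrightarrow> AE x in M. U (U f) x = f x"
  shows "L2_self_adjoint M {(f, h). f \<in> L2_space M \<and> h \<in> L2_space M \<and> (U f, U h) \<in> T}"
    (is "L2_self_adjoint M ?T'")
proof -
  note Umem = L2_symmetric_mem[OF U]
  have T': "(U f, U h) \<in> ?T'" if "(f, h) \<in> T" for f h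
  proof -
    note mem = self_adjoint_mem[OF that]
    have "(U (U f), U (U h)) \<in> T"
    proof (rule self_adjoint_cong[OF that])
      show "AE x in M. f x = U (U f) x" using UU[OF mem(1)] by eventually_elim simp
      show "AE x in M. h x = U (U h) x" using UU[OF mem(2)] by eventually_elim simp
    qed (intro Umem mem)+
    thus ?thesis using Umem[OF mem(1)] Umem[OF mem(2)] by simp
  qed
  have inn: "L2_inner M (U f) (U u) = L2_inner M f u" if "f \<in> L2_space M" "u \<in> L2_space M" for f u
    by (rule L2_involution_inner[OF U _ that]) (rule UU)
  show ?thesis
    unfolding L2_self_adjoint_def
  proof (intro conjI ballI allI impI)
    fix f and e :: real assume f: "f \<in> L2_space M" and e: "e > 0"
    obtain v h where vh: "(v, h) \<in> T" and n: "L2_norm M (\<lambda>x. U f x - v x) < e" 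
      by (rule self_adjoint_dense[OF Umem[OF f] e])
    note mem = self_adjoint_mem[OF vh]
    have norm_U: "(L2_norm M (U w))\<^sup>2 = (L2_norm M w)\<^sup>2" if "w \<in> L2_space M" for w
      using inn[OF that that] unfolding L2_inner_self of_real_eq_iff .
    \<comment> \<open>The natural identity f - U v = U (U f - v) holds only almost everywhere.
      Expanding the squares bypasses it, as U preserves norms and moves across the inner
      product.\<close>
    have "(L2_norm M (\<lambda>x. f x - U v x))\<^sup>2 = (L2_norm M (\<lambda>x. U f x - v x))\<^sup>2"
      unfolding L2_norm_diff_power2[OF f Umem[OF mem(1)]] L2_norm_diff_power2[OF Umem[OF f] mem(1)]
        norm_U[OF f] norm_U[OF mem(1)] L2_symmetric_inner[OF U f mem(1)] ..
    hence "L2_norm M (\<lambda>x. f x - U v x) < e" using n by simp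
    with T'[OF vh] show "\<exists>(v, h)\<in>?T'. L2_norm M (\<lambda>x. f x - v x) < e" by blast
  next
    have "(u, v) \<in> L2_adjoint M ?T' \<longleftrightarrow> (u, v) \<in> ?T'" for u v
    proof
      assume uv: "(u, v) \<in> L2_adjoint M ?T'"
      hence u: "u \<in> L2_space M" and v: "v \<in> L2_space M" by (auto simp: L2_adjoint_def)
      have "(U u, U v) \<in> T"
      proof (rule self_adjointI)
        fix f h assume fh: "(f, h) \<in> T"
        have "L2_inner M (U h) u = L2_inner M (U f) v" using uv T'[OF fh] by (auto simp: L2_adjoint_def)
        thus "L2_inner M h (U u) = L2_inner M f (U v)"
          using u v self_adjoint_mem[OF fh] by (simp add: L2_symmetric_inner[OF U])
      qed (use u v Umem in auto)
      thus "(u, v) \<in> ?T'" using u v by simp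
    next
      assume "(u, v) \<in> ?T'"
      hence u: "u \<in> L2_space M" and v: "v \<in> L2_space M" and uv: "(U u, U v) \<in> T" by auto
      have "L2_inner M h u = L2_inner M f v" if "(f, h) \<in> ?T'" for f h
        using self_adjoint_inner[of "U f" "U h", OF _ uv] that inn u v by auto
      thus "(u, v) \<in> L2_adjoint M ?T'" using u v by (auto simp: L2_adjoint_def)
    qed
    thus "L2_adjoint M ?T' = ?T'" by auto
  qed
qed

end

section \<open>Projection-valued measures\<close>

lemma has_complex_measure_integral_cong:
  assumes "\<And>\<omega>. \<omega> \<in> sets lebesgue \<Longrightarrow> \<nu> \<omega> = \<nu>' \<omega>" "has_complex_measure_integral \<nu> k I"
  shows "has_complex_measure_integral \<nu>' k I"
  using assms(2) unfolding has_complex_measure_integral_def by (simp add: assms(1))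

lemma pvm_symmetric: "projection_valued_measure M E \<Longrightarrow> \<omega> \<in> sets lebesgue \<Longrightarrow> L2_symmetric M (E \<omega>)"
  unfolding projection_valued_measure_def L2_symmetric_def by (elim conjE, drule bspec, assumption) auto

text \<open>Multiplicativity in weak form, one factor being moved to the other argument by symmetry.
  In this form it passes directly to conjugates and to restrictions.\<close>

lemma pvm_mult:
  assumes E: "projection_valued_measure M E" and "\<omega> \<in> sets lebesgue" "\<eta> \<in> sets lebesgue" 
    and f: "f \<in> L2_space M" and u: "u \<in> L2_space M"
  shows "L2_inner M (E (\<omega> \<inter> \<eta>) f) u = L2_inner M (E \<eta> f) (E \<omega> u)"
proof -
  have S: "L2_symmetric M (E \<omega>)" "L2_symmetric M (E \<eta>)" "L2_symmetric M (E (\<omega> \<inter> \<eta>))"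
    using assms by (auto intro!: pvm_symmetric)
  have "L2_inner M (E (\<omega> \<inter> \<eta>) f) u = L2_inner M (E \<omega> (E \<eta> f)) u"
  proof (rule L2_inner_cong_AE)
    show "AE x in M. E (\<omega> \<inter> \<eta>) f x = E \<omega> (E \<eta> f) x"
      using E assms(2,3) f unfolding projection_valued_measure_def by blast
  qed (intro AE_I2 refl L2_symmetric_mem[OF S(1)] L2_symmetric_mem[OF S(2)] L2_symmetric_mem[OF S(3)] f u)+
  thus ?thesis using L2_symmetric_inner[OF S(1) L2_symmetric_mem[OF S(2) f] u] by simp
qed

lemma pvm_empty: "projection_valued_measure M E \<Longrightarrow> f \<in> L2_space M \<Longrightarrow> AE x in M. E {} f x = 0"
  and pvm_UNIV: "projection_valued_measure M E \<Longrightarrow> f \<in> L2_space M \<Longrightarrow> AE x in M. E UNIV f x = f x"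
  unfolding projection_valued_measure_def by blast+

lemma pvm_sums:
  "projection_valued_measure M E \<Longrightarrow> f \<in> L2_space M \<Longrightarrow> u \<in> L2_space M \<Longrightarrow> range \<omega> \<subseteq> sets lebesgue \<Longrightarrow>
   disjoint_family \<omega> \<Longrightarrow> (\<lambda>n::nat. L2_inner M (E (\<omega> n) f) u) sums L2_inner M (E (\<Union>n. \<omega> n) f) u"
  unfolding projection_valued_measure_def by blast

text \<open>E \<omega> is symmetric and idempotent, so |E \<omega> f|^2 = <E \<omega> f, f>, and
  Cauchy-Schwarz applies.\<close>

lemma pvm_norm_le:
  assumes E: "projection_valued_measure M E" and \<omega>: "\<omega> \<in> sets lebesgue" and f: "f \<in> L2_space M"
  shows "L2_norm M (E \<omega> f) \<le> L2_norm M f"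
proof -
  note S = pvm_symmetric[OF E \<omega>]
  have Ef: "E \<omega> f \<in> L2_space M" by (rule L2_symmetric_mem[OF S f])
  have "L2_inner M (E \<omega> f) f = L2_inner M (E \<omega> f) (E \<omega> f)"
    using pvm_mult[OF E \<omega> \<omega> f f] by simp
  hence "(L2_norm M (E \<omega> f))\<^sup>2 = cmod (L2_inner M (E \<omega> f) f)"
    by (simp add: L2_inner_self norm_power)
  also have "\<dots> \<le> L2_norm M (E \<omega> f) * L2_norm M f"
    by (rule L2_Cauchy_Schwarz[OF Ef f])
  finally show ?thesis
    by (cases "L2_norm M (E \<omega> f) = 0") (auto simp: power2_eq_square less_le)
qed

text \<open>Reduces the almost-everywhere axioms to inner products. Linearity comes from symmetry,
  idempotence from multiplicativity with equal sets, and finite additivity from countable additivity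
  for a sequence that is empty after its second term.\<close>

lemma pvmI:
  assumes S: "\<And>\<omega>. \<omega> \<in> sets lebesgue \<Longrightarrow> L2_symmetric M (E \<omega>)"
    and mult: "\<And>\<omega> \<eta> f u. \<omega> \<in> sets lebesgue \<Longrightarrow> \<eta> \<in> sets lebesgue \<Longrightarrow> f \<in> L2_space M \<Longrightarrow> u \<in> L2_space M \<Longrightarrow>
      L2_inner M (E (\<omega> \<inter> \<eta>) f) u = L2_inner M (E \<eta> f) (E \<omega> u)"
    and empty: "\<And>f u. f \<in> L2_space M \<Longrightarrow> u \<in> L2_space M \<Longrightarrow> L2_inner M (E {} f) u = 0"
    and UNIV: "\<And>f u. f \<in> L2_space M \<Longrightarrow> u \<in> L2_space M \<Longrightarrow> L2_inner M (E UNIV f) u = L2_inner M f u"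
    and sums: "\<And>f u \<omega>. f \<in> L2_space M \<Longrightarrow> u \<in> L2_space M \<Longrightarrow> range \<omega> \<subseteq> sets lebesgue \<Longrightarrow> disjoint_family \<omega> \<Longrightarrow>
      (\<lambda>n::nat. L2_inner M (E (\<omega> n) f) u) sums L2_inner M (E (\<Union>n. \<omega> n) f) u"
  shows "projection_valued_measure M E"
proof -
  note mem = L2_symmetric_mem[OF S]
  have comp: "AE x in M. E (\<omega> \<inter> \<eta>) f x = E \<omega> (E \<eta> f) x"
    if "\<omega> \<in> sets lebesgue" "\<eta> \<in> sets lebesgue" "f \<in> L2_space M" for \<omega> \<eta> f
  proof (rule L2_AE_eqI_inner)
    fix v assume v: "v \<in> L2_space M"
    show "L2_inner M (E (\<omega> \<inter> \<eta>) f) v = L2_inner M (E \<omega> (E \<eta> f)) v"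
      unfolding mult[OF that v] L2_symmetric_inner[OF S[OF that(1)] mem[OF that(2,3)] v] ..
  qed (use that mem in auto)
  have add: "AE x in M. E (\<omega> \<union> \<eta>) f x = E \<omega> f x + E \<eta> f x"
    if w: "\<omega> \<in> sets lebesgue" "\<eta> \<in> sets lebesgue" and f: "f \<in> L2_space M" and "\<omega> \<inter> \<eta> = {}" for \<omega> \<eta> f
  proof (rule L2_AE_eqI_inner)
    fix v assume v: "v \<in> L2_space M"
    have "(\<lambda>n. L2_inner M (E (binaryset \<omega> \<eta> n) f) v) sums L2_inner M (E (\<Union>n. binaryset \<omega> \<eta> n) f) v"
    proof (rule sums[OF f v])
      show "range (binaryset \<omega> \<eta>) \<subseteq> sets lebesgue" using w by (simp add: range_binaryset_eq)
      show "disjoint_family (binaryset \<omega> \<eta>)" using that(4) by (auto simp: disjoint_family_on_def binaryset_def)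
    qed
    moreover have "(\<lambda>n. L2_inner M (E (binaryset \<omega> \<eta> n) f) v) sums (\<Sum>n\<in>{0,1}. L2_inner M (E (binaryset \<omega> \<eta> n) f) v)"
    proof (rule sums_finite)
      fix n :: nat assume "n \<notin> {0, 1}"
      hence "binaryset \<omega> \<eta> n = {}" by (simp add: binaryset_def)
      thus "L2_inner M (E (binaryset \<omega> \<eta> n) f) v = 0" using empty[OF f v] by simp
    qed simp
    ultimately have "L2_inner M (E (\<Union>n. binaryset \<omega> \<eta> n) f) v = (\<Sum>n\<in>{0,1}. L2_inner M (E (binaryset \<omega> \<eta> n) f) v)"
      by (rule sums_unique2)
    hence "L2_inner M (E (\<omega> \<union> \<eta>) f) v = L2_inner M (E \<omega> f) v + L2_inner M (E \<eta> f) v"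
      unfolding UN_binaryset_eq by (simp add: binaryset_def)
    thus "L2_inner M (E (\<omega> \<union> \<eta>) f) v = L2_inner M (\<lambda>x. E \<omega> f x + E \<eta> f x) v"
      unfolding L2_inner_add_left[OF mem[OF w(1) f] mem[OF w(2) f] v] .
  qed (intro mem L2_add sets.Un w f)+
  have idem: "AE x in M. E \<omega> (E \<omega> f) x = E \<omega> f x" if "\<omega> \<in> sets lebesgue" "f \<in> L2_space M" for \<omega> f
    using comp[OF that(1,1,2)] by eventually_elim simp
  have e: "AE x in M. E {} f x = 0" "AE x in M. E UNIV f x = f x" if "f \<in> L2_space M" for f
  proof -
    show "AE x in M. E {} f x = 0"
      by (rule L2_AE_eqI_inner[OF mem[OF sets.empty_sets that] L2_zero])
         (simp add: empty[OF that] L2_inner_def[of M "\<lambda>x. 0"])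
    show "AE x in M. E UNIV f x = f x"
      by (rule L2_AE_eqI_inner[OF mem[OF _ that] that]) (simp_all add: UNIV[OF that])
  qed
  show ?thesis
    unfolding projection_valued_measure_def
    by (intro conjI ballI allI impI, (rule mem; assumption), (rule L2_symmetric_lincomb[OF S]; assumption),
        (rule idem; assumption), (rule L2_symmetric_inner[OF S]; assumption), (rule e; assumption),
        (rule e; assumption), (rule comp; assumption), (rule add; assumption), (rule sums; assumption))
qed

text \<open>By \<open>sw\<close> the coefficients of the conjugate at f, u are those of E at U f, U
  u, so all axioms are inherited.\<close>

lemma pvm_conjugation:
  assumes E: "projection_valued_measure M E" and U: "L2_symmetric M U"
    and UU: "\<And>f. f \<in> L2_space M \<Longrightarrow> AE x in M. U (U f) x = f x"
  shows "projection_valued_measure M (\<lambda>\<omega> f. U (E \<omega> (U f)))"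
proof -
  note Umem = L2_symmetric_mem[OF U] and S = pvm_symmetric[OF E]
  note Emem = L2_symmetric_mem[OF S]
  have inn: "L2_inner M (U f) (U u) = L2_inner M f u" if "f \<in> L2_space M" "u \<in> L2_space M" for f u
    by (rule L2_involution_inner[OF U _ that]) (rule UU)
  have sw: "L2_inner M (U (E \<omega> (U f))) u = L2_inner M (E \<omega> (U f)) (U u)"
    if "\<omega> \<in> sets lebesgue" "f \<in> L2_space M" "u \<in> L2_space M" for \<omega> f u
    by (rule L2_symmetric_inner[OF U Emem[OF that(1) Umem[OF that(2)]] that(3)])
  show ?thesis
  proof (rule pvmI)
    show "L2_symmetric M (\<lambda>f. U (E \<omega> (U f)))" if w: "\<omega> \<in> sets lebesgue" for \<omega>
      unfolding L2_symmetric_def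
    proof (intro conjI ballI)
      fix f u assume f: "f \<in> L2_space M" and u: "u \<in> L2_space M"
      show "L2_inner M (U (E \<omega> (U f))) u = L2_inner M f (U (E \<omega> (U u)))"
        unfolding sw[OF w f u] L2_symmetric_inner[OF S[OF w] Umem[OF f] Umem[OF u]]
        by (rule L2_symmetric_inner[OF U f Emem[OF w Umem[OF u]]])
    qed (intro Umem Emem w)
    fix f u assume f: "f \<in> L2_space M" and u: "u \<in> L2_space M"
    show "L2_inner M (U (E (\<omega> \<inter> \<eta>) (U f))) u = L2_inner M (U (E \<eta> (U f))) (U (E \<omega> (U u)))"
      if w: "\<omega> \<in> sets lebesgue" "\<eta> \<in> sets lebesgue" for \<omega> \<eta>
      unfolding sw[OF sets.Int[OF w] f u] pvm_mult[OF E w Umem[OF f] Umem[OF u]]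
      by (rule inn[symmetric, OF Emem[OF w(2) Umem[OF f]] Emem[OF w(1) Umem[OF u]]])
    have "L2_inner M (E {} (U f)) (U u) = L2_inner M (\<lambda>x. 0) (U u)"
      by (rule L2_inner_cong_AE[OF pvm_empty[OF E Umem[OF f]] AE_I2[OF refl]])
        (intro Emem Umem L2_zero f u sets.empty_sets)+
    also have "\<dots> = 0" by (simp add: L2_inner_def)
    finally show "L2_inner M (U (E {} (U f))) u = 0"
      using sw[OF sets.empty_sets f u] by simp
    have "L2_inner M (E UNIV (U f)) (U u) = L2_inner M (U f) (U u)"
      by (rule L2_inner_cong_AE[OF pvm_UNIV[OF E Umem[OF f]] AE_I2[OF refl]])
        (intro Emem Umem f u; simp)+
    thus "L2_inner M (U (E UNIV (U f))) u = L2_inner M f u"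
      using sw[OF _ f u, of UNIV] inn[OF f u] by simp
    fix \<omega> :: "nat \<Rightarrow> real set" assume w: "range \<omega> \<subseteq> sets lebesgue" "disjoint_family \<omega>"
    hence w': "\<omega> n \<in> sets lebesgue" "(\<Union>n. \<omega> n) \<in> sets lebesgue" for n by auto
    show "(\<lambda>n. L2_inner M (U (E (\<omega> n) (U f))) u) sums L2_inner M (U (E (\<Union>n. \<omega> n) (U f))) u"
      unfolding sw[OF w'(1) f u] sw[OF w'(2) f u] by (rule pvm_sums[OF E Umem[OF f] Umem[OF u] w])
  qed
qed

section \<open>Measure-preserving maps\<close>

text \<open>Instantiated by the projections of the solenoid, by the bonding maps and by deck
  transformations. Preservation of the measure is what makes composition with \<pi>
  isometric.\<close>

locale measure_preserving =
  fixes M :: "'b measure" and N :: "'a measure" and \<pi>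
  assumes measurable_\<pi> [measurable]: "\<pi> \<in> measurable M N" and distr_\<pi>: "distr M N \<pi> = N"
begin

lemma AE_comp: "(AE x in N. Q x) \<Longrightarrow> AE x in M. Q (\<pi> x)"
  using AE_distrD[OF measurable_\<pi>] distr_\<pi> by metis

lemma L2_comp:
  assumes "f \<in> L2_space N"
  shows "f \<circ> \<pi> \<in> L2_space M"
proof -
  have [measurable]: "f \<in> borel_measurable N" by (rule L2_space_measurable[OF assms])
  have "integrable (distr M N \<pi>) (\<lambda>x. (cmod (f x))\<^sup>2)" using L2_space_integrable[OF assms] distr_\<pi> by simp
  hence "integrable M (\<lambda>x. (cmod (f (\<pi> x)))\<^sup>2)" by (subst (asm) integrable_distr_eq) measurable
  thus ?thesis by (simp add: L2_space_def)
qed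

lemma L2_inner_comp:
  assumes "f \<in> L2_space N" "u \<in> L2_space N"
  shows "L2_inner M (f \<circ> \<pi>) (u \<circ> \<pi>) = L2_inner N f u"
proof -
  have "L2_inner (distr M N \<pi>) f u = L2_inner M (f \<circ> \<pi>) (u \<circ> \<pi>)"
    unfolding L2_inner_def 
    by (subst integral_distr[OF measurable_\<pi>]) 
       (use borel_measurable_integrable[OF L2_mult_integrable[OF assms]] in auto)
  thus ?thesis by (simp add: distr_\<pi>)
qed

lemma L2_norm_comp:
  assumes "f \<in> L2_space N"
  shows "L2_norm M (f \<circ> \<pi>) = L2_norm N f"
proof -
  have "complex_of_real ((L2_norm M (f \<circ> \<pi>))\<^sup>2) = complex_of_real ((L2_norm N f)\<^sup>2)"
    using L2_inner_comp[OF assms assms] by (simp add: L2_inner_self)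
  hence "(L2_norm M (f \<circ> \<pi>))\<^sup>2 = (L2_norm N f)\<^sup>2" by (simp only: of_real_eq_iff)
  thus ?thesis by simp
qed

section \<open>The subspace of pullbacks and its orthogonal projection\<close>

definition "pullbacks = (\<lambda>w. w \<circ> \<pi>) ` L2_space N"

text \<open>Composition with \<pi> is isometric, so a convergent sequence of pullbacks comes from a
  Cauchy sequence on N. The pullback of its limit G there agrees with F almost everywhere.\<close>

lemma pullbacks_closed: "L2_closed_subspace M pullbacks"
  unfolding L2_closed_subspace_def
proof (intro conjI ballI allI impI)
  show "pullbacks \<subseteq> L2_space M" "pullbacks \<noteq> {}" by (auto simp: pullbacks_def L2_comp intro: L2_zero)
  fix f u a b assume "f \<in> pullbacks" "u \<in> pullbacks"
  then obtain f' u' where "f' \<in> L2_space N" "u' \<in> L2_space N" "f = f' \<circ> \<pi>" "u = u' \<circ> \<pi>"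
    by (auto simp: pullbacks_def)
  thus "(\<lambda>x. a * f x + b * u x) \<in> pullbacks"
    unfolding pullbacks_def by (intro image_eqI[of _ _ "\<lambda>x. a * f' x + b * u' x"]) (auto intro: L2_lincomb)
next
  fix f :: "nat \<Rightarrow> 'b \<Rightarrow> complex" and F
  assume f: "\<forall>n. f n \<in> pullbacks" and F: "F \<in> L2_space M" and lim: "(\<lambda>n. L2_norm M (\<lambda>x. f n x - F x)) \<longlonglongrightarrow> 0"
  from f have "\<forall>n. \<exists>w\<in>L2_space N. f n = w \<circ> \<pi>" by (auto simp: pullbacks_def)
  then obtain w where w: "\<And>n. w n \<in> L2_space N" and fw: "\<And>n. f n = w n \<circ> \<pi>" by metis
  have fL: "f n \<in> L2_space M" for n by (simp add: fw L2_comp w)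
  have "\<exists>K. \<forall>m\<ge>K. \<forall>n\<ge>K. L2_norm N (\<lambda>x. w m x - w n x) < e" if e: "e > 0" for e
  proof -
    from LIMSEQ_D[OF lim, of "e/2"] e obtain K where K: "\<And>n. n \<ge> K \<Longrightarrow> L2_norm M (\<lambda>x. f n x - F x) < e/2" by auto
    have "L2_norm N (\<lambda>x. w m x - w n x) < e" if "m \<ge> K" "n \<ge> K" for m n
    proof -
      have "L2_norm N (\<lambda>x. w m x - w n x) = L2_norm M (\<lambda>x. f m x - f n x)"
        using L2_norm_comp[OF L2_diff[OF w w], of m n] by (simp add: fw comp_def)
      also have "\<dots> \<le> L2_norm M (\<lambda>x. f m x - F x) + L2_norm M (\<lambda>x. F x - f n x)"
        by (rule L2_norm_triangle3[OF fL F fL])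
      also have "\<dots> < e" using K[OF that(1)] K[OF that(2)] L2_norm_minus_commute[of M F "f n"] by simp
      finally show ?thesis .
    qed
    thus ?thesis by blast
  qed
  from L2_complete[OF w this] obtain G where G: "G \<in> L2_space N" "(\<lambda>n. L2_norm N (\<lambda>x. w n x - G x)) \<longlonglongrightarrow> 0"
    by blast
  have lim2: "(\<lambda>n. L2_norm M (\<lambda>x. f n x - F x) + L2_norm N (\<lambda>x. w n x - G x)) \<longlonglongrightarrow> 0 + 0"
    by (intro tendsto_add lim G)
  have "L2_norm M (\<lambda>x. F x - (G \<circ> \<pi>) x) \<le> L2_norm M (\<lambda>x. f n x - F x) + L2_norm N (\<lambda>x. w n x - G x)" for n
  proof -
    have "L2_norm N (\<lambda>x. w n x - G x) = L2_norm M (\<lambda>x. f n x - (G \<circ> \<pi>) x)"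
      using L2_norm_comp[OF L2_diff[OF w G(1)], of n] by (simp add: fw comp_def)
    thus ?thesis using L2_norm_triangle3[OF F fL[of n] L2_comp[OF G(1)]] L2_norm_minus_commute[of M F "f n"] by simp
  qed
  hence "L2_norm M (\<lambda>x. F x - (G \<circ> \<pi>) x) \<le> 0" using LIMSEQ_le_const[OF lim2] by auto
  hence "AE x in M. F x = (G \<circ> \<pi>) x"
    by (intro L2_AE_eqI F L2_comp G(1)) (simp add: order_antisym)
  thus "\<exists>G\<in>pullbacks. AE x in M. F x = G x" using G(1) by (auto simp: pullbacks_def)
qed

definition "pr = L2_proj M pullbacks"

lemma pr_symmetric: "L2_symmetric M pr"
  unfolding pr_def by (rule L2_proj_symmetric[OF pullbacks_closed])

lemma pr_mem: "f \<in> L2_space M \<Longrightarrow> pr f \<in> L2_space M"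
  by (rule L2_symmetric_mem[OF pr_symmetric])

lemma pr_obtain:
  assumes "f \<in> L2_space M"
  obtains w where "w \<in> L2_space N" "pr f = w \<circ> \<pi>"
  using L2_proj_mem[OF pullbacks_closed assms] by (auto simp: pullbacks_def pr_def)

lemma pr_comp: "w \<in> L2_space N \<Longrightarrow> AE x in M. pr (w \<circ> \<pi>) x = w (\<pi> x)"
  using L2_proj_id[OF pullbacks_closed, of "w \<circ> \<pi>"] by (auto simp: pullbacks_def pr_def)

lemma pr_inner: 
  "f \<in> L2_space M \<Longrightarrow> w \<in> L2_space N \<Longrightarrow> L2_inner M (pr f) (w \<circ> \<pi>) = L2_inner M f (w \<circ> \<pi>)"
  using L2_proj_inner[OF pullbacks_closed] by (auto simp: pullbacks_def pr_def)

lemma pr_eqI: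
  assumes "f \<in> L2_space M" "v \<in> L2_space N" 
    "\<And>w. w \<in> L2_space N \<Longrightarrow> L2_inner M (\<lambda>x. f x - v (\<pi> x)) (w \<circ> \<pi>) = 0"
  shows "AE x in M. pr f x = v (\<pi> x)"
proof -
  have "AE x in M. L2_proj M pullbacks f x = (v \<circ> \<pi>) x"
  proof (rule L2_proj_eqI[OF pullbacks_closed assms(1)])
    show "v \<circ> \<pi> \<in> pullbacks" using assms by (simp add: pullbacks_def)
    fix s assume "s \<in> pullbacks"
    then obtain w where w: "w \<in> L2_space N" "s = w \<circ> \<pi>" by (auto simp: pullbacks_def)
    thus "L2_inner M f s = L2_inner M (v \<circ> \<pi>) s"
      using assms(3)[OF w(1)] L2_inner_diff_left[OF assms(1) L2_comp[OF assms(2)] L2_comp[OF w(1)]] 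
      by (simp add: comp_def)
  qed
  thus ?thesis by (simp add: pr_def)
qed

definition "reflect f x = 2 * pr f x - f x"

lemma reflect_symmetric: "L2_symmetric M reflect"
  using L2_proj_reflection(1)[OF pullbacks_closed] by (simp add: reflect_def[abs_def] pr_def)

lemma reflect_reflect: "f \<in> L2_space M \<Longrightarrow> AE x in M. reflect (reflect f) x = f x"
  using L2_proj_reflection(2)[OF pullbacks_closed] by (simp add: reflect_def[abs_def] pr_def)

text \<open>The uniqueness of the extension turns invariance of the initial operator under the
  reflection into invariance of its self-adjoint extension.\<close>

lemma pr_reduces:
  assumes T: "unique_self_adjoint_extension M T0 T"
    and T0: "\<And>f h. (f, h) \<in> T0 \<Longrightarrow> (pr f, pr h) \<in> T"
    and fh: "(f, h) \<in> T"
  shows "(pr f, pr h) \<in> T"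
proof -
  have sa: "L2_self_adjoint M T" and sub: "T0 \<subseteq> T" using T by (auto simp: unique_self_adjoint_extension_def)
  define T' where "T' = {(f, h). f \<in> L2_space M \<and> h \<in> L2_space M \<and> (reflect f, reflect h) \<in> T}"
  have "(f, h) \<in> T'" if "(f, h) \<in> T0" for f h
    using that sub self_adjoint_mem[OF sa, of f h] self_adjoint_lincomb[OF sa T0[OF that], of f h 2 "-1"]
    by (auto simp: T'_def reflect_def[abs_def])
  moreover have "L2_self_adjoint M T'"
    unfolding T'_def by (rule self_adjoint_conjugation[OF sa reflect_symmetric reflect_reflect])
  ultimately have "T' = T" using T unfolding unique_self_adjoint_extension_def by (metis subrelI)
  hence "(reflect f, reflect h) \<in> T" using fh by (auto simp: T'_def)
  \<comment> \<open>Half the sum of f and its reflection is \<open>pr f\<close>.\<close>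
  from self_adjoint_lincomb[OF sa this fh, of "1/2" "1/2"] show ?thesis
    by (simp add: reflect_def[abs_def] algebra_simps)
qed

text \<open>As \<open>pr\<close> preserves T, every pair of T may be replaced by its projection,
  which is a pair of pullbacks. This yields density of the restricted domain, and it lets a pair of
  the adjoint on N be tested against all of T.\<close>

lemma restriction_self_adjoint:
  assumes sa: "L2_self_adjoint M T" and red: "\<And>f h. (f, h) \<in> T \<Longrightarrow> (pr f, pr h) \<in> T"
  shows "L2_self_adjoint N {(u, v). u \<in> L2_space N \<and> v \<in> L2_space N \<and> (u \<circ> \<pi>, v \<circ> \<pi>) \<in> T}"
    (is "L2_self_adjoint N ?S")
  unfolding L2_self_adjoint_def
proof (intro conjI ballI allI impI)
  fix f and e :: real assume f: "f \<in> L2_space N" and e: "e > 0"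
  obtain v h where vh: "(v, h) \<in> T" and n: "L2_norm M (\<lambda>x. (f \<circ> \<pi>) x - v x) < e"
    by (rule self_adjoint_dense[OF sa L2_comp[OF f] e])
  note mem = self_adjoint_mem[OF sa vh]
  obtain a where a: "a \<in> L2_space N" "pr v = a \<circ> \<pi>" by (rule pr_obtain[OF mem(1)])
  obtain b where b: "b \<in> L2_space N" "pr h = b \<circ> \<pi>" by (rule pr_obtain[OF mem(2)])
  have ab: "(a, b) \<in> ?S" using red[OF vh] a b by auto
  have "L2_norm N (\<lambda>x. f x - a x) = L2_norm M (\<lambda>x. (f \<circ> \<pi>) x - pr v x)"
    using L2_norm_comp[OF L2_diff[OF f a(1)]] a(2) by (simp add: comp_def)
  also have "\<dots> = L2_norm M (pr (\<lambda>x. (f \<circ> \<pi>) x - v x))"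
  proof (rule L2_norm_cong_AE)
    show "AE x in M. (f \<circ> \<pi>) x - pr v x = pr (\<lambda>x. (f \<circ> \<pi>) x - v x) x"
      using L2_symmetric_diff[OF pr_symmetric L2_comp[OF f] mem(1)] pr_comp[OF f] by eventually_elim simp
  qed (intro L2_diff pr_mem L2_comp f mem)+
  also have "\<dots> \<le> L2_norm M (\<lambda>x. (f \<circ> \<pi>) x - v x)"
    unfolding pr_def by (rule L2_proj_norm_le[OF pullbacks_closed L2_diff[OF L2_comp[OF f] mem(1)]])
  finally have "L2_norm N (\<lambda>x. f x - a x) < e" using n by simp
  with ab show "\<exists>(v, h)\<in>?S. L2_norm N (\<lambda>x. f x - v x) < e" by (intro bexI[of _ "(a, b)"]) simp_all
next
  have "(u, v) \<in> L2_adjoint N ?S \<longleftrightarrow> (u, v) \<in> ?S" for u v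
  proof
    assume uv: "(u, v) \<in> L2_adjoint N ?S"
    hence u: "u \<in> L2_space N" and v: "v \<in> L2_space N" by (auto simp: L2_adjoint_def)
    have "(u \<circ> \<pi>, v \<circ> \<pi>) \<in> T"
    proof (rule self_adjointI[OF sa L2_comp[OF u] L2_comp[OF v]])
      fix f h assume fh: "(f, h) \<in> T"
      note mem = self_adjoint_mem[OF sa fh]
      obtain a where a: "a \<in> L2_space N" "pr f = a \<circ> \<pi>" by (rule pr_obtain[OF mem(1)])
      obtain b where b: "b \<in> L2_space N" "pr h = b \<circ> \<pi>" by (rule pr_obtain[OF mem(2)])
      have ab: "(a, b) \<in> ?S" using red[OF fh] a b by auto
      hence "L2_inner N b u = L2_inner N a v" using uv by (auto simp: L2_adjoint_def)
      thus "L2_inner M h (u \<circ> \<pi>) = L2_inner M f (v \<circ> \<pi>)"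
        using pr_inner[OF mem(1) v] pr_inner[OF mem(2) u] a b u v by (simp add: L2_inner_comp)
    qed
    thus "(u, v) \<in> ?S" using u v by simp
  next
    assume "(u, v) \<in> ?S"
    hence u: "u \<in> L2_space N" and v: "v \<in> L2_space N" and uv: "(u \<circ> \<pi>, v \<circ> \<pi>) \<in> T" by auto
    have "L2_inner N h u = L2_inner N f v" if "(f, h) \<in> ?S" for f h
      using that u v self_adjoint_inner[OF sa _ uv, of "f \<circ> \<pi>" "h \<circ> \<pi>"] by (auto simp: L2_inner_comp)
    thus "(u, v) \<in> L2_adjoint N ?S" using u v by (auto simp: L2_adjoint_def)
  qed
  thus "L2_adjoint N ?S = ?S" by auto
qed

text \<open>Conjugating the spectral measure with the reflection gives another spectral measure for the same
  operator, so uniqueness makes them commute.\<close>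

lemma pr_commutes_spectral_measure:
  assumes sa: "L2_self_adjoint M T" and red: "\<And>f h. (f, h) \<in> T \<Longrightarrow> (pr f, pr h) \<in> T"
    and E: "resolution_of_identity M T E" and \<omega>: "\<omega> \<in> sets lebesgue" and f: "f \<in> L2_space M"
  shows "AE x in M. pr (E \<omega> f) x = E \<omega> (pr f) x"
proof -
  have sp: "spectral_measure_for M T E" using E by (simp add: resolution_of_identity_def)
  hence pvm: "projection_valued_measure M E" by (simp add: spectral_measure_for_def)
  note S = pvm_symmetric[OF pvm] and Umem = L2_symmetric_mem[OF reflect_symmetric]
  note Emem = L2_symmetric_mem[OF S]
  have red': "(reflect f, reflect h) \<in> T" if "(f, h) \<in> T" for f h
    using self_adjoint_lincomb[OF sa red[OF that] that, of 2 "-1"] by (simp add: reflect_def[abs_def])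
  have "spectral_measure_for M T (\<lambda>\<omega> f. reflect (E \<omega> (reflect f)))"
    unfolding spectral_measure_for_def
  proof (intro conjI ballI, rule pvm_conjugation[OF pvm reflect_symmetric reflect_reflect], assumption, clarify)
    fix f h u assume fh: "(f, h) \<in> T" and u: "u \<in> L2_space M"
    note mem = self_adjoint_mem[OF sa fh]
    have "has_complex_measure_integral (\<lambda>\<omega>. L2_inner M (E \<omega> (reflect f)) (reflect u)) (\<lambda>t. t) (L2_inner M (reflect h) (reflect u))"
      using sp red'[OF fh] Umem[OF u] unfolding spectral_measure_for_def by blast
    hence "has_complex_measure_integral (\<lambda>\<omega>. L2_inner M (reflect (E \<omega> (reflect f))) u) (\<lambda>t. t) (L2_inner M (reflect h) (reflect u))"
      by (rule has_complex_measure_integral_cong[rotated])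
         (use mem u Umem Emem in \<open>simp add: L2_symmetric_inner[OF reflect_symmetric]\<close>)
    moreover have "L2_inner M (reflect h) (reflect u) = L2_inner M h u"
    proof -
      have "L2_inner M h (reflect (reflect u)) = L2_inner M h u"
        by (rule L2_inner_cong_AE) (use mem u reflect_reflect Umem in auto)
      thus ?thesis using mem u Umem by (simp add: L2_symmetric_inner[OF reflect_symmetric])
    qed
    ultimately show "has_complex_measure_integral (\<lambda>\<omega>. L2_inner M (reflect (E \<omega> (reflect f))) u) (\<lambda>t. t) (L2_inner M h u)"
      by simp
  qed
  hence eq: "AE x in M. reflect (E \<omega> (reflect f)) x = E \<omega> f x"
    using E \<omega> f unfolding resolution_of_identity_def by blast
  \<comment> \<open>Applying the reflection once more to \<open>eq\<close> shows that it commutes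
    with E \<omega>; inserting the definition 2 pr - 1 of the reflection gives the same for
    \<open>pr\<close>.\<close>
  have "AE x in M. reflect (reflect (E \<omega> (reflect f))) x = reflect (E \<omega> f) x"
    by (rule L2_symmetric_cong[OF reflect_symmetric _ _ eq]) (use f Umem Emem \<omega> in auto)
  moreover have "AE x in M. reflect (reflect (E \<omega> (reflect f))) x = E \<omega> (reflect f) x"
    by (rule reflect_reflect) (use f Umem Emem \<omega> in auto)
  moreover have "AE x in M. E \<omega> (\<lambda>x. 2 * pr f x + (-1) * f x) x = 2 * E \<omega> (pr f) x + (-1) * E \<omega> f x"
    by (rule L2_symmetric_lincomb[OF S[OF \<omega>] pr_mem[OF f] f])
  hence "AE x in M. E \<omega> (reflect f) x = 2 * E \<omega> (pr f) x - E \<omega> f x"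
    by (simp add: reflect_def[abs_def])
  ultimately show ?thesis
    by eventually_elim (simp add: reflect_def)
qed

text \<open>Since E \<omega> commutes with \<open>pr\<close>, it maps pullbacks to pullbacks up to
  null sets. The maps induced on N form a spectral measure of the restricted operator, which
  uniqueness identifies with E'.\<close>

lemma spectral_measure_pullback:
  assumes sa: "L2_self_adjoint M T" and red: "\<And>f h. (f, h) \<in> T \<Longrightarrow> (pr f, pr h) \<in> T"
    and E: "resolution_of_identity M T E"
    and E': "resolution_of_identity N {(u, v). u \<in> L2_space N \<and> v \<in> L2_space N \<and> (u \<circ> \<pi>, v \<circ> \<pi>) \<in> T} E'"
    and \<omega>: "\<omega> \<in> sets lebesgue" and u: "u \<in> L2_space N"
  shows "AE x in M. E \<omega> (u \<circ> \<pi>) x = E' \<omega> u (\<pi> x)"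
proof -
  have sp: "spectral_measure_for M T E" using E by (simp add: resolution_of_identity_def)
  hence pvm: "projection_valued_measure M E" by (simp add: spectral_measure_for_def)
  note S = pvm_symmetric[OF pvm] 
  note Emem = L2_symmetric_mem[OF S]
  have ex: "\<exists>w\<in>L2_space N. AE x in M. E \<omega> (u \<circ> \<pi>) x = w (\<pi> x)" 
    if \<omega>: "\<omega> \<in> sets lebesgue" and u: "u \<in> L2_space N" for \<omega> u
  proof -
    note Wu = L2_comp[OF u]
    obtain w where w: "w \<in> L2_space N" "pr (E \<omega> (u \<circ> \<pi>)) = w \<circ> \<pi>" by (rule pr_obtain[OF Emem[OF \<omega> Wu]])
    have "AE x in M. E \<omega> (pr (u \<circ> \<pi>)) x = E \<omega> (u \<circ> \<pi>) x"
      by (rule L2_symmetric_cong[OF S[OF \<omega>] pr_mem[OF Wu] Wu]) (use pr_comp[OF u] in auto)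
    moreover have "AE x in M. pr (E \<omega> (u \<circ> \<pi>)) x = E \<omega> (pr (u \<circ> \<pi>)) x"
      by (rule pr_commutes_spectral_measure[OF sa _ E \<omega> Wu]) (rule red)
    ultimately have "AE x in M. E \<omega> (u \<circ> \<pi>) x = w (\<pi> x)"
      by eventually_elim (simp add: w)
    with w show ?thesis by blast
  qed
  \<comment> \<open>The inducing function on N is determined only up to a null set, so a
    representative is chosen.\<close>
  define F where "F \<omega> u = (SOME w. w \<in> L2_space N \<and> (AE x in M. E \<omega> (u \<circ> \<pi>) x = w (\<pi> x)))" for \<omega> u
  have Fmem: "F \<omega> u \<in> L2_space N" and FE: "AE x in M. E \<omega> (u \<circ> \<pi>) x = (F \<omega> u \<circ> \<pi>) x"
    if "\<omega> \<in> sets lebesgue" "u \<in> L2_space N" for \<omega> u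
    using someI_ex[OF ex[OF that, unfolded Bex_def]] by (auto simp: F_def)
  have inn: "L2_inner N (F \<omega> u) v = L2_inner M (E \<omega> (u \<circ> \<pi>)) (v \<circ> \<pi>)"
    if "\<omega> \<in> sets lebesgue" "u \<in> L2_space N" "v \<in> L2_space N" for \<omega> u v
  proof -
    have "L2_inner M (E \<omega> (u \<circ> \<pi>)) (v \<circ> \<pi>) = L2_inner M (F \<omega> u \<circ> \<pi>) (v \<circ> \<pi>)"
      by (rule L2_inner_cong_AE) (use that Fmem FE L2_comp Emem in auto)
    thus ?thesis using L2_inner_comp[OF Fmem[OF that(1,2)] that(3)] by simp
  qed
  have "projection_valued_measure N F"
  proof (rule pvmI)
    have symm: "L2_inner N (F \<omega> f) u = L2_inner N f (F \<omega> u)" 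
      if w: "\<omega> \<in> sets lebesgue" and f: "f \<in> L2_space N" and u: "u \<in> L2_space N" for \<omega> f u
      using inn[OF w f u] inn[OF w u f] L2_symmetric_inner[OF S[OF w] L2_comp[OF f] L2_comp[OF u]]
      by (metis L2_inner_commute)
    thus "L2_symmetric N (F \<omega>)" if "\<omega> \<in> sets lebesgue" for \<omega>
      using that Fmem unfolding L2_symmetric_def by blast
    fix f u assume f: "f \<in> L2_space N" and u: "u \<in> L2_space N"
    note Wf = L2_comp[OF f] and Wu = L2_comp[OF u]
    show "L2_inner N (F (\<omega> \<inter> \<eta>) f) u = L2_inner N (F \<eta> f) (F \<omega> u)"
      if w: "\<omega> \<in> sets lebesgue" "\<eta> \<in> sets lebesgue" for \<omega> \<eta>
    proof -
      have "L2_inner N (F \<eta> f) (F \<omega> u) = L2_inner M (F \<eta> f \<circ> \<pi>) (F \<omega> u \<circ> \<pi>)"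
        using w f u Fmem by (simp add: L2_inner_comp)
      also have "\<dots> = L2_inner M (E \<eta> (f \<circ> \<pi>)) (E \<omega> (u \<circ> \<pi>))"
        by (rule sym, rule L2_inner_cong_AE) (use w f u Fmem FE L2_comp Emem in auto)
      finally show ?thesis using inn[of "\<omega> \<inter> \<eta>" f u] w f u pvm_mult[OF pvm w Wf Wu] by simp
    qed
    have "L2_inner M (E {} (f \<circ> \<pi>)) (u \<circ> \<pi>) = L2_inner M (\<lambda>x. 0) (u \<circ> \<pi>)"
      by (rule L2_inner_cong_AE) (use Wf Wu Emem L2_zero pvm_empty[OF pvm] in auto)
    thus "L2_inner N (F {} f) u = 0" using inn[of "{}" f u] f u by (simp add: L2_inner_def)
    have "L2_inner M (E UNIV (f \<circ> \<pi>)) (u \<circ> \<pi>) = L2_inner M (f \<circ> \<pi>) (u \<circ> \<pi>)"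
      by (rule L2_inner_cong_AE[OF pvm_UNIV[OF pvm Wf] AE_I2[OF refl]]) (intro Emem Wf Wu; simp)+
    thus "L2_inner N (F UNIV f) u = L2_inner N f u" using inn[of UNIV f u] f u by (simp add: L2_inner_comp)
    fix \<omega> :: "nat \<Rightarrow> real set" assume w: "range \<omega> \<subseteq> sets lebesgue" "disjoint_family \<omega>"
    hence w': "\<omega> n \<in> sets lebesgue" "(\<Union>n. \<omega> n) \<in> sets lebesgue" for n by auto
    show "(\<lambda>n. L2_inner N (F (\<omega> n) f) u) sums L2_inner N (F (\<Union>n. \<omega> n) f) u"
      using pvm_sums[OF pvm Wf Wu w] inn[OF w'(1) f u] inn[OF w'(2) f u] by simp
  qed
  hence "spectral_measure_for N {(u, v). u \<in> L2_space N \<and> v \<in> L2_space N \<and> (u \<circ> \<pi>, v \<circ> \<pi>) \<in> T} F"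
    unfolding spectral_measure_for_def
  proof (intro conjI ballI, assumption, clarify)
    fix f h u assume f: "f \<in> L2_space N" and h: "h \<in> L2_space N" and u: "u \<in> L2_space N" 
      and fh: "(f \<circ> \<pi>, h \<circ> \<pi>) \<in> T" 
    have "has_complex_measure_integral (\<lambda>\<omega>. L2_inner M (E \<omega> (f \<circ> \<pi>)) (u \<circ> \<pi>)) (\<lambda>t. t) (L2_inner M (h \<circ> \<pi>) (u \<circ> \<pi>))"
      using sp fh L2_comp[OF u] unfolding spectral_measure_for_def by blast
    hence "has_complex_measure_integral (\<lambda>\<omega>. L2_inner N (F \<omega> f) u) (\<lambda>t. t) (L2_inner M (h \<circ> \<pi>) (u \<circ> \<pi>))"
      by (rule has_complex_measure_integral_cong[rotated]) (simp add: inn f u)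
    thus "has_complex_measure_integral (\<lambda>\<omega>. L2_inner N (F \<omega> f) u) (\<lambda>t. t) (L2_inner N h u)"
      by (simp add: L2_inner_comp h u)
  qed
  hence "AE x in N. F \<omega> u x = E' \<omega> u x" using E' \<omega> u unfolding resolution_of_identity_def by blast
  from AE_comp[OF this] FE[OF \<omega> u] show ?thesis by eventually_elim simp
qed

end

section \<open>Towers of $L^2$ spaces\<close>

lemma unique_self_adjoint_extension_eq:
  "unique_self_adjoint_extension M T0 T \<Longrightarrow> L2_self_adjoint M S \<Longrightarrow> T0 \<subseteq> S \<Longrightarrow> T = S"
  by (simp add: unique_self_adjoint_extension_def)

text \<open>For v in the dense domain, |k|^2 = <k, k - v> <= |k| |k - v|, and the last factor can be
  made arbitrarily small.\<close>

lemma self_adjoint_orthogonal_domain: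
  assumes sa: "L2_self_adjoint M T" and k: "k \<in> L2_space M"
    and orth: "\<And>f h. (f, h) \<in> T \<Longrightarrow> L2_inner M k f = 0"
  shows "AE x in M. k x = 0"
proof -
  have "L2_norm M k \<le> e" if e: "e > 0" for e
  proof -
    obtain v h where vh: "(v, h) \<in> T" and n: "L2_norm M (\<lambda>x. k x - v x) < e"
      by (rule self_adjoint_dense[OF sa k e])
    have v: "v \<in> L2_space M" by (rule self_adjoint_mem[OF sa vh])
    have "(L2_norm M k)\<^sup>2 = cmod (L2_inner M k k)" by (simp add: L2_inner_self norm_power)
    also have "\<dots> = cmod (L2_inner M k (\<lambda>x. k x - v x))"
      using orth[OF vh] by (simp add: L2_inner_diff_right k v)
    also have "\<dots> \<le> L2_norm M k * L2_norm M (\<lambda>x. k x - v x)"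
      by (rule L2_Cauchy_Schwarz[OF k L2_diff[OF k v]])
    also have "\<dots> \<le> L2_norm M k * e" by (rule mult_left_mono) (use n in auto)
    finally show ?thesis using e
      by (cases "L2_norm M k = 0") (auto simp: power2_eq_square less_le)
  qed
  hence "L2_norm M k = 0" using dense_ge[of 0 "L2_norm M k"] by (simp add: order_antisym)
  thus ?thesis using L2_norm_eq_0_iff[OF k] by simp
qed

text \<open>The Hilbert space skeleton of the solenoid, free of geometry: M stands for the solenoid,
  N i for level i. Compatibility is needed on the space of M only, since a point of M is a
  compatible sequence there.\<close>

locale L2_tower =
  fixes M :: "'b measure" and N :: "nat \<Rightarrow> 'a measure" and \<pi> :: "nat \<Rightarrow> 'b \<Rightarrow> 'a" and q :: "nat \<Rightarrow> 'a \<Rightarrow> 'a"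
  assumes mp: "\<And>i. measure_preserving M (N i) (\<pi> i)"
    and mq: "\<And>i. measure_preserving (N (Suc i)) (N i) (q i)"
    and comp: "\<And>i x. x \<in> space M \<Longrightarrow> q i (\<pi> (Suc i) x) = \<pi> i x"
begin

sublocale lev: measure_preserving M "N i" "\<pi> i" for i by (rule mp)

sublocale bond: measure_preserving "N (Suc i)" "N i" "q i" for i by (rule mq)

lemma lift_function:
  assumes "i \<le> j" "w \<in> L2_space (N i)"
  shows "\<exists>w'\<in>L2_space (N j). \<forall>x\<in>space M. w' (\<pi> j x) = w (\<pi> i x)"
  using assms(1)
proof (induction j rule: dec_induct)
  case base
  show ?case using assms(2) by blast
next
  case (step j)
  then obtain w' where w': "w' \<in> L2_space (N j)" "\<And>x. x \<in> space M \<Longrightarrow> w' (\<pi> j x) = w (\<pi> i x)" by blast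
  show ?case by (rule bexI[OF _ bond.L2_comp[OF w'(1)]]) (simp add: comp w')
qed

text \<open>A pullback from level i is also one from each higher level n, and the residual is
  orthogonal to the latter.\<close>

lemma inner_pr_residual:
  assumes f: "f \<in> L2_space M" and w: "w \<in> L2_space (N i)" and "i \<le> n"
  shows "L2_inner M (\<lambda>x. f x - lev.pr n f x) (w \<circ> \<pi> i) = 0"
proof -
  obtain w' where w': "w' \<in> L2_space (N n)" "\<And>x. x \<in> space M \<Longrightarrow> w' (\<pi> n x) = w (\<pi> i x)"
    using lift_function[OF assms(3) w] by blast
  note r = L2_diff[OF f lev.pr_mem[OF f]]
  have "L2_inner M (\<lambda>x. f x - lev.pr n f x) (w \<circ> \<pi> i) = L2_inner M (\<lambda>x. f x - lev.pr n f x) (w' \<circ> \<pi> n)"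
    by (rule L2_inner_cong_AE) (use r lev.L2_comp w w' in auto)
  also have "\<dots> = 0"
    using lev.pr_inner[OF f w'(1)] L2_inner_diff_left[OF f lev.pr_mem[OF f] lev.L2_comp[OF w'(1)]] by simp
  finally show ?thesis .
qed

text \<open>The norms of the projections increase and are bounded by that of f, so by Pythagoras the
  projections form a Cauchy sequence. Density of the union of the levels, in the form of a trivial
  orthogonal complement, identifies the limit with f.\<close>

lemma pr_tendsto:
  assumes dens: "\<And>h. h \<in> L2_space M \<Longrightarrow> (\<And>i w. w \<in> L2_space (N i) \<Longrightarrow> L2_inner M h (w \<circ> \<pi> i) = 0) \<Longrightarrow> AE x in M. h x = 0"
    and f: "f \<in> L2_space M"
  shows "(\<lambda>n. L2_norm M (\<lambda>x. f x - lev.pr n f x)) \<longlonglongrightarrow> 0"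
proof -
  note pm = lev.pr_mem[OF f]
  define a where "a n = (L2_norm M (lev.pr n f))\<^sup>2" for n
  have diff: "(L2_norm M (\<lambda>x. lev.pr n f x - lev.pr m f x))\<^sup>2 = a n - a m" if "m \<le> n" for m n
  proof -
    obtain w where w: "w \<in> L2_space (N m)" "lev.pr m f = w \<circ> \<pi> m" by (rule lev.pr_obtain[OF f])
    have "L2_inner M f (lev.pr m f) = L2_inner M (lev.pr k f) (lev.pr m f)" if "m \<le> k" for k
      using inner_pr_residual[OF f w(1) that] L2_inner_diff_left[OF f pm[of k] lev.L2_comp[OF w(1)]] by (simp add: w(2))
    \<comment> \<open>The cases k = n and k = m combined: the inner product of two projections of f
      is the squared norm of the one to the lower level.\<close>
    from this[OF that] this[OF order.refl]
    have "L2_inner M (lev.pr n f) (lev.pr m f) = complex_of_real (a m)"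
      by (simp add: L2_inner_self a_def)
    thus ?thesis unfolding L2_norm_diff_power2[OF pm pm] by (simp add: a_def)
  qed
  have "incseq a"
    by (rule incseq_SucI) (use diff[of n "Suc n" for n] zero_le_power2 in \<open>metis diff_ge_0_iff_ge le_SucI order.refl\<close>)
  moreover have "a n \<le> (L2_norm M f)\<^sup>2" for n
    unfolding a_def by (rule power_mono) (simp_all add: lev.pr_def L2_proj_norm_le[OF lev.pullbacks_closed f])
  ultimately have "Cauchy a"
    using incseq_convergent[of a "(L2_norm M f)\<^sup>2"] convergent_Cauchy convergentI by metis
  have "\<exists>K. \<forall>m\<ge>K. \<forall>n\<ge>K. L2_norm M (\<lambda>x. lev.pr m f x - lev.pr n f x) < e" if e: "e > 0" for e
  proof -
    obtain K where K: "\<And>m n. m \<ge> K \<Longrightarrow> n \<ge> K \<Longrightarrow> norm (a m - a n) < e\<^sup>2"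
      using CauchyD[OF \<open>Cauchy a\<close>, of "e\<^sup>2"] e by auto
    have "L2_norm M (\<lambda>x. lev.pr m f x - lev.pr n f x) < e" if "m \<ge> K" "n \<ge> K" for m n
    proof (cases "n \<le> m")
      case True
      have "(L2_norm M (\<lambda>x. lev.pr m f x - lev.pr n f x))\<^sup>2 < e\<^sup>2" 
        using diff[OF True] K[OF that] by simp
      thus ?thesis by (rule power2_less_imp_less) (use e in simp)
    next
      case False
      hence "(L2_norm M (\<lambda>x. lev.pr n f x - lev.pr m f x))\<^sup>2 < e\<^sup>2" 
        using diff[of m n] K[OF that] by simp
      hence "L2_norm M (\<lambda>x. lev.pr n f x - lev.pr m f x) < e" by (rule power2_less_imp_less) (use e in simp)
      thus ?thesis by (subst L2_norm_minus_commute)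
    qed
    thus ?thesis by blast
  qed
  from L2_complete[OF pm this] obtain F where F: "F \<in> L2_space M" 
    and lim: "(\<lambda>n. L2_norm M (\<lambda>x. lev.pr n f x - F x)) \<longlonglongrightarrow> 0" by blast
  \<comment> \<open>For n >= i the function f may be replaced by its n-th projection in the inner
    product with a pullback from level i, and the projections tend to F.\<close>
  have "AE x in M. f x - F x = 0"
  proof (rule dens[OF L2_diff[OF f F]])
    fix i w assume w: "w \<in> L2_space (N i)"
    note Ww = lev.L2_comp[OF w]
    have bound: "cmod (L2_inner M (\<lambda>x. f x - F x) (w \<circ> \<pi> i)) \<le> L2_norm M (\<lambda>x. lev.pr n f x - F x) * L2_norm M (w \<circ> \<pi> i)"
      if "n \<ge> i" for n
    proof -
      have "L2_inner M (\<lambda>x. f x - F x) (w \<circ> \<pi> i) = L2_inner M (\<lambda>x. lev.pr n f x - F x) (w \<circ> \<pi> i)"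
        using inner_pr_residual[OF f w that] 
        by (simp add: L2_inner_diff_left[OF f F Ww] L2_inner_diff_left[OF f pm Ww] L2_inner_diff_left[OF pm F Ww])
      thus ?thesis using L2_Cauchy_Schwarz[OF L2_diff[OF pm F] Ww] by simp
    qed
    have "(\<lambda>n. L2_norm M (\<lambda>x. lev.pr n f x - F x) * L2_norm M (w \<circ> \<pi> i)) \<longlonglongrightarrow> 0 * L2_norm M (w \<circ> \<pi> i)"
      by (intro tendsto_intros lim)
    hence "cmod (L2_inner M (\<lambda>x. f x - F x) (w \<circ> \<pi> i)) \<le> 0 * L2_norm M (w \<circ> \<pi> i)"
      by (rule LIMSEQ_le_const) (use bound in blast)
    thus "L2_inner M (\<lambda>x. f x - F x) (w \<circ> \<pi> i) = 0" by simp
  qed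
  hence fF: "AE x in M. F x = f x" by eventually_elim simp
  have "L2_norm M (\<lambda>x. f x - lev.pr n f x) = L2_norm M (\<lambda>x. lev.pr n f x - F x)" for n
  proof -
    have "L2_norm M (\<lambda>x. lev.pr n f x - F x) = L2_norm M (\<lambda>x. lev.pr n f x - f x)"
      by (rule L2_norm_cong_AE) (use fF L2_diff[OF pm F] L2_diff[OF pm f] in auto)
    thus ?thesis by (simp add: L2_norm_minus_commute)
  qed
  with lim show ?thesis by simp
qed

section \<open>The orthogonal increments of the tower\<close>

definition "new i = (case i of 0 \<Rightarrow> L2_space (N 0) | 
  Suc j \<Rightarrow> {v \<in> L2_space (N (Suc j)). \<forall>w\<in>L2_space (N j). L2_inner (N (Suc j)) v (w \<circ> q j) = 0})"

text \<open>Shaped like \<open>new_component\<close>, so that the two become the same term once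
  \<open>new\<close> and \<open>new_space\<close> are identified.\<close>

definition "component i f =
  (SOME v. v \<in> new i \<and> is_orthogonal_projection M ((\<lambda>w. w \<circ> \<pi> i) ` new i) f (v \<circ> \<pi> i))"

lemma new_L2: "v \<in> new i \<Longrightarrow> v \<in> L2_space (N i)"
  by (auto simp: new_def split: nat.splits)

lemma new_diff: 
  assumes "v \<in> new i" "w \<in> new i"
  shows "(\<lambda>x. v x - w x) \<in> new i"
proof (cases i)
  case 0
  thus ?thesis using assms by (simp add: new_def L2_diff)
next
  case (Suc j)
  have "L2_inner (N (Suc j)) (\<lambda>x. v x - w x) (u \<circ> q j) = 0" if "u \<in> L2_space (N j)" for u
    using assms that bond.L2_comp[OF that] by (simp add: new_def Suc L2_inner_diff_left)
  thus ?thesis using assms by (simp add: new_def Suc L2_diff)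
qed

text \<open>A single v with the orthogonality property shows that the choice in
  \<open>component\<close> is not vacuous. It also identifies the chosen function up to a null set,
  since the difference of two candidates is again in \<open>new i\<close> and orthogonal to
  itself.\<close>

lemma component_eqI:
  assumes f: "f \<in> L2_space M" and v: "v \<in> new i" 
    and orth: "\<And>w. w \<in> new i \<Longrightarrow> L2_inner M (\<lambda>x. f x - v (\<pi> i x)) (w \<circ> \<pi> i) = 0"
  shows "component i f \<in> new i" "AE x in M. component i f (\<pi> i x) = v (\<pi> i x)"
proof -
  have "is_orthogonal_projection M ((\<lambda>w. w \<circ> \<pi> i) ` new i) f (v \<circ> \<pi> i)"
    using v orth by (auto simp: is_orthogonal_projection_def)
  hence ex: "\<exists>v. v \<in> new i \<and> is_orthogonal_projection M ((\<lambda>w. w \<circ> \<pi> i) ` new i) f (v \<circ> \<pi> i)" using v by blast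
  define c where "c = component i f"
  have c: "c \<in> new i" and corth: "\<And>w. w \<in> new i \<Longrightarrow> L2_inner M (\<lambda>x. f x - (c \<circ> \<pi> i) x) (w \<circ> \<pi> i) = 0"
    using someI_ex[OF ex, folded component_def] by (auto simp: is_orthogonal_projection_def c_def)
  show "component i f \<in> new i" using c by (simp add: c_def)
  define d where "d = (\<lambda>x. c x - v x)"
  have d: "d \<in> new i" using c v by (simp add: d_def new_diff)
  note L = lev.L2_comp[OF new_L2[OF c]] lev.L2_comp[OF new_L2[OF v]] lev.L2_comp[OF new_L2[OF d]]
  have "L2_inner M f (d \<circ> \<pi> i) = L2_inner M (c \<circ> \<pi> i) (d \<circ> \<pi> i)" 
    using corth[OF d] L2_inner_diff_left[OF f L(1) L(3)] by simp
  moreover have "L2_inner M f (d \<circ> \<pi> i) = L2_inner M (v \<circ> \<pi> i) (d \<circ> \<pi> i)" 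
    using orth[OF d] L2_inner_diff_left[OF f L(2) L(3)] by simp
  ultimately have "L2_inner M (\<lambda>x. (c \<circ> \<pi> i) x - (v \<circ> \<pi> i) x) (d \<circ> \<pi> i) = 0"
    using L2_inner_diff_left[OF L(1,2,3)] by simp
  hence "L2_inner M (d \<circ> \<pi> i) (d \<circ> \<pi> i) = 0" by (simp add: d_def comp_def)
  hence "L2_norm M (\<lambda>x. (c \<circ> \<pi> i) x - (v \<circ> \<pi> i) x) = 0" by (simp add: L2_inner_self d_def comp_def)
  from L2_AE_eqI[OF L(1,2) this] show "AE x in M. component i f (\<pi> i x) = v (\<pi> i x)" by (simp add: c_def)
qed

lemma component_0:
  assumes f: "f \<in> L2_space M"
  shows "component 0 f \<in> new 0" "AE x in M. component 0 f (\<pi> 0 x) = lev.pr 0 f x"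
proof -
  obtain a where a: "a \<in> L2_space (N 0)" "lev.pr 0 f = a \<circ> \<pi> 0" by (rule lev.pr_obtain[OF f])
  have "a \<in> new 0" using a by (simp add: new_def)
  moreover have "L2_inner M (\<lambda>x. f x - a (\<pi> 0 x)) (w \<circ> \<pi> 0) = 0" if "w \<in> new 0" for w
    using inner_pr_residual[OF f new_L2[OF that] order.refl] a by simp
  ultimately show "component 0 f \<in> new 0" "AE x in M. component 0 f (\<pi> 0 x) = lev.pr 0 f x"
    using component_eqI[OF f, of a 0] a by auto
qed

text \<open>The pullback of the increment is the part of level \<open>Suc i\<close> orthogonal to
  level i, so the projection onto it is the difference of the two level projections.\<close>

lemma component_Suc:
  assumes f: "f \<in> L2_space M"
  shows "component (Suc i) f \<in> new (Suc i)" 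
    "AE x in M. component (Suc i) f (\<pi> (Suc i) x) = lev.pr (Suc i) f x - lev.pr i f x"
proof -
  obtain a where a: "a \<in> L2_space (N (Suc i))" "lev.pr (Suc i) f = a \<circ> \<pi> (Suc i)" by (rule lev.pr_obtain[OF f])
  obtain b where b: "b \<in> L2_space (N i)" "lev.pr i f = b \<circ> \<pi> i" by (rule lev.pr_obtain[OF f])
  note bq = bond.L2_comp[OF b(1)]
  \<comment> \<open>The lower projection is pulled up along \<open>q i\<close>, so that the
    difference is a function on level \<open>Suc i\<close>.\<close>
  define d where "d = (\<lambda>x. a x - (b \<circ> q i) x)"
  have dL: "d \<in> L2_space (N (Suc i))" unfolding d_def by (rule L2_diff[OF a(1) bq])
  have dx: "d (\<pi> (Suc i) x) = lev.pr (Suc i) f x - lev.pr i f x" if "x \<in> space M" for x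
    using that by (simp add: d_def a b comp)
  note pm = lev.pr_mem[OF f]
  have "L2_inner (N (Suc i)) d (w \<circ> q i) = 0" if w: "w \<in> L2_space (N i)" for w
  proof -
    note wq = bond.L2_comp[OF w]
    have "L2_inner (N (Suc i)) d (w \<circ> q i) = L2_inner M (d \<circ> \<pi> (Suc i)) ((w \<circ> q i) \<circ> \<pi> (Suc i))"
      using lev.L2_inner_comp[OF dL wq] by simp
    also have "\<dots> = L2_inner M (\<lambda>x. lev.pr (Suc i) f x - lev.pr i f x) (w \<circ> \<pi> i)"
      by (rule L2_inner_cong_AE)
        (use dx comp L2_diff[OF pm pm] lev.L2_comp[OF dL] lev.L2_comp[OF wq] lev.L2_comp[OF w] in auto)
    also have "\<dots> = L2_inner M (\<lambda>x. f x - lev.pr i f x) (w \<circ> \<pi> i) - L2_inner M (\<lambda>x. f x - lev.pr (Suc i) f x) (w \<circ> \<pi> i)"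
      by (simp add: L2_inner_diff_left[OF f pm lev.L2_comp[OF w]] L2_inner_diff_left[OF pm pm lev.L2_comp[OF w]])
    also have "\<dots> = 0" by (simp add: inner_pr_residual[OF f w])
    finally show ?thesis .
  qed
  hence d: "d \<in> new (Suc i)" using dL by (simp add: new_def)
  have orth: "L2_inner M (\<lambda>x. f x - d (\<pi> (Suc i) x)) (v \<circ> \<pi> (Suc i)) = 0" if v: "v \<in> new (Suc i)" for v
  proof -
    note vL = new_L2[OF v] and Wv = lev.L2_comp[OF new_L2[OF v]]
    have "L2_inner M (\<lambda>x. f x - d (\<pi> (Suc i) x)) (v \<circ> \<pi> (Suc i)) = 
        L2_inner M (\<lambda>x. (f x - lev.pr (Suc i) f x) + lev.pr i f x) (v \<circ> \<pi> (Suc i))"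
      by (rule L2_inner_cong_AE)
        (use dx L2_add[OF L2_diff[OF f pm] pm] L2_diff[OF f lev.L2_comp[OF dL]] Wv in auto)
    also have "\<dots> = L2_inner M (lev.pr i f) (v \<circ> \<pi> (Suc i))"
      by (simp add: L2_inner_add_left[OF L2_diff[OF f pm] pm Wv] inner_pr_residual[OF f vL])
    also have "\<dots> = L2_inner M ((b \<circ> q i) \<circ> \<pi> (Suc i)) (v \<circ> \<pi> (Suc i))"
      by (rule L2_inner_cong_AE) (use pm[of i] Wv lev.L2_comp[OF bq] comp b in auto)
    also have "\<dots> = L2_inner (N (Suc i)) (b \<circ> q i) v" by (rule lev.L2_inner_comp[OF bq vL])
    also have "\<dots> = cnj (L2_inner (N (Suc i)) v (b \<circ> q i))" by (rule L2_inner_commute)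
    also have "\<dots> = 0" using v b by (simp add: new_def)
    finally show ?thesis .
  qed
  show "component (Suc i) f \<in> new (Suc i)" by (rule component_eqI(1)[OF f d orth])
  show "AE x in M. component (Suc i) f (\<pi> (Suc i) x) = lev.pr (Suc i) f x - lev.pr i f x"
    using component_eqI(2)[OF f d orth] dx by auto
qed

lemma component_L2: "f \<in> L2_space M \<Longrightarrow> component i f \<in> L2_space (N i)"
  using component_0(1) component_Suc(1) new_L2 by (cases i) auto

text \<open>The differences of consecutive projections telescope; the projection to level n collects
  the components 0 to n, hence \<open>Suc n\<close> terms.\<close>

lemma sum_components:
  assumes f: "f \<in> L2_space M"
  shows "AE x in M. (\<Sum>i<Suc n. (component i f \<circ> \<pi> i) x) = lev.pr n f x"
proof (induction n)
  case 0
  show ?case using component_0(2)[OF f] by simp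
next
  case (Suc n)
  show ?case using Suc component_Suc(2)[OF f, of n] by eventually_elim simp
qed

text \<open>All functional analysis of the proof, with the geometry condensed into three properties
  of the initial operators: \<open>lift\<close> and \<open>descend\<close> match the core on M with
  the cores of the levels, and \<open>average\<close> says that projecting to a lower level keeps a
  pair inside the core there.\<close>

theorem spectral_decomposition:
  assumes T: "unique_self_adjoint_extension M T0 T"
    and Ti: "\<And>i. unique_self_adjoint_extension (N i) (T0i i) (Ti i)"
    and E: "resolution_of_identity M T E"
    and Ei: "\<And>i. resolution_of_identity (N i) (Ti i) (Ei i)"
    and lift: "\<And>i u v. (u, v) \<in> T0i i \<Longrightarrow> (u \<circ> \<pi> i, v \<circ> \<pi> i) \<in> T"
    and descend: "\<And>f h. (f, h) \<in> T0 \<Longrightarrow> \<exists>j u v. (u, v) \<in> T0i j \<and> f = u \<circ> \<pi> j \<and> (AE x in M. h x = v (\<pi> j x))"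
    and average: "\<And>i j u v. i < j \<Longrightarrow> (u, v) \<in> T0i j \<Longrightarrow> \<exists>u' v'. (u', v') \<in> T0i i \<and>
      (\<forall>w\<in>L2_space (N i). L2_inner M (\<lambda>x. u (\<pi> j x) - u' (\<pi> i x)) (w \<circ> \<pi> i) = 0 \<and>
                            L2_inner M (\<lambda>x. v (\<pi> j x) - v' (\<pi> i x)) (w \<circ> \<pi> i) = 0)"
    and \<omega>: "\<omega> \<in> sets lebesgue" and f: "f \<in> L2_space M"
  shows "(\<lambda>n. L2_norm M (\<lambda>x. E \<omega> f x - (\<Sum>i<n. (Ei i \<omega> (component i f) \<circ> \<pi> i) x))) \<longlonglongrightarrow> 0"
proof -
  have sa: "L2_self_adjoint M T" and sub: "T0 \<subseteq> T" using T by (auto simp: unique_self_adjoint_extension_def)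
  have sai: "L2_self_adjoint (N i) (Ti i)" and subi: "T0i i \<subseteq> Ti i" for i 
    using Ti[of i] by (auto simp: unique_self_adjoint_extension_def)
  have memi: "u \<in> L2_space (N i)" "v \<in> L2_space (N i)" if "(u, v) \<in> T0i i" for u v i
    using self_adjoint_mem[OF sai] subi that by blast+

  \<comment> \<open>A core pair from a level up to i is fixed by the projection; one from a higher
    level is averaged down, and \<open>lift\<close> puts the result into T.\<close>
  have red0: "(lev.pr i f, lev.pr i h) \<in> T" if fh: "(f, h) \<in> T0" for i f h
  proof -
    have fhT: "(f, h) \<in> T" using fh sub by auto
    note mem = self_adjoint_mem[OF sa fhT]
    obtain j u v where uv: "(u, v) \<in> T0i j" and fu: "f = u \<circ> \<pi> j" and hv: "AE x in M. h x = v (\<pi> j x)"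
      using descend[OF fh] by blast
    note uL = memi[OF uv]
    have prh: "AE x in M. lev.pr i (v \<circ> \<pi> j) x = lev.pr i h x"
      by (rule L2_symmetric_cong[OF lev.pr_symmetric lev.L2_comp[OF uL(2)] mem(2)])
        (use hv in eventually_elim, simp)
    show ?thesis
    proof (cases "j \<le> i")
      case True
      have *: "AE x in M. lev.pr i (w \<circ> \<pi> j) x = w (\<pi> j x)" if w: "w \<in> L2_space (N j)" for w
      proof -
        obtain w' where w': "w' \<in> L2_space (N i)" "\<And>x. x \<in> space M \<Longrightarrow> w' (\<pi> i x) = w (\<pi> j x)"
          using lift_function[OF True w] by blast
        have "AE x in M. lev.pr i (w \<circ> \<pi> j) x = lev.pr i (w' \<circ> \<pi> i) x"
          by (rule L2_symmetric_cong[OF lev.pr_symmetric lev.L2_comp[OF w] lev.L2_comp[OF w'(1)]])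
            (use w' in auto)
        with lev.pr_comp[OF w'(1)] AE_space[of M] show ?thesis by eventually_elim (simp add: w')
      qed
      show ?thesis
      proof (rule self_adjoint_cong[OF sa fhT])
        show "AE x in M. f x = lev.pr i f x" using *[OF uL(1)] fu by (auto intro: AE_symmetric)
        show "AE x in M. h x = lev.pr i h x" using *[OF uL(2)] prh hv by eventually_elim simp
      qed (intro lev.pr_mem mem)+
    next
      case False
      then obtain u' v' where uv': "(u', v') \<in> T0i i" 
        and orth: "\<And>w. w \<in> L2_space (N i) \<Longrightarrow> L2_inner M (\<lambda>x. (u \<circ> \<pi> j) x - u' (\<pi> i x)) (w \<circ> \<pi> i) = 0"
          "\<And>w. w \<in> L2_space (N i) \<Longrightarrow> L2_inner M (\<lambda>x. (v \<circ> \<pi> j) x - v' (\<pi> i x)) (w \<circ> \<pi> i) = 0"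
        using average[OF _ uv, of i] by auto
      note uL' = memi[OF uv']
      have "AE x in M. lev.pr i (u \<circ> \<pi> j) x = u' (\<pi> i x)" "AE x in M. lev.pr i (v \<circ> \<pi> j) x = v' (\<pi> i x)"
        by (rule lev.pr_eqI[OF lev.L2_comp[OF uL(1)] uL'(1) orth(1)], assumption)
          (rule lev.pr_eqI[OF lev.L2_comp[OF uL(2)] uL'(2) orth(2)], assumption)
      note eqs = this
      show ?thesis
      proof (rule self_adjoint_cong[OF sa lift[OF uv']])
        show "AE x in M. (u' \<circ> \<pi> i) x = lev.pr i f x" unfolding fu using eqs(1) by eventually_elim simp
        show "AE x in M. (v' \<circ> \<pi> i) x = lev.pr i h x" using eqs(2) prh by eventually_elim simp
      qed (intro lev.pr_mem mem)+
    qed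
  qed
  have red: "(lev.pr i f, lev.pr i h) \<in> T" if "(f, h) \<in> T" for i f h
    by (rule lev.pr_reduces[OF T _ that]) (rule red0)

  \<comment> \<open>The restriction of T to level i is a self-adjoint extension of the core there,
    so uniqueness on level i applies.\<close>
  have Ti_eq: "Ti i = {(u, v). u \<in> L2_space (N i) \<and> v \<in> L2_space (N i) \<and> (u \<circ> \<pi> i, v \<circ> \<pi> i) \<in> T}" (is "_ = ?S i") for i
  proof -
    have "L2_self_adjoint (N i) (?S i)" by (rule lev.restriction_self_adjoint[OF sa]) (rule red)
    moreover have "T0i i \<subseteq> ?S i"
    proof (rule subrelI)
      fix u v assume "(u, v) \<in> T0i i"
      note uv = this
      show "(u, v) \<in> ?S i" by (intro CollectI case_prodI conjI memi[OF uv] lift[OF uv])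
    qed
    ultimately show ?thesis by (rule unique_self_adjoint_extension_eq[OF Ti])
  qed
  have E_comp: "AE x in M. E \<omega> (u \<circ> \<pi> i) x = Ei i \<omega> u (\<pi> i x)" if u: "u \<in> L2_space (N i)" for i u
    by (rule lev.spectral_measure_pullback[OF sa _ E Ei[of i, unfolded Ti_eq] \<omega> u]) (rule red)

  \<comment> \<open>Let R be the projection onto the complement K of all levels. It kills the core,
    so T + R extends the core as well and must be T. Hence R vanishes on the domain of T, and the
    domain is orthogonal to K.\<close>
  have dens: "AE x in M. k x = 0" 
    if k: "k \<in> L2_space M" and orth: "\<And>i w. w \<in> L2_space (N i) \<Longrightarrow> L2_inner M k (w \<circ> \<pi> i) = 0" for k
  proof -
    define K where "K = {h \<in> L2_space M. \<forall>i. \<forall>w\<in>L2_space (N i). L2_inner M h (w \<circ> \<pi> i) = 0}"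
    have K: "L2_closed_subspace M K"
      unfolding L2_closed_subspace_def
    proof (intro conjI ballI allI impI)
      show "K \<subseteq> L2_space M" by (auto simp: K_def)
      show "K \<noteq> {}" using k orth by (auto simp: K_def)
      show "(\<lambda>x. a * f x + b * u x) \<in> K" if "f \<in> K" "u \<in> K" for f u a b
        using that by (auto simp: K_def L2_lincomb L2_inner_lincomb_left lev.L2_comp)
      fix h :: "nat \<Rightarrow> 'b \<Rightarrow> complex" and F 
      assume h: "\<forall>n. h n \<in> K" and F: "F \<in> L2_space M" and lim: "(\<lambda>n. L2_norm M (\<lambda>x. h n x - F x)) \<longlonglongrightarrow> 0"
      have "L2_inner M F (w \<circ> \<pi> i) = 0" if w: "w \<in> L2_space (N i)" for i w
      proof -
        note Ww = lev.L2_comp[OF w]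
        have b: "cmod (L2_inner M F (w \<circ> \<pi> i)) \<le> L2_norm M (\<lambda>x. h n x - F x) * L2_norm M (w \<circ> \<pi> i)" for n
        proof -
          have hn: "h n \<in> L2_space M" "L2_inner M (h n) (w \<circ> \<pi> i) = 0" using h w by (auto simp: K_def)
          have "L2_inner M (\<lambda>x. h n x - F x) (w \<circ> \<pi> i) = - L2_inner M F (w \<circ> \<pi> i)"
            using hn(2) by (simp add: L2_inner_diff_left[OF hn(1) F Ww])
          thus ?thesis using L2_Cauchy_Schwarz[OF L2_diff[OF hn(1) F] Ww] by simp
        qed
        have "(\<lambda>n. L2_norm M (\<lambda>x. h n x - F x) * L2_norm M (w \<circ> \<pi> i)) \<longlonglongrightarrow> 0 * L2_norm M (w \<circ> \<pi> i)"
          by (intro tendsto_intros lim)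
        hence "cmod (L2_inner M F (w \<circ> \<pi> i)) \<le> 0 * L2_norm M (w \<circ> \<pi> i)"
          by (rule LIMSEQ_le_const) (use b in blast)
        thus ?thesis by simp
      qed
      thus "\<exists>G\<in>K. AE x in M. F x = G x" using F by (intro bexI[of _ F]) (auto simp: K_def)
    qed
    define R where "R = L2_proj M K"
    have R: "L2_symmetric M R" unfolding R_def by (rule L2_proj_symmetric[OF K])
    define T' where "T' = {(f, h). f \<in> L2_space M \<and> h \<in> L2_space M \<and> (f, \<lambda>x. h x - R f x) \<in> T}"
    have "(f, h) \<in> T'" if fh: "(f, h) \<in> T0" for f h
    proof -
      have fhT: "(f, h) \<in> T" using fh sub by auto
      note mem = self_adjoint_mem[OF sa fhT]
      obtain j u v where uv: "(u, v) \<in> T0i j" and fu: "f = u \<circ> \<pi> j" using descend[OF fh] by blast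
      have "AE x in M. R f x = (\<lambda>x. 0) x"
        unfolding R_def
      proof (rule L2_proj_eqI[OF K mem(1)])
        show "(\<lambda>x. 0) \<in> K" by (simp add: K_def L2_zero) (simp add: L2_inner_def)
        fix s assume s: "s \<in> K"
        have "L2_inner M s f = 0" using s memi[OF uv] by (simp add: K_def fu)
        hence "L2_inner M f s = 0" by (subst L2_inner_commute) simp
        thus "L2_inner M f s = L2_inner M (\<lambda>x. 0) s" by (simp add: L2_inner_def)
      qed
      hence "AE x in M. h x = h x - R f x" by eventually_elim simp
      hence "(f, \<lambda>x. h x - R f x) \<in> T"
        by (rule self_adjoint_cong[OF sa fhT AE_I2[OF refl]]) (intro mem L2_diff L2_symmetric_mem[OF R])+
      thus ?thesis using mem by (simp add: T'_def)
    qed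
    moreover have "L2_self_adjoint M T'" unfolding T'_def by (rule self_adjoint_perturbation[OF sa R])
    ultimately have T': "T' = T" using T unfolding unique_self_adjoint_extension_def by (metis subrelI)
    have kK: "k \<in> K" using k orth by (simp add: K_def)
    show ?thesis
    proof (rule self_adjoint_orthogonal_domain[OF sa k])
      fix f h assume fh: "(f, h) \<in> T"
      note mem = self_adjoint_mem[OF sa fh]
      note Rf = L2_symmetric_mem[OF R mem(1)]
      have "(f, \<lambda>x. h x - R f x) \<in> T" using fh T' by (auto simp: T'_def)
      \<comment> \<open>Subtracting the two pairs over the same f leaves R f as a value of T at 0,
        and a densely defined symmetric operator has only 0 there.\<close>
      from self_adjoint_lincomb[OF sa fh this, of 1 "-1"] have 0: "(\<lambda>x. 0, R f) \<in> T" by simp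
      have "AE x in M. R f x = 0"
      proof (rule self_adjoint_orthogonal_domain[OF sa Rf])
        fix u v assume "(u, v) \<in> T"
        from self_adjoint_inner[OF sa 0 this] show "L2_inner M (R f) u = 0" by (simp add: L2_inner_def)
      qed
      hence "L2_inner M (R f) k = L2_inner M (\<lambda>x. 0) k"
        by (rule L2_inner_cong_AE[OF _ AE_I2[OF refl]]) (intro Rf k L2_zero)+
      hence "L2_inner M f k = 0"
        using L2_proj_inner[OF K mem(1) kK] by (simp add: R_def L2_inner_def)
      thus "L2_inner M k f = 0" by (subst L2_inner_commute) simp
    qed
  qed

  have pvm: "projection_valued_measure M E"
    using E by (simp add: resolution_of_identity_def spectral_measure_for_def)
  note S = pvm_symmetric[OF pvm \<omega>]
  note Emem = L2_symmetric_mem[OF S]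
  have Eimem: "Ei i \<omega> u \<in> L2_space (N i)" if "u \<in> L2_space (N i)" for i u
  proof -
    have "projection_valued_measure (N i) (Ei i)" 
      using Ei[of i] by (simp add: resolution_of_identity_def spectral_measure_for_def)
    from L2_symmetric_mem[OF pvm_symmetric[OF this \<omega>] that] show ?thesis .
  qed
  note cL = component_L2[OF f]
  \<comment> \<open>By \<open>E_comp\<close> and the telescoping sum the error is E \<omega> applied
    to f minus its projection to level n, and E \<omega> is a contraction.\<close>
  have le: "L2_norm M (\<lambda>x. E \<omega> f x - (\<Sum>i<Suc n. (Ei i \<omega> (component i f) \<circ> \<pi> i) x)) 
      \<le> L2_norm M (\<lambda>x. f x - lev.pr n f x)" for n
  proof -
    note pm = lev.pr_mem[OF f, of n]
    have "AE x in M. E \<omega> (\<lambda>x. \<Sum>i<Suc n. (component i f \<circ> \<pi> i) x) x = (\<Sum>i<Suc n. E \<omega> (component i f \<circ> \<pi> i) x)"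
      by (rule L2_symmetric_sum[OF S finite_lessThan]) (intro lev.L2_comp cL)
    moreover have "AE x in M. E \<omega> (\<lambda>x. \<Sum>i<Suc n. (component i f \<circ> \<pi> i) x) x = E \<omega> (lev.pr n f) x"
      by (rule L2_symmetric_cong[OF S _ pm sum_components[OF f]]) (intro L2_sum finite_lessThan lev.L2_comp cL)
    moreover have "AE x in M. \<forall>i\<in>{..<Suc n}. E \<omega> (component i f \<circ> \<pi> i) x = Ei i \<omega> (component i f) (\<pi> i x)"
      by (rule AE_finite_allI[OF finite_lessThan]) (rule E_comp[OF cL])
    moreover have "AE x in M. E \<omega> (\<lambda>x. f x - lev.pr n f x) x = E \<omega> f x - E \<omega> (lev.pr n f) x"
      by (rule L2_symmetric_diff[OF S f pm])
    ultimately have eq: "AE x in M. E \<omega> f x - (\<Sum>i<Suc n. (Ei i \<omega> (component i f) \<circ> \<pi> i) x) = E \<omega> (\<lambda>x. f x - lev.pr n f x) x"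
      by eventually_elim simp
    have "L2_norm M (\<lambda>x. E \<omega> f x - (\<Sum>i<Suc n. (Ei i \<omega> (component i f) \<circ> \<pi> i) x)) = L2_norm M (E \<omega> (\<lambda>x. f x - lev.pr n f x))"
      by (rule L2_norm_cong_AE[OF eq])
        (intro L2_diff L2_sum finite_lessThan lev.L2_comp Eimem cL Emem f pm)+
    also have "\<dots> \<le> L2_norm M (\<lambda>x. f x - lev.pr n f x)"
      by (rule pvm_norm_le[OF pvm \<omega> L2_diff[OF f pm]])
    finally show ?thesis .
  qed
  have lim0: "(\<lambda>n. L2_norm M (\<lambda>x. f x - lev.pr n f x)) \<longlonglongrightarrow> 0"
    by (rule pr_tendsto[OF _ f]) (rule dens)
  have "(\<lambda>n. L2_norm M (\<lambda>x. E \<omega> f x - (\<Sum>i<Suc n. (Ei i \<omega> (component i f) \<circ> \<pi> i) x))) \<longlonglongrightarrow> 0"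
    by (rule tendsto_sandwich[OF _ _ tendsto_const lim0]) (intro always_eventually allI le L2_norm_nonneg)+
  \<comment> \<open>Partial sums with \<open>Suc n\<close> terms were compared with level n; the
    shift of the index does not affect the limit.\<close>
  thus ?thesis by (rule LIMSEQ_imp_Suc)
qed

end

section \<open>Partial derivatives\<close>

lemma frechet_derivative_cong_open:
  assumes "open T" "z \<in> T" "\<And>x. x \<in> T \<Longrightarrow> f x = g x"
  shows "frechet_derivative f (at z) = frechet_derivative g (at z)"
proof -
  have "(f has_derivative D) (at z) \<longleftrightarrow> (g has_derivative D) (at z)" for D
    using has_derivative_transform_within_open[of f D z UNIV T g] 
      has_derivative_transform_within_open[of g D z UNIV T f] assms by auto
  thus ?thesis by (simp add: frechet_derivative_def)
qed

lemma differentiable_cong_open: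
  assumes "open T" "z \<in> T" "\<And>x. x \<in> T \<Longrightarrow> f x = g x"
  shows "f differentiable (at z) \<longleftrightarrow> g differentiable (at z)"
  unfolding differentiable_def
  using has_derivative_transform_within_open[of f _ z UNIV T g, OF _ assms]
    has_derivative_transform_within_open[of g _ z UNIV T f, OF _ assms(1,2) assms(3)[symmetric]] by blast

lemma partial_deriv_cong_open:
  assumes "open T" "z \<in> T" "\<And>x. x \<in> T \<Longrightarrow> f x = g x"
  shows "partial_deriv i f z = partial_deriv i g z"
  unfolding partial_deriv_def by (simp add: frechet_derivative_cong_open[OF assms])

lemma partial_derivI: "(f has_derivative D) (at z) \<Longrightarrow> partial_deriv i f z = D (axis i 1)"
  unfolding partial_deriv_def by (simp add: frechet_derivative_at[symmetric])

lemma partial_deriv_const [simp]: "partial_deriv i (\<lambda>x. c) z = 0"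
  by (simp add: partial_deriv_def)

lemma partial_deriv_add:
  assumes "f differentiable (at z)" "g differentiable (at z)"
  shows "partial_deriv i (\<lambda>x. f x + g x) z = partial_deriv i f z + partial_deriv i g z"
proof -
  have "((\<lambda>x. f x + g x) has_derivative (\<lambda>v. frechet_derivative f (at z) v + frechet_derivative g (at z) v)) (at z)"
    using assms by (intro has_derivative_add) (auto simp: frechet_derivative_works)
  from partial_derivI[OF this, of i] show ?thesis by (simp add: partial_deriv_def)
qed

lemma partial_deriv_sum:
  assumes "finite I" "\<And>k. k \<in> I \<Longrightarrow> f k differentiable (at z)"
  shows "partial_deriv i (\<lambda>x. \<Sum>k\<in>I. f k x) z = (\<Sum>k\<in>I. partial_deriv i (f k) z)"
proof -
  have "((\<lambda>x. \<Sum>k\<in>I. f k x) has_derivative (\<lambda>v. \<Sum>k\<in>I. frechet_derivative (f k) (at z) v)) (at z)"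
    using assms by (intro has_derivative_sum) (auto simp: frechet_derivative_works)
  from partial_derivI[OF this, of i] show ?thesis by (simp add: partial_deriv_def)
qed

lemma partial_deriv_scaleR:
  fixes f :: "real ^ 'n::finite \<Rightarrow> 'b::real_normed_vector"
  assumes "a differentiable (at z)" "f differentiable (at z)"
  shows "partial_deriv i (\<lambda>x. a x *\<^sub>R f x) z = partial_deriv i a z *\<^sub>R f z + a z *\<^sub>R partial_deriv i f z"
proof -
  have "((\<lambda>x. a x *\<^sub>R f x) has_derivative 
    (\<lambda>v. a z *\<^sub>R frechet_derivative f (at z) v + frechet_derivative a (at z) v *\<^sub>R f z)) (at z)"
    using assms by (intro has_derivative_scaleR) (auto simp: frechet_derivative_works)
  from partial_derivI[OF this, of i] show ?thesis by (simp add: partial_deriv_def)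
qed

lemma partial_deriv_mult:
  fixes f :: "real ^ 'n::finite \<Rightarrow> real"
  assumes "a differentiable (at z)" "f differentiable (at z)"
  shows "partial_deriv i (\<lambda>x. a x * f x) z = partial_deriv i a z * f z + a z * partial_deriv i f z"
  using partial_deriv_scaleR[OF assms] by simp

lemma partial_deriv_bounded_linear:
  assumes "bounded_linear L" "f differentiable (at z)"
  shows "partial_deriv i (\<lambda>x. L (f x)) z = L (partial_deriv i f z)"
proof -
  have "((\<lambda>x. L (f x)) has_derivative (\<lambda>v. L (frechet_derivative f (at z) v))) (at z)"
    by (rule bounded_linear.has_derivative[OF assms(1)]) (use assms(2) in \<open>simp add: frechet_derivative_works\<close>)
  from partial_derivI[OF this, of i] show ?thesis by (simp add: partial_deriv_def)
qed

lemma differentiable_bounded_linear: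
  assumes "bounded_linear L" "f differentiable (at z)"
  shows "(\<lambda>x. L (f x)) differentiable (at z)"
proof -
  obtain D where "(f has_derivative D) (at z)" using assms(2) by (auto simp: differentiable_def)
  from bounded_linear.has_derivative[OF assms(1) this] show ?thesis by (rule differentiableI)
qed

lemma partial_deriv_nth:
  fixes f :: "real ^ 'n::finite \<Rightarrow> 'b::real_normed_vector ^ 'm::finite"
  assumes "f differentiable (at z)"
  shows "partial_deriv i (\<lambda>x. f x $ j) z = partial_deriv i f z $ j"
  by (rule partial_deriv_bounded_linear[OF bounded_linear_vec_nth assms])

lemma differentiable_nth:
  fixes f :: "real ^ 'n::finite \<Rightarrow> 'b::real_normed_vector ^ 'm::finite"
  assumes "f differentiable (at z)"
  shows "(\<lambda>x. f x $ j) differentiable (at z)"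
  by (rule differentiable_bounded_linear[OF bounded_linear_vec_nth assms])

lemma partial_deriv_compose:
  fixes g :: "real ^ 'n::finite \<Rightarrow> real ^ 'm::finite" and f :: "real ^ 'm \<Rightarrow> 'b::real_normed_vector"
  assumes g: "g differentiable (at z)" and f: "f differentiable (at (g z))"
  shows "partial_deriv i (\<lambda>x. f (g x)) z = (\<Sum>j\<in>UNIV. (partial_deriv i g z $ j) *\<^sub>R partial_deriv j f (g z))"
proof -
  define v where "v = partial_deriv i g z"
  have lin: "linear (frechet_derivative f (at (g z)))" by (rule linear_frechet_derivative[OF f])
  have v: "v = (\<Sum>j\<in>UNIV. (v $ j) *\<^sub>R axis j 1)"
    using basis_expansion[of v] unfolding scalar_mult_eq_scaleR by (rule sym)
  have "partial_deriv i (f \<circ> g) z = frechet_derivative f (at (g z)) v"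
    unfolding partial_deriv_def frechet_derivative_compose[OF g f] by (simp add: v_def partial_deriv_def)
  also have "\<dots> = frechet_derivative f (at (g z)) (\<Sum>j\<in>UNIV. (v $ j) *\<^sub>R axis j 1)"
    by (rule arg_cong[OF v])
  also have "\<dots> = (\<Sum>j\<in>UNIV. (v $ j) *\<^sub>R partial_deriv j f (g z))"
    by (simp add: linear_sum[OF lin] linear_cmul[OF lin] partial_deriv_def)
  finally show ?thesis by (simp add: comp_def v_def)
qed

section \<open>Smooth functions\<close>

lemma C_k_on_subset: "C_k_on k S f \<Longrightarrow> T \<subseteq> S \<Longrightarrow> C_k_on k T f"
  by (induction k arbitrary: f) (auto intro: continuous_on_subset)

lemma C_k_on_cong:
  assumes "open S" "\<And>x. x \<in> S \<Longrightarrow> f x = g x"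
  shows "C_k_on k S f \<longleftrightarrow> C_k_on k S g"
  using assms(2)
proof (induction k arbitrary: f g)
  case 0
  thus ?case by (simp cong: continuous_on_cong)
next
  case (Suc k)
  have "C_k_on k S (partial_deriv i f) \<longleftrightarrow> C_k_on k S (partial_deriv i g)" for i
    by (rule Suc.IH) (rule partial_deriv_cong_open[OF assms(1)], use Suc.prems in auto)
  moreover have "f differentiable (at y) \<longleftrightarrow> g differentiable (at y)" if "y \<in> S" for y
    by (rule differentiable_cong_open[OF assms(1) that]) (rule Suc.prems)
  ultimately show ?case by simp
qed

lemma C_k_on_eq: "open S \<Longrightarrow> C_k_on k S f \<Longrightarrow> (\<And>x. x \<in> S \<Longrightarrow> f x = g x) \<Longrightarrow> C_k_on k S g"
  using C_k_on_cong[of S f g k] by simp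

lemma C_k_on_local:
  assumes "\<And>y. y \<in> S \<Longrightarrow> \<exists>T. open T \<and> y \<in> T \<and> C_k_on k T f"
  shows "C_k_on k S f"
  using assms
proof (induction k arbitrary: f)
  case 0
  have "isCont f y" if "y \<in> S" for y
    using 0[OF that] by (auto simp: continuous_on_eq_continuous_at)
  thus ?case by (simp add: continuous_at_imp_continuous_on)
next
  case (Suc k)
  show ?case
  proof (simp, intro conjI ballI allI)
    show "f differentiable (at y)" if "y \<in> S" for y using Suc.prems[OF that] by auto
    show "C_k_on k S (partial_deriv i f)" for i
    proof (rule Suc.IH)
      fix y assume "y \<in> S"
      from Suc.prems[OF this] show "\<exists>T. open T \<and> y \<in> T \<and> C_k_on k T (partial_deriv i f)" by auto
    qed
  qed
qed

lemma C_k_on_Suc: "C_k_on (Suc k) S f \<Longrightarrow> C_k_on k S f"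
proof (induction k arbitrary: f)
  case 0
  thus ?case by (auto intro!: continuous_at_imp_continuous_on differentiable_imp_continuous_within)
next
  case (Suc k)
  from Suc.prems have "f differentiable (at y)" if "y \<in> S" for y using that by auto
  moreover have "C_k_on k S (partial_deriv i f)" for i
    by (rule Suc.IH) (use Suc.prems in auto)
  ultimately show ?case by simp
qed

lemma C_k_on_const: 
  fixes S :: "(real ^ 'n::finite) set" and c :: "'b::real_normed_vector"
  shows "C_k_on k S (\<lambda>x. c)"
proof (induction k arbitrary: c)
  case (Suc k)
  have "partial_deriv i (\<lambda>x. c) = (\<lambda>x. 0)" for i :: 'n by (rule ext) simp
  thus ?case using Suc by simp
qed simp

lemma C_k_on_add:
  assumes "open S" "C_k_on k S f" "C_k_on k S g"
  shows "C_k_on k S (\<lambda>x. f x + g x)"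
  using assms(2,3)
proof (induction k arbitrary: f g)
  case 0 thus ?case by (auto intro: continuous_on_add)
next
  case (Suc k)
  have "C_k_on k S (partial_deriv i (\<lambda>x. f x + g x))" for i
  proof -
    have "C_k_on k S (\<lambda>x. partial_deriv i f x + partial_deriv i g x)" by (rule Suc.IH) (use Suc.prems in auto)
    moreover have "partial_deriv i f x + partial_deriv i g x = partial_deriv i (\<lambda>x. f x + g x) x" if "x \<in> S" for x
      by (rule partial_deriv_add[symmetric]) (use Suc.prems that in auto)
    ultimately show ?thesis by (rule C_k_on_eq[OF assms(1)])
  qed
  thus ?case using Suc.prems by (auto intro: differentiable_add)
qed

lemma C_k_on_sum:
  assumes "open S" "finite I" "\<And>j. j \<in> I \<Longrightarrow> C_k_on k S (f j)"
  shows "C_k_on k S (\<lambda>x. \<Sum>j\<in>I. f j x)"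
  using assms(2,3) by (induction I rule: finite_induct) (auto intro: C_k_on_const C_k_on_add assms(1))

lemma C_k_on_scaleR:
  fixes f :: "real ^ 'n::finite \<Rightarrow> 'b::real_normed_vector"
  assumes "open S" "C_k_on k S a" "C_k_on k S f"
  shows "C_k_on k S (\<lambda>x. a x *\<^sub>R f x)"
  using assms(2,3)
proof (induction k arbitrary: a f)
  case 0 thus ?case by (auto intro: continuous_on_scaleR)
next
  case (Suc k)
  have "C_k_on k S (partial_deriv i (\<lambda>x. a x *\<^sub>R f x))" for i
  proof -
    have "C_k_on k S (\<lambda>x. partial_deriv i a x *\<^sub>R f x + a x *\<^sub>R partial_deriv i f x)"
      by (rule C_k_on_add[OF assms(1)]; rule Suc.IH) (use Suc.prems C_k_on_Suc in auto)
    moreover have "partial_deriv i a x *\<^sub>R f x + a x *\<^sub>R partial_deriv i f x = partial_deriv i (\<lambda>x. a x *\<^sub>R f x) x" if "x \<in> S" for x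
      by (rule partial_deriv_scaleR[symmetric]) (use Suc.prems that in auto)
    ultimately show ?thesis by (rule C_k_on_eq[OF assms(1)])
  qed
  thus ?case using Suc.prems by (auto intro: differentiable_scaleR)
qed

lemma C_k_on_bounded_linear:
  assumes L: "bounded_linear L" and "open S" and "C_k_on k S f"
  shows "C_k_on k S (\<lambda>x. L (f x))"
  using assms(3)
proof (induction k arbitrary: f)
  case 0
  thus ?case using bounded_linear.continuous_on[OF L] by simp
next
  case (Suc k)
  have "C_k_on k S (partial_deriv i (\<lambda>x. L (f x)))" for i
  proof -
    have "C_k_on k S (\<lambda>x. L (partial_deriv i f x))" by (rule Suc.IH) (use Suc.prems in auto)
    moreover have "L (partial_deriv i f x) = partial_deriv i (\<lambda>x. L (f x)) x" if "x \<in> S" for x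
      by (rule partial_deriv_bounded_linear[OF L, symmetric]) (use Suc.prems that in auto)
    ultimately show ?thesis by (rule C_k_on_eq[OF assms(2)])
  qed
  moreover have "(\<lambda>x. L (f x)) differentiable (at y)" if "y \<in> S" for y
    by (rule differentiable_bounded_linear[OF L]) (use Suc.prems that in auto)
  ultimately show ?case by simp
qed

text \<open>The chain rule expresses the partial derivatives of the composition by those of f
  composed with the same g, so the induction generalizes over f only.\<close>

lemma C_k_on_compose:
  fixes g :: "real ^ 'n::finite \<Rightarrow> real ^ 'm::finite" and f :: "real ^ 'm \<Rightarrow> 'b::real_normed_vector"
  assumes "open S" "open T" "g ` S \<subseteq> T" "C_k_on k S g" "C_k_on k T f"
  shows "C_k_on k S (\<lambda>x. f (g x))"
  using assms(4,5)
proof (induction k arbitrary: f)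
  case 0
  thus ?case using continuous_on_compose2[of T f S g] assms(3) by auto
next
  case (Suc k)
  note g = C_k_on_Suc[OF Suc.prems(1)]
  have "C_k_on k S (partial_deriv i (\<lambda>x. f (g x)))" for i
  proof -
    have "C_k_on k S (\<lambda>x. \<Sum>j\<in>UNIV. (partial_deriv i g x $ j) *\<^sub>R partial_deriv j f (g x))"
    proof (intro C_k_on_sum C_k_on_scaleR assms(1) finite)
      fix j
      show "C_k_on k S (\<lambda>x. partial_deriv i g x $ j)"
        by (rule C_k_on_bounded_linear[OF bounded_linear_vec_nth assms(1)]) (use Suc.prems in auto)
      show "C_k_on k S (\<lambda>x. partial_deriv j f (g x))" by (rule Suc.IH[OF g]) (use Suc.prems in auto)
    qed
    moreover have "(\<Sum>j\<in>UNIV. (partial_deriv i g x $ j) *\<^sub>R partial_deriv j f (g x)) = partial_deriv i (\<lambda>x. f (g x)) x" 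
      if "x \<in> S" for x
      by (rule partial_deriv_compose[symmetric]) (use Suc.prems that assms(3) in auto)
    ultimately show ?thesis by (rule C_k_on_eq[OF assms(1)])
  qed
  moreover have "(\<lambda>x. f (g x)) differentiable (at y)" if "y \<in> S" for y
    using differentiable_chain_at[of g y f] Suc.prems that assms(3) by (auto simp: comp_def)
  ultimately show ?case by simp
qed

lemma smooth_on_subset: "smooth_on S f \<Longrightarrow> T \<subseteq> S \<Longrightarrow> smooth_on T f"
  unfolding smooth_on_def using C_k_on_subset by blast

lemma smooth_on_cong: "open S \<Longrightarrow> (\<And>x. x \<in> S \<Longrightarrow> f x = g x) \<Longrightarrow> smooth_on S f \<longleftrightarrow> smooth_on S g"
  unfolding smooth_on_def using C_k_on_cong[of S f g] by simp

lemma smooth_on_eq: "open S \<Longrightarrow> smooth_on S f \<Longrightarrow> (\<And>x. x \<in> S \<Longrightarrow> f x = g x) \<Longrightarrow> smooth_on S g"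
  using smooth_on_cong[of S f g] by simp

lemma smooth_on_local:
  assumes "\<And>y. y \<in> S \<Longrightarrow> \<exists>T. open T \<and> y \<in> T \<and> smooth_on T f"
  shows "smooth_on S f"
  unfolding smooth_on_def by (intro allI C_k_on_local) (use assms in \<open>auto simp: smooth_on_def\<close>)

lemma smooth_on_sum:
  "open S \<Longrightarrow> finite I \<Longrightarrow> (\<And>j. j \<in> I \<Longrightarrow> smooth_on S (f j)) \<Longrightarrow> smooth_on S (\<lambda>x. \<Sum>j\<in>I. f j x)"
  unfolding smooth_on_def by (auto intro: C_k_on_sum)

lemma smooth_on_bounded_linear:
  "bounded_linear L \<Longrightarrow> open S \<Longrightarrow> smooth_on S f \<Longrightarrow> smooth_on S (\<lambda>x. L (f x))"
  unfolding smooth_on_def by (auto intro: C_k_on_bounded_linear)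

lemma smooth_on_compose:
  fixes g :: "real ^ 'n::finite \<Rightarrow> real ^ 'm::finite" and f :: "real ^ 'm \<Rightarrow> 'b::real_normed_vector"
  assumes "open S" "open T" "g ` S \<subseteq> T" "smooth_on S g" "smooth_on T f"
  shows "smooth_on S (\<lambda>x. f (g x))"
  using assms unfolding smooth_on_def by (auto intro: C_k_on_compose)

lemma smooth_on_differentiable: "smooth_on S f \<Longrightarrow> y \<in> S \<Longrightarrow> f differentiable (at y)"
  unfolding smooth_on_def using C_k_on.simps(2)[of 0 S f] by auto

lemma smooth_on_continuous: "smooth_on S f \<Longrightarrow> continuous_on S f"
  unfolding smooth_on_def using C_k_on.simps(1)[of S f] by metis

text \<open>Both iterated derivatives are limits of the same second difference quotient, which the mean
  value theorem expresses by either of them.\<close>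

lemma second_difference:
  fixes f :: "real ^ 'n::finite \<Rightarrow> real"
  assumes diff: "\<And>s t. 0 \<le> s \<Longrightarrow> s \<le> h \<Longrightarrow> 0 \<le> t \<Longrightarrow> t \<le> h \<Longrightarrow> f differentiable (at (y + s *\<^sub>R axis i 1 + t *\<^sub>R axis j 1))"
    and diff2: "\<And>s t. 0 \<le> s \<Longrightarrow> s \<le> h \<Longrightarrow> 0 \<le> t \<Longrightarrow> t \<le> h \<Longrightarrow> 
      partial_deriv i f differentiable (at (y + s *\<^sub>R axis i 1 + t *\<^sub>R axis j 1))"
    and h: "h > 0"
  obtains s t where "0 < s" "s < h" "0 < t" "t < h" 
    "f (y + h *\<^sub>R axis i 1 + h *\<^sub>R axis j 1) - f (y + h *\<^sub>R axis i 1) - f (y + h *\<^sub>R axis j 1) + f y =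
     h * h * partial_deriv j (partial_deriv i f) (y + s *\<^sub>R axis i 1 + t *\<^sub>R axis j 1)"
proof -
  define p where "p s t = y + s *\<^sub>R axis i 1 + t *\<^sub>R axis j (1::real)" for s t
  define \<phi> where "\<phi> s = f (p s h) - f (p s 0)" for s
  have D1: "((\<lambda>s. g (p s t)) has_real_derivative partial_deriv i g (p s t)) (at s)" 
    if g: "g differentiable (at (p s t))" for g :: "real ^ 'n \<Rightarrow> real" and s t
  proof -
    have "((\<lambda>s. p s t) has_derivative (\<lambda>d. d *\<^sub>R axis i 1)) (at s)"
      unfolding p_def by (auto intro!: derivative_eq_intros)
    from has_derivative_compose[OF this, of g "frechet_derivative g (at (p s t))"] g
    have "((\<lambda>s. g (p s t)) has_derivative (\<lambda>d. frechet_derivative g (at (p s t)) (d *\<^sub>R axis i 1))) (at s)"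
      by (simp add: frechet_derivative_works)
    thus ?thesis unfolding has_field_derivative_def partial_deriv_def
      by (simp add: linear_cmul[OF linear_frechet_derivative[OF g]] mult_commute_abs)
  qed
  have D2: "((\<lambda>t. g (p s t)) has_real_derivative partial_deriv j g (p s t)) (at t)" 
    if g: "g differentiable (at (p s t))" for g :: "real ^ 'n \<Rightarrow> real" and s t
  proof -
    have "((\<lambda>t. p s t) has_derivative (\<lambda>d. d *\<^sub>R axis j 1)) (at t)"
      unfolding p_def by (auto intro!: derivative_eq_intros)
    from has_derivative_compose[OF this, of g "frechet_derivative g (at (p s t))"] g
    have "((\<lambda>t. g (p s t)) has_derivative (\<lambda>d. frechet_derivative g (at (p s t)) (d *\<^sub>R axis j 1))) (at t)"
      by (simp add: frechet_derivative_works)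
    thus ?thesis unfolding has_field_derivative_def partial_deriv_def
      by (simp add: linear_cmul[OF linear_frechet_derivative[OF g]] mult_commute_abs)
  qed
  have "\<exists>s>0. s < h \<and> \<phi> h - \<phi> 0 = (h - 0) * (partial_deriv i f (p s h) - partial_deriv i f (p s 0))"
    unfolding \<phi>_def 
  proof (rule MVT2[OF h], intro DERIV_diff D1)
    fix s assume s: "0 \<le> s" "s \<le> h"
    show "f differentiable (at (p s h))" "f differentiable (at (p s 0))"
      using diff[OF s, of h] diff[OF s, of 0] h by (simp_all add: p_def)
  qed
  then obtain s where s: "0 < s" "s < h" "\<phi> h - \<phi> 0 = h * (partial_deriv i f (p s h) - partial_deriv i f (p s 0))"
    by auto
  have "\<exists>t>0. t < h \<and> partial_deriv i f (p s h) - partial_deriv i f (p s 0) = (h - 0) * partial_deriv j (partial_deriv i f) (p s t)"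
    by (rule MVT2[OF h], intro D2) (use diff2 h s in \<open>auto simp: p_def\<close>)
  then obtain t where t: "0 < t" "t < h" 
    "partial_deriv i f (p s h) - partial_deriv i f (p s 0) = h * partial_deriv j (partial_deriv i f) (p s t)"
    by auto
  show ?thesis
    by (rule that[OF s(1,2) t(1,2)]) (use s(3) t(3) in \<open>simp add: \<phi>_def p_def\<close>)
qed

text \<open>The second difference is symmetric in i and j, so near y the two mixed derivatives take
  a common value, at two possibly different points. By continuity they cannot differ at y.\<close>

lemma partial_deriv_commute:
  fixes f :: "real ^ 'n::finite \<Rightarrow> real"
  assumes f: "C_k_on 2 S f" and S: "open S" "y \<in> S"
  shows "partial_deriv i (partial_deriv j f) y = partial_deriv j (partial_deriv i f) y"
proof (rule ccontr)
  define A where "A = partial_deriv j (partial_deriv i f)"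
  define B where "B = partial_deriv i (partial_deriv j f)"
  assume "\<not> ?thesis"
  hence AB: "\<bar>A y - B y\<bar> / 2 > 0" by (simp add: A_def B_def)
  define e where "e = \<bar>A y - B y\<bar> / 2"
  have d: "f differentiable (at x)" "partial_deriv k f differentiable (at x)" if "x \<in> S" for x k
    using f that by (auto simp: numeral_2_eq_2)
  have "continuous_on S A" "continuous_on S B" using f by (auto simp: numeral_2_eq_2 A_def B_def)
  hence "isCont A y" "isCont B y" using S by (auto simp: continuous_on_eq_continuous_at)
  then obtain dA dB where dA: "dA > 0" "\<And>x. dist x y < dA \<Longrightarrow> dist (A x) (A y) < e"
    and dB: "dB > 0" "\<And>x. dist x y < dB \<Longrightarrow> dist (B x) (B y) < e"
    using AB unfolding continuous_at_eps_delta e_def by metis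
  obtain dS where dS: "dS > 0" "ball y dS \<subseteq> S" using S open_contains_ball by blast
  \<comment> \<open>The intermediate points lie within s + t <= 2h of y, so a third of the common
    radius suffices.\<close>
  define h where "h = min dS (min dA dB) / 3"
  have h: "h > 0" using dA dB dS by (simp add: h_def)
  have near: "dist (y + s *\<^sub>R axis k 1 + t *\<^sub>R axis l 1) y < min dS (min dA dB)" 
    if "0 \<le> s" "s \<le> h" "0 \<le> t" "t \<le> h" for s t and k l :: 'n
  proof -
    have "dist (y + s *\<^sub>R axis k 1 + t *\<^sub>R axis l 1) y = norm (s *\<^sub>R axis k (1::real) + t *\<^sub>R axis l (1::real))"
      by (simp add: dist_norm algebra_simps)
    also have "\<dots> \<le> s + t" using norm_triangle_ineq[of "s *\<^sub>R axis k (1::real)" "t *\<^sub>R axis l (1::real)"] that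
      by simp
    also have "\<dots> < min dS (min dA dB)" using that h by (simp add: h_def)
    finally show ?thesis .
  qed
  have inS: "y + s *\<^sub>R axis k 1 + t *\<^sub>R axis l 1 \<in> S" 
    if "0 \<le> s" "s \<le> h" "0 \<le> t" "t \<le> h" for s t and k l :: 'n
    using near[OF that, of k l] dS by (auto simp: dist_commute)
  obtain s t where st: "0 < s" "s < h" "0 < t" "t < h" 
    "f (y + h *\<^sub>R axis i 1 + h *\<^sub>R axis j 1) - f (y + h *\<^sub>R axis i 1) - f (y + h *\<^sub>R axis j 1) + f y =
     h * h * A (y + s *\<^sub>R axis i 1 + t *\<^sub>R axis j 1)"
    unfolding A_def by (rule second_difference[of h f y i j]) (use d inS h in auto)
  obtain s' t' where st': "0 < s'" "s' < h" "0 < t'" "t' < h" 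
    "f (y + h *\<^sub>R axis j 1 + h *\<^sub>R axis i 1) - f (y + h *\<^sub>R axis j 1) - f (y + h *\<^sub>R axis i 1) + f y =
     h * h * B (y + s' *\<^sub>R axis j 1 + t' *\<^sub>R axis i 1)"
    unfolding B_def by (rule second_difference[of h f y j i]) (use d inS h in auto)
  have "h * h * A (y + s *\<^sub>R axis i 1 + t *\<^sub>R axis j 1) = h * h * B (y + s' *\<^sub>R axis j 1 + t' *\<^sub>R axis i 1)"
    using st(5) st'(5)[unfolded add.commute[of "h *\<^sub>R axis j (1::real)"] add.assoc]
    by (simp add: algebra_simps)
  hence eq: "A (y + s *\<^sub>R axis i 1 + t *\<^sub>R axis j 1) = B (y + s' *\<^sub>R axis j 1 + t' *\<^sub>R axis i 1)" using h by simp
  have "dist (A (y + s *\<^sub>R axis i 1 + t *\<^sub>R axis j 1)) (A y) < e" using near[of s t i j] st dA by auto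
  moreover have "dist (B (y + s' *\<^sub>R axis j 1 + t' *\<^sub>R axis i 1)) (B y) < e" using near[of s' t' j i] st' dB by auto
  ultimately have "\<bar>A y - B y\<bar> < 2 * e" using eq by (simp add: dist_real_def)
  thus False by (simp add: e_def)
qed

section \<open>Derivatives of determinants and inverse matrices\<close>

lemma differentiable_prod:
  fixes f :: "'i \<Rightarrow> 'a::real_normed_vector \<Rightarrow> real"
  assumes "\<And>i. i \<in> I \<Longrightarrow> f i differentiable (at z)"
  shows "(\<lambda>x. \<Prod>i\<in>I. f i x) differentiable (at z)"
proof -
  have "((\<lambda>x. \<Prod>i\<in>I. f i x) has_derivative 
      (\<lambda>y. \<Sum>i\<in>I. frechet_derivative (f i) (at z) y * (\<Prod>j\<in>I - {i}. f j z))) (at z)"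
    by (rule has_derivative_prod) (use assms in \<open>simp add: frechet_derivative_works\<close>)
  thus ?thesis by (rule differentiableI)
qed

lemma differentiable_det:
  fixes A :: "'a::real_normed_vector \<Rightarrow> real ^ 'n::finite ^ 'n"
  assumes "\<And>i j. (\<lambda>x. A x $ i $ j) differentiable (at z)"
  shows "(\<lambda>x. det (A x)) differentiable (at z)"
  unfolding det_def
  by (intro differentiable_sum ballI differentiable_mult differentiable_const differentiable_prod assms)
     (rule finite_permutations, simp)

lemma partial_deriv_prod:
  fixes f :: "'i \<Rightarrow> real ^ 'n::finite \<Rightarrow> real"
  assumes "\<And>a. a \<in> I \<Longrightarrow> f a differentiable (at z)"
  shows "partial_deriv i (\<lambda>x. \<Prod>a\<in>I. f a x) z = (\<Sum>a\<in>I. partial_deriv i (f a) z * (\<Prod>b\<in>I - {a}. f b z))"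
proof -
  have "((\<lambda>x. \<Prod>i\<in>I. f i x) has_derivative 
      (\<lambda>y. \<Sum>i\<in>I. frechet_derivative (f i) (at z) y * (\<Prod>j\<in>I - {i}. f j z))) (at z)"
    by (rule has_derivative_prod) (use assms in \<open>simp add: frechet_derivative_works\<close>)
  from partial_derivI[OF this, of i] show ?thesis by (simp add: partial_deriv_def)
qed

text \<open>In the Leibniz formula only the identity permutation contributes to first order at the
  identity matrix, so the derivative is the trace.\<close>

lemma partial_deriv_det_mat1:
  fixes B :: "real ^ 'n::finite \<Rightarrow> real ^ 'm::finite ^ 'm"
  assumes B: "\<And>a b. (\<lambda>x. B x $ a $ b) differentiable (at z)" and z: "B z = mat 1"
  shows "partial_deriv i (\<lambda>x. det (B x)) z = (\<Sum>a\<in>UNIV. partial_deriv i (\<lambda>x. B x $ a $ a) z)"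
proof -
  let ?P = "{p. p permutes (UNIV :: 'm set)}"
  have fin: "finite ?P" by (rule finite_permutations) simp
  have summand: "partial_deriv i (\<lambda>x. of_int (sign p) * (\<Prod>a\<in>UNIV. B x $ a $ p a)) z =
      of_int (sign p) * (\<Sum>a\<in>UNIV. partial_deriv i (\<lambda>x. B x $ a $ p a) z * (\<Prod>b\<in>UNIV - {a}. B z $ b $ p b))" for p
    by (simp add: partial_deriv_mult differentiable_prod B partial_deriv_prod)
  \<comment> \<open>A permutation other than the identity moves at least two points, so an
    off-diagonal zero remains after one factor is removed.\<close>
  have zero: "(\<Prod>b\<in>UNIV - {a}. B z $ b $ p b) = 0" if p: "p permutes UNIV" "p \<noteq> id" for p and a :: 'm
  proof -
    have "\<exists>b. b \<noteq> a \<and> p b \<noteq> b"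
    proof (rule ccontr)
      assume "\<not> ?thesis"
      hence fixed: "p b = b" if "b \<noteq> a" for b using that by auto
      have "p a = a"
      proof (rule ccontr)
        assume "p a \<noteq> a"
        hence "p (p a) = p a" by (rule fixed)
        thus False using \<open>p a \<noteq> a\<close> permutes_inj[OF p(1)] by (meson injD)
      qed
      with fixed have "p = id" by (metis eq_id_iff)
      thus False using p(2) by simp
    qed
    then obtain b where "b \<noteq> a" "p b \<noteq> b" by blast
    thus ?thesis by (intro prod_zero bexI[of _ b]) (auto simp: z mat_def)
  qed
  have "partial_deriv i (\<lambda>x. det (B x)) z = (\<Sum>p\<in>?P. partial_deriv i (\<lambda>x. of_int (sign p) * (\<Prod>a\<in>UNIV. B x $ a $ p a)) z)"
    unfolding det_def by (rule partial_deriv_sum[OF fin]) (intro differentiable_mult differentiable_const differentiable_prod B)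
  also have "\<dots> = (\<Sum>p\<in>{id}. partial_deriv i (\<lambda>x. of_int (sign p) * (\<Prod>a\<in>UNIV. B x $ a $ p a)) z)"
    by (rule sum.mono_neutral_right[OF fin]) (auto simp: permutes_id summand zero)
  also have "\<dots> = (\<Sum>a\<in>UNIV. partial_deriv i (\<lambda>x. B x $ a $ a) z)"
    using summand[of id] by (simp add: sign_id z mat_def)
  finally show ?thesis .
qed

lemma matrix_inv_mult:
  fixes A :: "real ^ 'n::finite ^ 'n"
  assumes "det A \<noteq> 0"
  shows "A ** matrix_inv A = mat 1" "matrix_inv A ** A = mat 1"
proof -
  have "\<exists>A'. A ** A' = mat 1 \<and> A' ** A = mat 1"
    using assms invertible_det_nz[of A] by (auto simp: invertible_def)
  from someI_ex[OF this] show "A ** matrix_inv A = mat 1" "matrix_inv A ** A = mat 1"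
    by (auto simp: matrix_inv_def)
qed

lemma matrix_inv_eqI:
  fixes A :: "real ^ 'n::finite ^ 'n"
  assumes "B ** A = mat 1"
  shows "matrix_inv A = B"
proof -
  have "det B * det A = 1" using assms det_mul[of B A] by simp
  hence d: "det A \<noteq> 0" by auto
  have "B = B ** (A ** matrix_inv A)" by (simp add: matrix_inv_mult[OF d])
  also have "\<dots> = matrix_inv A" by (simp add: matrix_mul_assoc assms)
  finally show ?thesis ..
qed

text \<open>Jacobi's formula, reduced to the identity matrix by det (A x) = det (A z) det (C A x)
  with C the inverse of A z.\<close>

lemma partial_deriv_det:
  fixes A :: "real ^ 'n::finite \<Rightarrow> real ^ 'm::finite ^ 'm"
  assumes A: "\<And>a b. (\<lambda>x. A x $ a $ b) differentiable (at z)" and d: "det (A z) \<noteq> 0"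
  shows "partial_deriv i (\<lambda>x. det (A x)) z =
    det (A z) * (\<Sum>a\<in>UNIV. \<Sum>b\<in>UNIV. matrix_inv (A z) $ a $ b * partial_deriv i (\<lambda>x. A x $ b $ a) z)"
proof -
  define C where "C = matrix_inv (A z)"
  have CA: "C ** A z = mat 1" "A z ** C = mat 1" using matrix_inv_mult[OF d] by (simp_all add: C_def)
  have dC: "det (A z) * det C = 1" using det_mul[of "A z" C] CA by simp
  have ent: "(C ** A x) $ a $ b = (\<Sum>k\<in>UNIV. C $ a $ k * A x $ k $ b)" for x a b
    by (simp add: matrix_matrix_mult_def)
  have B: "(\<lambda>x. (C ** A x) $ a $ b) differentiable (at z)" for a b
    unfolding ent by (intro differentiable_sum ballI differentiable_mult differentiable_const A finite)
  have "det (A x) = det (A z) * det (C ** A x)" for x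
    using dC by (simp add: det_mul mult.assoc[symmetric])
  hence "partial_deriv i (\<lambda>x. det (A x)) z = partial_deriv i (\<lambda>x. det (A z) * det (C ** A x)) z" by metis
  also have "\<dots> = det (A z) * partial_deriv i (\<lambda>x. det (C ** A x)) z"
    by (simp add: partial_deriv_mult differentiable_det B)
  also have "partial_deriv i (\<lambda>x. det (C ** A x)) z = (\<Sum>a\<in>UNIV. partial_deriv i (\<lambda>x. (C ** A x) $ a $ a) z)"
    by (rule partial_deriv_det_mat1[OF B CA(1)])
  also have "\<dots> = (\<Sum>a\<in>UNIV. \<Sum>b\<in>UNIV. C $ a $ b * partial_deriv i (\<lambda>x. A x $ b $ a) z)"
    unfolding ent by (simp add: partial_deriv_sum partial_deriv_mult A differentiable_mult)
  finally show ?thesis by (simp add: C_def)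
qed

text \<open>By Cramer's rule the entries of the inverse are quotients of determinants.\<close>

lemma differentiable_matrix_inv:
  fixes A :: "real ^ 'n::finite \<Rightarrow> real ^ 'm::finite ^ 'm"
  assumes A: "\<And>a b. (\<lambda>x. A x $ a $ b) differentiable (at z)"
    and T: "open T" "z \<in> T" and d: "\<And>x. x \<in> T \<Longrightarrow> det (A x) \<noteq> 0"
  shows "(\<lambda>x. matrix_inv (A x) $ a $ b) differentiable (at z)"
proof -
  let ?C = "\<lambda>x. (\<chi> i j. if j = a then axis b 1 $ i else A x $ i $ j) :: real ^ 'm ^ 'm"
  have eq: "det (?C x) / det (A x) = matrix_inv (A x) $ a $ b" if x: "x \<in> T" for x
  proof -
    have "A x *v (matrix_inv (A x) *v axis b 1) = axis b 1"
      by (simp add: matrix_vector_mul_assoc matrix_inv_mult[OF d[OF x]])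
    hence "matrix_inv (A x) *v axis b 1 = (\<chi> k. det (\<chi> i j. if j = k then axis b 1 $ i else A x $ i $ j) / det (A x))"
      using cramer[OF d[OF x]] by blast
    hence "(matrix_inv (A x) *v axis b 1) $ a = det (?C x) / det (A x)" by simp
    thus ?thesis by (simp add: matrix_vector_mul_component inner_axis matrix_vector_mult_basis column_def)
  qed
  have "(\<lambda>x. ?C x $ i $ j) differentiable (at z)" for i j by (cases "j = a") (simp_all add: A)
  hence "(\<lambda>x. det (?C x) / det (A x)) differentiable (at z)"
    using T d by (intro differentiable_divide differentiable_det A) auto
  thus ?thesis using differentiable_cong_open[OF T eq] by simp
qed

text \<open>Differentiate A C = 1 for the inverse C of A, then multiply by C from the left.\<close>

lemma partial_deriv_matrix_inv:
  fixes A :: "real ^ 'n::finite \<Rightarrow> real ^ 'm::finite ^ 'm"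
  assumes A: "\<And>a b. (\<lambda>x. A x $ a $ b) differentiable (at z)"
    and T: "open T" "z \<in> T" and d: "\<And>x. x \<in> T \<Longrightarrow> det (A x) \<noteq> 0"
  shows "partial_deriv i (\<lambda>x. matrix_inv (A x) $ a $ b) z =
    - (\<Sum>c\<in>UNIV. \<Sum>e\<in>UNIV. matrix_inv (A z) $ a $ c * partial_deriv i (\<lambda>x. A x $ c $ e) z * matrix_inv (A z) $ e $ b)"
proof -
  let ?C = "\<lambda>x. matrix_inv (A x)"
  have C: "(\<lambda>x. ?C x $ a $ b) differentiable (at z)" for a b
    by (rule differentiable_matrix_inv[OF A T d])
  have prod: "(\<Sum>e\<in>UNIV. partial_deriv i (\<lambda>x. A x $ c $ e) z * ?C z $ e $ b + A z $ c $ e * partial_deriv i (\<lambda>x. ?C x $ e $ b) z) = 0" for c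
  proof -
    have "partial_deriv i (\<lambda>x. \<Sum>e\<in>UNIV. A x $ c $ e * ?C x $ e $ b) z = partial_deriv i (\<lambda>x. (mat 1 :: real^'m^'m) $ c $ b) z"
    proof (rule partial_deriv_cong_open[OF T])
      fix x assume "x \<in> T"
      have "(A x ** ?C x) $ c $ b = (mat 1 :: real^'m^'m) $ c $ b" using matrix_inv_mult(1)[OF d[OF \<open>x \<in> T\<close>]] by simp
      thus "(\<Sum>e\<in>UNIV. A x $ c $ e * ?C x $ e $ b) = (mat 1 :: real^'m^'m) $ c $ b" by (simp add: matrix_matrix_mult_def)
    qed
    thus ?thesis by (simp add: partial_deriv_sum partial_deriv_mult A C differentiable_mult)
  qed
  have CA: "(\<Sum>c\<in>UNIV. ?C z $ a $ c * A z $ c $ e) = (if a = e then 1 else 0)" for e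
    using matrix_inv_mult(2)[OF d[OF T(2)]] by (simp add: matrix_matrix_mult_def mat_def vec_eq_iff)
  have "0 = (\<Sum>c\<in>UNIV. ?C z $ a $ c * 
    (\<Sum>e\<in>UNIV. partial_deriv i (\<lambda>x. A x $ c $ e) z * ?C z $ e $ b + A z $ c $ e * partial_deriv i (\<lambda>x. ?C x $ e $ b) z))"
    by (simp add: prod)
  also have "\<dots> = (\<Sum>c\<in>UNIV. \<Sum>e\<in>UNIV. ?C z $ a $ c * partial_deriv i (\<lambda>x. A x $ c $ e) z * ?C z $ e $ b)
      + (\<Sum>c\<in>UNIV. \<Sum>e\<in>UNIV. ?C z $ a $ c * A z $ c $ e * partial_deriv i (\<lambda>x. ?C x $ e $ b) z)"
    by (simp add: sum_distrib_left sum.distrib algebra_simps)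
  also have "(\<Sum>c\<in>UNIV. \<Sum>e\<in>UNIV. ?C z $ a $ c * A z $ c $ e * partial_deriv i (\<lambda>x. ?C x $ e $ b) z) =
      (\<Sum>e\<in>UNIV. \<Sum>c\<in>UNIV. ?C z $ a $ c * A z $ c $ e * partial_deriv i (\<lambda>x. ?C x $ e $ b) z)"
    by (rule sum.swap)
  also have "\<dots> = (\<Sum>e\<in>UNIV. (\<Sum>c\<in>UNIV. ?C z $ a $ c * A z $ c $ e) * partial_deriv i (\<lambda>x. ?C x $ e $ b) z)"
    by (simp add: sum_distrib_right)
  also have "\<dots> = partial_deriv i (\<lambda>x. ?C x $ a $ b) z"
  proof -
    have "(\<Sum>e\<in>UNIV. (if a = e then 1 else 0) * partial_deriv i (\<lambda>x. ?C x $ e $ b) z) 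
        = (\<Sum>e\<in>UNIV. if e = a then partial_deriv i (\<lambda>x. ?C x $ e $ b) z else 0)"
      by (rule sum.cong) auto
    thus ?thesis unfolding CA by simp
  qed
  finally show ?thesis by linarith
qed

section \<open>Coordinate invariance of the Laplacian\<close>

definition jacobian_matrix :: "(real ^ 'n::finite \<Rightarrow> real ^ 'n) \<Rightarrow> real ^ 'n \<Rightarrow> real ^ 'n ^ 'n" where
  "jacobian_matrix \<psi> y = matrix (frechet_derivative \<psi> (at y))"

lemma jacobian_matrix_nth: "jacobian_matrix \<psi> y $ a $ b = partial_deriv b \<psi> y $ a"
  by (simp add: jacobian_matrix_def matrix_def partial_deriv_def)

text \<open>Piola's identity. The two sums obtained from the product rule cancel by the symmetry of second
  derivatives.\<close>

lemma piola:
  fixes \<psi> :: "real ^ 'n::finite \<Rightarrow> real ^ 'n"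
  assumes \<psi>: "C_k_on 2 S \<psi>" and S: "open S" "z \<in> S" and d: "\<And>y. y \<in> S \<Longrightarrow> det (jacobian_matrix \<psi> y) \<noteq> 0"
  shows "(\<lambda>y. det (jacobian_matrix \<psi> y) * matrix_inv (jacobian_matrix \<psi> y) $ i $ k) differentiable (at z)" (is ?D)
    and "(\<Sum>i\<in>UNIV. partial_deriv i (\<lambda>y. det (jacobian_matrix \<psi> y) * matrix_inv (jacobian_matrix \<psi> y) $ i $ k) z) = 0"
proof -
  let ?J = "jacobian_matrix \<psi>"
  let ?C = "matrix_inv (?J z)"
  have diff: "\<psi> differentiable (at y)" "partial_deriv b \<psi> differentiable (at y)" if "y \<in> S" for y b
    using \<psi> that by (auto simp: numeral_2_eq_2)
  have J: "(\<lambda>y. ?J y $ a $ b) differentiable (at z)" for a b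
    unfolding jacobian_matrix_nth by (rule differentiable_nth[OF diff(2)[OF S(2)]])
  have C: "(\<lambda>y. matrix_inv (?J y) $ a $ b) differentiable (at z)" for a b
    by (rule differentiable_matrix_inv[OF J S d])
  have D: "(\<lambda>y. det (?J y)) differentiable (at z)" by (rule differentiable_det[OF J])
  show ?D by (intro differentiable_mult D C)
  have sym: "partial_deriv i (\<lambda>y. ?J y $ b $ a) z = partial_deriv a (\<lambda>y. ?J y $ b $ i) z" for i a b
  proof -
    have *: "partial_deriv i (\<lambda>y. ?J y $ b $ a) z = partial_deriv i (partial_deriv a (\<lambda>y. \<psi> y $ b)) z" for i a
      unfolding jacobian_matrix_nth by (rule partial_deriv_cong_open[OF S]) (simp add: partial_deriv_nth diff)
    have "C_k_on 2 S (\<lambda>y. \<psi> y $ b)" by (rule C_k_on_bounded_linear[OF bounded_linear_vec_nth S(1) \<psi>])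
    from partial_deriv_commute[OF this S] show ?thesis unfolding * .
  qed
  have pC: "partial_deriv i (\<lambda>y. matrix_inv (?J y) $ i $ k) z = 
    - (\<Sum>c\<in>UNIV. \<Sum>e\<in>UNIV. ?C $ i $ c * partial_deriv i (\<lambda>x. ?J x $ c $ e) z * ?C $ e $ k)" for i
    by (rule partial_deriv_matrix_inv[OF J S d])
  have "partial_deriv i (\<lambda>y. det (?J y) * matrix_inv (?J y) $ i $ k) z = 
     det (?J z) * ((\<Sum>a\<in>UNIV. \<Sum>b\<in>UNIV. ?C $ a $ b * partial_deriv i (\<lambda>x. ?J x $ b $ a) z * ?C $ i $ k)
       - (\<Sum>c\<in>UNIV. \<Sum>e\<in>UNIV. ?C $ i $ c * partial_deriv i (\<lambda>x. ?J x $ c $ e) z * ?C $ e $ k))" for i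
    unfolding partial_deriv_mult[OF D C] partial_deriv_det[OF J d[OF S(2)]] pC
    by (simp add: sum_distrib_left sum_distrib_right algebra_simps)
  hence "(\<Sum>i\<in>UNIV. partial_deriv i (\<lambda>y. det (?J y) * matrix_inv (?J y) $ i $ k) z) = 
     det (?J z) * ((\<Sum>i\<in>UNIV. \<Sum>a\<in>UNIV. \<Sum>b\<in>UNIV. ?C $ a $ b * partial_deriv i (\<lambda>x. ?J x $ b $ a) z * ?C $ i $ k)
       - (\<Sum>i\<in>UNIV. \<Sum>c\<in>UNIV. \<Sum>e\<in>UNIV. ?C $ i $ c * partial_deriv i (\<lambda>x. ?J x $ c $ e) z * ?C $ e $ k))"
    by (simp add: sum_distrib_left[symmetric] sum_subtractf[symmetric])
  also have "(\<Sum>i\<in>UNIV. \<Sum>a\<in>UNIV. \<Sum>b\<in>UNIV. ?C $ a $ b * partial_deriv i (\<lambda>x. ?J x $ b $ a) z * ?C $ i $ k)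
     = (\<Sum>i\<in>UNIV. \<Sum>a\<in>UNIV. \<Sum>b\<in>UNIV. ?C $ a $ b * partial_deriv a (\<lambda>x. ?J x $ b $ i) z * ?C $ i $ k)"
    by (intro sum.cong refl) (subst sym, rule refl)
  also have "\<dots> = (\<Sum>a\<in>UNIV. \<Sum>i\<in>UNIV. \<Sum>b\<in>UNIV. ?C $ a $ b * partial_deriv a (\<lambda>x. ?J x $ b $ i) z * ?C $ i $ k)"
    by (rule sum.swap)
  also have "\<dots> = (\<Sum>i\<in>UNIV. \<Sum>c\<in>UNIV. \<Sum>e\<in>UNIV. ?C $ i $ c * partial_deriv i (\<lambda>x. ?J x $ c $ e) z * ?C $ e $ k)"
    by (rule sum.cong[OF refl]) (rule sum.swap)
  finally show "(\<Sum>i\<in>UNIV. partial_deriv i (\<lambda>y. det (?J y) * matrix_inv (?J y) $ i $ k) z) = 0" by simp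
qed

text \<open>With J the Jacobian of \<psi>, the inverse of G is J^-1 G'^-1 J^-T, while the
  differential of u is J^T applied to that of w; the factors J^-T and J^T cancel.\<close>

lemma coord_grad_transform:
  fixes \<psi> :: "real ^ 'n::finite \<Rightarrow> real ^ 'n"
  assumes \<psi>: "\<psi> differentiable (at y)" and w: "w differentiable (at (\<psi> y))" and S: "open S" "y \<in> S"
    and u: "\<And>x. x \<in> S \<Longrightarrow> u x = w (\<psi> x)"
    and G: "G y = transpose (jacobian_matrix \<psi> y) ** G' (\<psi> y) ** jacobian_matrix \<psi> y"
    and d: "det (jacobian_matrix \<psi> y) \<noteq> 0" "det (G' (\<psi> y)) \<noteq> 0"
  shows "coord_grad G u i y = (\<Sum>k\<in>UNIV. (matrix_inv (jacobian_matrix \<psi> y) $ i $ k) *\<^sub>R coord_grad G' w k (\<psi> y))"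
proof -
  let ?J = "jacobian_matrix \<psi> y"
  let ?C = "matrix_inv ?J" and ?H = "matrix_inv (G' (\<psi> y))"
  have CJ: "?C ** ?J = mat 1" "?J ** ?C = mat 1" by (rule matrix_inv_mult[OF d(1)])+
  have tCJ: "transpose ?C ** transpose ?J = mat 1" 
    using CJ(2) by (metis matrix_transpose_mul transpose_mat)
  have inv: "matrix_inv (G y) = ?C ** ?H ** transpose ?C"
  proof (rule matrix_inv_eqI)
    have "(?C ** ?H ** transpose ?C) ** G y = ?C ** (?H ** ((transpose ?C ** transpose ?J) ** G' (\<psi> y))) ** ?J"
      unfolding G by (simp add: matrix_mul_assoc)
    also have "\<dots> = mat 1" by (simp add: tCJ matrix_inv_mult[OF d(2)] CJ)
    finally show "(?C ** ?H ** transpose ?C) ** G y = mat 1" .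
  qed
  have invJ: "matrix_inv (G y) ** transpose ?J = ?C ** ?H"
  proof -
    have "matrix_inv (G y) ** transpose ?J = ?C ** ?H ** (transpose ?C ** transpose ?J)"
      unfolding inv by (simp add: matrix_mul_assoc)
    thus ?thesis by (simp add: tCJ)
  qed
  have pd: "partial_deriv j u y = (\<Sum>b\<in>UNIV. (?J $ b $ j) *\<^sub>R partial_deriv b w (\<psi> y))" for j
    using partial_deriv_cong_open[OF S u] partial_deriv_compose[OF \<psi> w] by (simp add: jacobian_matrix_nth)
  have "coord_grad G u i y = (\<Sum>j\<in>UNIV. \<Sum>b\<in>UNIV. (matrix_inv (G y) $ i $ j * transpose ?J $ j $ b) *\<^sub>R partial_deriv b w (\<psi> y))"
    by (simp add: coord_grad_def pd scaleR_sum_right transpose_def)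
  also have "\<dots> = (\<Sum>b\<in>UNIV. \<Sum>j\<in>UNIV. (matrix_inv (G y) $ i $ j * transpose ?J $ j $ b) *\<^sub>R partial_deriv b w (\<psi> y))"
    by (rule sum.swap)
  also have "\<dots> = (\<Sum>b\<in>UNIV. ((matrix_inv (G y) ** transpose ?J) $ i $ b) *\<^sub>R partial_deriv b w (\<psi> y))"
    by (simp add: matrix_matrix_mult_def scaleR_sum_left)
  also have "\<dots> = (\<Sum>b\<in>UNIV. \<Sum>k\<in>UNIV. (?C $ i $ k * ?H $ k $ b) *\<^sub>R partial_deriv b w (\<psi> y))"
    unfolding invJ by (simp add: matrix_matrix_mult_def scaleR_sum_left)
  also have "\<dots> = (\<Sum>k\<in>UNIV. \<Sum>b\<in>UNIV. (?C $ i $ k * ?H $ k $ b) *\<^sub>R partial_deriv b w (\<psi> y))"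
    by (rule sum.swap)
  also have "\<dots> = (\<Sum>k\<in>UNIV. (?C $ i $ k) *\<^sub>R coord_grad G' w k (\<psi> y))"
    by (simp add: coord_grad_def scaleR_sum_right)
  finally show ?thesis .
qed

text \<open>The density of G is |det J| times that of G', so the flux of u is, up to sign, the Piola
  transform of the flux F of w: the matrix a = det J J^-1 applied to F o \<psi>. Its divergence is
  det J times that of F, and the determinant cancels against the density.\<close>

lemma coord_laplacian_transform:
  fixes \<psi> :: "real ^ 'n::finite \<Rightarrow> real ^ 'n"
  assumes \<psi>: "C_k_on 2 S \<psi>" and S: "open S" "z \<in> S" and S': "open S'" "\<psi> ` S \<subseteq> S'"
    and w: "C_k_on 2 S' w" and u: "\<And>y. y \<in> S \<Longrightarrow> u y = w (\<psi> y)"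
    and G: "\<And>y. y \<in> S \<Longrightarrow> G y = transpose (jacobian_matrix \<psi> y) ** G' (\<psi> y) ** jacobian_matrix \<psi> y"
    and d: "\<And>y. y \<in> S \<Longrightarrow> det (jacobian_matrix \<psi> y) \<noteq> 0" and G': "\<And>x. x \<in> S' \<Longrightarrow> det (G' x) > 0"
    and dG': "\<And>x a b. x \<in> S' \<Longrightarrow> (\<lambda>x. G' x $ a $ b) differentiable (at x)"
  shows "coord_div G (coord_grad G u) z = coord_div G' (coord_grad G' w) (\<psi> z)"
proof -
  let ?J = "jacobian_matrix \<psi>"
  define a where "a i k y = det (?J y) * matrix_inv (?J y) $ i $ k" for i k y
  define \<sigma> where "\<sigma> = sgn (det (?J z))"
  define r where "r x = sqrt (det (G' x))" for x
  define F where "F k x = r x *\<^sub>R coord_grad G' w k x" for k x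
  have \<psi>S: "\<psi> y \<in> S'" if "y \<in> S" for y using that S'(2) by auto
  have diff: "\<psi> differentiable (at y)" "partial_deriv b \<psi> differentiable (at y)" if "y \<in> S" for y b
    using \<psi> that by (auto simp: numeral_2_eq_2)
  have wdiff: "w differentiable (at x)" "partial_deriv b w differentiable (at x)" if "x \<in> S'" for x b
    using w that by (auto simp: numeral_2_eq_2)
  have Jd: "(\<lambda>y. ?J y $ a $ b) differentiable (at z)" for a b
    unfolding jacobian_matrix_nth by (rule differentiable_nth[OF diff(2)[OF S(2)]])
  have sqrtG: "sqrt (det (G y)) = \<bar>det (?J y)\<bar> * r (\<psi> y)" if "y \<in> S" for y
    by (simp add: G[OF that] det_mul r_def real_sqrt_mult)

  have cont: "isCont (\<lambda>y. det (?J y)) z"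
    by (rule differentiable_imp_continuous_within[OF differentiable_det[OF Jd]])
  have dz: "det (?J z) \<noteq> 0" by (rule d[OF S(2)])
  \<comment> \<open>On this ball det J stays closer to its value at z than that value is to 0, so
    its sign is constantly \<sigma> and the absolute value can be differentiated.\<close>
  obtain e where e: "e > 0" "\<And>y. dist y z < e \<Longrightarrow> dist (det (?J y)) (det (?J z)) < \<bar>det (?J z)\<bar>"
    using cont dz unfolding continuous_at_eps_delta by (metis zero_less_abs_iff)
  define T where "T = S \<inter> ball z e"
  have T: "open T" "z \<in> T" and TS: "T \<subseteq> S" using S e by (auto simp: T_def)
  have \<sigma>: "\<bar>det (?J y)\<bar> = \<sigma> * det (?J y)" if "y \<in> T" for y
  proof -
    have "dist (det (?J y)) (det (?J z)) < \<bar>det (?J z)\<bar>" using that e(2)[of y] by (auto simp: T_def dist_commute)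
    thus ?thesis by (auto simp: \<sigma>_def dist_real_def sgn_if abs_if split: if_splits)
  qed
  have \<sigma>1: "\<sigma> * \<sigma> = 1" using dz by (simp add: \<sigma>_def sgn_if)

  have flux: "sqrt (det (G y)) *\<^sub>R coord_grad G u i y = (\<Sum>k\<in>UNIV. (\<sigma> * a i k y) *\<^sub>R F k (\<psi> y))" if y: "y \<in> T" for i y
  proof -
    have yS: "y \<in> S" using y TS by auto
    have "coord_grad G u i y = (\<Sum>k\<in>UNIV. (matrix_inv (?J y) $ i $ k) *\<^sub>R coord_grad G' w k (\<psi> y))"
      by (rule coord_grad_transform[where S = S]) 
        (use diff wdiff \<psi>S[OF yS] yS S u G d G'[OF \<psi>S[OF yS]] in auto)
    thus ?thesis by (simp add: sqrtG[OF yS] \<sigma>[OF y] scaleR_sum_right F_def a_def mult_ac)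
  qed
  have F: "F k differentiable (at x)" if x: "x \<in> S'" for k x
  proof -
    have "r differentiable (at x)"
    proof -
      have "sqrt differentiable (at (det (G' x)))"
        using DERIV_real_sqrt[OF G'[OF x]] by (auto simp: differentiable_def has_field_derivative_def)
      from differentiable_chain_at[OF differentiable_det[OF dG'[OF x]] this] show ?thesis
        by (simp add: r_def[abs_def] comp_def)
    qed
    moreover have "coord_grad G' w k differentiable (at x)"
      unfolding coord_grad_def
      by (intro differentiable_sum ballI differentiable_scaleR wdiff[OF x] finite
          differentiable_matrix_inv[OF dG'[OF x] S'(1) x]) (use G' in fastforce)
    ultimately show ?thesis unfolding F_def by (rule differentiable_scaleR)
  qed
  note Fz = F[OF \<psi>S[OF S(2)]]
  have F\<psi>: "(\<lambda>y. F k (\<psi> y)) differentiable (at z)" for k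
    using differentiable_chain_at[OF diff(1)[OF S(2)] Fz] by (simp add: comp_def)
  have a: "(\<lambda>y. a i k y) differentiable (at z)" for i k
    unfolding a_def by (rule piola(1)[OF \<psi> S d])
  have a0: "(\<Sum>i\<in>UNIV. partial_deriv i (a i k) z) = 0" for k
    unfolding a_def by (rule piola(2)[OF \<psi> S d])
  have aJ: "(\<Sum>i\<in>UNIV. a i k z * ?J z $ b $ i) = det (?J z) * (if b = k then 1 else 0)" for k b
  proof -
    have "(\<Sum>i\<in>UNIV. a i k z * ?J z $ b $ i) = det (?J z) * (?J z ** matrix_inv (?J z)) $ b $ k"
      by (simp add: a_def matrix_matrix_mult_def sum_distrib_left mult_ac)
    thus ?thesis by (simp add: matrix_inv_mult[OF dz] mat_def)
  qed
  have "(\<Sum>i\<in>UNIV. partial_deriv i (\<lambda>y. sqrt (det (G y)) *\<^sub>R coord_grad G u i y) z) = 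
      (\<Sum>i\<in>UNIV. \<Sum>k\<in>UNIV. partial_deriv i (\<lambda>y. (\<sigma> * a i k y) *\<^sub>R F k (\<psi> y)) z)"
  proof (rule sum.cong[OF refl])
    fix i
    have "partial_deriv i (\<lambda>y. sqrt (det (G y)) *\<^sub>R coord_grad G u i y) z = partial_deriv i (\<lambda>y. \<Sum>k\<in>UNIV. (\<sigma> * a i k y) *\<^sub>R F k (\<psi> y)) z"
      by (rule partial_deriv_cong_open[OF T flux])
    also have "\<dots> = (\<Sum>k\<in>UNIV. partial_deriv i (\<lambda>y. (\<sigma> * a i k y) *\<^sub>R F k (\<psi> y)) z)"
      by (rule partial_deriv_sum) (auto intro!: differentiable_scaleR differentiable_mult a F\<psi>)
    finally show "partial_deriv i (\<lambda>y. sqrt (det (G y)) *\<^sub>R coord_grad G u i y) z = \<dots>" .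
  qed
  also have "\<dots> = (\<Sum>i\<in>UNIV. \<Sum>k\<in>UNIV. \<sigma> *\<^sub>R (partial_deriv i (a i k) z *\<^sub>R F k (\<psi> z) + 
      (\<Sum>b\<in>UNIV. (a i k z * ?J z $ b $ i) *\<^sub>R partial_deriv b (F k) (\<psi> z))))"
  proof (intro sum.cong refl)
    fix i k
    have "partial_deriv i (\<lambda>y. (\<sigma> * a i k y) *\<^sub>R F k (\<psi> y)) z = 
        partial_deriv i (\<lambda>y. \<sigma> * a i k y) z *\<^sub>R F k (\<psi> z) + (\<sigma> * a i k z) *\<^sub>R partial_deriv i (\<lambda>y. F k (\<psi> y)) z"
      by (rule partial_deriv_scaleR) (auto intro!: differentiable_mult a F\<psi>)
    also have "partial_deriv i (\<lambda>y. \<sigma> * a i k y) z = \<sigma> * partial_deriv i (a i k) z"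
      using partial_deriv_mult[OF differentiable_const a, of i \<sigma>] by simp
    also have "partial_deriv i (\<lambda>y. F k (\<psi> y)) z = (\<Sum>b\<in>UNIV. (?J z $ b $ i) *\<^sub>R partial_deriv b (F k) (\<psi> z))"
      using partial_deriv_compose[OF diff(1)[OF S(2)] Fz] by (simp add: jacobian_matrix_nth)
    finally show "partial_deriv i (\<lambda>y. (\<sigma> * a i k y) *\<^sub>R F k (\<psi> y)) z = \<sigma> *\<^sub>R (partial_deriv i (a i k) z *\<^sub>R F k (\<psi> z) + 
      (\<Sum>b\<in>UNIV. (a i k z * ?J z $ b $ i) *\<^sub>R partial_deriv b (F k) (\<psi> z)))"
      by (simp add: scaleR_add_right scaleR_sum_right mult.assoc)
  qed
  also have "\<dots> = \<sigma> *\<^sub>R (\<Sum>i\<in>UNIV. \<Sum>k\<in>UNIV. partial_deriv i (a i k) z *\<^sub>R F k (\<psi> z) + 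
      (\<Sum>b\<in>UNIV. (a i k z * ?J z $ b $ i) *\<^sub>R partial_deriv b (F k) (\<psi> z)))"
    by (simp add: scaleR_sum_right)
  also have "(\<Sum>i\<in>UNIV. \<Sum>k\<in>UNIV. partial_deriv i (a i k) z *\<^sub>R F k (\<psi> z) + 
      (\<Sum>b\<in>UNIV. (a i k z * ?J z $ b $ i) *\<^sub>R partial_deriv b (F k) (\<psi> z))) =
      (\<Sum>k\<in>UNIV. (\<Sum>i\<in>UNIV. partial_deriv i (a i k) z) *\<^sub>R F k (\<psi> z) + 
      (\<Sum>b\<in>UNIV. (\<Sum>i\<in>UNIV. a i k z * ?J z $ b $ i) *\<^sub>R partial_deriv b (F k) (\<psi> z)))"
  proof (subst sum.swap, rule sum.cong[OF refl])
    fix k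
    have "(\<Sum>i\<in>UNIV. \<Sum>b\<in>UNIV. (a i k z * ?J z $ b $ i) *\<^sub>R partial_deriv b (F k) (\<psi> z)) = 
      (\<Sum>b\<in>UNIV. \<Sum>i\<in>UNIV. (a i k z * ?J z $ b $ i) *\<^sub>R partial_deriv b (F k) (\<psi> z))" by (rule sum.swap)
    thus "(\<Sum>i\<in>UNIV. partial_deriv i (a i k) z *\<^sub>R F k (\<psi> z) + 
      (\<Sum>b\<in>UNIV. (a i k z * ?J z $ b $ i) *\<^sub>R partial_deriv b (F k) (\<psi> z))) = 
      (\<Sum>i\<in>UNIV. partial_deriv i (a i k) z) *\<^sub>R F k (\<psi> z) + 
      (\<Sum>b\<in>UNIV. (\<Sum>i\<in>UNIV. a i k z * ?J z $ b $ i) *\<^sub>R partial_deriv b (F k) (\<psi> z))"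
      by (simp add: sum.distrib scaleR_sum_left)
  qed
  \<comment> \<open>Piola's identity \<open>a0\<close> removes the terms in which the derivative
    falls on a, and \<open>aJ\<close> contracts a with the Jacobian to det J times the
    identity.\<close>
  also have "\<dots> = det (?J z) *\<^sub>R (\<Sum>k\<in>UNIV. partial_deriv k (F k) (\<psi> z))"
  proof -
    have "(\<Sum>b\<in>UNIV. (det (?J z) * (if b = k then 1 else 0)) *\<^sub>R partial_deriv b (F k) (\<psi> z)) = 
      (\<Sum>b\<in>UNIV. if b = k then det (?J z) *\<^sub>R partial_deriv b (F k) (\<psi> z) else 0)" for k
      by (rule sum.cong) auto
    thus ?thesis unfolding aJ a0 by (simp add: scaleR_sum_right)
  qed
  finally have div: "(\<Sum>i\<in>UNIV. partial_deriv i (\<lambda>y. sqrt (det (G y)) *\<^sub>R coord_grad G u i y) z) = 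
    (\<sigma> * det (?J z)) *\<^sub>R (\<Sum>k\<in>UNIV. partial_deriv k (F k) (\<psi> z))" by simp
  have "\<sigma> * det (?J z) = \<bar>det (?J z)\<bar>" using \<sigma>[OF T(2)] by simp
  thus ?thesis
    unfolding coord_div_def div sqrtG[OF S(2)] using dz by (simp add: F_def[abs_def] r_def[abs_def])
qed

lemma coord_laplacian_cong:
  assumes S: "open S" "z \<in> S" and "\<And>y. y \<in> S \<Longrightarrow> G y = G' y" "\<And>y. y \<in> S \<Longrightarrow> u y = u' y"
  shows "coord_div G (coord_grad G u) z = coord_div G' (coord_grad G' u') z"
proof -
  have "coord_grad G u i y = coord_grad G' u' i y" if "y \<in> S" for i y
    unfolding coord_grad_def using assms(3)[OF that] partial_deriv_cong_open[OF S(1) that assms(4)] by simp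
  hence "partial_deriv i (\<lambda>z. sqrt (det (G z)) *\<^sub>R coord_grad G u i z) z = 
    partial_deriv i (\<lambda>z. sqrt (det (G' z)) *\<^sub>R coord_grad G' u' i z) z" for i
    by (intro partial_deriv_cong_open[OF S]) (simp add: assms(3))
  thus ?thesis unfolding coord_div_def using assms(3)[OF S(2)] by simp
qed

text \<open>The factor c will be the reciprocal of the order of a deck group.\<close>

lemma coord_laplacian_sum:
  fixes u :: "'i \<Rightarrow> real ^ 'n::finite \<Rightarrow> complex"
  assumes S: "open S" "z \<in> S" and I: "finite I" and u: "\<And>k. k \<in> I \<Longrightarrow> C_k_on 2 S (u k)"
    and G: "\<And>x. x \<in> S \<Longrightarrow> det (G x) > 0"
    and dG: "\<And>x a b. x \<in> S \<Longrightarrow> (\<lambda>x. G x $ a $ b) differentiable (at x)"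
  shows "coord_div G (coord_grad G (\<lambda>x. c * (\<Sum>k\<in>I. u k x))) z = c * (\<Sum>k\<in>I. coord_div G (coord_grad G (u k)) z)"
proof -
  have ud: "u k differentiable (at x)" "partial_deriv b (u k) differentiable (at x)" if "x \<in> S" "k \<in> I" for x k b
    using u[OF that(2)] that by (auto simp: numeral_2_eq_2)
  have cm: "bounded_linear (\<lambda>x. c * x)" by (rule bounded_linear_mult_right)
  have grad: "coord_grad G (\<lambda>x. c * (\<Sum>k\<in>I. u k x)) i x = c * (\<Sum>k\<in>I. coord_grad G (u k) i x)" if x: "x \<in> S" for i x
  proof -
    have "partial_deriv j (\<lambda>x. c * (\<Sum>k\<in>I. u k x)) x = c * (\<Sum>k\<in>I. partial_deriv j (u k) x)" for j
      using partial_deriv_bounded_linear[OF cm, of "\<lambda>x. \<Sum>k\<in>I. u k x"] ud x I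
      by (simp add: partial_deriv_sum)
    hence "coord_grad G (\<lambda>x. c * (\<Sum>k\<in>I. u k x)) i x = 
       (\<Sum>j\<in>UNIV. \<Sum>k\<in>I. c * (matrix_inv (G x) $ i $ j) *\<^sub>R partial_deriv j (u k) x)"
      by (simp add: coord_grad_def sum_distrib_left scaleR_sum_right)
    also have "\<dots> = (\<Sum>k\<in>I. \<Sum>j\<in>UNIV. c * (matrix_inv (G x) $ i $ j) *\<^sub>R partial_deriv j (u k) x)" by (rule sum.swap)
    finally show ?thesis by (simp add: coord_grad_def sum_distrib_left)
  qed
  have flux: "(\<lambda>x. sqrt (det (G x)) *\<^sub>R coord_grad G (u k) i x) differentiable (at z)" if k: "k \<in> I" for k i
  proof -
    have "(\<lambda>x. sqrt (det (G x))) differentiable (at z)"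
    proof -
      have "sqrt differentiable (at (det (G z)))"
        using DERIV_real_sqrt[OF G[OF S(2)]] by (auto simp: differentiable_def has_field_derivative_def)
      from differentiable_chain_at[OF differentiable_det[OF dG[OF S(2)]] this] show ?thesis by (simp add: comp_def)
    qed
    moreover have "coord_grad G (u k) i differentiable (at z)"
      unfolding coord_grad_def
      by (intro differentiable_sum ballI differentiable_scaleR ud[OF S(2) k] finite
          differentiable_matrix_inv[OF dG[OF S(2)] S]) (use G in fastforce)
    ultimately show ?thesis by (rule differentiable_scaleR)
  qed
  have "partial_deriv i (\<lambda>x. sqrt (det (G x)) *\<^sub>R coord_grad G (\<lambda>x. c * (\<Sum>k\<in>I. u k x)) i x) z =
     c * (\<Sum>k\<in>I. partial_deriv i (\<lambda>x. sqrt (det (G x)) *\<^sub>R coord_grad G (u k) i x) z)" for i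
  proof -
    have "partial_deriv i (\<lambda>x. sqrt (det (G x)) *\<^sub>R coord_grad G (\<lambda>x. c * (\<Sum>k\<in>I. u k x)) i x) z =
      partial_deriv i (\<lambda>x. c * (\<Sum>k\<in>I. sqrt (det (G x)) *\<^sub>R coord_grad G (u k) i x)) z"
    proof (rule partial_deriv_cong_open[OF S])
      fix x assume "x \<in> S"
      show "sqrt (det (G x)) *\<^sub>R coord_grad G (\<lambda>x. c * (\<Sum>k\<in>I. u k x)) i x = 
          c * (\<Sum>k\<in>I. sqrt (det (G x)) *\<^sub>R coord_grad G (u k) i x)"
        unfolding grad[OF \<open>x \<in> S\<close>] by (simp add: scaleR_sum_right sum_distrib_left)
    qed
    also have "\<dots> = c * partial_deriv i (\<lambda>x. \<Sum>k\<in>I. sqrt (det (G x)) *\<^sub>R coord_grad G (u k) i x) z"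
      by (rule partial_deriv_bounded_linear[OF cm]) (intro differentiable_sum I ballI flux)
    also have "partial_deriv i (\<lambda>x. \<Sum>k\<in>I. sqrt (det (G x)) *\<^sub>R coord_grad G (u k) i x) z =
       (\<Sum>k\<in>I. partial_deriv i (\<lambda>x. sqrt (det (G x)) *\<^sub>R coord_grad G (u k) i x) z)"
      by (rule partial_deriv_sum[OF I flux])
    finally show ?thesis .
  qed
  hence "coord_div G (coord_grad G (\<lambda>x. c * (\<Sum>k\<in>I. u k x))) z = 
     (\<Sum>i\<in>UNIV. \<Sum>k\<in>I. c * (1 / sqrt (det (G z))) *\<^sub>R partial_deriv i (\<lambda>x. sqrt (det (G x)) *\<^sub>R coord_grad G (u k) i x) z)"
    by (simp add: coord_div_def sum_distrib_left scaleR_sum_right)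
  also have "\<dots> = (\<Sum>k\<in>I. \<Sum>i\<in>UNIV. c * (1 / sqrt (det (G z))) *\<^sub>R partial_deriv i (\<lambda>x. sqrt (det (G x)) *\<^sub>R coord_grad G (u k) i x) z)"
    by (rule sum.swap)
  finally show ?thesis by (simp add: coord_div_def sum_distrib_left scaleR_sum_right)
qed

text \<open>The segment from the identity matrix to A consists of positive definite, hence
  invertible matrices, so the determinant cannot change sign along it.\<close>

lemma det_pos_if_positive_definite:
  fixes A :: "real ^ 'n::finite ^ 'n"
  assumes "\<And>v. v \<noteq> 0 \<Longrightarrow> v \<bullet> (A *v v) > 0"
  shows "det A > 0"
proof (rule ccontr)
  assume neg: "\<not> det A > 0"
  define B where "B t = t *\<^sub>R A + (1 - t) *\<^sub>R mat 1" for t :: real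
  have cont: "continuous_on {0..1} (\<lambda>t. det (B t))"
    unfolding det_def B_def by (intro continuous_intros continuous_on_prod) 
  have "\<exists>t\<ge>0. t \<le> 1 \<and> det (B t) = 0"
    by (rule IVT2'[of "\<lambda>t. det (B t)"]) (use neg cont in \<open>auto simp: B_def\<close>)
  then obtain t where t: "0 \<le> t" "t \<le> 1" "det (B t) = 0" by blast
  have "B t *v v \<noteq> 0" if v: "v \<noteq> 0" for v
  proof -
    have "v \<bullet> (B t *v v) = t * (v \<bullet> (A *v v)) + (1 - t) * (v \<bullet> v)"
      by (simp add: B_def matrix_vector_mult_add_rdistrib inner_add_right scaleR_matrix_vector_assoc[symmetric])
    also have "\<dots> > 0"
    proof (cases "t = 0")
      case True thus ?thesis using v by simp
    next
      case False
      hence "t * (v \<bullet> (A *v v)) > 0" using t assms[OF v] by simp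
      thus ?thesis using t by (simp add: add_pos_nonneg)
    qed
    finally show ?thesis by auto
  qed
  then obtain C where "C ** B t = mat 1" using matrix_left_invertible_ker[of "B t"] by blast
  hence "det C * det (B t) = 1" using det_mul[of C "B t"] by simp
  thus False using t by simp
qed

section \<open>Lifting along coverings\<close>

lemma sheet_section:
  assumes h: "homeomorphic_map (subtopology Y W) (subtopology X U) p" and W: "openin Y W" and U: "openin X U"
  shows "inj_on p W" "p ` W = U" "continuous_map (subtopology X U) (subtopology Y W) (inv_into W p)"
proof -
  have tW: "topspace (subtopology Y W) = W" and tU: "topspace (subtopology X U) = U"
    using openin_subset[OF W] openin_subset[OF U] by auto
  obtain g where g: "homeomorphic_maps (subtopology Y W) (subtopology X U) p g"
    using h homeomorphic_map_maps by blast
  show inj: "inj_on p W" using h tW unfolding homeomorphic_map_def by simp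
  show im: "p ` W = U" using homeomorphic_imp_surjective_map[OF h] by (simp only: tW tU)
  have "continuous_map (subtopology X U) (subtopology Y W) g" using g by (simp add: homeomorphic_maps_def)
  moreover have "inv_into W p x = g x" if xU: "x \<in> U" for x
  proof -
    obtain y where y: "y \<in> W" "x = p y" using im xU by blast
    have "y \<in> topspace (subtopology Y W)" using y(1) by (simp only: tW)
    hence "g (p y) = y" using g unfolding homeomorphic_maps_def by blast
    thus ?thesis using inv_into_f_f[OF inj y(1)] y(2) by simp
  qed
  ultimately show "continuous_map (subtopology X U) (subtopology Y W) (inv_into W p)"
    using continuous_map_eq[of "subtopology X U" "subtopology Y W" g "inv_into W p"] by (simp add: tU)
qed

text \<open>A sheet through each given point is the form in which the lifting arguments use even
  covering.\<close>

definition evenly_covered :: "'a topology \<Rightarrow> 'b topology \<Rightarrow> ('a \<Rightarrow> 'b) \<Rightarrow> 'b set \<Rightarrow> bool" where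
  "evenly_covered Y X p U \<longleftrightarrow> openin X U \<and> (\<forall>y\<in>topspace Y. p y \<in> U \<longrightarrow>
     (\<exists>W. y \<in> W \<and> openin Y W \<and> homeomorphic_map (subtopology Y W) (subtopology X U) p))"

definition top_covering :: "'a topology \<Rightarrow> 'b topology \<Rightarrow> ('a \<Rightarrow> 'b) \<Rightarrow> bool" where
  "top_covering Y X p \<longleftrightarrow> continuous_map Y X p \<and> p ` topspace Y = topspace X \<and>
     (\<forall>x\<in>topspace X. \<exists>U. x \<in> U \<and> evenly_covered Y X p U)"

lemma top_covering_locally_injective:
  assumes "top_covering Y X p" "y \<in> topspace Y"
  shows "\<exists>W. openin Y W \<and> y \<in> W \<and> inj_on p W"
proof -
  have "p y \<in> topspace X" using assms by (auto simp: top_covering_def)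
  then obtain U W where "openin X U" "openin Y W" "y \<in> W" "homeomorphic_map (subtopology Y W) (subtopology X U) p"
    using assms unfolding top_covering_def evenly_covered_def by meson
  thus ?thesis using sheet_section(1) by blast
qed

text \<open>The set where the lifts agree is closed because Y is Hausdorff, and open because p is
  locally injective.\<close>

lemma lift_unique:
  assumes Z: "connected_space Z" and F: "continuous_map Z Y F" and G: "continuous_map Z Y G"
    and Y: "Hausdorff_space Y" and inj: "\<And>y. y \<in> topspace Y \<Longrightarrow> \<exists>W. openin Y W \<and> y \<in> W \<and> inj_on p W"
    and eq: "\<And>z. z \<in> topspace Z \<Longrightarrow> p (F z) = p (G z)"
    and z0: "z0 \<in> topspace Z" "F z0 = G z0" and z: "z \<in> topspace Z"
  shows "F z = G z"
proof -
  define E where "E = {z \<in> topspace Z. F z = G z}"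
  have "closedin Z E" unfolding E_def by (rule closedin_continuous_maps_eq[OF Y F G])
  moreover have "openin Z E"
  proof (subst openin_subopen, intro ballI)
    fix z assume z: "z \<in> E"
    hence "F z \<in> topspace Y" using continuous_map_image_subset_topspace[OF F] by (auto simp only: E_def)
    then obtain W where W: "openin Y W" "F z \<in> W" "inj_on p W" using inj by blast
    let ?T = "{z \<in> topspace Z. F z \<in> W} \<inter> {z \<in> topspace Z. G z \<in> W}"
    have "openin Z ?T" by (intro openin_Int openin_continuous_map_preimage[OF F W(1)] openin_continuous_map_preimage[OF G W(1)])
    moreover have "z \<in> ?T" using z W unfolding E_def by simp
    moreover have "?T \<subseteq> E" using W(3) eq by (auto simp: E_def dest: inj_onD)
    ultimately show "\<exists>T. openin Z T \<and> z \<in> T \<and> T \<subseteq> E" by blast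
  qed
  ultimately have "E = {} \<or> E = topspace Z" using Z by (simp add: connected_space_clopen_in)
  thus ?thesis using z0 z by (auto simp: E_def)
qed

context
  fixes Y :: "'a topology" and X :: "'b topology" and p :: "'a \<Rightarrow> 'b"
    and \<beta> :: "'c::euclidean_space \<Rightarrow> 'b" and c :: 'c and r :: real and y0 :: 'a
  assumes cov: "top_covering Y X p" and haus: "Hausdorff_space Y"
    and \<beta>: "continuous_map (top_of_set (ball c r)) X \<beta>" and r: "r > 0"
    and y0: "y0 \<in> topspace Y" "p y0 = \<beta> c"
begin

text \<open>Convexity of the domains and the common point c make intersections of two domains
  connected and nonempty, so partial lifts agree wherever both are defined.\<close>

definition "ball_lift C s \<longleftrightarrow> open C \<and> convex C \<and> c \<in> C \<and> C \<subseteq> ball c r \<and>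
  continuous_map (top_of_set C) Y s \<and> s c = y0 \<and> (\<forall>x\<in>C. p (s x) = \<beta> x)"

lemma ball_lift_unique:
  assumes "continuous_map (top_of_set C) Y s" "continuous_map (top_of_set C') Y s'"
    and "connected (C \<inter> C')" "z \<in> C \<inter> C'" "s z = s' z" and "\<And>x. x \<in> C \<inter> C' \<Longrightarrow> p (s x) = p (s' x)" and x: "x \<in> C \<inter> C'"
  shows "s x = s' x"
proof (rule lift_unique[of "top_of_set (C \<inter> C')" Y s s' p z x])
  show "connected_space (top_of_set (C \<inter> C'))"
    using assms(3) connectedin_iff_connected[of "C \<inter> C'"] by (simp add: connectedin_def del: connectedin_iff_connected)
  show "continuous_map (top_of_set (C \<inter> C')) Y s" "continuous_map (top_of_set (C \<inter> C')) Y s'"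
    using assms(1,2) by (auto intro: continuous_map_from_subtopology_mono)
qed (use assms haus top_covering_locally_injective[OF cov] in auto)

lemma covering_local_section:
  assumes D: "D \<subseteq> ball c r" and U: "evenly_covered Y X p U" "\<beta> ` D \<subseteq> U" 
    and y: "y \<in> topspace Y" "a \<in> D" "p y = \<beta> a"
  obtains s where "continuous_map (top_of_set D) Y s" "s a = y" "\<forall>x\<in>D. p (s x) = \<beta> x"
proof -
  have "p y \<in> U" using y U by auto
  then obtain W where W: "y \<in> W" "openin Y W" "homeomorphic_map (subtopology Y W) (subtopology X U) p"
    using U(1) y(1) by (auto simp: evenly_covered_def)
  have "openin X U" using U(1) by (simp add: evenly_covered_def)
  note sec = sheet_section[OF W(3,2) this]
  have \<beta>D: "continuous_map (top_of_set D) (subtopology X U) \<beta>"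
    using continuous_map_from_subtopology_mono[OF \<beta> D] U(2) by (auto simp: continuous_map_in_subtopology)
  have "continuous_map (top_of_set D) (subtopology Y W) (inv_into W p \<circ> \<beta>)"
    by (rule continuous_map_compose[OF \<beta>D sec(3)])
  hence "continuous_map (top_of_set D) Y (inv_into W p \<circ> \<beta>)" by (rule continuous_map_into_fulltopology)
  moreover have "(inv_into W p \<circ> \<beta>) a = y" using sec(1) W(1) y(3) by (metis comp_apply inv_into_f_f)
  moreover have "\<forall>x\<in>D. p ((inv_into W p \<circ> \<beta>) x) = \<beta> x"
  proof
    fix x assume "x \<in> D"
    hence "\<beta> x \<in> p ` W" using U(2) sec(2) by blast
    thus "p ((inv_into W p \<circ> \<beta>) x) = \<beta> x" by (simp add: f_inv_into_f)
  qed
  ultimately show ?thesis by (rule that)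
qed

lemma evenly_covered_ball:
  assumes "a \<in> ball c r"
  obtains d U where "d > 0" "ball a d \<subseteq> ball c r" "evenly_covered Y X p U" "\<beta> ` ball a d \<subseteq> U" 
proof -
  have "\<beta> a \<in> topspace X" using \<beta> assms by (auto simp: continuous_map_def)
  then obtain U where U: "\<beta> a \<in> U" "evenly_covered Y X p U"
    using cov unfolding top_covering_def by meson
  hence "openin X U" by (simp add: evenly_covered_def)
  have "openin (top_of_set (ball c r)) {x \<in> topspace (top_of_set (ball c r)). \<beta> x \<in> U}"
    by (rule openin_continuous_map_preimage[OF \<beta> \<open>openin X U\<close>])
  hence "open {x \<in> ball c r. \<beta> x \<in> U}" by (simp add: openin_open_eq)
  then obtain d where "d > 0" "ball a d \<subseteq> {x \<in> ball c r. \<beta> x \<in> U}"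
    using assms U(1) open_contains_ball by (metis (no_types, lifting) mem_Collect_eq)
  thus ?thesis by (intro that[of d U] U(2)) auto
qed

text \<open>A lift on a neighbourhood of a segment is extended a bit beyond the end of the segment by a local section,
  and then restricted to a tube around the longer segment, which is again convex.\<close>

lemma ball_lift_extend:
  assumes C: "ball_lift C s" and a: "a \<in> C" "a \<in> D" and D: "open D" "convex D" "D \<subseteq> ball c r" 
    and b: "b \<in> D" "a \<in> closed_segment c b"
    and U: "evenly_covered Y X p U" "\<beta> ` D \<subseteq> U" 
  shows "\<exists>C' s'. ball_lift C' s' \<and> b \<in> C'"
proof -
  have Cf: "open C" "convex C" "c \<in> C" "C \<subseteq> ball c r" "continuous_map (top_of_set C) Y s" "s c = y0" 
    "\<And>x. x \<in> C \<Longrightarrow> p (s x) = \<beta> x" using C by (auto simp: ball_lift_def)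
  have say: "s a \<in> topspace Y" using Cf(5) a(1) by (auto simp: continuous_map_def)
  obtain s' where s': "continuous_map (top_of_set D) Y s'" "s' a = s a" "\<forall>x\<in>D. p (s' x) = \<beta> x"
    by (rule covering_local_section[OF D(3) U say a(2) Cf(7)[OF a(1)]])
  have agree: "s x = s' x" if "x \<in> C \<inter> D" for x
    by (rule ball_lift_unique[OF Cf(5) s'(1), of a])
      (use a s' that Cf(7) convex_Int[OF Cf(2) D(2)] convex_connected in auto)
  \<comment> \<open>The pasting lemma works with indexed families; the type \<open>bool\<close>
    indexes the two pieces.\<close>
  define f where "f i = (if i then s else s')" for i :: bool
  define T where "T i = (if i then C else D)" for i :: bool
  obtain g where g: "continuous_map (top_of_set (C \<union> D)) Y g" 
    "\<And>x i. i \<in> UNIV \<Longrightarrow> x \<in> topspace (top_of_set (C \<union> D)) \<inter> T i \<Longrightarrow> g x = f i x"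
  proof (rule pasting_lemma_exists[where X = "top_of_set (C \<union> D)" and I = UNIV and T = T and Y = Y and f = f])
    show "topspace (top_of_set (C \<union> D)) \<subseteq> (\<Union>i. T i)" by (auto simp: T_def split: if_splits)
    show "openin (top_of_set (C \<union> D)) (T i)" for i using Cf(1) D(1) by (auto simp: T_def openin_open_eq[OF open_Un[OF Cf(1) D(1)]])
    show "continuous_map (subtopology (top_of_set (C \<union> D)) (T i)) Y (f i)" for i
      using Cf(5) s' by (cases i) (auto simp: T_def f_def subtopology_subtopology Int_absorb1 Int_absorb2)
    show "f i x = f j x" if "x \<in> topspace (top_of_set (C \<union> D)) \<inter> T i \<inter> T j" for i j x
      using agree[of x] that by (auto simp: f_def T_def split: if_splits)
  qed auto
  have gC: "g x = s x" if "x \<in> C" for x using g(2)[of True x] that by (simp add: T_def f_def)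
  have gD: "g x = s' x" if "x \<in> D" for x using g(2)[of False x] that by (simp add: T_def f_def)
  have "closed_segment c a \<subseteq> C" by (rule closed_segment_subset[OF Cf(3) a(1) Cf(2)])
  moreover have "closed_segment a b \<subseteq> D" by (rule closed_segment_subset[OF a(2) b(1) D(2)])
  ultimately have K: "closed_segment c b \<subseteq> C \<union> D" using Un_closed_segment[OF b(2)] by blast
  \<comment> \<open>The segment is compact, so a whole tube around it stays in C \<union> D.\<close>
  obtain e where e: "e > 0" "(\<Union>x\<in>closed_segment c b. ball x e) \<subseteq> C \<union> D"
    by (rule compact_subset_open_imp_ball_epsilon_subset[OF compact_segment(1) _ K]) (use Cf(1) D(1) in auto)
  define C' where "C' = (\<Union>x\<in>closed_segment c b. ball x e)"
  \<comment> \<open>The union C \<union> D need not be convex, but the tube is: it is the Minkowski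
    sum of a segment and a ball.\<close>
  have C'_eq: "C' = (\<Union>x\<in>closed_segment c b. \<Union>y\<in>ball 0 e. {x + y})"
  proof -
    have "ball x e = (\<Union>y\<in>ball 0 e. {x + y})" for x :: 'c
    proof -
      have "w \<in> ball x e \<longleftrightarrow> (\<exists>y\<in>ball 0 e. w = x + y)" for w
      proof
        assume "w \<in> ball x e"
        hence "w - x \<in> ball 0 e" by (simp add: dist_norm norm_minus_commute)
        thus "\<exists>y\<in>ball 0 e. w = x + y" by (rule bexI[rotated]) simp
      qed (auto simp: dist_norm)
      thus ?thesis by blast
    qed
    note * = this
    show ?thesis unfolding C'_def by (rule SUP_cong[OF refl *])
  qed
  have conv: "convex C'" unfolding C'_eq by (rule convex_sums[OF convex_closed_segment convex_ball])
  have ends: "c \<in> C'" "b \<in> C'" 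
    using UN_I[of c "closed_segment c b" c "\<lambda>x. ball x e"] UN_I[of b "closed_segment c b" b "\<lambda>x. ball x e"] e(1)
    by (simp_all add: C'_def)
  have "ball_lift C' g"
    unfolding ball_lift_def
  proof (intro conjI conv ends ballI)
    show "open C'" by (simp add: C'_def open_UN)
    show "C' \<subseteq> ball c r" using e(2) Cf(4) D(3) by (auto simp: C'_def)
    show "continuous_map (top_of_set C') Y g"
      by (rule continuous_map_from_subtopology_mono[OF g(1)]) (use e(2) in \<open>simp add: C'_def\<close>)
    show "g c = y0" using gC[OF Cf(3)] Cf(6) by simp
    show "p (g x) = \<beta> x" if "x \<in> C'" for x
    proof -
      have "x \<in> C \<union> D" using that e(2) unfolding C'_def by blast
      thus ?thesis using gC[of x] gD[of x] Cf(7)[of x] s'(3) by auto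
    qed
  qed
  thus ?thesis using ends by blast
qed

text \<open>Continuity method on the segment from c to b: the supremum of the parameters that a lift
  reaches is itself passed by one more local section unless it is already the end.\<close>

lemma ball_lift_reaches:
  assumes b: "b \<in> ball c r"
  shows "\<exists>C s. ball_lift C s \<and> b \<in> C"
proof -
  define \<gamma> where "\<gamma> t = c + t *\<^sub>R (b - c)" for t
  have \<gamma>_ball: "\<gamma> t \<in> ball c r" if "0 \<le> t" "t \<le> 1" for t
  proof -
    have "norm (t *\<^sub>R (b - c)) \<le> 1 * norm (b - c)" unfolding norm_scaleR by (rule mult_right_mono) (use that in auto)
    thus ?thesis using b by (simp add: \<gamma>_def dist_norm norm_minus_commute)
  qed
  have seg: "\<gamma> t \<in> closed_segment c (\<gamma> t')" if "0 \<le> t" "t \<le> t'" for t t'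
  proof (cases "t' = 0")
    case True thus ?thesis using that by simp
  next
    case False
    define u where "u = t / t'"
    have "u * t' = t" using False by (simp add: u_def)
    hence "\<gamma> t = (1 - u) *\<^sub>R c + u *\<^sub>R \<gamma> t'" 
      by (simp add: \<gamma>_def scaleR_left_diff_distrib scaleR_add_right)
    moreover have "0 \<le> u" "u \<le> 1" using that False by (simp_all add: u_def)
    ultimately show ?thesis unfolding closed_segment_def by blast
  qed
  define T where "T = {t. 0 \<le> t \<and> t \<le> 1 \<and> (\<exists>C s. ball_lift C s \<and> \<gamma> t \<in> C)}"
  have T0: "0 \<in> T"
  proof -
    have "c \<in> ball c r" using r by simp
    then obtain d U where dU: "d > 0" "ball c d \<subseteq> ball c r" "evenly_covered Y X p U" "\<beta> ` ball c d \<subseteq> U" 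
      by (rule evenly_covered_ball)
    have cd: "c \<in> ball c d" using dU(1) by simp
    obtain s where "continuous_map (top_of_set (ball c d)) Y s" "s c = y0" "\<forall>x\<in>ball c d. p (s x) = \<beta> x"
      by (rule covering_local_section[OF dU(2,3,4) y0(1) cd y0(2)])
    hence "ball_lift (ball c d) s" using dU cd by (simp add: ball_lift_def)
    thus ?thesis using cd by (auto simp: T_def \<gamma>_def)
  qed
  have bdd: "bdd_above T" by (rule bdd_aboveI[of _ 1]) (auto simp: T_def)
  define t0 where "t0 = Sup T"
  have t0: "0 \<le> t0" "t0 \<le> 1"
  proof -
    show "0 \<le> t0" unfolding t0_def by (rule cSup_upper[OF T0 bdd])
    have "T \<noteq> {}" using T0 by blast
    thus "t0 \<le> 1" unfolding t0_def by (rule cSup_least) (simp add: T_def)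
  qed
  obtain d U where dU: "d > 0" "ball (\<gamma> t0) d \<subseteq> ball c r" "evenly_covered Y X p U" "\<beta> ` ball (\<gamma> t0) d \<subseteq> U" 
    by (rule evenly_covered_ball[OF \<gamma>_ball[OF t0]])
  \<comment> \<open>The curve \<gamma> has speed |b - c|; the added 1 covers the case b = c.\<close>
  define e where "e = d / (norm (b - c) + 1)"
  have e: "e > 0" using dU(1) by (simp add: e_def add_nonneg_pos)
  have near: "\<gamma> t \<in> ball (\<gamma> t0) d" if "\<bar>t - t0\<bar> < e" for t
  proof -
    have "dist (\<gamma> t0) (\<gamma> t) = \<bar>t - t0\<bar> * norm (b - c)"
    proof -
      have "\<gamma> t0 - \<gamma> t = (t0 - t) *\<^sub>R (b - c)" by (simp add: \<gamma>_def algebra_simps)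
      thus ?thesis by (simp add: dist_norm abs_minus_commute)
    qed
    also have "\<dots> \<le> \<bar>t - t0\<bar> * (norm (b - c) + 1)" by (simp add: mult_left_mono)
    also have "\<dots> < e * (norm (b - c) + 1)" 
      by (rule mult_strict_right_mono[OF that]) (simp add: add_nonneg_pos)
    also have "\<dots> = d" using add_nonneg_pos[OF norm_ge_zero[of "b - c"] zero_less_one] by (simp add: e_def)
    finally show ?thesis by simp
  qed
  obtain t where t: "t \<in> T" "t0 - e < t" 
    using less_cSupD[of T "t0 - e"] T0 e by (auto simp: t0_def)
  have "t \<le> t0" unfolding t0_def by (rule cSup_upper[OF t(1) bdd])
  \<comment> \<open>This parameter lies beyond the supremum unless it is cut off at 1. As it is
    reached, it cannot exceed the supremum, so it equals 1.\<close>
  define t' where "t' = min 1 (t0 + e / 2)"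
  have t': "t \<le> t'" "\<bar>t' - t0\<bar> < e" "0 \<le> t'" "t' \<le> 1" using t0 e \<open>t \<le> t0\<close> t(1) by (auto simp: t'_def T_def)
  obtain C s where C: "ball_lift C s" "\<gamma> t \<in> C" using t(1) by (auto simp: T_def)
  have 1: "\<gamma> t \<in> ball (\<gamma> t0) d" by (rule near) (use t \<open>t \<le> t0\<close> in auto)
  have 2: "\<gamma> t' \<in> ball (\<gamma> t0) d" by (rule near[OF t'(2)])
  have 3: "\<gamma> t \<in> closed_segment c (\<gamma> t')" by (rule seg) (use t(1) t'(1) in \<open>auto simp: T_def\<close>)
  have "\<exists>C' s'. ball_lift C' s' \<and> \<gamma> t' \<in> C'"
    by (rule ball_lift_extend[OF C 1 open_ball convex_ball dU(2) 2 3 dU(3,4)])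
  hence "t' \<in> T" using t' by (simp add: T_def)
  hence "t' \<le> t0" unfolding t0_def by (rule cSup_upper[OF _ bdd])
  hence "t' = 1" using e by (auto simp: t'_def min_def split: if_splits)
  with \<open>t' \<in> T\<close> show ?thesis by (simp add: T_def \<gamma>_def)
qed

text \<open>The lifts that reach the single points of the ball agree on overlaps, which are convex
  and contain c, and are pasted together.\<close>

lemma covering_ball_lift:
  obtains s where "continuous_map (top_of_set (ball c r)) Y s" "s c = y0" "\<forall>x\<in>ball c r. p (s x) = \<beta> x"
proof -
  obtain C s where Cs: "\<And>b. b \<in> ball c r \<Longrightarrow> ball_lift (C b) (s b)" "\<And>b. b \<in> ball c r \<Longrightarrow> b \<in> C b"
    using ball_lift_reaches by metis
  have Cf: "open (C b)" "convex (C b)" "c \<in> C b" "C b \<subseteq> ball c r" "continuous_map (top_of_set (C b)) Y (s b)" 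
    "s b c = y0" "\<And>x. x \<in> C b \<Longrightarrow> p (s b x) = \<beta> x" if "b \<in> ball c r" for b 
    using Cs(1)[OF that] by (auto simp: ball_lift_def)
  have agree: "s b x = s b' x" if bb: "b \<in> ball c r" "b' \<in> ball c r" and x: "x \<in> C b \<inter> C b'" for b b' x
    by (rule ball_lift_unique[OF Cf(5)[OF bb(1)] Cf(5)[OF bb(2)], of c])
      (use x Cf(3,6,7)[OF bb(1)] Cf(3,6,7)[OF bb(2)] convex_Int[OF Cf(2)[OF bb(1)] Cf(2)[OF bb(2)]] convex_connected in auto)
  obtain g where g: "continuous_map (top_of_set (ball c r)) Y g" 
    "\<And>x b. b \<in> ball c r \<Longrightarrow> x \<in> topspace (top_of_set (ball c r)) \<inter> C b \<Longrightarrow> g x = s b x"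
  proof (rule pasting_lemma_exists[where X = "top_of_set (ball c r)" and I = "ball c r" and T = C and Y = Y and f = s])
    show "topspace (top_of_set (ball c r)) \<subseteq> (\<Union>b\<in>ball c r. C b)" using Cs(2) by auto
    show "openin (top_of_set (ball c r)) (C b)" if "b \<in> ball c r" for b using Cf(1,4)[OF that] by (simp add: openin_open_eq)
    show "continuous_map (subtopology (top_of_set (ball c r)) (C b)) Y (s b)" if "b \<in> ball c r" for b
      using Cf(4,5)[OF that] by (simp add: subtopology_subtopology Int_absorb1)
    show "s b x = s b' x" if "b \<in> ball c r" "b' \<in> ball c r" "x \<in> topspace (top_of_set (ball c r)) \<inter> C b \<inter> C b'" for b b' x
      using agree[OF that(1,2)] that(3) by auto
  qed auto
  show ?thesis
  proof (rule that[OF g(1)])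
    show "g c = y0" using g(2)[of c c] Cf(3,6)[of c] r by auto
    show "\<forall>x\<in>ball c r. p (g x) = \<beta> x"
    proof
      fix x assume x: "x \<in> ball c r"
      show "p (g x) = \<beta> x" using g(2)[OF x] Cs(2)[OF x] Cf(7)[OF x] x by auto
    qed
  qed
qed

end

section \<open>Charts and coverings\<close>

lemma chart_inv_left: 
  assumes "smooth_manifold X A" "c \<in> A" "x \<in> fst c"
  shows "chart_inv c (snd c x) = x"
proof -
  have "homeomorphic_map (subtopology X (fst c)) (top_of_set (snd c ` fst c)) (snd c)" "openin X (fst c)"
    using assms by (auto simp: smooth_manifold_def)
  hence "inj_on (snd c) (fst c)"
    unfolding homeomorphic_map_def by (metis Int_absorb1 openin_subset topspace_subtopology)
  thus ?thesis unfolding chart_inv_def using assms(3) by simp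
qed

lemma chart_inv_right: "y \<in> snd c ` fst c \<Longrightarrow> snd c (chart_inv c y) = y"
  unfolding chart_inv_def by (rule f_inv_into_f)

lemma chart_inv_mem: "y \<in> snd c ` fst c \<Longrightarrow> chart_inv c y \<in> fst c"
  unfolding chart_inv_def by (rule inv_into_into)

lemma chart_open:
  assumes "smooth_manifold X A" "c \<in> A"
  shows "openin X (fst c)" "open (snd c ` fst c)" "fst c \<subseteq> topspace X"
  using assms openin_subset by (auto simp: smooth_manifold_def)

lemma chart_image_open:
  assumes M: "smooth_manifold X A" "c \<in> A" and V: "openin X V" "V \<subseteq> fst c"
  shows "open (snd c ` V)"
proof -
  have "homeomorphic_map (subtopology X (fst c)) (top_of_set (snd c ` fst c)) (snd c)" 
    using M by (auto simp: smooth_manifold_def)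
  moreover have "openin (subtopology X (fst c)) V" 
    using V chart_open(1)[OF M] openin_open_subtopology by blast
  ultimately have "openin (top_of_set (snd c ` fst c)) (snd c ` V)"
    using homeomorphic_imp_open_map open_map_def by blast
  thus ?thesis using openin_open_eq[OF chart_open(2)[OF M]] by blast
qed

lemma continuous_chart:
  assumes M: "smooth_manifold X A" "c \<in> A"
  shows "continuous_map (subtopology X (fst c)) euclidean (snd c)"
    "continuous_map (top_of_set (snd c ` fst c)) X (chart_inv c)"
proof -
  have h: "homeomorphic_map (subtopology X (fst c)) (top_of_set (snd c ` fst c)) (snd c)" 
    using M by (auto simp: smooth_manifold_def)
  thus "continuous_map (subtopology X (fst c)) euclidean (snd c)"
    using continuous_map_into_fulltopology homeomorphic_imp_continuous_map by blast
  obtain g where g: "homeomorphic_maps (subtopology X (fst c)) (top_of_set (snd c ` fst c)) (snd c) g"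
    using h homeomorphic_map_maps by blast
  have gi: "chart_inv c y = g y" if y: "y \<in> snd c ` fst c" for y
  proof -
    obtain x where x: "x \<in> fst c" "y = snd c x" using y by blast
    moreover have "x \<in> topspace (subtopology X (fst c))" using x chart_open(3)[OF M] by auto
    ultimately show ?thesis using g chart_inv_left[OF M x(1)] unfolding homeomorphic_maps_def by metis
  qed
  have "continuous_map (top_of_set (snd c ` fst c)) (subtopology X (fst c)) g" using g by (simp add: homeomorphic_maps_def)
  hence "continuous_map (top_of_set (snd c ` fst c)) X g" by (rule continuous_map_into_fulltopology)
  thus "continuous_map (top_of_set (snd c ` fst c)) X (chart_inv c)"
    using continuous_map_eq[of "top_of_set (snd c ` fst c)" X g "chart_inv c"] gi by simp
qed

lemma chart_exists: "smooth_manifold X A \<Longrightarrow> x \<in> topspace X \<Longrightarrow> \<exists>c\<in>A. x \<in> fst c"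
  unfolding smooth_manifold_def by blast

lemma smooth_transition:
  "smooth_manifold X A \<Longrightarrow> c \<in> A \<Longrightarrow> d \<in> A \<Longrightarrow> smooth_on (snd c ` (fst c \<inter> fst d)) (snd d \<circ> chart_inv c)"
  unfolding smooth_manifold_def by blast

text \<open>Provides the case i = j for the maps of the tower, so that later statements can assume i
  \<le> j. The whole space serves as the only sheet.\<close>

lemma smooth_covering_id:
  assumes M: "smooth_manifold X A"
  shows "smooth_covering X A X A id"
proof -
  let ?T = "topspace X"
  have 1: "smooth_map_on A A ?T id"
    unfolding smooth_map_on_def
  proof (intro ballI)
    fix c d assume cd: "c \<in> A" "d \<in> A"
    have "?T \<inter> fst c \<inter> id -` fst d = fst c \<inter> fst d" using chart_open(3)[OF M cd(1)] by auto
    thus "smooth_on (snd c ` (?T \<inter> fst c \<inter> id -` fst d)) (snd d \<circ> id \<circ> chart_inv c)"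
      using smooth_transition[OF M cd] by simp
  qed
  have 2: "smooth_map_on A A ?T (inv_into ?T id)"
    unfolding smooth_map_on_def
  proof (intro ballI)
    fix c d assume cd: "c \<in> A" "d \<in> A"
    have inv: "inv_into ?T id x = x" if "x \<in> ?T" for x using inv_into_f_f[of id ?T x] that by simp
    have *: "?T \<inter> fst c \<inter> inv_into ?T id -` fst d = fst c \<inter> fst d" using chart_open(3)[OF M cd(1)] inv by auto
    have op: "open (snd c ` (fst c \<inter> fst d))"
      by (rule chart_image_open[OF M cd(1)]) (use chart_open[OF M cd(1)] chart_open[OF M cd(2)] in auto)
    have "(snd d \<circ> chart_inv c) y = (snd d \<circ> inv_into ?T id \<circ> chart_inv c) y" if "y \<in> snd c ` (fst c \<inter> fst d)" for y
    proof -
      have "chart_inv c y \<in> ?T" using chart_inv_mem[of y c] chart_open(3)[OF M cd(1)] that by auto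
      thus ?thesis by (simp add: inv)
    qed
    thus "smooth_on (snd c ` (?T \<inter> fst c \<inter> inv_into ?T id -` fst d)) (snd d \<circ> inv_into ?T id \<circ> chart_inv c)"
      unfolding * using smooth_on_cong[OF op, of "snd d \<circ> chart_inv c"] smooth_transition[OF M cd] by blast
  qed
  have "diffeomorphism_between X A ?T X A ?T id"
    using 1 2 by (simp add: diffeomorphism_between_def)
  moreover have "\<Union>{?T} = ?T \<inter> id -` ?T" "pairwise disjnt {?T}" "openin X ?T" by auto
  ultimately have "\<exists>U. x \<in> U \<and> openin X U \<and> (\<exists>\<W>. \<Union>\<W> = ?T \<inter> id -` U \<and> pairwise disjnt \<W> \<and>
           (\<forall>W\<in>\<W>. openin X W \<and> diffeomorphism_between X A W X A U id))" if "x \<in> ?T" for x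
    using that by (intro exI[of _ ?T] conjI exI[of _ "{?T}"]) auto
  thus ?thesis by (simp add: smooth_covering_def)
qed

lemma smooth_covering_top_covering:
  assumes "smooth_covering Y B X A p"
  shows "top_covering Y X p"
  unfolding top_covering_def
proof (intro conjI ballI)
  fix x assume "x \<in> topspace X"
  then obtain U \<W> where U: "x \<in> U" "openin X U" "\<Union>\<W> = topspace Y \<inter> p -` U" 
    "\<And>W. W \<in> \<W> \<Longrightarrow> openin Y W \<and> diffeomorphism_between Y B W X A U p"
    using assms unfolding smooth_covering_def by meson
  have "\<exists>W. y \<in> W \<and> openin Y W \<and> homeomorphic_map (subtopology Y W) (subtopology X U) p" 
    if "y \<in> topspace Y" "p y \<in> U" for y
  proof -
    have "y \<in> \<Union>\<W>" using U(3) that by auto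
    then obtain W where "W \<in> \<W>" "y \<in> W" by blast
    thus ?thesis using U(4)[of W] by (auto simp: diffeomorphism_between_def)
  qed
  hence "evenly_covered Y X p U" using U(2) by (simp add: evenly_covered_def)
  thus "\<exists>U. x \<in> U \<and> evenly_covered Y X p U" using U(1) by blast
qed (use assms in \<open>auto simp: smooth_covering_def\<close>)

section \<open>Towers of coverings\<close>

lemma tower_map_refl [simp]: "tower_map P i i = id"
  by (cases i) auto

lemma tower_map_step: "tower_map P (Suc i) i = P i"
  by simp

lemma tower_map_comp: "i \<le> j \<Longrightarrow> j \<le> k \<Longrightarrow> tower_map P k i = tower_map P j i \<circ> tower_map P k j"
proof (induction k)
  case (Suc k)
  show ?case
  proof (cases "j \<le> k")
    case True
    thus ?thesis using Suc by (simp add: comp_assoc)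
  next
    case False
    hence "j = Suc k" using Suc by simp
    thus ?thesis by simp
  qed
qed simp

declare tower_map.simps(2) [simp del]

locale covering_tower =
  fixes X :: "nat \<Rightarrow> 'a topology" and A :: "nat \<Rightarrow> ('a, 'n::finite) chart set" and P :: "nat \<Rightarrow> 'a \<Rightarrow> 'a"
  assumes manifold: "\<And>i. smooth_manifold (X i) (A i)"
    and connected: "\<And>i. connected_space (X i)"
    and nonempty: "\<And>i. topspace (X i) \<noteq> {}"
    and regular: "\<And>i j. i < j \<Longrightarrow> regular_finite_covering (X j) (A j) (X i) (A i) (tower_map P j i)"
begin

abbreviation "proj j i \<equiv> tower_map P j i"
abbreviation "deck j i \<equiv> deck_group (X j) (proj j i)"
abbreviation "S \<equiv> solenoid X P"

lemma hausdorff: "Hausdorff_space (X i)"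
  using manifold[of i] by (simp add: smooth_manifold_def)

lemma smooth_covering_proj: "i \<le> j \<Longrightarrow> smooth_covering (X j) (A j) (X i) (A i) (proj j i)"
  using regular[of i j] smooth_covering_id[OF manifold[of i]] 
  by (cases "i = j") (auto simp: regular_finite_covering_def)

lemma top_covering_proj: "i \<le> j \<Longrightarrow> top_covering (X j) (X i) (proj j i)"
  by (rule smooth_covering_top_covering[OF smooth_covering_proj])

lemma continuous_proj: "i \<le> j \<Longrightarrow> continuous_map (X j) (X i) (proj j i)"
  using top_covering_proj by (simp add: top_covering_def)

lemma proj_mem: "i \<le> j \<Longrightarrow> y \<in> topspace (X j) \<Longrightarrow> proj j i y \<in> topspace (X i)"
  using top_covering_proj[of i j] by (auto simp: top_covering_def)

lemma proj_surj: "i \<le> j \<Longrightarrow> x \<in> topspace (X i) \<Longrightarrow> \<exists>y\<in>topspace (X j). proj j i y = x"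
  using top_covering_proj[of i j] unfolding top_covering_def by (metis image_iff)

lemma finite_fiber: "i \<le> j \<Longrightarrow> x \<in> topspace (X i) \<Longrightarrow> finite {y \<in> topspace (X j). proj j i y = x}"
  using regular[of i j] by (cases "i = j") (auto simp: regular_finite_covering_def)

section \<open>Deck groups and their action on fibres\<close>

lemma deck_mem: 
  assumes "h \<in> deck j i" 
  shows "homeomorphic_map (X j) (X j) h" "y \<in> topspace (X j) \<Longrightarrow> proj j i (h y) = proj j i y" 
    "h \<in> extensional (topspace (X j))" "continuous_map (X j) (X j) h" "y \<in> topspace (X j) \<Longrightarrow> h y \<in> topspace (X j)"
proof -
  show h: "homeomorphic_map (X j) (X j) h" "h \<in> extensional (topspace (X j))"
    and "y \<in> topspace (X j) \<Longrightarrow> proj j i (h y) = proj j i y" using assms by (auto simp: deck_group_def)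
  show "continuous_map (X j) (X j) h" by (rule homeomorphic_imp_continuous_map[OF h(1)])
  show "y \<in> topspace (X j) \<Longrightarrow> h y \<in> topspace (X j)" 
    using homeomorphic_imp_surjective_map[OF h(1)] by auto
qed

lemma deck_transitive:
  assumes "i \<le> j" "y \<in> topspace (X j)" "y' \<in> topspace (X j)" "proj j i y = proj j i y'"
  shows "\<exists>h\<in>deck j i. h y = y'"
proof (cases "i = j")
  case True
  hence yy: "y = y'" using assms by simp
  moreover have "homeomorphic_map (X j) (X j) (restrict id (topspace (X j)))"
    using homeomorphic_map_eq[of "X j" "X j" id "restrict id (topspace (X j))"] by simp
  hence "restrict id (topspace (X j)) \<in> deck j i" by (simp add: deck_group_def)
  ultimately show ?thesis using assms by (intro bexI[of _ "restrict id (topspace (X j))"]) auto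
next
  case False
  thus ?thesis using regular[of i j] assms by (simp add: regular_finite_covering_def)
qed

lemma lift_unique_proj:
  assumes "i \<le> j" "connected_space Z" "continuous_map Z (X j) F" "continuous_map Z (X j) G"
    and "\<And>z. z \<in> topspace Z \<Longrightarrow> proj j i (F z) = proj j i (G z)" 
    and "z0 \<in> topspace Z" "F z0 = G z0" "z \<in> topspace Z"
  shows "F z = G z"
  by (rule lift_unique[OF assms(2-4) hausdorff top_covering_locally_injective[OF top_covering_proj[OF assms(1)]] assms(5-8)])

text \<open>Both transformations lift the projection to level i, so agreement at one point spreads
  over the connected space.\<close>

lemma deck_free:
  assumes "i \<le> j" "h \<in> deck j i" "k \<in> deck j i" "y \<in> topspace (X j)" "h y = k y"
  shows "h = k"
proof (rule extensionalityI[OF deck_mem(3)[OF assms(2)] deck_mem(3)[OF assms(3)]])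
  fix z assume "z \<in> topspace (X j)"
  thus "h z = k z"
    by (intro lift_unique_proj[OF assms(1) connected deck_mem(4)[OF assms(2)] deck_mem(4)[OF assms(3)] _ assms(4,5)])
       (simp_all add: deck_mem(2)[OF assms(2)] deck_mem(2)[OF assms(3)])
qed

text \<open>Injective because the action is free, onto because the covering is regular. It turns
  counting points of a fibre into counting deck transformations.\<close>

lemma deck_bij_fiber:
  assumes "i \<le> j" "y \<in> topspace (X j)"
  shows "bij_betw (\<lambda>h. h y) (deck j i) {z \<in> topspace (X j). proj j i z = proj j i y}"
proof (rule bij_betwI')
  show "(h y = k y) = (h = k)" if "h \<in> deck j i" "k \<in> deck j i" for h k
    using deck_free[OF assms(1) that assms(2)] by auto
  show "h y \<in> {z \<in> topspace (X j). proj j i z = proj j i y}" if "h \<in> deck j i" for h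
    using deck_mem[OF that] assms by auto
  show "\<exists>h\<in>deck j i. z = h y" if "z \<in> {z \<in> topspace (X j). proj j i z = proj j i y}" for z
    using deck_transitive[OF assms, of z] that by auto
qed

lemma finite_deck: "i \<le> j \<Longrightarrow> finite (deck j i)" and deck_nonempty: "i \<le> j \<Longrightarrow> deck j i \<noteq> {}"
  and card_fiber: "i \<le> j \<Longrightarrow> x \<in> topspace (X i) \<Longrightarrow> card {z \<in> topspace (X j). proj j i z = x} = card (deck j i)"
proof -
  assume ij: "i \<le> j"
  obtain y where y: "y \<in> topspace (X j)" using nonempty by blast
  show "finite (deck j i)" 
    using bij_betw_finite[OF deck_bij_fiber[OF ij y]] finite_fiber[OF ij proj_mem[OF ij y]] by simp
  show "deck j i \<noteq> {}" using deck_transitive[OF ij y y] by auto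
  assume "x \<in> topspace (X i)"
  then obtain z where z: "z \<in> topspace (X j)" "proj j i z = x" using proj_surj[OF ij] by blast
  show "card {z \<in> topspace (X j). proj j i z = x} = card (deck j i)"
    using bij_betw_same_card[OF deck_bij_fiber[OF ij z(1)]] z(2) by simp
qed

section \<open>Points of the solenoid and the action of its structure group\<close>

lemma topspace_solenoid: 
  "topspace S = {x. (\<forall>i. x i \<in> topspace (X i)) \<and> (\<forall>i j. i \<le> j \<longrightarrow> proj j i (x j) = x i)}"
  by (auto simp: solenoid_def le_less)

lemma solenoid_mem: "x \<in> topspace S \<Longrightarrow> x i \<in> topspace (X i)"
  and solenoid_compat: "x \<in> topspace S \<Longrightarrow> i \<le> j \<Longrightarrow> proj j i (x j) = x i"
  by (auto simp: topspace_solenoid)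

lemma continuous_solenoid_proj: "continuous_map S (X i) (solenoid_proj i)"
  unfolding solenoid_def solenoid_proj_def
  by (intro continuous_map_from_subtopology) (use continuous_map_product_projection[of i UNIV X] in simp)

text \<open>Preimages are chosen successively above level i, and coordinates below it are obtained
  by projecting.\<close>

lemma solenoid_extend:
  assumes y: "y \<in> topspace (X i)"
  shows "\<exists>x\<in>topspace S. x i = y"
proof -
  have "\<exists>z. \<forall>n. (z n \<in> topspace (X (i + n)) \<and> (n = 0 \<longrightarrow> z n = y)) \<and> proj (i + Suc n) (i + n) (z (Suc n)) = z n"
  proof (rule dependent_nat_choice)
    show "\<exists>x. x \<in> topspace (X (i + 0)) \<and> (0 = 0 \<longrightarrow> x = y)" using y by auto
  next
    fix x n assume "x \<in> topspace (X (i + n)) \<and> (n = 0 \<longrightarrow> x = y)"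
    thus "\<exists>w. (w \<in> topspace (X (i + Suc n)) \<and> (Suc n = 0 \<longrightarrow> w = y)) \<and> proj (i + Suc n) (i + n) w = x"
      using proj_surj[of "i + n" "i + Suc n" x] by auto
  qed
  then obtain z where z: "\<And>n. z n \<in> topspace (X (i + n))" "z 0 = y" 
    "\<And>n. proj (i + Suc n) (i + n) (z (Suc n)) = z n" by blast
  have zm: "proj (i + m) (i + n) (z m) = z n" if "n \<le> m" for n m
    using that
  proof (induction m rule: dec_induct)
    case (step m)
    have "proj (i + Suc m) (i + n) (z (Suc m)) = proj (i + m) (i + n) (proj (i + Suc m) (i + m) (z (Suc m)))"
      by (subst tower_map_comp[of "i + n" "i + m"]) (use step in auto)
    thus ?case using z(3) step by simp
  qed simp
  \<comment> \<open>Level i + j lies above both i and j, so one formula covers the levels on either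
    side of i.\<close>
  define x where "x j = proj (i + j) j (z j)" for j
  have "x \<in> topspace S"
    unfolding topspace_solenoid
  proof (intro CollectI conjI allI impI)
    show "x j \<in> topspace (X j)" for j unfolding x_def by (rule proj_mem[OF _ z(1)]) simp
    fix k j :: nat assume kj: "k \<le> j"
    have "proj j k (x j) = proj (i + j) k (z j)"
      using tower_map_comp[of k j "i + j" P] kj by (simp add: x_def)
    also have "\<dots> = proj (i + k) k (proj (i + j) (i + k) (z j))"
      using tower_map_comp[of k "i + k" "i + j" P] kj by simp
    finally show "proj j k (x j) = x k" by (simp add: x_def zm[OF kj])
  qed
  moreover have "x i = y" using zm[of 0 i] z(2) by (simp add: x_def)
  ultimately show ?thesis by blast
qed

lemma topspace_solenoid_group: 
  "topspace (solenoid_group X P) = {h. (\<forall>i. h i \<in> deck i 0) \<and>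
     (\<forall>i j. i < j \<longrightarrow> (\<forall>y\<in>topspace (X j). proj j i (h j y) = h i (proj j i y)))}"
  by (auto simp: solenoid_group_def)

text \<open>At each level a deck transformation carries x j to x' j. These are compatible by
  uniqueness of lifts: both composites from level j to level i lift the projection to level 0, and
  they agree at x j.\<close>

lemma solenoid_group_transitive:
  assumes x: "x \<in> topspace S" and x': "x' \<in> topspace S" and eq: "x 0 = x' 0"
  shows "\<exists>h\<in>topspace (solenoid_group X P). \<forall>j. h j (x j) = x' j"
proof -
  have "\<exists>h\<in>deck j 0. h (x j) = x' j" for j
    by (rule deck_transitive) (use solenoid_mem[OF x] solenoid_mem[OF x'] solenoid_compat[OF x, of 0 j] solenoid_compat[OF x', of 0 j] eq in auto)
  then obtain h where h: "\<And>j. h j \<in> deck j 0" "\<And>j. h j (x j) = x' j" by metis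
  have "proj j i (h j y) = h i (proj j i y)" if ij: "i < j" and y: "y \<in> topspace (X j)" for i j y
  proof -
    have le: "i \<le> j" using ij by simp
    have "(proj j i \<circ> h j) y = (h i \<circ> proj j i) y"
    proof (rule lift_unique_proj[of 0 i "X j" _ _ "x j" y])
      show "continuous_map (X j) (X i) (proj j i \<circ> h j)" "continuous_map (X j) (X i) (h i \<circ> proj j i)"
        by (rule continuous_map_compose[OF deck_mem(4)[OF h(1)] continuous_proj[OF le]]
            continuous_map_compose[OF continuous_proj[OF le] deck_mem(4)[OF h(1)]])+
      fix z assume z: "z \<in> topspace (X j)"
      have "proj i 0 (proj j i (h j z)) = proj j 0 (h j z)" using tower_map_comp[of 0 i j P] le by simp
      also have "\<dots> = proj j 0 z" by (rule deck_mem(2)[OF h(1) z])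
      also have "\<dots> = proj i 0 (proj j i z)" using tower_map_comp[of 0 i j P] le by simp
      also have "\<dots> = proj i 0 (h i (proj j i z))" by (rule deck_mem(2)[OF h(1) proj_mem[OF le z], symmetric])
      finally show "proj i 0 ((proj j i \<circ> h j) z) = proj i 0 ((h i \<circ> proj j i) z)" by simp
    next
      show "(proj j i \<circ> h j) (x j) = (h i \<circ> proj j i) (x j)"
        using h(2) solenoid_compat[OF x le] solenoid_compat[OF x' le] by simp
    qed (use connected solenoid_mem[OF x] y in auto)
    thus ?thesis by simp
  qed
  hence "h \<in> topspace (solenoid_group X P)" using h(1) by (simp add: topspace_solenoid_group)
  thus ?thesis using h(2) by blast
qed

lemma solenoid_group_action:
  assumes h: "h \<in> topspace (solenoid_group X P)" and y: "y \<in> topspace S"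
  shows "(\<lambda>i. h i (y i)) \<in> topspace S" "h 0 (y 0) = y 0"
proof -
  have hd: "h i \<in> deck i 0" for i using h by (simp add: topspace_solenoid_group)
  have "proj j i (h j (y j)) = h i (y i)" if "i \<le> j" for i j
  proof (cases "i = j")
    case False
    hence "proj j i (h j (y j)) = h i (proj j i (y j))"
      using h that solenoid_mem[OF y] unfolding topspace_solenoid_group by (simp add: le_less)
    thus ?thesis using solenoid_compat[OF y that] by simp
  qed simp
  thus "(\<lambda>i. h i (y i)) \<in> topspace S"
    using deck_mem(5)[OF hd solenoid_mem[OF y]] by (simp add: topspace_solenoid)
  show "h 0 (y 0) = y 0" using deck_mem(2)[OF hd[of 0] solenoid_mem[OF y, of 0]] by simp
qed

section \<open>Haar measure and the projections of the solenoid\<close>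

context
  fixes H :: "(nat \<Rightarrow> 'a \<Rightarrow> 'a) measure"
  assumes haar: "normalized_haar_measure (solenoid_group X P) (solenoid_group_mult X) H"
begin

lemma sets_haar: "sets H = sigma_sets (topspace (solenoid_group X P)) {U. openin (solenoid_group X P) U}"
proof -
  have "{U. openin (solenoid_group X P) U} \<subseteq> Pow (topspace (solenoid_group X P))" using openin_subset by auto
  thus ?thesis using haar by (simp add: normalized_haar_measure_def borel_of_def)
qed

lemma cylinder_measurable: "{h \<in> topspace (solenoid_group X P). h i \<in> K} \<in> sets H"
proof -
  have "openin (solenoid_group X P) {h \<in> topspace (solenoid_group X P). h i \<in> K \<inter> deck i 0}"
  proof (rule openin_continuous_map_preimage)
    show "continuous_map (solenoid_group X P) (discrete_topology (deck i 0)) (\<lambda>h. h i)"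
      unfolding solenoid_group_def
      by (intro continuous_map_from_subtopology) 
        (use continuous_map_product_projection[of i UNIV "\<lambda>i. discrete_topology (deck i 0)"] in simp)
    show "openin (discrete_topology (deck i 0)) (K \<inter> deck i 0)" by simp
  qed
  moreover have "{h \<in> topspace (solenoid_group X P). h i \<in> K \<inter> deck i 0} = {h \<in> topspace (solenoid_group X P). h i \<in> K}"
    by (auto simp: topspace_solenoid_group)
  ultimately show ?thesis unfolding sets_haar by (auto intro: sigma_sets.Basic)
qed

text \<open>A group element whose i-th entry takes k to k' translates one cylinder into the other,
  and the Haar measure is invariant. An inclusion suffices, since the roles of k and k' can be
  exchanged.\<close>

lemma haar_cylinder_le:
  assumes k: "k \<in> deck i 0" "k' \<in> deck i 0"
  shows "emeasure H {h \<in> topspace (solenoid_group X P). h i = k} \<le> emeasure H {h \<in> topspace (solenoid_group X P). h i = k'}"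
proof -
  obtain y where y: "y \<in> topspace (X i)" using nonempty by blast
  \<comment> \<open>The translating element is found through the solenoid: it moves a point over k y
    to one over k' y, and freeness upgrades this to an equality of deck transformations.\<close>
  obtain z where z: "z \<in> topspace S" "z i = k y" using solenoid_extend[OF deck_mem(5)[OF k(1) y]] by blast
  obtain z' where z': "z' \<in> topspace S" "z' i = k' y" using solenoid_extend[OF deck_mem(5)[OF k(2) y]] by blast
  have "z 0 = z' 0"
    using solenoid_compat[OF z(1), of 0 i] solenoid_compat[OF z'(1), of 0 i] z(2) z'(2) deck_mem(2)[OF k(1) y] deck_mem(2)[OF k(2) y]
    by simp
  then obtain g where g: "g \<in> topspace (solenoid_group X P)" "\<And>j. g j (z j) = z' j" 
    using solenoid_group_transitive[OF z(1) z'(1)] by blast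
  have gd: "g j \<in> deck j 0" for j using g(1) by (simp add: topspace_solenoid_group)
  let ?C = "\<lambda>k. {h \<in> topspace (solenoid_group X P). h i = k}"
  have C: "?C k \<in> sets H" for k using cylinder_measurable[of i "{k}"] by simp
  have comp: "compose (topspace (X j)) a b \<in> deck j 0" if ab: "a \<in> deck j 0" "b \<in> deck j 0" for a b j
  proof -
    have "homeomorphic_map (X j) (X j) (compose (topspace (X j)) a b)"
      using homeomorphic_map_eq[OF homeomorphic_map_compose[OF deck_mem(1)[OF ab(2)] deck_mem(1)[OF ab(1)]], of "compose (topspace (X j)) a b"]
      by (simp add: compose_def)
    thus ?thesis using deck_mem(2,5)[OF ab(2)] deck_mem(2)[OF ab(1)] by (simp add: deck_group_def compose_def)
  qed
  have "solenoid_group_mult X g h \<in> ?C k'" if h: "h \<in> ?C k" for h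
  proof -
    have hG: "h \<in> topspace (solenoid_group X P)" and hi: "h i = k" using h by auto
    have hd: "h j \<in> deck j 0" for j using hG by (simp add: topspace_solenoid_group)
    have "proj m j (compose (topspace (X m)) (g m) (h m) y) = compose (topspace (X j)) (g j) (h j) (proj m j y)"
      if jm: "j < m" and y: "y \<in> topspace (X m)" for j m y
      using g(1) hG jm y deck_mem(5)[OF hd y] proj_mem[OF less_imp_le[OF jm] y]
      by (simp add: topspace_solenoid_group compose_def)
    hence "solenoid_group_mult X g h \<in> topspace (solenoid_group X P)"
      using comp[OF gd hd] by (simp add: topspace_solenoid_group solenoid_group_mult_def)
    moreover have "compose (topspace (X i)) (g i) (h i) = k'"
      by (rule deck_free[OF _ comp[OF gd hd] k(2) y]) (use g(2)[of i] y in \<open>simp_all add: compose_def hi z(2) z'(2)\<close>)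
    ultimately show ?thesis by (simp add: solenoid_group_mult_def)
  qed
  hence "solenoid_group_mult X g ` ?C k \<subseteq> ?C k'" by blast
  hence "emeasure H (solenoid_group_mult X g ` ?C k) \<le> emeasure H (?C k')"
    by (rule emeasure_mono) (rule C)
  thus ?thesis using haar g(1) C[of k] by (simp add: normalized_haar_measure_def)
qed

text \<open>The cylinders over the single elements of the finite deck group partition a group of
  mass 1 and have equal mass.\<close>

lemma haar_cylinder:
  assumes K: "K \<subseteq> deck i 0"
  shows "emeasure H {h \<in> topspace (solenoid_group X P). h i \<in> K} = ennreal (real (card K) / real (card (deck i 0)))"
proof -
  let ?C = "\<lambda>k. {h \<in> topspace (solenoid_group X P). h i = k}"
  have fin: "finite (deck i 0)" by (rule finite_deck) simp
  obtain k0 where k0: "k0 \<in> deck i 0" using deck_nonempty[of 0 i] by auto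
  define m where "m = emeasure H (?C k0)"
  have meas: "?C k \<in> sets H" for k using cylinder_measurable[of i "{k}"] by simp
  have Cm: "emeasure H (?C k) = m" if "k \<in> deck i 0" for k
    unfolding m_def by (rule antisym; rule haar_cylinder_le) (use that k0 in auto)
  have *: "emeasure H {h \<in> topspace (solenoid_group X P). h i \<in> L} = of_nat (card L) * m" if L: "L \<subseteq> deck i 0" for L
  proof -
    have "{h \<in> topspace (solenoid_group X P). h i \<in> L} = (\<Union>k\<in>L. ?C k)" by auto
    also have "emeasure H \<dots> = (\<Sum>k\<in>L. emeasure H (?C k))"
      by (rule sum_emeasure[symmetric]) (use meas finite_subset[OF L fin] in \<open>auto simp: disjoint_family_on_def\<close>)
    also have "\<dots> = (\<Sum>k\<in>L. m)" by (rule sum.cong) (use L Cm in auto)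
    finally show ?thesis by simp
  qed
  have "{h \<in> topspace (solenoid_group X P). h i \<in> deck i 0} = topspace (solenoid_group X P)" by (auto simp: topspace_solenoid_group)
  hence one: "of_nat (card (deck i 0)) * m = 1" using *[OF order.refl] haar by (simp add: normalized_haar_measure_def)
  have cpos: "card (deck i 0) > 0" using fin k0 by (auto simp: card_gt_0_iff)
  have "m = ennreal (1 / real (card (deck i 0)))"
  proof -
    have "m \<noteq> \<infinity>"
    proof
      assume "m = \<infinity>"
      thus False using one cpos by (simp add: ennreal_mult_eq_top_iff)
    qed
    then obtain r where r: "r \<ge> 0" "m = ennreal r" by (cases m) auto
    have "ennreal (real (card (deck i 0)) * r) = ennreal 1" 
      using one r by (simp add: ennreal_mult' ennreal_of_nat_eq_real_of_nat)
    hence "real (card (deck i 0)) * r = 1" using r(1) by (subst (asm) ennreal_inj) auto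
    thus ?thesis using r cpos by (simp add: field_simps)
  qed
  thus ?thesis using *[OF K] 
    by (simp add: ennreal_of_nat_eq_real_of_nat ennreal_mult'[symmetric])
qed

text \<open>Evaluation at the i-th coordinate of the base point y is a bijection from the deck group
  to the fibre, so the mass of a cylinder becomes the normalized number of points in the definition
  of the level measure.\<close>

lemma fiber_measure_cylinder:
  assumes x: "x \<in> topspace (X 0)"
  shows "fiber_measure X P H x ((solenoid_proj i -` B \<inter> topspace S) \<inter> {y \<in> topspace S. solenoid_proj 0 y = x}) =
    ennreal (real (card (B \<inter> {y \<in> topspace (X i). proj i 0 y = x})) / real (card (deck i 0)))"
proof -
  define y where "y = (SOME y. y \<in> topspace S \<and> solenoid_proj 0 y = x)"
  have "\<exists>y. y \<in> topspace S \<and> solenoid_proj 0 y = x" using solenoid_extend[OF x] by (auto simp: solenoid_proj_def)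
  from someI_ex[OF this] have y: "y \<in> topspace S" "y 0 = x" by (auto simp: y_def solenoid_proj_def)
  define K where "K = {k \<in> deck i 0. k (y i) \<in> B}"
  have "{h \<in> topspace (solenoid_group X P). (\<lambda>i. h i (y i)) \<in> (solenoid_proj i -` B \<inter> topspace S) \<inter> {y \<in> topspace S. solenoid_proj 0 y = x}}
     = {h \<in> topspace (solenoid_group X P). h i \<in> K}"
  proof (rule Collect_cong, rule conj_cong[OF refl])
    fix h assume h: "h \<in> topspace (solenoid_group X P)"
    hence "h i \<in> deck i 0" by (simp add: topspace_solenoid_group)
    moreover have "solenoid_proj 0 (\<lambda>i. h i (y i)) = x" 
      using solenoid_group_action(2)[OF h y(1)] y(2) by (simp add: solenoid_proj_def)
    ultimately show "((\<lambda>i. h i (y i)) \<in> (solenoid_proj i -` B \<inter> topspace S) \<inter> {y \<in> topspace S. solenoid_proj 0 y = x}) = (h i \<in> K)"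
      using solenoid_group_action(1)[OF h y(1)] by (simp add: K_def solenoid_proj_def)
  qed
  hence "fiber_measure X P H x ((solenoid_proj i -` B \<inter> topspace S) \<inter> {y \<in> topspace S. solenoid_proj 0 y = x}) =
      emeasure H {h \<in> topspace (solenoid_group X P). h i \<in> K}"
    unfolding fiber_measure_def Let_def y_def[symmetric] by simp
  also have "\<dots> = ennreal (real (card K) / real (card (deck i 0)))" by (rule haar_cylinder) (auto simp: K_def)
  also have "card K = card (B \<inter> {z \<in> topspace (X i). proj i 0 z = x})"
  proof (rule bij_betw_same_card)
    have "bij_betw (\<lambda>h. h (y i)) (deck i 0) {z \<in> topspace (X i). proj i 0 z = proj i 0 (y i)}"
      by (rule deck_bij_fiber) (use solenoid_mem[OF y(1)] in auto)
    moreover have "proj i 0 (y i) = x" using solenoid_compat[OF y(1), of 0 i] y(2) by simp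
    ultimately have b: "bij_betw (\<lambda>h. h (y i)) (deck i 0) {z \<in> topspace (X i). proj i 0 z = x}" by simp
    have "bij_betw (\<lambda>h. h (y i)) K ((\<lambda>h. h (y i)) ` K)"
      by (rule bij_betw_subset[OF b]) (auto simp: K_def)
    moreover have "(\<lambda>h. h (y i)) ` K = B \<inter> {z \<in> topspace (X i). proj i 0 z = x}"
    proof -
      have "(\<lambda>h. h (y i)) ` K = B \<inter> (\<lambda>h. h (y i)) ` deck i 0" by (auto simp: K_def)
      thus ?thesis by (simp only: bij_betw_imp_surj_on[OF b])
    qed
    ultimately show "bij_betw (\<lambda>h. h (y i)) K (B \<inter> {z \<in> topspace (X i). proj i 0 z = x})" by simp
  qed
  finally show ?thesis .
qed

end

end

section \<open>The measures on the tower and on the solenoid\<close>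

lemma borel_of_subset: "{U. openin T U} \<subseteq> Pow (topspace T)"
  using openin_subset by auto

lemma space_borel_of [simp]: "space (borel_of T) = topspace T"
  by (simp add: borel_of_def space_measure_of[OF borel_of_subset])

lemma continuous_map_measurable:
  assumes "continuous_map T T' f"
  shows "f \<in> measurable (borel_of T) (borel_of T')"
  unfolding borel_of_def[of T']
proof (rule measurable_measure_of[OF borel_of_subset])
  show "f \<in> space (borel_of T) \<rightarrow> topspace T'" using assms by (simp add: continuous_map_def)
  fix U assume "U \<in> {U. openin T' U}"
  hence "openin T {x \<in> topspace T. f x \<in> U}" using assms openin_continuous_map_preimage by blast
  moreover have "f -` U \<inter> space (borel_of T) = {x \<in> topspace T. f x \<in> U}" by auto
  ultimately show "f -` U \<inter> space (borel_of T) \<in> sets (borel_of T)" by (simp add: borel_of_def borel_of_subset)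
qed

text \<open>Settles the degenerate case of \<open>solenoid_measure_cases\<close>.\<close>

lemma null_measure_L2_norm:
  assumes "emeasure M (space M) = 0"
  shows "L2_norm M f = 0"
proof -
  have "AE x in M. False" using assms by (intro AE_I[of _ _ "space M"]) auto
  hence "AE x in M. (cmod (f x))\<^sup>2 = 0" by eventually_elim simp
  thus ?thesis by (simp add: L2_norm_def integral_eq_zero_AE)
qed

context covering_tower
begin

context
  fixes H :: "(nat \<Rightarrow> 'a \<Rightarrow> 'a) measure" and \<mu> :: "'a measure"
  assumes haar: "normalized_haar_measure (solenoid_group X P) (solenoid_group_mult X) H"
    and \<mu>: "sets \<mu> = sets (borel_of (X 0))"
begin

abbreviation "M \<equiv> solenoid_measure X P \<mu> H"
abbreviation "N i \<equiv> level_measure X P \<mu> i"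

lemma space_\<mu>: "space \<mu> = topspace (X 0)"
  using sets_eq_imp_space_eq[OF \<mu>] by simp

lemma borel_closed: "sigma_sets (topspace T) (sets (borel_of T)) = sets (borel_of T)"
  using sets.sigma_sets_eq[of "borel_of T"] by simp

lemma borel_Pow: "sets (borel_of T) \<subseteq> Pow (topspace T)"
  using sets.space_closed[of "borel_of T"] by simp

lemma sets_M [simp, measurable_cong]: "sets M = sets (borel_of S)" and space_M [simp]: "space M = topspace S"
  unfolding solenoid_measure_def by (simp_all add: sets_measure_of[OF borel_Pow] space_measure_of[OF borel_Pow] borel_closed)

lemma sets_N [simp, measurable_cong]: "sets (N i) = sets (borel_of (X i))" and space_N [simp]: "space (N i) = topspace (X i)"
  unfolding level_measure_def by (simp_all add: sets_measure_of[OF borel_Pow] space_measure_of[OF borel_Pow] borel_closed)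

lemma measurable_solenoid_proj: "solenoid_proj i \<in> measurable M (N i)"
  using continuous_map_measurable[OF continuous_solenoid_proj[of i]] by (simp cong: measurable_cong_sets)

lemma measurable_proj: "i \<le> j \<Longrightarrow> proj j i \<in> measurable (N j) (N i)"
  using continuous_map_measurable[OF continuous_proj[of i j]] by (simp cong: measurable_cong_sets)

text \<open>\<open>measure_of\<close> yields the null measure for a set function that is not countably additive.\<close>

lemma solenoid_measure_cases:
  obtains (null) "emeasure M (space M) = 0" 
  | (preserving) "\<And>i. measure_preserving M (N i) (solenoid_proj i)"
proof -
  define F where "F Z = (\<integral>\<^sup>+ x. fiber_measure X P H x (Z \<inter> {y \<in> topspace S. solenoid_proj 0 y = x}) \<partial>\<mu>)" for Z
  have M: "M = measure_of (topspace S) (sets (borel_of S)) F" by (simp add: solenoid_measure_def F_def[abs_def])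
  have em: "emeasure M = (\<lambda>B. if B \<in> sets (borel_of S) \<and> measure_space (topspace S) (sets (borel_of S)) F then F B else 0)"
    unfolding M emeasure_measure_of_conv borel_closed ..
  show ?thesis
  proof (cases "measure_space (topspace S) (sets (borel_of S)) F")
    case False
    hence "emeasure M (space M) = 0" by (simp add: em)
    thus ?thesis by (rule null)
  next
    case True
    \<comment> \<open>By \<open>fiber_measure_cylinder\<close> the push-forward of M agrees on Borel
      sets with the set function that defines \<open>N i\<close>, so countable additivity of the
      latter comes from that of M.\<close>
    have N: "N i = distr M (N i) (solenoid_proj i)" for i
    proof -
      have D: "distr M (N i) (solenoid_proj i) = distr M (borel_of (X i)) (solenoid_proj i)" by (rule distr_cong) simp_all
      have me: "solenoid_proj i \<in> measurable M (borel_of (X i))" 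
        using measurable_solenoid_proj by (simp cong: measurable_cong_sets)
      have "N i = measure_of (space (distr M (borel_of (X i)) (solenoid_proj i))) (sets (distr M (borel_of (X i)) (solenoid_proj i)))
          (emeasure (distr M (borel_of (X i)) (solenoid_proj i)))"
        unfolding level_measure_def space_distr sets_distr space_borel_of
      proof (rule measure_of_eq[OF borel_Pow], unfold borel_closed)
        fix B assume B: "B \<in> sets (borel_of (X i))"
        have "emeasure (distr M (borel_of (X i)) (solenoid_proj i)) B = F (solenoid_proj i -` B \<inter> topspace S)"
          using measurable_sets[OF me B] by (simp add: emeasure_distr[OF me B] em True)
        also have "\<dots> = (\<integral>\<^sup>+ x. ennreal (real (card (B \<inter> {y \<in> topspace (X i). proj i 0 y = x})) / real (card (deck i 0))) \<partial>\<mu>)"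
          unfolding F_def by (rule nn_integral_cong) (simp add: space_\<mu> fiber_measure_cylinder[OF haar])
        finally show "(\<integral>\<^sup>+ x. ennreal (real (card (B \<inter> {y \<in> topspace (X i). proj i 0 y = x})) / real (card (deck i 0))) \<partial>\<mu>)
          = emeasure (distr M (borel_of (X i)) (solenoid_proj i)) B" ..
      qed
      thus ?thesis unfolding measure_of_of_measure D .
    qed
    show ?thesis
      by (rule preserving, rule measure_preserving.intro) (rule measurable_solenoid_proj, rule N[symmetric])
  qed
qed

text \<open>The push-forward of M to level i factors through level j.\<close>

lemma proj_measure_preserving:
  assumes mp: "\<And>i. measure_preserving M (N i) (solenoid_proj i)" and ij: "i \<le> j"
  shows "measure_preserving (N j) (N i) (proj j i)"
proof (rule measure_preserving.intro)
  show mj: "proj j i \<in> measurable (N j) (N i)" by (rule measurable_proj[OF ij])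
  have "distr (N j) (N i) (proj j i) = distr (distr M (N j) (solenoid_proj j)) (N i) (proj j i)"
    using measure_preserving.distr_\<pi>[OF mp[of j]] by simp
  also have "\<dots> = distr M (N i) (proj j i \<circ> solenoid_proj j)"
    by (rule distr_distr[OF mj measurable_solenoid_proj])
  also have "\<dots> = distr M (N i) (solenoid_proj i)"
    by (rule distr_cong) (use solenoid_compat[OF _ ij] in \<open>auto simp: solenoid_proj_def\<close>)
  also have "\<dots> = N i" by (rule measure_preserving.distr_\<pi>[OF mp])
  finally show "distr (N j) (N i) (proj j i) = N i" .
qed

lemma deck_deck_0: "i \<le> j \<Longrightarrow> h \<in> deck j i \<Longrightarrow> y \<in> topspace (X j) \<Longrightarrow> proj j 0 (h y) = proj j 0 y"
  using tower_map_comp[of 0 i j P] deck_mem(2)[of h j i y] by simp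

text \<open>A deck transformation permutes the points of each fibre over level 0, so the counts
  under the integral do not change.\<close>

lemma deck_measure_preserving:
  assumes ij: "i \<le> j" and h: "h \<in> deck j i"
  shows "measure_preserving (N j) (N j) h"
proof (rule measure_preserving.intro)
  show mh: "h \<in> measurable (N j) (N j)"
    using continuous_map_measurable[OF deck_mem(4)[OF h]] by (simp cong: measurable_cong_sets)
  define F where "F B = (\<integral>\<^sup>+ x. ennreal (real (card (B \<inter> {y \<in> topspace (X j). proj j 0 y = x})) / real (card (deck j 0))) \<partial>\<mu>)" for B
  have N: "N j = measure_of (topspace (X j)) (sets (borel_of (X j))) F" by (simp add: level_measure_def F_def[abs_def])
  \<comment> \<open>If F were not countably additive, both sides would be 0; this formula treats
    both cases together.\<close>
  have em: "emeasure (N j) = (\<lambda>B. if B \<in> sets (borel_of (X j)) \<and> measure_space (topspace (X j)) (sets (borel_of (X j))) F then F B else 0)"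
    unfolding N emeasure_measure_of_conv borel_closed ..
  show "distr (N j) (N j) h = N j"
  proof (rule measure_eqI)
    fix B assume "B \<in> sets (distr (N j) (N j) h)"
    hence B: "B \<in> sets (N j)" by simp
    have "card ((h -` B \<inter> topspace (X j)) \<inter> {y \<in> topspace (X j). proj j 0 y = x}) = card (B \<inter> {y \<in> topspace (X j). proj j 0 y = x})" for x
    proof (rule bij_betw_same_card)
      have hm: "inj_on h (topspace (X j))" "h ` topspace (X j) = topspace (X j)"
        using deck_mem(1)[OF h] homeomorphic_imp_surjective_map homeomorphic_map_def by blast+
      show "bij_betw h ((h -` B \<inter> topspace (X j)) \<inter> {y \<in> topspace (X j). proj j 0 y = x}) (B \<inter> {y \<in> topspace (X j). proj j 0 y = x})"
        unfolding bij_betw_def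
      proof
        show "inj_on h ((h -` B \<inter> topspace (X j)) \<inter> {y \<in> topspace (X j). proj j 0 y = x})"
          by (rule inj_on_subset[OF hm(1)]) auto
        show "h ` ((h -` B \<inter> topspace (X j)) \<inter> {y \<in> topspace (X j). proj j 0 y = x}) = B \<inter> {y \<in> topspace (X j). proj j 0 y = x}"
        proof (intro set_eqI iffI)
          fix z assume z: "z \<in> B \<inter> {y \<in> topspace (X j). proj j 0 y = x}"
          then obtain y where "y \<in> topspace (X j)" "z = h y" using hm(2) by blast
          thus "z \<in> h ` ((h -` B \<inter> topspace (X j)) \<inter> {y \<in> topspace (X j). proj j 0 y = x})"
            using z deck_deck_0[OF ij h] by auto
        qed (use deck_mem(5)[OF h] deck_deck_0[OF ij h] in auto)
      qed
    qed
    hence "F (h -` B \<inter> topspace (X j)) = F B" by (simp add: F_def)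
    thus "emeasure (distr (N j) (N j) h) B = emeasure (N j) B"
      using measurable_sets[OF mh B] B by (simp add: emeasure_distr[OF mh B] em)
  qed simp
qed

text \<open>A pullback from level i is invariant under the deck group and the action preserves the
  measure, so all translates of u, and hence their average, have the same inner product with
  it.\<close>

lemma deck_average_orthogonal:
  assumes mp: "\<And>i. measure_preserving M (N i) (solenoid_proj i)" and ij: "i \<le> j"
    and u: "u \<in> L2_space (N j)" and u': "u' \<in> L2_space (N i)" and w: "w \<in> L2_space (N i)"
    and avg: "\<And>y. y \<in> topspace (X j) \<Longrightarrow> of_nat (card (deck j i)) * u' (proj j i y) = (\<Sum>h\<in>deck j i. u (h y))"
  shows "L2_inner M (\<lambda>x. u (solenoid_proj j x) - u' (solenoid_proj i x)) (w \<circ> solenoid_proj i) = 0"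
proof -
  interpret pj: measure_preserving M "N j" "solenoid_proj j" by (rule mp)
  interpret pi: measure_preserving M "N i" "solenoid_proj i" by (rule mp)
  interpret pp: measure_preserving "N j" "N i" "proj j i" by (rule proj_measure_preserving[OF mp ij])
  let ?n = "of_nat (card (deck j i)) :: complex"
  have n0: "?n \<noteq> 0" using finite_deck[OF ij] deck_nonempty[OF ij] by simp
  note up = pp.L2_comp[OF u'] and wp = pp.L2_comp[OF w]
  have hu: "u \<circ> h \<in> L2_space (N j)" and hi: "L2_inner (N j) (u \<circ> h) (w \<circ> proj j i) = L2_inner (N j) u (w \<circ> proj j i)"
    if h: "h \<in> deck j i" for h
  proof -
    interpret hh: measure_preserving "N j" "N j" h by (rule deck_measure_preserving[OF ij h])
    show "u \<circ> h \<in> L2_space (N j)" by (rule hh.L2_comp[OF u])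
    have "L2_inner (N j) (u \<circ> h) (w \<circ> proj j i) = L2_inner (N j) (u \<circ> h) ((w \<circ> proj j i) \<circ> h)"
    proof (rule L2_inner_cong_AE[OF AE_I2[OF refl] AE_I2])
      fix y assume "y \<in> space (N j)"
      thus "(w \<circ> proj j i) y = (w \<circ> proj j i \<circ> h) y" using deck_mem(2)[OF h, of y] by simp
    qed (intro hh.L2_comp u wp)+
    also have "\<dots> = L2_inner (N j) u (w \<circ> proj j i)" by (rule hh.L2_inner_comp[OF u wp])
    finally show "L2_inner (N j) (u \<circ> h) (w \<circ> proj j i) = L2_inner (N j) u (w \<circ> proj j i)" .
  qed
  \<comment> \<open>Stated for subsets of the deck group to allow induction over finite
    sets.\<close>
  have sum_inner: "L2_inner (N j) (\<lambda>x. \<Sum>h\<in>I. (u \<circ> h) x) (w \<circ> proj j i) = of_nat (card I) * L2_inner (N j) u (w \<circ> proj j i)"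
    if "finite I" "I \<subseteq> deck j i" for I
    using that
  proof (induction I rule: finite_induct)
    case empty
    show ?case by (simp add: L2_inner_def)
  next
    case (insert h I)
    have "L2_inner (N j) (\<lambda>x. (u \<circ> h) x + (\<Sum>h\<in>I. (u \<circ> h) x)) (w \<circ> proj j i) 
      = L2_inner (N j) (u \<circ> h) (w \<circ> proj j i) + L2_inner (N j) (\<lambda>x. \<Sum>h\<in>I. (u \<circ> h) x) (w \<circ> proj j i)"
    proof (rule L2_inner_add_left[OF _ _ wp])
      show "u \<circ> h \<in> L2_space (N j)" by (rule hu) (use insert in blast)
      show "(\<lambda>x. \<Sum>h\<in>I. (u \<circ> h) x) \<in> L2_space (N j)"
        by (rule L2_sum[OF insert(1)], rule hu) (use insert in blast)
    qed
    also have "\<dots> = of_nat (card (insert h I)) * L2_inner (N j) u (w \<circ> proj j i)"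
    proof -
      have "L2_inner (N j) (\<lambda>x. \<Sum>h\<in>I. (u \<circ> h) x) (w \<circ> proj j i) = of_nat (card I) * L2_inner (N j) u (w \<circ> proj j i)"
        by (rule insert.IH) (use insert.prems in blast)
      moreover have "h \<in> deck j i" using insert.prems by blast
      ultimately show ?thesis using hi[of h] insert(1,2) by (simp only: card_insert_disjoint) (simp add: algebra_simps)
    qed
    finally show ?case unfolding sum.insert[OF insert(1,2)] .
  qed
  have "?n * L2_inner (N j) (u' \<circ> proj j i) (w \<circ> proj j i) = L2_inner (N j) (\<lambda>x. ?n * (u' \<circ> proj j i) x) (w \<circ> proj j i)"
    by (rule L2_inner_scale_left[OF up wp, symmetric])
  also have "\<dots> = L2_inner (N j) (\<lambda>x. \<Sum>h\<in>deck j i. (u \<circ> h) x) (w \<circ> proj j i)"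
  proof (rule L2_inner_cong_AE[OF AE_I2 AE_I2[OF refl]])
    fix y assume "y \<in> space (N j)"
    thus "?n * (u' \<circ> proj j i) y = (\<Sum>h\<in>deck j i. (u \<circ> h) y)" using avg[of y] by simp
  qed (intro L2_scale L2_sum up wp hu finite_deck[OF ij]; assumption)+
  also have "\<dots> = ?n * L2_inner (N j) u (w \<circ> proj j i)" by (rule sum_inner[OF finite_deck[OF ij] order.refl])
  finally have eq: "L2_inner (N j) (u' \<circ> proj j i) (w \<circ> proj j i) = L2_inner (N j) u (w \<circ> proj j i)" using n0 by simp
  have "L2_inner M (\<lambda>x. u (solenoid_proj j x) - u' (solenoid_proj i x)) (w \<circ> solenoid_proj i) =
     L2_inner M ((\<lambda>x. u x - (u' \<circ> proj j i) x) \<circ> solenoid_proj j) ((w \<circ> proj j i) \<circ> solenoid_proj j)"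
  proof (rule L2_inner_cong_AE[OF AE_I2 AE_I2])
    fix x assume "x \<in> space M"
    hence c: "proj j i (solenoid_proj j x) = solenoid_proj i x" using solenoid_compat[OF _ ij] by (simp add: solenoid_proj_def)
    show "u (solenoid_proj j x) - u' (solenoid_proj i x) = ((\<lambda>x. u x - (u' \<circ> proj j i) x) \<circ> solenoid_proj j) x"
      "(w \<circ> solenoid_proj i) x = (w \<circ> proj j i \<circ> solenoid_proj j) x" using c by simp_all
  next
    show "(\<lambda>x. u (solenoid_proj j x) - u' (solenoid_proj i x)) \<in> L2_space M"
      using L2_diff[OF pj.L2_comp[OF u] pi.L2_comp[OF u']] by simp
  qed (intro pj.L2_comp pi.L2_comp L2_diff u up wp w)+
  also have "\<dots> = L2_inner (N j) (\<lambda>x. u x - (u' \<circ> proj j i) x) (w \<circ> proj j i)"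
    by (rule pj.L2_inner_comp[OF L2_diff[OF u up] wp])
  also have "\<dots> = 0" unfolding L2_inner_diff_left[OF u up wp] eq by simp
  finally show ?thesis .
qed

end

end

section \<open>The Laplacian in charts\<close>

text \<open>Makes the chart explicit that \<open>laplacian\<close> picks by choice, so that values
  in different charts can be compared.\<close>

definition chart_laplacian ::
    "('a, 'n::finite) chart \<Rightarrow> ('a, 'n) metric_tensor \<Rightarrow> ('a \<Rightarrow> complex) \<Rightarrow> 'a \<Rightarrow> complex" where
  "chart_laplacian c g u x =
     - coord_div (g c \<circ> chart_inv c) (coord_grad (g c \<circ> chart_inv c) (u \<circ> chart_inv c)) (snd c x)"

lemma laplacian_eq_chart_laplacian:
  "laplacian A g u x = chart_laplacian (SOME c. c \<in> A \<and> x \<in> fst c) g u x"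
  by (simp add: laplacian_def chart_laplacian_def Let_def)

lemma jacobian_matrix_compose:
  assumes "g differentiable (at z)" "f differentiable (at (g z))"
  shows "jacobian_matrix (f \<circ> g) z = jacobian_matrix f (g z) ** jacobian_matrix g z"
  unfolding jacobian_matrix_def frechet_derivative_compose[OF assms]
  by (rule matrix_compose[OF linear_frechet_derivative[OF assms(1)] linear_frechet_derivative[OF assms(2)]])

lemma jacobian_matrix_cong_open:
  assumes "open T" "z \<in> T" "\<And>x. x \<in> T \<Longrightarrow> f x = g x"
  shows "jacobian_matrix f z = jacobian_matrix g z"
  unfolding jacobian_matrix_def using frechet_derivative_cong_open[OF assms] by simp

lemma jacobian_matrix_left_inverse:
  assumes T: "open T" "z \<in> T" and inv: "\<And>x. x \<in> T \<Longrightarrow> f (g x) = x"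
    and "g differentiable (at z)" "f differentiable (at (g z))"
  shows "det (jacobian_matrix g z) \<noteq> 0"
proof -
  have "jacobian_matrix (f \<circ> g) z = jacobian_matrix (\<lambda>x. x) z"
    by (rule jacobian_matrix_cong_open[OF T]) (simp add: inv)
  hence "jacobian_matrix f (g z) ** jacobian_matrix g z = mat 1"
    using jacobian_matrix_compose[OF assms(4,5)] by (simp add: jacobian_matrix_def frechet_derivative_ident matrix_id_mat_1[unfolded id_def])
  hence "det (jacobian_matrix f (g z)) * det (jacobian_matrix g z) = 1" by (metis det_I det_mul)
  thus ?thesis by auto
qed

lemma riemannian_metric_props:
  assumes g: "riemannian_metric A g" and M: "smooth_manifold X A" and d: "d \<in> A" and x: "x \<in> snd d ` fst d"
  shows "det ((g d \<circ> chart_inv d) x) > 0" "(\<lambda>x. (g d \<circ> chart_inv d) x $ a $ b) differentiable (at x)"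
proof -
  have "smooth_on (snd d ` fst d) (g d \<circ> chart_inv d)" "\<And>y. y \<in> fst d \<Longrightarrow> (\<forall>v. v \<noteq> 0 \<longrightarrow> v \<bullet> (g d y *v v) > 0)"
    using g d by (auto simp: riemannian_metric_def)
  note sm = this
  show "det ((g d \<circ> chart_inv d) x) > 0"
    using det_pos_if_positive_definite[of "g d (chart_inv d x)"] sm(2)[OF chart_inv_mem[OF x]] by simp
  show "(\<lambda>x. (g d \<circ> chart_inv d) x $ a $ b) differentiable (at x)"
    by (intro differentiable_nth smooth_on_differentiable[OF sm(1) x])
qed

lemma riemannian_metric_transform:
  assumes "riemannian_metric A g" "c \<in> A" "d \<in> A" "x \<in> fst c" "x \<in> fst d"
  shows "g c x = transpose (jacobian_matrix (snd d \<circ> chart_inv c) (snd c x)) ** g d x ** 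
    jacobian_matrix (snd d \<circ> chart_inv c) (snd c x)"
  using assms unfolding riemannian_metric_def jacobian_matrix_def Let_def by blast

text \<open>The definition picks some chart around p y. The transition from d to that chart is
  absorbed by the chain rule and the transformation rule of g. The assumptions on c are local
  because c will also be a chart of a leaf.\<close>

lemma pullback_metric_chart:
  assumes M: "smooth_manifold X A" and g: "riemannian_metric A g" and d: "d \<in> A"
    and O: "open O'" "snd c y \<in> O'" "\<And>z. z \<in> O' \<Longrightarrow> p (chart_inv c z) \<in> fst d" and y: "chart_inv c (snd c y) = y"
    and diff: "(snd d \<circ> p \<circ> chart_inv c) differentiable (at (snd c y))"
  shows "pullback_metric p A g c y = transpose (jacobian_matrix (snd d \<circ> p \<circ> chart_inv c) (snd c y)) ** g d (p y) **
      jacobian_matrix (snd d \<circ> p \<circ> chart_inv c) (snd c y)"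
proof -
  define d' where "d' = (SOME d. d \<in> A \<and> p y \<in> fst d)"
  have py: "p y \<in> fst d" using O(3)[OF O(2)] y by simp
  hence "\<exists>d. d \<in> A \<and> p y \<in> fst d" using d by blast
  from someI_ex[OF this] have d': "d' \<in> A" "p y \<in> fst d'" by (auto simp: d'_def)
  let ?\<psi> = "snd d \<circ> p \<circ> chart_inv c" and ?\<tau> = "snd d' \<circ> chart_inv d"
  have \<psi>y: "?\<psi> (snd c y) = snd d (p y)" by (simp add: y)
  have \<tau>: "?\<tau> differentiable (at (?\<psi> (snd c y)))"
    unfolding \<psi>y by (rule smooth_on_differentiable[OF smooth_transition[OF M d d'(1)]]) (use py d' in auto)
  have "jacobian_matrix (snd d' \<circ> p \<circ> chart_inv c) (snd c y) = jacobian_matrix (?\<tau> \<circ> ?\<psi>) (snd c y)"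
    by (rule jacobian_matrix_cong_open[OF O(1,2)]) (simp add: chart_inv_left[OF M d O(3)])
  also have "\<dots> = jacobian_matrix ?\<tau> (snd d (p y)) ** jacobian_matrix ?\<psi> (snd c y)"
    using jacobian_matrix_compose[OF diff \<tau>] unfolding \<psi>y .
  finally have J: "jacobian_matrix (snd d' \<circ> p \<circ> chart_inv c) (snd c y) = jacobian_matrix ?\<tau> (snd d (p y)) ** jacobian_matrix ?\<psi> (snd c y)" .
  have "pullback_metric p A g c y = transpose (jacobian_matrix (snd d' \<circ> p \<circ> chart_inv c) (snd c y)) ** g d' (p y) **
      jacobian_matrix (snd d' \<circ> p \<circ> chart_inv c) (snd c y)"
    by (simp add: pullback_metric_def Let_def d'_def[symmetric] jacobian_matrix_def)
  also have "\<dots> = transpose (jacobian_matrix ?\<psi> (snd c y)) ** 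
     (transpose (jacobian_matrix ?\<tau> (snd d (p y))) ** g d' (p y) ** jacobian_matrix ?\<tau> (snd d (p y))) ** jacobian_matrix ?\<psi> (snd c y)"
    unfolding J matrix_transpose_mul by (simp add: matrix_mul_assoc)
  also have "transpose (jacobian_matrix ?\<tau> (snd d (p y))) ** g d' (p y) ** jacobian_matrix ?\<tau> (snd d (p y)) = g d (p y)"
    by (rule riemannian_metric_transform[OF g d d'(1) py d'(2), symmetric])
  finally show ?thesis .
qed

text \<open>Coordinate invariance for the coordinate expression of p. It serves both the covering
  maps between levels and the projection of a leaf, so c has to be invertible only near y.\<close>

lemma chart_laplacian_pullback:
  assumes M: "smooth_manifold X A" and g: "riemannian_metric A g" and d: "d \<in> A"
    and O: "open O'" "snd c y \<in> O'" and c: "\<And>z. z \<in> O' \<Longrightarrow> snd c (chart_inv c z) = z" "chart_inv c (snd c y) = y"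
    and p: "\<And>z. z \<in> O' \<Longrightarrow> p (chart_inv c z) \<in> fst d"
    and \<psi>: "smooth_on O' (snd d \<circ> p \<circ> chart_inv c)" 
    and det: "\<And>z. z \<in> O' \<Longrightarrow> det (jacobian_matrix (snd d \<circ> p \<circ> chart_inv c) z) \<noteq> 0"
    and w: "open O''" "(snd d \<circ> p \<circ> chart_inv c) ` O' \<subseteq> O''" "O'' \<subseteq> snd d ` fst d" "smooth_on O'' (w \<circ> chart_inv d)"
    and u: "\<And>z. z \<in> O' \<Longrightarrow> u (chart_inv c z) = w (p (chart_inv c z))"
  shows "chart_laplacian c (pullback_metric p A g) u y = chart_laplacian d g w (p y)"
proof -
  let ?\<psi> = "snd d \<circ> p \<circ> chart_inv c"
  have inv: "chart_inv d (?\<psi> z) = p (chart_inv c z)" if "z \<in> O'" for z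
    using chart_inv_left[OF M d p[OF that]] by simp
  have "coord_div (pullback_metric p A g c \<circ> chart_inv c) (coord_grad (pullback_metric p A g c \<circ> chart_inv c) (u \<circ> chart_inv c)) (snd c y)
    = coord_div (g d \<circ> chart_inv d) (coord_grad (g d \<circ> chart_inv d) (w \<circ> chart_inv d)) (?\<psi> (snd c y))"
  proof (rule coord_laplacian_transform[where S = O' and S' = O''])
    show "C_k_on 2 O' ?\<psi>" "C_k_on 2 O'' (w \<circ> chart_inv d)" using \<psi> w(4) by (simp_all add: smooth_on_def)
    show "(u \<circ> chart_inv c) z = (w \<circ> chart_inv d) (?\<psi> z)" if "z \<in> O'" for z using u[OF that] inv[OF that] by simp
    show "(pullback_metric p A g c \<circ> chart_inv c) z = transpose (jacobian_matrix ?\<psi> z) ** (g d \<circ> chart_inv d) (?\<psi> z) ** jacobian_matrix ?\<psi> z"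
      if z: "z \<in> O'" for z
    proof -
      have "pullback_metric p A g c (chart_inv c z) = transpose (jacobian_matrix ?\<psi> (snd c (chart_inv c z))) ** g d (p (chart_inv c z)) ** 
          jacobian_matrix ?\<psi> (snd c (chart_inv c z))"
        by (rule pullback_metric_chart[OF M g d O(1)]) 
          (use z c(1)[OF z] p smooth_on_differentiable[OF \<psi> z] in auto)
      moreover have "(g d \<circ> chart_inv d) (?\<psi> z) = g d (p (chart_inv c z))" using inv[OF z] by simp
      ultimately show ?thesis unfolding c(1)[OF z] by simp
    qed
    show "det (jacobian_matrix ?\<psi> z) \<noteq> 0" if "z \<in> O'" for z by (rule det[OF that])
  qed (use O w riemannian_metric_props[OF g M d] in auto)
  moreover have "?\<psi> (snd c y) = snd d (p y)" by (simp add: c(2))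
  ultimately show ?thesis by (simp add: chart_laplacian_def)
qed

lemma chart_laplacian_cong:
  assumes M: "smooth_manifold X A" "d \<in> A" and V: "openin X V" "x \<in> V" "x \<in> fst d" and u: "\<And>y. y \<in> V \<Longrightarrow> u y = u' y"
  shows "chart_laplacian d g u x = chart_laplacian d g u' x"
proof -
  have op: "open (snd d ` (V \<inter> fst d))" 
    by (rule chart_image_open[OF M]) (use V chart_open[OF M] in auto)
  have "(u \<circ> chart_inv d) z = (u' \<circ> chart_inv d) z" if "z \<in> snd d ` (V \<inter> fst d)" for z
    using that chart_inv_left[OF M] u by auto
  thus ?thesis unfolding chart_laplacian_def
    by (intro arg_cong[where f = uminus] coord_laplacian_cong[OF op]) (use V in auto)
qed

lemma chart_laplacian_sum:
  assumes M: "smooth_manifold X A" and g: "riemannian_metric A g" and d: "d \<in> A" and x: "x \<in> fst d" and I: "finite I"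
    and u: "\<And>k. k \<in> I \<Longrightarrow> \<exists>T. open T \<and> snd d x \<in> T \<and> smooth_on T (u k \<circ> chart_inv d)"
  shows "chart_laplacian d g (\<lambda>y. c * (\<Sum>k\<in>I. u k y)) x = c * (\<Sum>k\<in>I. chart_laplacian d g (u k) x)"
proof -
  obtain T where T: "\<And>k. k \<in> I \<Longrightarrow> open (T k) \<and> snd d x \<in> T k \<and> smooth_on (T k) (u k \<circ> chart_inv d)"
    using u by metis
  define O' where "O' = snd d ` fst d \<inter> (\<Inter>k\<in>I. T k)"
  have O: "open O'" "snd d x \<in> O'" unfolding O'_def using T x chart_open[OF M d] I by (auto intro!: open_Int open_INT)
  have "coord_div (g d \<circ> chart_inv d) (coord_grad (g d \<circ> chart_inv d) (\<lambda>z. c * (\<Sum>k\<in>I. (u k \<circ> chart_inv d) z))) (snd d x)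
     = c * (\<Sum>k\<in>I. coord_div (g d \<circ> chart_inv d) (coord_grad (g d \<circ> chart_inv d) (u k \<circ> chart_inv d)) (snd d x))"
  proof (rule coord_laplacian_sum[OF O I])
    show "C_k_on 2 O' (u k \<circ> chart_inv d)" if "k \<in> I" for k
    proof (rule C_k_on_subset)
      show "C_k_on 2 (T k) (u k \<circ> chart_inv d)" using T[OF that] by (simp add: smooth_on_def)
      show "O' \<subseteq> T k" using that by (auto simp: O'_def)
    qed
  qed (use riemannian_metric_props[OF g M d] in \<open>auto simp: O'_def\<close>)
  thus ?thesis by (simp add: chart_laplacian_def comp_def sum_negf)
qed

context covering_tower
begin

section \<open>Local sections of the coverings and their coordinate expressions\<close>

definition "smooth_function i u \<longleftrightarrow> (\<forall>c\<in>A i. smooth_on (snd c ` fst c) (u \<circ> chart_inv c))"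

text \<open>Only continuity is asked for: a continuous section agrees locally with the inverse of a
  sheet, which is smooth.\<close>

definition "local_section j i V \<sigma> \<longleftrightarrow> openin (X i) V \<and> continuous_map (subtopology (X i) V) (X j) \<sigma> \<and>
  (\<forall>x\<in>V. proj j i (\<sigma> x) = x)"

lemma sheet_exists:
  assumes ij: "i \<le> j" and y: "y \<in> topspace (X j)"
  obtains U W where "openin (X i) U" "openin (X j) W" "y \<in> W" "diffeomorphism_between (X j) (A j) W (X i) (A i) U (proj j i)"
proof -
  have "proj j i y \<in> topspace (X i)" by (rule proj_mem[OF ij y])
  then obtain U \<W> where U: "proj j i y \<in> U" "openin (X i) U" "\<Union>\<W> = topspace (X j) \<inter> proj j i -` U" 
    "\<And>W. W \<in> \<W> \<Longrightarrow> openin (X j) W \<and> diffeomorphism_between (X j) (A j) W (X i) (A i) U (proj j i)"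
    using smooth_covering_proj[OF ij] unfolding smooth_covering_def by meson
  have "y \<in> \<Union>\<W>" using U(1,3) y by auto
  then obtain W where W: "W \<in> \<W>" "y \<in> W" by blast
  with U(2) U(4)[OF W(1)] show ?thesis by (intro that[of U W]) auto
qed

lemma local_section_exists:
  assumes ij: "i \<le> j" and y: "y \<in> topspace (X j)"
  obtains V \<sigma> where "local_section j i V \<sigma>" "proj j i y \<in> V" "\<sigma> (proj j i y) = y"
proof -
  obtain U W where UW: "openin (X i) U" "openin (X j) W" "y \<in> W" "diffeomorphism_between (X j) (A j) W (X i) (A i) U (proj j i)"
    by (rule sheet_exists[OF ij y])
  have "homeomorphic_map (subtopology (X j) W) (subtopology (X i) U) (proj j i)"
    using UW(4) by (simp add: diffeomorphism_between_def)
  note s = sheet_section[OF this UW(2,1)]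
  show ?thesis
  proof (rule that[of U "inv_into W (proj j i)"])
    have "proj j i (inv_into W (proj j i) x) = x" if "x \<in> U" for x
      using s(2) that by (metis f_inv_into_f)
    thus "local_section j i U (inv_into W (proj j i))"
      unfolding local_section_def using UW(1) continuous_map_into_fulltopology[OF s(3)] by blast
    show "proj j i y \<in> U" using s(2) UW(3) by blast
    show "inv_into W (proj j i) (proj j i y) = y" by (rule inv_into_f_f[OF s(1) UW(3)])
  qed
qed

text \<open>Near x the section is the inverse of the sheet through \<sigma> x, whose smoothness in
  both directions is part of the covering. The domains are shrunk until the coordinate expressions
  of the projection and of the section are inverse to each other on O'.\<close>

lemma local_section_coordinates:
  assumes ij: "i \<le> j" and \<sigma>: "local_section j i V \<sigma>" and x: "x \<in> V"
    and c: "c \<in> A j" "\<sigma> x \<in> fst c" and d: "d \<in> A i" "x \<in> fst d"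
  obtains O' T where "open O'" "snd c (\<sigma> x) \<in> O'" "O' \<subseteq> snd c ` fst c" 
    "smooth_on O' (snd d \<circ> proj j i \<circ> chart_inv c)"
    "openin (X i) T" "x \<in> T" "T \<subseteq> V \<inter> fst d" "smooth_on (snd d ` T) (snd c \<circ> \<sigma> \<circ> chart_inv d)"
    "\<forall>y\<in>T. \<sigma> y \<in> fst c" "\<forall>z\<in>O'. proj j i (chart_inv c z) \<in> T \<and> \<sigma> (proj j i (chart_inv c z)) = chart_inv c z"
proof -
  let ?p = "proj j i"
  have V: "openin (X i) V" and \<sigma>c: "continuous_map (subtopology (X i) V) (X j) \<sigma>" and p\<sigma>: "\<And>x. x \<in> V \<Longrightarrow> ?p (\<sigma> x) = x"
    using \<sigma> by (auto simp: local_section_def)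
  have tV: "topspace (subtopology (X i) V) = V" using openin_subset[OF V] by auto
  have \<sigma>x: "\<sigma> x \<in> topspace (X j)" using \<sigma>c x tV by (auto simp: continuous_map_def)
  obtain U W where UW: "openin (X i) U" "openin (X j) W" "\<sigma> x \<in> W" "diffeomorphism_between (X j) (A j) W (X i) (A i) U ?p"
    by (rule sheet_exists[OF ij \<sigma>x])
  have hom: "homeomorphic_map (subtopology (X j) W) (subtopology (X i) U) ?p" and sm1: "smooth_map_on (A j) (A i) W ?p" 
    and sm2: "smooth_map_on (A i) (A j) U (inv_into W ?p)"
    using UW(4) by (auto simp: diffeomorphism_between_def)
  note s = sheet_section[OF hom UW(2,1)]
  \<comment> \<open>Points that the section keeps in the sheet W and in the chart c; there it must
    be the inverse of the sheet.\<close>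
  define T where "T = {y \<in> V. \<sigma> y \<in> W \<inter> fst c} \<inter> fst d"
  have Wc: "openin (X j) (W \<inter> fst c)" by (intro openin_Int UW(2) chart_open(1)[OF manifold c(1)])
  have "openin (subtopology (X i) V) {y \<in> topspace (subtopology (X i) V). \<sigma> y \<in> W \<inter> fst c}"
    by (rule openin_continuous_map_preimage[OF \<sigma>c Wc])
  hence "openin (X i) {y \<in> V. \<sigma> y \<in> W \<inter> fst c}" unfolding tV by (rule openin_trans_full[OF _ V])
  hence T: "openin (X i) T" unfolding T_def by (intro openin_Int chart_open(1)[OF manifold d(1)])
  have xT: "x \<in> T" using x UW(3) c d by (simp add: T_def)
  have \<sigma>s: "\<sigma> y = inv_into W ?p y" and TU: "y \<in> U" if "y \<in> T" for y
  proof -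
    have yW: "\<sigma> y \<in> W" "?p (\<sigma> y) = y" using that p\<sigma> by (auto simp: T_def)
    show "\<sigma> y = inv_into W ?p y" using inv_into_f_f[OF s(1) yW(1)] yW(2) by simp
    show "y \<in> U" using imageI[OF yW(1), of ?p] s(2) yW(2) by simp
  qed
  define Q where "Q = {y \<in> topspace (X j). ?p y \<in> T} \<inter> (W \<inter> fst c)"
  have Q: "openin (X j) Q" unfolding Q_def by (intro openin_Int[OF _ Wc] openin_continuous_map_preimage[OF continuous_proj[OF ij] T])
  have Qc: "Q \<subseteq> fst c" by (auto simp: Q_def)
  show ?thesis
  proof (rule that[of "snd c ` Q" T])
    show "open (snd c ` Q)" by (rule chart_image_open[OF manifold c(1) Q Qc])
    show "snd c (\<sigma> x) \<in> snd c ` Q" using \<sigma>x UW(3) c(2) xT p\<sigma>[OF x] by (auto simp: Q_def)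
    show "snd c ` Q \<subseteq> snd c ` fst c" using Qc by blast
    show "smooth_on (snd c ` Q) (snd d \<circ> ?p \<circ> chart_inv c)"
    proof (rule smooth_on_subset)
      show "smooth_on (snd c ` (W \<inter> fst c \<inter> ?p -` fst d)) (snd d \<circ> ?p \<circ> chart_inv c)"
        using sm1 c d by (simp add: smooth_map_on_def)
      show "snd c ` Q \<subseteq> snd c ` (W \<inter> fst c \<inter> ?p -` fst d)" by (auto simp: Q_def T_def)
    qed
    show "T \<subseteq> V \<inter> fst d" "\<forall>y\<in>T. \<sigma> y \<in> fst c" by (auto simp: T_def)
    have opT: "open (snd d ` T)" by (rule chart_image_open[OF manifold d(1) T]) (simp add: T_def)
    have "smooth_on (snd d ` T) (snd c \<circ> inv_into W ?p \<circ> chart_inv d)"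
    proof (rule smooth_on_subset)
      show "smooth_on (snd d ` (U \<inter> fst d \<inter> inv_into W ?p -` fst c)) (snd c \<circ> inv_into W ?p \<circ> chart_inv d)"
        using sm2 c d by (simp add: smooth_map_on_def)
      show "snd d ` T \<subseteq> snd d ` (U \<inter> fst d \<inter> inv_into W ?p -` fst c)"
        using \<sigma>s TU by (intro image_mono) (auto simp: T_def)
    qed
    moreover have "(snd c \<circ> inv_into W ?p \<circ> chart_inv d) z = (snd c \<circ> \<sigma> \<circ> chart_inv d) z" if "z \<in> snd d ` T" for z
    proof -
      obtain y where y: "y \<in> T" "z = snd d y" using \<open>z \<in> snd d ` T\<close> by blast
      have "chart_inv d z = y" unfolding y(2) by (rule chart_inv_left[OF manifold d(1)]) (use y in \<open>simp add: T_def\<close>)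
      thus ?thesis using \<sigma>s[OF y(1)] by simp
    qed
    ultimately show "smooth_on (snd d ` T) (snd c \<circ> \<sigma> \<circ> chart_inv d)" by (rule smooth_on_eq[OF opT])
    show "\<forall>z\<in>snd c ` Q. ?p (chart_inv c z) \<in> T \<and> \<sigma> (?p (chart_inv c z)) = chart_inv c z"
    proof
      fix z assume "z \<in> snd c ` Q"
      then obtain y where y: "y \<in> Q" "z = snd c y" by blast
      have cz: "chart_inv c z = y" unfolding y(2) by (rule chart_inv_left[OF manifold c(1)]) (use y Qc in blast)
      have yW: "y \<in> W" "?p y \<in> T" using y(1) by (auto simp: Q_def)
      thus "?p (chart_inv c z) \<in> T \<and> \<sigma> (?p (chart_inv c z)) = chart_inv c z"
        unfolding cz using \<sigma>s[OF yW(2)] inv_into_f_f[OF s(1) yW(1)] by simp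
    qed
  qed (rule T, rule xT)
qed

lemma local_section_mem: "local_section j i V \<sigma> \<Longrightarrow> x \<in> V \<Longrightarrow> \<sigma> x \<in> topspace (X j)"
proof -
  assume \<sigma>: "local_section j i V \<sigma>" and x: "x \<in> V"
  hence "x \<in> topspace (subtopology (X i) V)" using openin_subset by (fastforce simp: local_section_def)
  thus "\<sigma> x \<in> topspace (X j)" using \<sigma> continuous_map_image_subset_topspace unfolding local_section_def by blast
qed

lemma section_chart_exists:
  assumes \<sigma>: "local_section j i V \<sigma>" and x: "x \<in> V"
  shows "\<exists>c\<in>A j. \<sigma> x \<in> fst c"
  using chart_exists[OF manifold local_section_mem[OF assms]] .

lemma section_smooth:
  assumes ij: "i \<le> j" and \<sigma>: "local_section j i V \<sigma>" and x: "x \<in> V" and d: "d \<in> A i" "x \<in> fst d" and u: "smooth_function j u"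
  obtains T where "openin (X i) T" "x \<in> T" "T \<subseteq> V \<inter> fst d" "smooth_on (snd d ` T) (u \<circ> \<sigma> \<circ> chart_inv d)"
proof -
  obtain c where c: "c \<in> A j" "\<sigma> x \<in> fst c" using section_chart_exists[OF \<sigma> x] by blast
  obtain O' T where T: "openin (X i) T" "x \<in> T" "T \<subseteq> V \<inter> fst d" "smooth_on (snd d ` T) (snd c \<circ> \<sigma> \<circ> chart_inv d)"
    "\<forall>y\<in>T. \<sigma> y \<in> fst c"
    by (rule local_section_coordinates[OF ij \<sigma> x c d])
  have opT: "open (snd d ` T)" by (rule chart_image_open[OF manifold d(1) T(1)]) (use T(3) in blast)
  have inv: "\<sigma> (chart_inv d z) \<in> fst c" if z: "z \<in> snd d ` T" for z
  proof -
    obtain y where y: "y \<in> T" "z = snd d y" using z by blast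
    have "chart_inv d z = y" unfolding y(2) by (rule chart_inv_left[OF manifold d(1)]) (use y T(3) in blast)
    thus ?thesis using T(5) y by simp
  qed
  have "smooth_on (snd d ` T) (\<lambda>z. (u \<circ> chart_inv c) ((snd c \<circ> \<sigma> \<circ> chart_inv d) z))"
  proof (rule smooth_on_compose[OF opT chart_open(2)[OF manifold c(1)] _ T(4)])
    show "smooth_on (snd c ` fst c) (u \<circ> chart_inv c)" using u c(1) by (simp add: smooth_function_def)
    show "(snd c \<circ> \<sigma> \<circ> chart_inv d) ` snd d ` T \<subseteq> snd c ` fst c" using inv by (auto intro!: imageI)
  qed
  moreover have "(u \<circ> chart_inv c) ((snd c \<circ> \<sigma> \<circ> chart_inv d) z) = (u \<circ> \<sigma> \<circ> chart_inv d) z" if "z \<in> snd d ` T" for z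
    using chart_inv_left[OF manifold c(1) inv[OF that]] by simp
  ultimately have "smooth_on (snd d ` T) (u \<circ> \<sigma> \<circ> chart_inv d)" by (rule smooth_on_eq[OF opT])
  thus ?thesis by (intro that[OF T(1,2,3)])
qed

context
  fixes g :: "('a, 'n) metric_tensor"
  assumes g: "riemannian_metric (A 0) g"
begin

abbreviation "level_laplacian i \<equiv> laplacian (A i) (pullback_metric (proj i 0) (A 0) g)"

text \<open>In coordinates the projection to level 0 is a diffeomorphism with the section as
  inverse, so coordinate invariance moves the computation to an arbitrary chart of level 0.
  Different sheets and different levels thus become comparable.\<close>

lemma level_laplacian_section:
  assumes \<sigma>: "local_section i 0 V \<sigma>" and x: "x \<in> V" and d: "d \<in> A 0" "x \<in> fst d" and u: "smooth_function i u"
  shows "level_laplacian i u (\<sigma> x) = chart_laplacian d g (u \<circ> \<sigma>) x"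
proof -
  define c where "c = (SOME c. c \<in> A i \<and> \<sigma> x \<in> fst c)"
  have "\<exists>c. c \<in> A i \<and> \<sigma> x \<in> fst c" using section_chart_exists[OF \<sigma> x] by blast
  from someI_ex[OF this] have c: "c \<in> A i" "\<sigma> x \<in> fst c" by (auto simp: c_def)
  obtain O' T where O: "open O'" "snd c (\<sigma> x) \<in> O'" "O' \<subseteq> snd c ` fst c" 
    "smooth_on O' (snd d \<circ> proj i 0 \<circ> chart_inv c)"
    and T: "openin (X 0) T" "x \<in> T" "T \<subseteq> V \<inter> fst d" "smooth_on (snd d ` T) (snd c \<circ> \<sigma> \<circ> chart_inv d)"
    "\<forall>y\<in>T. \<sigma> y \<in> fst c" and OT: "\<forall>z\<in>O'. proj i 0 (chart_inv c z) \<in> T \<and> \<sigma> (proj i 0 (chart_inv c z)) = chart_inv c z"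
    by (rule local_section_coordinates[OF le0 \<sigma> x c d])
  obtain T' where T': "openin (X 0) T'" "x \<in> T'" "T' \<subseteq> V \<inter> fst d" "smooth_on (snd d ` T') (u \<circ> \<sigma> \<circ> chart_inv d)"
    by (rule section_smooth[OF le0 \<sigma> x d u])
  let ?p = "proj i 0" and ?\<psi> = "snd d \<circ> proj i 0 \<circ> chart_inv c"
  have p\<sigma>: "?p (\<sigma> x) = x" using \<sigma> x by (simp add: local_section_def)
  have opT: "open (snd d ` T)" by (rule chart_image_open[OF manifold d(1) T(1)]) (use T(3) in blast)
  have opT': "open (snd d ` T')" by (rule chart_image_open[OF manifold d(1) T'(1)]) (use T'(3) in blast)
  \<comment> \<open>Shrinks O' so that its image lies where u composed with the section is known to
    be smooth.\<close>
  define O2 where "O2 = O' \<inter> ?\<psi> -` (snd d ` T')"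
  have O2: "open O2" unfolding O2_def Int_commute[of O']
    using continuous_open_preimage[OF smooth_on_continuous[OF O(4)] O(1) opT'] by (simp add: Int_commute vimage_def)
  have cx: "chart_inv c (snd c (\<sigma> x)) = \<sigma> x" by (rule chart_inv_left[OF manifold c])
  have xO2: "snd c (\<sigma> x) \<in> O2" using O(2) T'(2) by (simp add: O2_def cx p\<sigma>)
  have "chart_laplacian c (pullback_metric ?p (A 0) g) u (\<sigma> x) = chart_laplacian d g (u \<circ> \<sigma>) (?p (\<sigma> x))"
  proof (rule chart_laplacian_pullback[OF manifold g d(1) O2 xO2])
    show "snd c (chart_inv c z) = z" if "z \<in> O2" for z
      by (rule chart_inv_right) (use that O(3) in \<open>auto simp: O2_def\<close>)
    show "?p (chart_inv c z) \<in> fst d" if "z \<in> O2" for z using that OT T(3) by (auto simp: O2_def)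
    show "smooth_on O2 ?\<psi>" by (rule smooth_on_subset[OF O(4)]) (simp add: O2_def)
    show "det (jacobian_matrix ?\<psi> z) \<noteq> 0" if z: "z \<in> O2" for z
    proof (rule jacobian_matrix_left_inverse[OF O(1)])
      show zO: "z \<in> O'" using z by (simp add: O2_def)
      show "?\<psi> differentiable (at z)" by (rule smooth_on_differentiable[OF O(4) zO])
      show "(snd c \<circ> \<sigma> \<circ> chart_inv d) differentiable (at (?\<psi> z))"
        by (rule smooth_on_differentiable[OF T(4)]) (use OT zO in auto)
      show "(snd c \<circ> \<sigma> \<circ> chart_inv d) (?\<psi> y) = y" if y: "y \<in> O'" for y
      proof -
        have "?p (chart_inv c y) \<in> T" "\<sigma> (?p (chart_inv c y)) = chart_inv c y" using OT y by auto
        moreover from this(1) have "chart_inv d (?\<psi> y) = ?p (chart_inv c y)" 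
          using chart_inv_left[OF manifold d(1), of "?p (chart_inv c y)"] T(3) by auto
        ultimately show ?thesis using chart_inv_right[of y c] O(3) y by auto
      qed
    qed
    show "?\<psi> ` O2 \<subseteq> snd d ` T'" by (auto simp: O2_def)
    show "snd d ` T' \<subseteq> snd d ` fst d" using T'(3) by blast
    show "smooth_on (snd d ` T') (u \<circ> \<sigma> \<circ> chart_inv d)" by (rule T'(4))
    show "u (chart_inv c z) = (u \<circ> \<sigma>) (?p (chart_inv c z))" if "z \<in> O2" for z using that OT by (simp add: O2_def)
  qed (use opT' cx in auto)
  thus ?thesis unfolding laplacian_eq_chart_laplacian c_def[symmetric] p\<sigma> .
qed

end

end

section \<open>Leaves of the solenoid\<close>

context covering_tower
begin

abbreviation "leaf x \<equiv> path_component_of_set S x"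
abbreviation "leaf_top x \<equiv> leaf_topology S (leaf x)"

lemma topspace_leaf: "topspace (leaf_top x) \<subseteq> leaf x"
  unfolding leaf_topology_def topology_generated_by_topspace by blast

lemma leaf_subset: "leaf x \<subseteq> topspace S"
  using path_connectedin_subset_topspace[OF path_connectedin_path_component_of] .

lemma leaf_basic_open:
  assumes Q: "openin S Q" and y: "y \<in> Q" "y \<in> leaf x"
  shows "openin (leaf_top x) (path_component_of_set (subtopology S Q) y)" 
    "y \<in> path_component_of_set (subtopology S Q) y" "path_component_of_set (subtopology S Q) y \<subseteq> Q"
proof -
  let ?W = "path_component_of_set (subtopology S Q) y"
  have yt: "y \<in> topspace (subtopology S Q)" using y openin_subset[OF Q] by auto
  thus yW: "y \<in> ?W" by (simp add: path_component_of_refl)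
  have pc: "path_connectedin (subtopology S Q) ?W" by (rule path_connectedin_path_component_of)
  show "?W \<subseteq> Q" using path_connectedin_subset_topspace[OF pc] by simp
  have "path_connectedin S ?W" using pc by (simp add: path_connectedin_subtopology)
  hence "?W \<subseteq> path_component_of_set S y" using yW by (rule path_component_of_maximal)
  also have "path_component_of_set S y = leaf x"
    using y(2) by (metis mem_Collect_eq path_component_of_eq path_component_of_equiv)
  finally have "?W \<subseteq> leaf x" .
  moreover have "?W \<in> path_components_of (subtopology S Q)" 
    unfolding path_component_in_path_components_of by (rule yt)
  ultimately show "openin (leaf_top x) ?W"
    unfolding leaf_topology_def by (intro topology_generated_by_Basis) (use Q in blast)
qed

text \<open>The leaf topology is finer than the induced one: the path component of a point in an
  open preimage is a basic neighbourhood inside that preimage.\<close>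

lemma continuous_leaf:
  assumes f: "continuous_map S Z f"
  shows "continuous_map (leaf_top x) Z f"
  unfolding continuous_map_def
proof (intro conjI allI impI)
  have sub: "topspace (leaf_top x) \<subseteq> topspace S" using topspace_leaf leaf_subset by blast
  show "f \<in> topspace (leaf_top x) \<rightarrow> topspace Z"
    using continuous_map_image_subset_topspace[OF f] sub by blast
  fix U assume U: "openin Z U"
  define Q where "Q = {s \<in> topspace S. f s \<in> U}"
  have Q: "openin S Q" unfolding Q_def by (rule openin_continuous_map_preimage[OF f U])
  show "openin (leaf_top x) {y \<in> topspace (leaf_top x). f y \<in> U}"
  proof (subst openin_subopen, intro ballI)
    fix y assume y: "y \<in> {y \<in> topspace (leaf_top x). f y \<in> U}"
    hence yQ: "y \<in> Q" and yl: "y \<in> leaf x" using sub topspace_leaf by (auto simp only: Q_def)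
    note b = leaf_basic_open[OF Q yQ yl]
    have "path_component_of_set (subtopology S Q) y \<subseteq> {y \<in> topspace (leaf_top x). f y \<in> U}"
    proof
      fix z assume z: "z \<in> path_component_of_set (subtopology S Q) y"
      have "z \<in> topspace (leaf_top x)" using openin_subset[OF b(1)] z by blast
      moreover have "f z \<in> U" using b(3) z unfolding Q_def by blast
      ultimately show "z \<in> {y \<in> topspace (leaf_top x). f y \<in> U}" by simp
    qed
    with b(1,2) show "\<exists>T. openin (leaf_top x) T \<and> y \<in> T \<and> T \<subseteq> {y \<in> topspace (leaf_top x). f y \<in> U}" by blast
  qed
qed

text \<open>A coordinate ball lifts to every level, hence to the solenoid, and its lift through a point is a
  path component of the preimage of the ball.\<close>

lemma leaf_chart_exists:
  assumes x: "x \<in> topspace S"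
  shows "\<exists>c\<in>pullback_atlas (leaf_top x) (solenoid_proj 0) (X 0) (A 0). x \<in> fst c"
proof -
  obtain e where e: "e \<in> A 0" "x 0 \<in> fst e" using chart_exists[OF manifold solenoid_mem[OF x]] by blast
  define a where "a = snd e (x 0)"
  have "a \<in> snd e ` fst e" using e by (simp add: a_def)
  then obtain r where r: "r > 0" "ball a r \<subseteq> snd e ` fst e"
    using chart_open(2)[OF manifold e(1)] open_contains_ball by blast
  define B where "B = ball a r"
  have aB: "a \<in> B" using r(1) by (simp add: B_def)
  have \<beta>: "continuous_map (top_of_set (ball a r)) (X 0) (chart_inv e)"
    by (rule continuous_map_from_subtopology_mono[OF continuous_chart(2)[OF manifold e(1)] r(2)])
  have \<beta>a: "chart_inv e a = x 0" unfolding a_def by (rule chart_inv_left[OF manifold e])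
  have "\<exists>s. continuous_map (top_of_set (ball a r)) (X i) s \<and> s a = x i \<and> (\<forall>b\<in>ball a r. proj i 0 (s b) = chart_inv e b)" for i
  proof -
    have "proj i 0 (x i) = chart_inv e a" using solenoid_compat[OF x, of 0 i] \<beta>a by simp
    then obtain s where "continuous_map (top_of_set (ball a r)) (X i) s" "s a = x i" "\<forall>b\<in>ball a r. proj i 0 (s b) = chart_inv e b"
      by (rule covering_ball_lift[OF top_covering_proj[OF le0] hausdorff \<beta> r(1) solenoid_mem[OF x]])
    thus ?thesis by blast
  qed
  then obtain s where s: "\<And>i. continuous_map (top_of_set B) (X i) (s i)" "\<And>i. s i a = x i" 
    "\<And>i b. b \<in> B \<Longrightarrow> proj i 0 (s i b) = chart_inv e b" unfolding B_def by metis
  have conB: "connected_space (top_of_set B)"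
    using connectedin_iff_connected[of B] by (simp add: B_def connectedin_def del: connectedin_iff_connected)
  have smem: "s i b \<in> topspace (X i)" if "b \<in> B" for i b
    using continuous_map_image_subset_topspace[OF s(1)[of i]] that by auto
  \<comment> \<open>Both sides lift the same map to level 0 and agree at the centre a, so the lifts
    at all levels fit together to a point of the solenoid.\<close>
  have compat: "proj j i (s j b) = s i b" if ij: "i \<le> j" and b: "b \<in> B" for i j b
  proof -
    have "(proj j i \<circ> s j) b = s i b"
    proof (rule lift_unique_proj[OF le0 conB continuous_map_compose[OF s(1) continuous_proj[OF ij]] s(1)])
      fix z assume "z \<in> topspace (top_of_set B)"
      hence z: "z \<in> B" by simp
      have "proj i 0 ((proj j i \<circ> s j) z) = proj j 0 (s j z)" using tower_map_comp[of 0 i j P] ij by simp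
      also have "\<dots> = proj i 0 (s i z)" by (simp add: s(3)[OF z])
      finally show "proj i 0 ((proj j i \<circ> s j) z) = proj i 0 (s i z)" .
    next
      show "(proj j i \<circ> s j) a = s i a" using solenoid_compat[OF x ij] by (simp add: s(2))
      show "a \<in> topspace (top_of_set B)" "b \<in> topspace (top_of_set B)" using aB b by simp_all
    qed
    thus ?thesis by simp
  qed
  define \<Sigma> where "\<Sigma> b = (\<lambda>i. s i b)" for b
  have \<Sigma>S: "\<Sigma> b \<in> topspace S" if "b \<in> B" for b
    using smem[OF that] compat that by (simp add: topspace_solenoid \<Sigma>_def)
  have \<Sigma>0: "\<Sigma> b 0 = chart_inv e b" if "b \<in> B" for b using s(3)[OF that, of 0] by (simp add: \<Sigma>_def)
  have \<Sigma>a: "\<Sigma> a = x" by (simp add: \<Sigma>_def s(2))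
  have \<Sigma>c: "continuous_map (top_of_set B) S \<Sigma>"
  proof -
    have "continuous_map (top_of_set B) (product_topology X UNIV) \<Sigma>"
      unfolding continuous_map_componentwise_UNIV \<Sigma>_def using s(1) by simp
    moreover have "\<Sigma> \<in> topspace (top_of_set B) \<rightarrow> {x. \<forall>i j. i < j \<longrightarrow> proj j i (x j) = x i}"
      using compat by (auto simp: \<Sigma>_def)
    ultimately show ?thesis unfolding solenoid_def continuous_map_in_subtopology by blast
  qed
  have img_pc: "path_connectedin S (\<Sigma> ` D)" if "D \<subseteq> B" "convex D" for D
  proof (rule path_connectedin_continuous_map_image[OF \<Sigma>c])
    show "path_connectedin (top_of_set B) D"
      using that convex_imp_path_connected[OF that(2)] by (simp add: path_connectedin_subtopology)
  qed
  define V where "V = chart_inv e ` B"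
  have eb: "snd e (chart_inv e b) = b" "chart_inv e b \<in> fst e" if "b \<in> B" for b
    using chart_inv_right[of b e] chart_inv_mem[of b e] r(2) that by (auto simp: B_def)
  have V_eq: "V = {y \<in> fst e. snd e y \<in> B}"
  proof (intro set_eqI iffI)
    show "y \<in> {y \<in> fst e. snd e y \<in> B}" if "y \<in> V" for y
    proof -
      obtain b where "b \<in> B" "y = chart_inv e b" using \<open>y \<in> V\<close> unfolding V_def by blast
      thus ?thesis using eb by simp
    qed
    show "y \<in> V" if "y \<in> {y \<in> fst e. snd e y \<in> B}" for y
      unfolding V_def using chart_inv_left[OF manifold e(1), of y] that by (intro image_eqI[of _ _ "snd e y"]) simp_all
  qed
  have V: "openin (X 0) V"
  proof -
    have "openin (subtopology (X 0) (fst e)) {y \<in> topspace (subtopology (X 0) (fst e)). snd e y \<in> B}"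
      by (rule openin_continuous_map_preimage[OF continuous_chart(1)[OF manifold e(1)]]) (simp add: B_def)
    moreover have "topspace (subtopology (X 0) (fst e)) = fst e" using chart_open(3)[OF manifold e(1)] by auto
    ultimately have "openin (subtopology (X 0) (fst e)) V" by (simp only: V_eq)
    thus ?thesis by (rule openin_trans_full[OF _ chart_open(1)[OF manifold e(1)]])
  qed
  define Q where "Q = {y \<in> topspace S. solenoid_proj 0 y \<in> V}"
  have Q: "openin S Q" unfolding Q_def by (rule openin_continuous_map_preimage[OF continuous_solenoid_proj V])
  define W where "W = \<Sigma> ` B"
  have WQ: "W \<subseteq> Q" using \<Sigma>S \<Sigma>0 by (auto simp: W_def Q_def V_def solenoid_proj_def)
  have xW: "x \<in> W" unfolding W_def using \<Sigma>a aB by (metis image_eqI)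
  have pcW: "path_connectedin (subtopology S Q) W"
    unfolding path_connectedin_subtopology using WQ img_pc[of B] by (simp add: W_def B_def)
  \<comment> \<open>On a connected set C in Q through x, each coordinate and the lift s i of the
    base coordinate lift the same map and agree at x, so C stays inside the lifted ball.\<close>
  have W_comp: "path_component_of_set (subtopology S Q) x = W"
  proof (rule path_component_of_unique[OF xW pcW])
    fix C assume xC: "x \<in> C" and C: "path_connectedin (subtopology S Q) C"
    hence CQ: "C \<subseteq> Q" and "connectedin S C" 
      using path_connectedin_imp_connectedin by (auto simp: path_connectedin_subtopology)
    hence CS: "C \<subseteq> topspace S" "connected_space (subtopology S C)" by (auto simp: connectedin_def)
    have tC: "topspace (subtopology S C) = C" using CS(1) by auto
    have c0: "continuous_map (subtopology S C) (top_of_set B) (\<lambda>y. snd e (y 0))"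
    proof -
      have "continuous_map (subtopology S C) (subtopology (X 0) (fst e)) (solenoid_proj 0)"
        using continuous_map_from_subtopology[OF continuous_solenoid_proj[of 0], of C] CQ tC
        by (auto simp: continuous_map_in_subtopology Q_def V_eq)
      from continuous_map_compose[OF this continuous_chart(1)[OF manifold e(1)]]
      have "continuous_map (subtopology S C) euclidean (\<lambda>y. snd e (y 0))" by (simp add: comp_def solenoid_proj_def)
      thus ?thesis using CQ tC by (auto simp: continuous_map_in_subtopology Q_def V_eq solenoid_proj_def)
    qed
    show "C \<subseteq> W"
    proof
      fix y assume y: "y \<in> C"
      have bB: "snd e (z 0) \<in> B" "chart_inv e (snd e (z 0)) = z 0" if "z \<in> C" for z
      proof -
        have "z 0 \<in> V" using CQ that by (auto simp: Q_def solenoid_proj_def)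
        thus "snd e (z 0) \<in> B" "chart_inv e (snd e (z 0)) = z 0"
          using chart_inv_left[OF manifold e(1), of "z 0"] by (auto simp: V_eq)
      qed
      have y_eq: "solenoid_proj i y = (s i \<circ> (\<lambda>y. snd e (y 0))) y" for i
      proof (rule lift_unique_proj[OF le0 CS(2) continuous_map_from_subtopology[OF continuous_solenoid_proj] 
            continuous_map_compose[OF c0 s(1)]])
        fix z assume "z \<in> topspace (subtopology S C)"
        hence z: "z \<in> C" by (simp only: tC)
        have "proj i 0 (z i) = z 0" using solenoid_compat[of z 0 i] CS(1) z by auto
        thus "proj i 0 (solenoid_proj i z) = proj i 0 ((s i \<circ> (\<lambda>y. snd e (y 0))) z)"
          using s(3)[OF bB(1)[OF z], of i] bB(2)[OF z] by (simp add: solenoid_proj_def)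
      next
        show "solenoid_proj i x = (s i \<circ> (\<lambda>y. snd e (y 0))) x" using s(2)[of i] by (simp add: solenoid_proj_def a_def)
      qed (simp_all only: tC xC y)
      have "y = \<Sigma> (snd e (y 0))" 
        unfolding \<Sigma>_def using y_eq[unfolded solenoid_proj_def comp_def] by (rule ext)
      thus "y \<in> W" unfolding W_def using bB(1)[OF y] by blast
    qed
  qed
  have xl: "x \<in> leaf x" using x by (simp add: path_component_of_refl)
  have xQ: "x \<in> Q" using xW WQ by blast
  have Wo: "openin (leaf_top x) W" using leaf_basic_open(1)[OF Q xQ xl] unfolding W_comp .
  \<comment> \<open>Small balls have path-connected images inside U, so the image of one that meets
    the path component W' lies in it.\<close>
  have \<Sigma>leaf: "continuous_map (top_of_set B) (leaf_top x) \<Sigma>"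
    unfolding leaf_topology_def
  proof (rule continuous_on_generated_topo)
    let ?basis = "{W. \<exists>U. openin S U \<and> W \<in> path_components_of (subtopology S U) \<and> W \<subseteq> leaf x}"
    have "topspace (leaf_top x) = \<Union>?basis" unfolding leaf_topology_def by simp
    thus "\<Sigma> ` topspace (top_of_set B) \<subseteq> \<Union>?basis" using openin_subset[OF Wo] by (simp add: W_def)
    fix W' assume "W' \<in> ?basis"
    then obtain U where U: "openin S U" "W' \<in> path_components_of (subtopology S U)" by blast
    have W'U: "W' \<subseteq> U" using path_components_of_subset[OF U(2)] by simp
    have op: "open {b \<in> B. \<Sigma> b \<in> U}"
      using openin_continuous_map_preimage[OF \<Sigma>c U(1)] by (simp add: B_def openin_open_eq)
    have "open (\<Sigma> -` W' \<inter> B)"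
      unfolding open_contains_ball
    proof
      fix b assume b: "b \<in> \<Sigma> -` W' \<inter> B"
      hence "b \<in> {b \<in> B. \<Sigma> b \<in> U}" using W'U by auto
      then obtain d where d: "d > 0" "ball b d \<subseteq> {b \<in> B. \<Sigma> b \<in> U}" using op open_contains_ball by metis
      have "path_connectedin (subtopology S U) (\<Sigma> ` ball b d)"
        unfolding path_connectedin_subtopology using img_pc[of "ball b d"] d(2) by auto
      moreover have "\<not> disjnt W' (\<Sigma> ` ball b d)" using b d(1) by (auto simp: disjnt_iff)
      ultimately have "\<Sigma> ` ball b d \<subseteq> W'" by (rule path_components_of_maximal[OF U(2)])
      thus "\<exists>d>0. ball b d \<subseteq> \<Sigma> -` W' \<inter> B" using d by blast
    qed
    thus "openin (top_of_set B) (\<Sigma> -` W' \<inter> topspace (top_of_set B))" by (simp add: B_def openin_open_eq)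
  qed
  have imW: "solenoid_proj 0 ` W = V"
    using \<Sigma>0 unfolding W_def V_def image_image by (intro image_cong) (simp_all add: solenoid_proj_def)
  have tW: "topspace (subtopology (leaf_top x) W) = W" "topspace (subtopology (X 0) V) = V" 
    using openin_subset[OF Wo] openin_subset[OF V] by auto
  have "homeomorphic_maps (subtopology (leaf_top x) W) (subtopology (X 0) V) (solenoid_proj 0) (\<Sigma> \<circ> snd e)"
    unfolding homeomorphic_maps_def
  proof (intro conjI ballI)
    show "continuous_map (subtopology (leaf_top x) W) (subtopology (X 0) V) (solenoid_proj 0)"
      using continuous_map_from_subtopology[OF continuous_leaf[OF continuous_solenoid_proj]] imW tW
      by (auto simp: continuous_map_in_subtopology)
    have "continuous_map (subtopology (X 0) V) (top_of_set B) (snd e)"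
      using continuous_map_from_subtopology_mono[OF continuous_chart(1)[OF manifold e(1)], of V] tW
      by (auto simp: continuous_map_in_subtopology V_eq)
    from continuous_map_compose[OF this \<Sigma>leaf]
    show "continuous_map (subtopology (X 0) V) (subtopology (leaf_top x) W) (\<Sigma> \<circ> snd e)"
      using tW by (auto simp: continuous_map_in_subtopology W_def V_eq)
  next
    fix y assume "y \<in> topspace (subtopology (leaf_top x) W)"
    hence "y \<in> W" by (simp only: tW)
    then obtain b where b: "b \<in> B" "y = \<Sigma> b" unfolding W_def by blast
    thus "(\<Sigma> \<circ> snd e) (solenoid_proj 0 y) = y" using \<Sigma>0 eb by (simp add: solenoid_proj_def)
  next
    fix y assume "y \<in> topspace (subtopology (X 0) V)"
    hence "y \<in> V" by (simp only: tW)
    then obtain b where b: "b \<in> B" "y = chart_inv e b" unfolding V_def by blast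
    thus "solenoid_proj 0 ((\<Sigma> \<circ> snd e) y) = y" using \<Sigma>0 eb by (simp add: solenoid_proj_def)
  qed
  hence "homeomorphic_map (subtopology (leaf_top x) W) (subtopology (X 0) (solenoid_proj 0 ` W)) (solenoid_proj 0)"
    unfolding imW by (rule homeomorphic_maps_imp_map)
  moreover have "(fst e, snd e) \<in> A 0" using e by simp
  moreover have "solenoid_proj 0 ` W \<subseteq> fst e" unfolding imW V_eq by blast
  moreover have "openin (X 0) (solenoid_proj 0 ` W)" unfolding imW by (rule V)
  ultimately have "(W, snd e \<circ> solenoid_proj 0) \<in> pullback_atlas (leaf_top x) (solenoid_proj 0) (X 0) (A 0)"
    using Wo unfolding pullback_atlas_def by blast
  thus ?thesis using xW by (intro bexI[of _ "(W, snd e \<circ> solenoid_proj 0)"]) simp_all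
qed

text \<open>By \<open>leaf_chart_exists\<close> the chart picked on the leaf is a genuine one, with
  domain mapped homeomorphically to an open set of level 0. The i-th coordinate of the inverse is a
  local section of level i, and both Laplacians reduce to the Laplacian of u composed with it in a
  chart of level 0.\<close>

lemma leafwise_laplacian_pullback:
  assumes g: "riemannian_metric (A 0) g" and u: "smooth_function i u" and x: "x \<in> topspace S"
  shows "leafwise_laplacian X A P g (u \<circ> solenoid_proj i) x = level_laplacian g i u (x i)"
proof -
  let ?B = "pullback_atlas (leaf_top x) (solenoid_proj 0) (X 0) (A 0)"
  define c where "c = (SOME c. c \<in> ?B \<and> x \<in> fst c)"
  have "\<exists>c. c \<in> ?B \<and> x \<in> fst c" using leaf_chart_exists[OF x] by blast
  from someI_ex[OF this] have c: "c \<in> ?B" "x \<in> fst c" by (auto simp: c_def)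
  obtain W U \<phi> where cW: "c = (W, \<phi> \<circ> solenoid_proj 0)" and e: "(U, \<phi>) \<in> A 0" and W: "openin (leaf_top x) W"
    and V: "openin (X 0) (solenoid_proj 0 ` W)" and VU: "solenoid_proj 0 ` W \<subseteq> U"
    and hom: "homeomorphic_map (subtopology (leaf_top x) W) (subtopology (X 0) (solenoid_proj 0 ` W)) (solenoid_proj 0)"
    using c(1) unfolding pullback_atlas_def by blast
  have xW: "x \<in> W" using c(2) cW by simp
  have WS: "W \<subseteq> topspace S" using openin_subset[OF W] topspace_leaf leaf_subset by blast
  note sec = sheet_section[OF hom W V]
  define V where "V = solenoid_proj 0 ` W"
  define \<sigma> where "\<sigma> = inv_into W (solenoid_proj 0)"
  have \<sigma>W: "\<sigma> z \<in> W" "\<sigma> z 0 = z" if "z \<in> V" for z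
    using inv_into_into[of z "solenoid_proj 0" W] f_inv_into_f[of z "solenoid_proj 0" W] that
    by (auto simp: \<sigma>_def V_def solenoid_proj_def)
  have \<sigma>x: "\<sigma> (x 0) = x" using inv_into_f_f[OF sec(1) xW] by (simp add: \<sigma>_def solenoid_proj_def)
  have xV: "x 0 \<in> V" using xW by (auto simp: V_def solenoid_proj_def)
  define \<tau> where "\<tau> z = \<sigma> z i" for z
  have \<tau>: "local_section i 0 V \<tau>"
    unfolding local_section_def
  proof (intro conjI ballI)
    show "openin (X 0) V" using V by (simp add: V_def)
    have "continuous_map (subtopology (X 0) V) (leaf_top x) \<sigma>"
      unfolding \<sigma>_def V_def by (rule continuous_map_into_fulltopology[OF sec(3)])
    from continuous_map_compose[OF this continuous_leaf[OF continuous_solenoid_proj[of i]]]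
    show "continuous_map (subtopology (X 0) V) (X i) \<tau>" by (simp add: \<tau>_def[abs_def] comp_def solenoid_proj_def)
    show "proj i 0 (\<tau> z) = z" if "z \<in> V" for z
      using solenoid_compat[of "\<sigma> z" 0 i] \<sigma>W[OF that] WS by (auto simp: \<tau>_def)
  qed
  obtain d where d: "d \<in> A 0" "x 0 \<in> fst d" using chart_exists[OF manifold solenoid_mem[OF x]] by blast
  obtain T where T: "openin (X 0) T" "x 0 \<in> T" "T \<subseteq> V \<inter> fst d" "smooth_on (snd d ` T) (u \<circ> \<tau> \<circ> chart_inv d)"
    by (rule section_smooth[OF le0 \<tau> xV d u])
  let ?e = "(U, \<phi>)"
  have TU: "T \<subseteq> fst ?e" using T(3) VU by (auto simp: V_def)
  have opT: "open (\<phi> ` T)" using chart_image_open[OF manifold e T(1) TU] by simp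
  have opT': "open (snd d ` T)" by (rule chart_image_open[OF manifold d(1) T(1)]) (use T(3) in blast)
  have \<phi>inv: "chart_inv ?e (\<phi> t) = t" if "t \<in> T" for t
    using chart_inv_left[OF manifold e, of t] TU that by auto
  \<comment> \<open>Read through \<phi>, the inverse of the leaf chart is the section \<sigma>, so
    its transition to d is an ordinary transition map of level 0.\<close>
  have cinv: "chart_inv c (\<phi> t) = \<sigma> t" if t: "t \<in> T" for t
  proof -
    have tV: "t \<in> V" using T(3) t by blast
    have "inj_on (\<phi> \<circ> solenoid_proj 0) W"
    proof (rule comp_inj_on[OF sec(1)], rule inj_onI)
      fix y z assume "y \<in> solenoid_proj 0 ` W" "z \<in> solenoid_proj 0 ` W" "\<phi> y = \<phi> z"
      moreover from this have "y \<in> U" "z \<in> U" using VU by blast+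
      ultimately show "y = z" using chart_inv_left[OF manifold e, of y] chart_inv_left[OF manifold e, of z] by simp
    qed
    from inv_into_f_f[OF this \<sigma>W(1)[OF tV]] show ?thesis
      using \<sigma>W(2)[OF tV] by (simp add: chart_inv_def cW solenoid_proj_def)
  qed
  have pt: "solenoid_proj 0 (\<sigma> t) = t" if "t \<in> T" for t using \<sigma>W(2)[of t] T(3) that by (auto simp: solenoid_proj_def)
  let ?\<psi> = "snd d \<circ> solenoid_proj 0 \<circ> chart_inv c"
  have \<psi>: "(snd d \<circ> chart_inv ?e) z = ?\<psi> z" if "z \<in> \<phi> ` T" for z
    using that by (auto simp: \<phi>inv cinv pt)
  have sm: "smooth_on (\<phi> ` T) (snd d \<circ> chart_inv ?e)"
    by (rule smooth_on_subset[OF smooth_transition[OF manifold e d(1)]]) (use TU T(3) in auto)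
  have sm': "smooth_on (snd d ` T) (\<phi> \<circ> chart_inv d)"
    using smooth_on_subset[OF smooth_transition[OF manifold d(1) e], of "snd d ` T"] TU T(3) by auto
  have dinv: "chart_inv d (snd d t) = t" if "t \<in> T" for t
    using chart_inv_left[OF manifold d(1), of t] T(3) that by auto
  have "chart_laplacian c (pullback_metric (solenoid_proj 0) (A 0) g) (u \<circ> solenoid_proj i) x 
      = chart_laplacian d g (u \<circ> \<tau>) (solenoid_proj 0 x)"
  proof (rule chart_laplacian_pullback[OF manifold g d(1) opT])
    show "snd c x \<in> \<phi> ` T" using T(2) by (simp add: cW solenoid_proj_def)
    show "chart_inv c (snd c x) = x" using cinv[OF T(2)] by (simp add: cW solenoid_proj_def \<sigma>x[unfolded solenoid_proj_def])
    show "snd c (chart_inv c z) = z" if "z \<in> \<phi> ` T" for z using that by (auto simp: cinv) (simp add: cW pt)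
    show "solenoid_proj 0 (chart_inv c z) \<in> fst d" if "z \<in> \<phi> ` T" for z using that T(3) by (auto simp: cinv pt)
    show "smooth_on (\<phi> ` T) ?\<psi>" by (rule smooth_on_eq[OF opT sm \<psi>])
    show "det (jacobian_matrix ?\<psi> z) \<noteq> 0" if z: "z \<in> \<phi> ` T" for z
    proof -
      have "det (jacobian_matrix (snd d \<circ> chart_inv ?e) z) \<noteq> 0"
      proof (rule jacobian_matrix_left_inverse[OF opT z])
        show "(\<phi> \<circ> chart_inv d) ((snd d \<circ> chart_inv ?e) y) = y" if "y \<in> \<phi> ` T" for y
          using that by (auto simp: \<phi>inv dinv)
        show "(snd d \<circ> chart_inv ?e) differentiable (at z)" by (rule smooth_on_differentiable[OF sm z])
        show "(\<phi> \<circ> chart_inv d) differentiable (at ((snd d \<circ> chart_inv ?e) z))"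
          by (rule smooth_on_differentiable[OF sm']) (use z in \<open>auto simp: \<phi>inv\<close>)
      qed
      moreover have "jacobian_matrix (snd d \<circ> chart_inv ?e) z = jacobian_matrix ?\<psi> z"
        by (rule jacobian_matrix_cong_open[OF opT z]) (rule \<psi>)
      ultimately show ?thesis by (simp only: not_False_eq_True)
    qed
    show "?\<psi> ` \<phi> ` T \<subseteq> snd d ` T" by (auto simp: cinv pt)
    show "(u \<circ> solenoid_proj i) (chart_inv c z) = (u \<circ> \<tau>) (solenoid_proj 0 (chart_inv c z))" if "z \<in> \<phi> ` T" for z
      using that by (auto simp: cinv pt) (simp add: \<tau>_def solenoid_proj_def)
  qed (use opT' T in auto)
  also have "\<dots> = level_laplacian g i u (\<tau> (x 0))"
    using level_laplacian_section[OF g \<tau> xV d u] by (simp add: solenoid_proj_def)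
  also have "\<tau> (x 0) = x i" by (simp add: \<tau>_def \<sigma>x)
  finally show ?thesis
    unfolding leafwise_laplacian_def Let_def laplacian_eq_chart_laplacian c_def .
qed

section \<open>Averaging over deck groups\<close>

text \<open>The sum runs over a fibre instead of the deck group to obtain a function on level i; the
  two sums agree by \<open>deck_bij_fiber\<close>.\<close>

definition "avg j i u x = (1 / of_nat (card (deck j i))) * (\<Sum>y\<in>{y \<in> topspace (X j). proj j i y = x}. u y)"
  for u :: "'a \<Rightarrow> complex"

lemma avg_proj:
  assumes "i \<le> j" "y \<in> topspace (X j)"
  shows "avg j i u (proj j i y) = (1 / of_nat (card (deck j i))) * (\<Sum>h\<in>deck j i. u (h y))"
  unfolding avg_def using sum.reindex_bij_betw[OF deck_bij_fiber[OF assms], of u] by simp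

lemma local_section_deck:
  assumes \<sigma>: "local_section j k V \<sigma>" and h: "h \<in> deck j i" and "k \<le> i" "i \<le> j"
  shows "local_section j k V (h \<circ> \<sigma>)"
  unfolding local_section_def
proof (intro conjI ballI)
  show "openin (X k) V" using \<sigma> by (simp add: local_section_def)
  show "continuous_map (subtopology (X k) V) (X j) (h \<circ> \<sigma>)"
    by (rule continuous_map_compose[OF _ deck_mem(4)[OF h]]) (use \<sigma> in \<open>simp add: local_section_def\<close>)
  fix x assume x: "x \<in> V"
  have "proj j k (h (\<sigma> x)) = proj i k (proj j i (h (\<sigma> x)))" using tower_map_comp[OF assms(3,4), of P] by simp
  also have "\<dots> = proj i k (proj j i (\<sigma> x))" using deck_mem(2)[OF h local_section_mem[OF \<sigma> x]] by simp
  also have "\<dots> = proj j k (\<sigma> x)" using tower_map_comp[OF assms(3,4), of P] by simp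
  also have "\<dots> = x" using \<sigma> x by (simp add: local_section_def)
  finally show "proj j k ((h \<circ> \<sigma>) x) = x" by simp
qed

lemma local_section_proj:
  assumes \<sigma>: "local_section j k V \<sigma>" and "k \<le> i" "i \<le> j"
  shows "local_section i k V (proj j i \<circ> \<sigma>)"
  unfolding local_section_def
proof (intro conjI ballI)
  show "openin (X k) V" using \<sigma> by (simp add: local_section_def)
  show "continuous_map (subtopology (X k) V) (X i) (proj j i \<circ> \<sigma>)"
    by (rule continuous_map_compose[OF _ continuous_proj[OF assms(3)]]) (use \<sigma> in \<open>simp add: local_section_def\<close>)
  fix x assume x: "x \<in> V"
  thus "proj i k ((proj j i \<circ> \<sigma>) x) = x" using tower_map_comp[OF assms(2,3), of P] \<sigma> by (simp add: local_section_def)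
qed

text \<open>Near x the average is a finite sum of u composed with the deck translates of one local
  section; finiteness of the deck group gives a common neighbourhood.\<close>

lemma avg_smooth:
  assumes ij: "i \<le> j" and u: "smooth_function j u"
  shows "smooth_function i (avg j i u)"
  unfolding smooth_function_def
proof (intro ballI smooth_on_local)
  fix c z assume c: "c \<in> A i" and "z \<in> snd c ` fst c"
  then obtain x where x: "x \<in> fst c" "z = snd c x" by blast
  have xX: "x \<in> topspace (X i)" using x(1) chart_open(3)[OF manifold c] by blast
  obtain y where y: "y \<in> topspace (X j)" "proj j i y = x" using proj_surj[OF ij xX] by blast
  obtain V \<sigma> where "local_section j i V \<sigma>" "proj j i y \<in> V" "\<sigma> (proj j i y) = y"
    by (rule local_section_exists[OF ij y(1)])
  hence \<sigma>: "local_section j i V \<sigma>" and xV: "x \<in> V" by (simp_all add: y(2))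
  have "\<exists>T. openin (X i) T \<and> x \<in> T \<and> T \<subseteq> V \<inter> fst c \<and> smooth_on (snd c ` T) (u \<circ> (h \<circ> \<sigma>) \<circ> chart_inv c)" 
    if h: "h \<in> deck j i" for h
    by (rule section_smooth[OF ij local_section_deck[OF \<sigma> h order.refl ij] xV c x(1) u]) blast
  then obtain T where T: "\<And>h. h \<in> deck j i \<Longrightarrow> openin (X i) (T h) \<and> x \<in> T h \<and> T h \<subseteq> V \<inter> fst c \<and> 
      smooth_on (snd c ` T h) (u \<circ> (h \<circ> \<sigma>) \<circ> chart_inv c)" by metis
  define T' where "T' = (\<Inter>h\<in>deck j i. T h)"
  have T': "openin (X i) T'" unfolding T'_def
    by (rule openin_INT2[OF finite_deck[OF ij] deck_nonempty[OF ij]]) (use T in blast)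
  have xT: "x \<in> T'" using T by (simp add: T'_def)
  obtain h0 where "h0 \<in> deck j i" using deck_nonempty[OF ij] by blast
  hence T'V: "T' \<subseteq> V \<inter> fst c" using T[of h0] by (auto simp: T'_def)
  have op: "open (snd c ` T')" by (rule chart_image_open[OF manifold c T']) (use T'V in blast)
  let ?n = "1 / of_nat (card (deck j i)) :: complex"
  have "smooth_on (snd c ` T') (\<lambda>z. ?n * (\<Sum>h\<in>deck j i. (u \<circ> (h \<circ> \<sigma>) \<circ> chart_inv c) z))"
  proof (rule smooth_on_bounded_linear[OF bounded_linear_mult_right op], rule smooth_on_sum[OF op finite_deck[OF ij]])
    fix h assume h: "h \<in> deck j i"
    show "smooth_on (snd c ` T') (u \<circ> (h \<circ> \<sigma>) \<circ> chart_inv c)"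
      by (rule smooth_on_subset[of "snd c ` T h"]) (use T[OF h] h in \<open>auto simp: T'_def\<close>)
  qed
  moreover have "?n * (\<Sum>h\<in>deck j i. (u \<circ> (h \<circ> \<sigma>) \<circ> chart_inv c) w) = (avg j i u \<circ> chart_inv c) w" if w: "w \<in> snd c ` T'" for w
  proof -
    obtain t where t: "t \<in> T'" "w = snd c t" using w by blast
    have tV: "t \<in> V" and cw: "chart_inv c w = t" using t T'V chart_inv_left[OF manifold c, of t] by auto
    have "proj j i (\<sigma> t) = t" using \<sigma> tV by (simp add: local_section_def)
    thus ?thesis using avg_proj[OF ij local_section_mem[OF \<sigma> tV], of u] by (simp add: cw)
  qed
  ultimately have "smooth_on (snd c ` T') (avg j i u \<circ> chart_inv c)" by (rule smooth_on_eq[OF op])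
  thus "\<exists>T. open T \<and> z \<in> T \<and> smooth_on T (avg j i u \<circ> chart_inv c)" using op xT x(2) by blast
qed

text \<open>The average can be nonzero only on the image of the support of u, which is compact and,
  in a Hausdorff space, closed.\<close>

lemma avg_compact_support:
  assumes ij: "i \<le> j" and u: "u \<in> smooth_compact_support (X j) (A j)"
  shows "avg j i u \<in> smooth_compact_support (X i) (A i)"
proof -
  define K where "K = X j closure_of {x \<in> topspace (X j). u x \<noteq> 0}"
  have K: "compactin (X j) K" and sm: "smooth_function j u"
    using u by (auto simp: smooth_compact_support_def K_def smooth_function_def)
  have sub: "{x \<in> topspace (X i). avg j i u x \<noteq> 0} \<subseteq> proj j i ` K"
  proof
    fix x assume "x \<in> {x \<in> topspace (X i). avg j i u x \<noteq> 0}"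
    hence "(\<Sum>y\<in>{y \<in> topspace (X j). proj j i y = x}. u y) \<noteq> 0" by (auto simp: avg_def)
    then obtain y where y: "y \<in> topspace (X j)" "proj j i y = x" "u y \<noteq> 0"
      by (metis (mono_tags, lifting) mem_Collect_eq sum.neutral)
    have "y \<in> K" unfolding K_def using closure_of_subset[of "{x \<in> topspace (X j). u x \<noteq> 0}" "X j"] y by auto
    thus "x \<in> proj j i ` K" using y(2) by blast
  qed
  have cK: "compactin (X i) (proj j i ` K)" by (rule image_compactin[OF K continuous_proj[OF ij]])
  have "closedin (X i) (proj j i ` K)" by (rule compactin_imp_closedin[OF hausdorff cK])
  hence "X i closure_of {x \<in> topspace (X i). avg j i u x \<noteq> 0} \<subseteq> proj j i ` K" by (rule closure_of_minimal[OF sub])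
  hence "compactin (X i) (X i closure_of {x \<in> topspace (X i). avg j i u x \<noteq> 0})"
    by (rule closed_compactin[OF cK _ closedin_closure_of])
  thus ?thesis using avg_smooth[OF ij sm] by (simp add: smooth_compact_support_def smooth_function_def)
qed

text \<open>Through a local section over level 0 both sides are read in a single chart, where the
  average becomes a finite linear combination of smooth functions. Hence the sections go down to
  level 0 and not just to level i.\<close>

lemma level_laplacian_avg:
  assumes g: "riemannian_metric (A 0) g" and ij: "i \<le> j" and u: "smooth_function j u" and y: "y \<in> topspace (X j)"
  shows "level_laplacian g i (avg j i u) (proj j i y) = 
    (1 / of_nat (card (deck j i))) * (\<Sum>h\<in>deck j i. level_laplacian g j u (h y))"
proof -
  obtain V \<sigma> where \<sigma>: "local_section j 0 V \<sigma>" and x: "proj j 0 y \<in> V" and \<sigma>y: "\<sigma> (proj j 0 y) = y"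
    by (rule local_section_exists[OF le0 y])
  define x where "x = proj j 0 y"
  have xV: "x \<in> V" and \<sigma>x: "\<sigma> x = y" using x \<sigma>y by (simp_all add: x_def)
  have V: "openin (X 0) V" using \<sigma> by (simp add: local_section_def)
  obtain d where d: "d \<in> A 0" "x \<in> fst d" using chart_exists[OF manifold proj_mem[OF le0 y]] unfolding x_def by blast
  let ?n = "1 / of_nat (card (deck j i)) :: complex"
  note sh = local_section_deck[OF \<sigma> _ le0 ij]
  have "level_laplacian g i (avg j i u) ((proj j i \<circ> \<sigma>) x) = chart_laplacian d g (avg j i u \<circ> (proj j i \<circ> \<sigma>)) x"
    by (rule level_laplacian_section[OF g local_section_proj[OF \<sigma> le0 ij] xV d avg_smooth[OF ij u]])
  also have "\<dots> = chart_laplacian d g (\<lambda>z. ?n * (\<Sum>h\<in>deck j i. (u \<circ> (h \<circ> \<sigma>)) z)) x"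
    by (rule chart_laplacian_cong[OF manifold d(1) V xV d(2)]) 
      (simp add: avg_proj[OF ij local_section_mem[OF \<sigma>]])
  also have "\<dots> = ?n * (\<Sum>h\<in>deck j i. chart_laplacian d g (u \<circ> (h \<circ> \<sigma>)) x)"
  proof (rule chart_laplacian_sum[OF manifold g d finite_deck[OF ij]])
    fix h assume h: "h \<in> deck j i"
    obtain T where T: "openin (X 0) T" "x \<in> T" "T \<subseteq> V \<inter> fst d" "smooth_on (snd d ` T) (u \<circ> (h \<circ> \<sigma>) \<circ> chart_inv d)"
      by (rule section_smooth[OF le0 sh[OF h] xV d u])
    have "open (snd d ` T)" by (rule chart_image_open[OF manifold d(1) T(1)]) (use T(3) in blast)
    thus "\<exists>T. open T \<and> snd d x \<in> T \<and> smooth_on T (u \<circ> (h \<circ> \<sigma>) \<circ> chart_inv d)" using T by blast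
  qed
  also have "(\<Sum>h\<in>deck j i. chart_laplacian d g (u \<circ> (h \<circ> \<sigma>)) x) = (\<Sum>h\<in>deck j i. level_laplacian g j u (h y))"
  proof (rule sum.cong[OF refl])
    fix h assume h: "h \<in> deck j i"
    show "chart_laplacian d g (u \<circ> (h \<circ> \<sigma>)) x = level_laplacian g j u (h y)"
      using level_laplacian_section[OF g sh[OF h] xV d u] by (simp add: \<sigma>x)
  qed
  finally show ?thesis by (simp add: \<sigma>x)
qed

end

section \<open>The resolution of the identity of the leaf-wise Laplacian\<close>

theorem theorem4p6:
  fixes X :: "nat \<Rightarrow> 'a topology"
    and A :: "nat \<Rightarrow> ('a, 'n::finite) chart set"
    and P :: "nat \<Rightarrow> 'a \<Rightarrow> 'a"
    and g :: "('a, 'n) metric_tensor"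
    and \<mu> :: "'a measure"
    and H :: "(nat \<Rightarrow> 'a \<Rightarrow> 'a) measure"
    and \<Delta> :: "nat \<Rightarrow> 'a operator_graph"
    and \<Delta>inf :: "(nat \<Rightarrow> 'a) operator_graph"
    and E :: "nat \<Rightarrow> real set \<Rightarrow> ('a \<Rightarrow> complex) \<Rightarrow> 'a \<Rightarrow> complex"
    and Einf :: "real set \<Rightarrow> ((nat \<Rightarrow> 'a) \<Rightarrow> complex) \<Rightarrow> (nat \<Rightarrow> 'a) \<Rightarrow> complex"
  assumes "\<And>i. smooth_manifold (X i) (A i)"
    and "\<And>i. connected_space (X i)"
    and "\<And>i. topspace (X i) \<noteq> {}"
    and "\<And>i j. i < j \<Longrightarrow> regular_finite_covering (X j) (A j) (X i) (A i) (tower_map P j i)"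
    and "complete_riemannian_metric (X 0) (A 0) g"
    and "riemannian_volume (X 0) (A 0) g \<mu>"
    and "normalized_haar_measure (solenoid_group X P) (solenoid_group_mult X) H"
    and "\<And>i. unique_self_adjoint_extension (level_measure X P \<mu> i)
               (level_laplacian_graph X A P g i) (\<Delta> i)"
    and "unique_self_adjoint_extension (solenoid_measure X P \<mu> H)
           (leafwise_laplacian_graph X A P g) \<Delta>inf"
    and "\<And>i. resolution_of_identity (level_measure X P \<mu> i) (\<Delta> i) (E i)"
    and "resolution_of_identity (solenoid_measure X P \<mu> H) \<Delta>inf Einf"
  shows "\<forall>\<omega>\<in>sets lebesgue. \<forall>f\<in>L2_space (solenoid_measure X P \<mu> H).
           (\<lambda>n. L2_norm (solenoid_measure X P \<mu> H)
                  (\<lambda>x. Einf \<omega> f x -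
                       (\<Sum>i<n. (E i \<omega> (new_component X P \<mu> H i f) \<circ> solenoid_proj i) x)))
             \<longlonglongrightarrow> 0"
proof -
  interpret covering_tower X A P by unfold_locales (fact assms)+
  have g: "riemannian_metric (A 0) g" using assms(5) by (simp add: complete_riemannian_metric_def)
  have \<mu>: "sets \<mu> = sets (borel_of (X 0))" using assms(6) by (simp add: riemannian_volume_def)
  let ?M = "solenoid_measure X P \<mu> H" and ?N = "level_measure X P \<mu>"
  show ?thesis
  proof (cases rule: solenoid_measure_cases[OF assms(7) \<mu>])
    case 1
    \<comment> \<open>For the null measure all norms vanish.\<close>
    thus ?thesis by (simp add: null_measure_L2_norm)
  next
    case 2
    note mp = this
    interpret L2_tower ?M ?N solenoid_proj P
    proof (rule L2_tower.intro)
      show "measure_preserving ?M (?N i) (solenoid_proj i)" for i by (rule mp)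
      show "measure_preserving (?N (Suc i)) (?N i) (P i)" for i
        using proj_measure_preserving[OF assms(7) \<mu> mp, of i "Suc i"] by (simp add: tower_map_step)
      show "P i (solenoid_proj (Suc i) x) = solenoid_proj i x" if "x \<in> space ?M" for i x
        using solenoid_compat[of x i "Suc i"] that space_M[OF assms(7) \<mu>] by (simp add: tower_map_step solenoid_proj_def)
    qed
    \<comment> \<open>Identifies the concrete increments with those of the abstract tower, whose
      measures and maps are now instantiated.\<close>
    have new: "new_space X P \<mu> i = new i" for i by (cases i) (simp_all add: new_def)
    have component: "new_component X P \<mu> H i f = component i f" for i f
      by (simp add: new_component_def component_def new)
    have saT: "L2_self_adjoint ?M \<Delta>inf" "leafwise_laplacian_graph X A P g \<subseteq> \<Delta>inf"
      using assms(9) by (auto simp: unique_self_adjoint_extension_def)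
    have sa: "L2_self_adjoint (?N i) (\<Delta> i)" "level_laplacian_graph X A P g i \<subseteq> \<Delta> i" for i
      using assms(8)[of i] by (auto simp: unique_self_adjoint_extension_def)
    have mem: "u \<in> L2_space (?N i)" "v \<in> L2_space (?N i)" if "(u, v) \<in> level_laplacian_graph X A P g i" for i u v
      using self_adjoint_mem[OF sa(1)] sa(2) that by blast+
    have graph: "(u, level_laplacian g i u) \<in> level_laplacian_graph X A P g i" 
      if "u \<in> smooth_compact_support (X i) (A i)" for i u
      using that by (auto simp: level_laplacian_graph_def)
    have smooth: "smooth_function i u" if "u \<in> smooth_compact_support (X i) (A i)" for i u
      using that by (simp add: smooth_function_def smooth_compact_support_def)
    have leafwise: "AE x in ?M. leafwise_laplacian X A P g (u \<circ> solenoid_proj i) x = (level_laplacian g i u \<circ> solenoid_proj i) x"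
      if "u \<in> smooth_compact_support (X i) (A i)" for i u
    proof (rule AE_I2)
      fix x assume "x \<in> space ?M"
      hence "x \<in> topspace S" by (simp add: space_M[OF assms(7) \<mu>])
      from leafwise_laplacian_pullback[OF g smooth[OF that] this]
      show "leafwise_laplacian X A P g (u \<circ> solenoid_proj i) x = (level_laplacian g i u \<circ> solenoid_proj i) x"
        by (simp add: solenoid_proj_def)
    qed
    \<comment> \<open>The leaf-wise Laplacian and the pulled back one agree on the solenoid, but as
      total functions they may differ outside it, hence the passage through almost-everywhere
      equality.\<close>
    have lift: "(u \<circ> solenoid_proj i, v \<circ> solenoid_proj i) \<in> \<Delta>inf" if uv: "(u, v) \<in> level_laplacian_graph X A P g i" for i u v
    proof -
      have u: "u \<in> smooth_compact_support (X i) (A i)" and v: "v = level_laplacian g i u"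
        using uv by (auto simp: level_laplacian_graph_def)
      have "(u \<circ> solenoid_proj i, leafwise_laplacian X A P g (u \<circ> solenoid_proj i)) \<in> leafwise_laplacian_graph X A P g"
        using u unfolding leafwise_laplacian_graph_def by blast
      hence "(u \<circ> solenoid_proj i, leafwise_laplacian X A P g (u \<circ> solenoid_proj i)) \<in> \<Delta>inf" using saT(2) by blast
      thus ?thesis
        by (rule self_adjoint_cong[OF saT(1) _ AE_I2[OF refl] leafwise[OF u, folded v] 
              lev.L2_comp[OF mem(1)[OF uv]] lev.L2_comp[OF mem(2)[OF uv]]])
    qed
    have descend: "\<exists>j u v. (u, v) \<in> level_laplacian_graph X A P g j \<and> f = u \<circ> solenoid_proj j \<and> (AE x in ?M. h x = v (solenoid_proj j x))"
      if fh: "(f, h) \<in> leafwise_laplacian_graph X A P g" for f h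
    proof -
      obtain i u where u: "u \<in> smooth_compact_support (X i) (A i)" "f = u \<circ> solenoid_proj i" 
        "h = leafwise_laplacian X A P g (u \<circ> solenoid_proj i)"
        using fh unfolding leafwise_laplacian_graph_def by blast
      have "AE x in ?M. h x = level_laplacian g i u (solenoid_proj i x)"
        using leafwise[OF u(1)] unfolding u(3) by simp
      with graph[OF u(1)] u(2) show ?thesis by blast
    qed
    have average: "\<exists>u' v'. (u', v') \<in> level_laplacian_graph X A P g i \<and>
      (\<forall>w\<in>L2_space (?N i). L2_inner ?M (\<lambda>x. u (solenoid_proj j x) - u' (solenoid_proj i x)) (w \<circ> solenoid_proj i) = 0 \<and>
                            L2_inner ?M (\<lambda>x. v (solenoid_proj j x) - v' (solenoid_proj i x)) (w \<circ> solenoid_proj i) = 0)"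
      if "i < j" and uv: "(u, v) \<in> level_laplacian_graph X A P g j" for i j u v
    proof -
      have ij: "i \<le> j" using \<open>i < j\<close> by simp
      have u: "u \<in> smooth_compact_support (X j) (A j)" and v: "v = level_laplacian g j u"
        using uv by (auto simp: level_laplacian_graph_def)
      \<comment> \<open>Averaging commutes with the Laplacian, so u and v are averaged
        simultaneously and the results again form a pair of the core.\<close>
      let ?u = "avg j i u"
      let ?v = "level_laplacian g i ?u"
      have uv': "(?u, ?v) \<in> level_laplacian_graph X A P g i" by (rule graph[OF avg_compact_support[OF ij u]])
      have n: "card (deck j i) \<noteq> 0" using finite_deck[OF ij] deck_nonempty[OF ij] by simp
      have 1: "L2_inner ?M (\<lambda>x. u (solenoid_proj j x) - ?u (solenoid_proj i x)) (w \<circ> solenoid_proj i) = 0" 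
        if w: "w \<in> L2_space (?N i)" for w
        by (rule deck_average_orthogonal[OF assms(7) \<mu> mp ij mem(1)[OF uv] mem(1)[OF uv'] w])
          (simp add: avg_proj[OF ij] n)
      have 2: "L2_inner ?M (\<lambda>x. v (solenoid_proj j x) - ?v (solenoid_proj i x)) (w \<circ> solenoid_proj i) = 0" 
        if w: "w \<in> L2_space (?N i)" for w
        by (rule deck_average_orthogonal[OF assms(7) \<mu> mp ij mem(2)[OF uv] mem(2)[OF uv'] w])
          (simp add: level_laplacian_avg[OF g ij smooth[OF u]] n v)
      from uv' 1 2 show ?thesis by blast
    qed
    show ?thesis
    proof (intro ballI)
      fix \<omega> :: "real set" and f assume "\<omega> \<in> sets lebesgue" "f \<in> L2_space ?M"
      thus "(\<lambda>n. L2_norm ?M (\<lambda>x. Einf \<omega> f x - (\<Sum>i<n. (E i \<omega> (new_component X P \<mu> H i f) \<circ> solenoid_proj i) x))) \<longlonglongrightarrow> 0"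
        unfolding component
        by (intro spectral_decomposition[OF assms(9) assms(8) assms(11) assms(10)] lift descend average)
    qed
  qed
qed

end
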